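(* Let $M$ be a compact hyperbolic surface, $x\in M$, and let $d(x)$ be twice the maximal radius of an open metric ball centred at $x$ that is isometric to a ball in the hyperbolic plane $\mathbb H^2$. Let $\varphi$ be an $L^2$-normalised eigenfunction of the Laplace operator on $M$ with eigenvalue $\lambda^2$, $\lambda\ge0$. Then $$|\nabla^2\varphi(x)|^2\le\frac1{12\pi}\left(\frac{24\nu_4^2+6\pi\nu_4}{\pi d(x)}\left(\lambda+\frac{\nu_4}{d(x)}\right)^5\right)+\frac1{8\pi}\left(\frac{16\nu_3^2+4\pi\nu_3}{\pi d(x)}\left(\lambda+\frac{\nu_3}{d(x)}\right)^3\right)+\frac{29}{630\pi}.$$
   Context: A hyperbolic surface is a 2-dimensional Riemannian manifold locally isometric to $\mathbb H^2$ (constant curvature $-1$); the Laplacian is taken non-negative. $\nabla^2\varphi$ is the second covariant derivative and $|\nabla^2\varphi|^2=\mathsf g^{i_1j_1}\mathsf g^{i_2j_2}(\nabla^2\varphi)_{i_1i_2}\overline{(\nabla^2\varphi)_{j_1j_2}}$, where $\mathsf g$ is the metric. For $k\ge1$, $\nu_k$ is the $2k$-th root of the first (smallest) eigenvalue of $\Delta^k=(-1)^k\frac{d^{2k}}{ds^{2k}}$ on $(-1/2,1/2)$ with Dirichlet boundary conditions (all derivatives of order $0,\dots,k-1$ vanish at both endpoints). *)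

theory Defs
  imports "HOL-Analysis.Analysis"
begin

subsection \<open>Smooth functions on open subsets of Euclidean space\<close>

definition partial :: "'n::finite \<Rightarrow> (real^'n \<Rightarrow> 'b::real_normed_vector) \<Rightarrow> real^'n \<Rightarrow> 'b" where
  "partial i f x = frechet_derivative f (at x) (axis i 1)"

text \<open>Intended for open \<open>S\<close> only.\<close>

primrec Ck_on :: "nat \<Rightarrow> (real^'n::finite) set \<Rightarrow> (real^'n \<Rightarrow> 'b::real_normed_vector) \<Rightarrow> bool" where
  "Ck_on 0 S f \<longleftrightarrow> continuous_on S f"
| "Ck_on (Suc k) S f \<longleftrightarrow> f differentiable_on S \<and> (\<forall>i. Ck_on k S (partial i f))"

definition smooth_on :: "(real^'n::finite) set \<Rightarrow> (real^'n \<Rightarrow> 'b::real_normed_vector) \<Rightarrow> bool" where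
  "smooth_on S f \<longleftrightarrow> (\<forall>k. Ck_on k S f)"


subsection \<open>Riemannian manifolds\<close>

text \<open>A chart is a pair of its domain and its coordinate map. The value of the map outside the
  domain is irrelevant.\<close>

type_synonym ('a, 'n) chart = "'a set \<times> ('a \<Rightarrow> real^'n)"

text \<open>\<open>metric_in M c x\<close> is the matrix of components of the metric tensor in the chart \<open>c\<close>, at the
  point with coordinates \<open>x\<close>.\<close>

record ('a, 'n::finite) riemannian =
  top_space :: "'a topology"
  atlas :: "('a, 'n) chart set"
  metric_in :: "('a, 'n) chart \<Rightarrow> real^'n \<Rightarrow> real^'n^'n"

abbreviation points :: "('a, 'n::finite) riemannian \<Rightarrow> 'a set" where
  "points M \<equiv> topspace (top_space M)"

definition chart_inv :: "('a, 'n::finite) chart \<Rightarrow> real^'n \<Rightarrow> 'a" where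
  "chart_inv c = inv_into (fst c) (snd c)"

definition is_chart :: "'a topology \<Rightarrow> ('a, 'n::finite) chart \<Rightarrow> bool" where
  "is_chart X c \<longleftrightarrow> openin X (fst c) \<and> open (snd c ` fst c) \<and>
     homeomorphic_map (subtopology X (fst c)) (top_of_set (snd c ` fst c)) (snd c)"

text \<open>The map \<open>F\<close>, defined on the open set \<open>U\<close>, is smooth in the charts \<open>c\<close> and \<open>d\<close>, and there
  the metric \<open>h\<close> (components in \<open>d\<close>) pulls back to \<open>g\<close> (components in \<open>c\<close>).\<close>

definition isometric_in_charts ::
  "('a, 'n::finite) chart \<Rightarrow> (real^'n \<Rightarrow> real^'n^'n) \<Rightarrow> 'a set \<Rightarrow>
   ('b, 'n) chart \<Rightarrow> (real^'n \<Rightarrow> real^'n^'n) \<Rightarrow> ('a \<Rightarrow> 'b) \<Rightarrow> bool" where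
  "isometric_in_charts c g U d h F \<longleftrightarrow>
     (let S = snd c ` {p \<in> U \<inter> fst c. F p \<in> fst d};
          \<tau> = snd d \<circ> F \<circ> chart_inv c
      in smooth_on S \<tau> \<and>
         (\<forall>x\<in>S. transpose (jacobian \<tau> (at x)) ** h (\<tau> x) ** jacobian \<tau> (at x) = g x))"

text \<open>The last clause says that the charts are smoothly compatible (\<open>F\<close> is the identity, so
  \<open>\<tau>\<close> is the transition map) and that the metric components transform as a tensor.
  Manifolds have no boundary and need not be connected.\<close>

definition riemannian_manifold :: "('a, 'n::finite) riemannian \<Rightarrow> bool" where
  "riemannian_manifold M \<longleftrightarrow>
     Hausdorff_space (top_space M) \<and> second_countable (top_space M) \<and>
     (\<forall>c\<in>atlas M. is_chart (top_space M) c) \<and> (\<Union>c\<in>atlas M. fst c) = points M \<and>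
     (\<forall>c\<in>atlas M. smooth_on (snd c ` fst c) (metric_in M c) \<and>
        (\<forall>x\<in>snd c ` fst c. transpose (metric_in M c x) = metric_in M c x \<and>
           (\<forall>v. v \<noteq> 0 \<longrightarrow> v \<bullet> (metric_in M c x *v v) > 0))) \<and>
     (\<forall>c\<in>atlas M. \<forall>d\<in>atlas M.
        isometric_in_charts c (metric_in M c) (points M) d (metric_in M d) (\<lambda>p. p))"

text \<open>Isometry in the Riemannian sense between open subsets \<open>U\<close> of \<open>M\<close> and \<open>V\<close> of \<open>N\<close>.
  The inverse of \<open>F\<close> is automatically smooth, since the Jacobians are invertible.\<close>

definition riemannian_isometry ::
  "('a, 'n::finite) riemannian \<Rightarrow> 'a set \<Rightarrow> ('b, 'n) riemannian \<Rightarrow> 'b set \<Rightarrow> ('a \<Rightarrow> 'b) \<Rightarrow> bool" where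
  "riemannian_isometry M U N V F \<longleftrightarrow>
     openin (top_space M) U \<and> openin (top_space N) V \<and>
     homeomorphic_map (subtopology (top_space M) U) (subtopology (top_space N) V) F \<and>
     (\<forall>c\<in>atlas M. \<forall>d\<in>atlas N. isometric_in_charts c (metric_in M c) U d (metric_in N d) F)"

text \<open>An arbitrary chart around a point; it is only used for quantities that do not depend on
  the chart.\<close>

definition chart_at :: "('a, 'n::finite) riemannian \<Rightarrow> 'a \<Rightarrow> ('a, 'n) chart" where
  "chart_at M p = (SOME c. c \<in> atlas M \<and> p \<in> fst c)"


subsection \<open>Riemannian distance and volume\<close>

definition piecewise_C1_curve :: "('a, 'n::finite) riemannian \<Rightarrow> (real \<Rightarrow> 'a) \<Rightarrow> bool" where
  "piecewise_C1_curve M \<gamma> \<longleftrightarrow>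
     continuous_map (top_of_set {0..1}) (top_space M) \<gamma> \<and>
     (\<exists>T. finite T \<and> (\<forall>c\<in>atlas M.
        (snd c \<circ> \<gamma>) C1_differentiable_on {t \<in> {0<..<1} - T. \<gamma> t \<in> fst c}))"

definition speed :: "('a, 'n::finite) riemannian \<Rightarrow> (real \<Rightarrow> 'a) \<Rightarrow> real \<Rightarrow> real" where
  "speed M \<gamma> t =
     (let c = chart_at M (\<gamma> t); v = vector_derivative (snd c \<circ> \<gamma>) (at t)
      in sqrt (v \<bullet> (metric_in M c (snd c (\<gamma> t)) *v v)))"

definition curve_length :: "('a, 'n::finite) riemannian \<Rightarrow> (real \<Rightarrow> 'a) \<Rightarrow> ennreal" where
  "curve_length M \<gamma> = (\<integral>\<^sup>+t\<in>{0..1}. ennreal (speed M \<gamma> t) \<partial>lborel)"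

definition riemannian_dist :: "('a, 'n::finite) riemannian \<Rightarrow> 'a \<Rightarrow> 'a \<Rightarrow> ennreal" where
  "riemannian_dist M p q =
     Inf {curve_length M \<gamma> |\<gamma>. piecewise_C1_curve M \<gamma> \<and> \<gamma> 0 = p \<and> \<gamma> 1 = q}"

definition metric_ball :: "('a, 'n::finite) riemannian \<Rightarrow> 'a \<Rightarrow> real \<Rightarrow> 'a set" where
  "metric_ball M p r = {q \<in> points M. riemannian_dist M p q < ennreal r}"

text \<open>\<open>vol\<close> is the Riemannian volume measure \<open>sqrt (det g) dx\<close> on the Borel sets of \<open>M\<close>; the
  charts determine it uniquely.\<close>

definition riemannian_volume :: "('a, 'n::finite) riemannian \<Rightarrow> 'a measure \<Rightarrow> bool" where
  "riemannian_volume M vol \<longleftrightarrow>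
     space vol = points M \<and> sets vol = sigma_sets (points M) {U. openin (top_space M) U} \<and>
     (\<forall>c\<in>atlas M. \<forall>B\<in>sets vol. B \<subseteq> fst c \<longrightarrow>
        emeasure vol B = (\<integral>\<^sup>+x\<in>snd c ` B. ennreal (sqrt (det (metric_in M c x))) \<partial>lborel))"


subsection \<open>Second covariant derivative and Laplacian\<close>

definition inverse_metric :: "('a, 'n::finite) riemannian \<Rightarrow> ('a, 'n) chart \<Rightarrow> real^'n \<Rightarrow> real^'n^'n" where
  "inverse_metric M c x = matrix_inv (metric_in M c x)"

definition christoffel ::
  "('a, 'n::finite) riemannian \<Rightarrow> ('a, 'n) chart \<Rightarrow> 'n \<Rightarrow> 'n \<Rightarrow> 'n \<Rightarrow> real^'n \<Rightarrow> real" where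
  "christoffel M c k i j x = (1/2) * (\<Sum>l\<in>UNIV. inverse_metric M c x $ k $ l *
     (partial i (\<lambda>y. metric_in M c y $ j $ l) x + partial j (\<lambda>y. metric_in M c y $ i $ l) x
      - partial l (\<lambda>y. metric_in M c y $ i $ j) x))"

definition smooth_function :: "('a, 'n::finite) riemannian \<Rightarrow> ('a \<Rightarrow> complex) \<Rightarrow> bool" where
  "smooth_function M \<phi> \<longleftrightarrow> (\<forall>c\<in>atlas M. smooth_on (snd c ` fst c) (\<phi> \<circ> chart_inv c))"

text \<open>The components of the second covariant derivative in the chart \<open>c\<close>.\<close>

definition cov_hessian ::
  "('a, 'n::finite) riemannian \<Rightarrow> ('a, 'n) chart \<Rightarrow> ('a \<Rightarrow> complex) \<Rightarrow> 'n \<Rightarrow> 'n \<Rightarrow> real^'n \<Rightarrow> complex" where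
  "cov_hessian M c \<phi> i j x =
     partial i (partial j (\<phi> \<circ> chart_inv c)) x
     - (\<Sum>k\<in>UNIV. of_real (christoffel M c k i j x) * partial k (\<phi> \<circ> chart_inv c) x)"

text \<open>The sum is real (and nonnegative), so taking the real part only changes its type.\<close>

definition cov_hessian_norm_sq :: "('a, 'n::finite) riemannian \<Rightarrow> ('a \<Rightarrow> complex) \<Rightarrow> 'a \<Rightarrow> real" where
  "cov_hessian_norm_sq M \<phi> p =
     (let c = chart_at M p; x = snd c p; g' = inverse_metric M c x
      in Re (\<Sum>i\<^sub>1\<in>UNIV. \<Sum>i\<^sub>2\<in>UNIV. \<Sum>j\<^sub>1\<in>UNIV. \<Sum>j\<^sub>2\<in>UNIV.
               of_real (g' $ i\<^sub>1 $ j\<^sub>1) * of_real (g' $ i\<^sub>2 $ j\<^sub>2) *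
               cov_hessian M c \<phi> i\<^sub>1 i\<^sub>2 x * cnj (cov_hessian M c \<phi> j\<^sub>1 j\<^sub>2 x)))"

text \<open>The nonnegative Laplacian, minus the trace of the second covariant derivative.\<close>

definition laplacian :: "('a, 'n::finite) riemannian \<Rightarrow> ('a \<Rightarrow> complex) \<Rightarrow> 'a \<Rightarrow> complex" where
  "laplacian M \<phi> p =
     (let c = chart_at M p; x = snd c p
      in - (\<Sum>i\<in>UNIV. \<Sum>j\<in>UNIV.
              of_real (inverse_metric M c x $ i $ j) * cov_hessian M c \<phi> i j x))"

definition laplace_eigenfunction ::
  "('a, 'n::finite) riemannian \<Rightarrow> real \<Rightarrow> ('a \<Rightarrow> complex) \<Rightarrow> bool" where
  "laplace_eigenfunction M \<mu> \<phi> \<longleftrightarrow>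
     smooth_function M \<phi> \<and> (\<exists>p\<in>points M. \<phi> p \<noteq> 0) \<and>
     (\<forall>p\<in>points M. laplacian M \<phi> p = of_real \<mu> * \<phi> p)"


subsection \<open>Hyperbolic surfaces\<close>

text \<open>The upper half-plane with the metric \<open>(dx\<^sub>1\<^sup>2 + dx\<^sub>2\<^sup>2) / x\<^sub>2\<^sup>2\<close>, of curvature \<open>-1\<close>.\<close>

definition hyperbolic_plane :: "(real^2, 2) riemannian" where
  "hyperbolic_plane =
     \<lparr>top_space = top_of_set {z. z $ 2 > 0},
      atlas = {({z. z $ 2 > 0}, \<lambda>z. z)},
      metric_in = \<lambda>_ z. mat (1 / (z $ 2)\<^sup>2)\<rparr>"

definition hyperbolic_surface :: "('a, 2) riemannian \<Rightarrow> bool" where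
  "hyperbolic_surface M \<longleftrightarrow> riemannian_manifold M \<and>
     (\<forall>p\<in>points M. \<exists>U V F. p \<in> U \<and> riemannian_isometry M U hyperbolic_plane V F)"

text \<open>Twice the maximal radius of a metric ball around \<open>x\<close> that is isometric to a ball of the
  hyperbolic plane. On a compact hyperbolic surface the supremum is finite and attained.\<close>

definition embedded_ball_diameter :: "('a, 2) riemannian \<Rightarrow> 'a \<Rightarrow> real" where
  "embedded_ball_diameter M x = 2 * Sup {r. r > 0 \<and>
     (\<exists>p\<in>points hyperbolic_plane. \<exists>s>0. \<exists>F.
        riemannian_isometry M (metric_ball M x r)
          hyperbolic_plane (metric_ball hyperbolic_plane p s) F)}"


subsection \<open>The constants \<open>\<nu>\<^sub>k\<close>\<close>

text \<open>\<open>\<mu>\<close> is an eigenvalue of \<open>(-1)\<^sup>k d\<^sup>2\<^sup>k/ds\<^sup>2\<^sup>k\<close> on \<open>(-1/2, 1/2)\<close> with Dirichlet boundary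
  conditions: \<open>u 0\<close> is an eigenfunction and \<open>u j\<close> its \<open>j\<close>-th derivative (one-sided at the
  endpoints).\<close>

definition dirichlet_eigenvalue :: "nat \<Rightarrow> real \<Rightarrow> bool" where
  "dirichlet_eigenvalue k \<mu> \<longleftrightarrow> (\<exists>u :: nat \<Rightarrow> real \<Rightarrow> real.
     (\<forall>j<2*k. \<forall>s\<in>{-1/2..1/2}.
        (u j has_real_derivative u (Suc j) s) (at s within {-1/2..1/2})) \<and>
     (\<forall>s\<in>{-1/2<..<1/2}. (-1)^k * u (2*k) s = \<mu> * u 0 s) \<and>
     (\<forall>j<k. u j (-1/2) = 0 \<and> u j (1/2) = 0) \<and>
     (\<exists>s\<in>{-1/2<..<1/2}. u 0 s \<noteq> 0))"

definition nu :: "nat \<Rightarrow> real" where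
  "nu k = root (2*k) (LEAST \<mu>. dirichlet_eigenvalue k \<mu>)"

end

theory Submission
  imports Defs
begin

text \<open>
  In geodesic polar coordinates \<open>(r, t)\<close> around \<open>x\<close>, the second covariant derivative of \<open>\<phi>\<close> at \<open>x\<close> is read
  off from the angular Fourier modes of orders 0 and 2 of \<open>\<phi>\<close>. Each mode solves a second order
  equation in \<open>r\<close> with prescribed leading coefficient at \<open>r = 0\<close>. A comparison argument near \<open>0\<close> (the mode is
  still close to its leading term) and a nearly conserved energy further out bound its mass on the ball from
  below, and Bessel's inequality in \<open>t\<close> bounds it from above by the mass of \<open>\<phi>\<close>, which is at most 1
  because the polar coordinates are injective on the embedded ball. By compactness of \<open>M\<close> they are defined on the
  whole ball.

  The resulting explicit bound is below the claimed one as soon as \<open>\<nu>\<^sub>3 \<ge> 4.4\<close> and \<open>\<nu>\<^sub>4 \<ge> 5.15\<close>. For a clamped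
  eigenfunction on \<open>(-1/2, 1/2)\<close> this follows from Taylor's formula with integral remainder at both
  endpoints and the Cauchy-Schwarz inequality.
\<close>

subsection \<open>Radial modes\<close>

lemma right_limit_le:
 fixes f f' :: "real => real"
 assumes d: "!!r. 0 < r ==> r < R ==> (f has_real_derivative f' r) (at r)"
  and nn: "!!r. 0 < r ==> r < R ==> 0 <= f' r"
  and lim: "(f \<longlongrightarrow> l) (at_right 0)" and r: "0 < r" "r < R"
 shows "l <= f r"
proof (rule tendsto_upperbound[OF lim])
 show "\<forall>\<^sub>F s in at_right 0. f s <= f r"
  unfolding eventually_at_right_field
 proof (intro exI[of _ r] conjI allI impI)
  fix s assume s: "0 < s" "s < r"
  show "f s <= f r"
   by (rule DERIV_nonneg_imp_nondecreasing) (use s r d nn in "force+")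
 qed (use r in auto)
qed simp

lemma weighted_energy_bound:
 fixes w w' Q :: "real => real"
 assumes ab: "a < b"
  and dw: "!!r. a <= r ==> r <= b ==> (w has_real_derivative w' r) (at r)"
  and dw': "!!r. a <= r ==> r <= b ==> (w' has_real_derivative - Q r * w r) (at r)"
  and e: "!!r. a <= r ==> r <= b ==> e <= (w' r)^2 + Q r * (w r)^2"
  and wa: "0 <= w a * w' a"
  and Q: "!!r. a <= r ==> r <= b ==> Q r <= q" and q: "0 <= q"
 shows "8/15 * e * (b-a)^3 <= integral {a..b} (%r. (w r)^2) * (2 * q * (b-a)^2 + 4)"
proof -
 define L where "L = b - a"
 have L: "L > 0" using ab by (simp add: L_def)
 define P where "P = (%r. (1 - ((r-a)/L)^2)^2)"
 define P1 where "P1 = (%r. 2 * (1 - ((r-a)/L)^2) * (- 2 * ((r-a)/L) / L))"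
 define P2 where "P2 = (%r. (12 * ((r-a)/L)^2 - 4) / L^2)"
 have dP: "(P has_real_derivative P1 r) (at r)" for r
  unfolding P_def P1_def using L
  by (auto intro!: derivative_eq_intros) (simp add: field_simps)
 have dP1: "(P1 has_real_derivative P2 r) (at r)" for r
  unfolding P1_def P2_def using L
  by (auto intro!: derivative_eq_intros) (simp add: field_simps power2_eq_square power3_eq_cube)
 define Z where "Z = (%r. P r * w r * w' r - P1 r * (w r)^2 / 2
  - e * ((r-a) - 2 / (3*L^2) * (r-a)^3 + 1 / (5*L^4) * (r-a)^5))"
 define Z' where "Z' = (%r. P r * ((w' r)^2 - Q r * (w r)^2) - P2 r * (w r)^2 / 2 - e * P r)"
 have dZ: "(Z has_real_derivative Z' r) (at r)" if "a <= r" "r <= b" for r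
 proof -
  have D: "((%r. (r-a) - 2 / (3*L^2) * (r-a)^3 + 1 / (5*L^4) * (r-a)^5) has_real_derivative P r) (at r)"
  proof (rule DERIV_cong)
   show "((%r. (r-a) - 2 / (3*L^2) * (r-a)^3 + 1 / (5*L^4) * (r-a)^5) has_real_derivative
    1 - 2 / (3*L^2) * (3 * (r-a)^2) + 1 / (5*L^4) * (5 * (r-a)^4)) (at r)"
    by (rule derivative_eq_intros refl | simp)+
   have x: "(1 - x\<^sup>2)^2 = 1 - 2 * x^2 + x ^ 4" for x :: real by algebra
   show "1 - 2 / (3*L^2) * (3 * (r-a)^2) + 1 / (5*L^4) * (5 * (r-a)^4) = P r"
    unfolding P_def x by (simp add: power_divide)
  qed
  note d = DERIV_diff[OF DERIV_diff[OF DERIV_mult[OF DERIV_mult[OF dP dw[OF that]] dw'[OF that]]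
   DERIV_cdivide[OF DERIV_mult[OF dP1 DERIV_power[OF dw[OF that], of 2]], of 2]] DERIV_cmult[OF D, of e]]
  show ?thesis unfolding Z_def Z'_def
   by (rule DERIV_cong[OF d]) (simp add: algebra_simps power2_eq_square)
 qed
 have cw: "continuous_on {a..b} w"
  by (rule DERIV_continuous_on[where D=w']) (use dw in "auto intro: has_field_derivative_at_within")
 then have iw: "(%r. (w r)^2) integrable_on {a..b}"
  by (intro integrable_continuous_real continuous_intros)
 have "(Z' has_integral Z b - Z a) {a..b}"
  by (rule fundamental_theorem_of_calculus)
   (use ab dZ in "auto simp: has_real_derivative_iff_has_vector_derivative[symmetric] intro: has_field_derivative_at_within")
 then have Z': "(Z' has_integral Z b - Z a) {a..b}" .
 have W': "((%r. - (2 * q + 4 / L^2) * (w r)^2) has_integral - (2 * q + 4 / L^2) * integral {a..b} (%r. (w r)^2)) {a..b}"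
  using iw by (intro has_integral_mult_right) (simp add: integrable_integral)
 have le: "- (2 * q + 4 / L^2) * (w r)^2 <= Z' r" if r: "r \<in> {a..b}" for r
 proof -
  have x: "0 <= (r-a)/L" "(r-a)/L <= 1" using r L by (auto simp: L_def)
  then have x2: "0 <= ((r-a)/L)^2" "((r-a)/L)^2 <= 1" by (auto simp: power_le_one)
  then have P: "0 <= P r" "P r <= 1" unfolding P_def by (auto simp: power_le_one)
  have P2: "P2 r / 2 <= 4 / L^2"
   unfolding P2_def using x2 L divide_right_mono[of "6 * ((r-a)/L)^2 - 2" 4 "L^2"] by (simp add: diff_divide_distrib)
  have "P r * (e - ((w' r)^2 + Q r * (w r)^2)) <= 0"
   using P(1) e[of r] r by (intro mult_nonneg_nonpos) auto
  moreover have "P r * Q r * (w r)^2 <= q * (w r)^2"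
  proof (rule mult_right_mono)
   have "P r * Q r <= P r * q" using P(1) Q[of r] r by (intro mult_left_mono) auto
   also have "\<dots> <= q" using P(2) q by (simp add: mult_left_le_one_le P(1))
   finally show "P r * Q r <= q" .
  qed simp
  moreover have "P2 r / 2 * (w r)^2 <= 4 / L^2 * (w r)^2" by (intro mult_right_mono P2) simp
  ultimately show ?thesis unfolding Z'_def by (simp add: algebra_simps)
 qed
 have "- (2 * q + 4 / L^2) * integral {a..b} (%r. (w r)^2) <= Z b - Z a"
  by (rule has_integral_le[OF W' Z' le])
 then have "- ((2 * q + 4 / L^2) * integral {a..b} (%r. (w r)^2)) <= Z b - Z a"
  by (simp only: mult_minus_left)
 moreover have "2 / (3*L^2) * L^3 = 2/3 * L" "1 / (5*L^4) * L^5 = L/5"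
  using L by (simp_all add: eval_nat_numeral)
 then have "Z b = - e * (8/15 * L)"
  unfolding Z_def P_def P1_def L_def[symmetric] using L by simp
 moreover have "Z a = w a * w' a" unfolding Z_def P_def P1_def by simp
 ultimately have "8/15 * e * L <= (2 * q + 4 / L^2) * integral {a..b} (%r. (w r)^2)"
  using wa by linarith
 then have "8/15 * e * L * L^2 <= (2 * q + 4 / L^2) * integral {a..b} (%r. (w r)^2) * L^2"
  by (intro mult_right_mono) auto
 also have "\<dots> = integral {a..b} (%r. (w r)^2) * (2 * q * L^2 + 4)"
  using L by (simp add: field_simps)
 finally show ?thesis unfolding L_def[symmetric] by (simp only: power2_eq_square power3_eq_cube mult.assoc)
qed

definition half_tanh :: "real => real" where "half_tanh r = sinh r / (cosh r + 1)"

lemma cosh_add_1_pos [simp]: "cosh r + 1 > (0::real)"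
 using cosh_real_pos[of r] by linarith

lemma half_tanh_pos: "r > 0 ==> half_tanh r > 0"
 unfolding half_tanh_def by simp

lemma half_tanh_sq: "(half_tanh r)^2 = (cosh r - 1) / (cosh r + 1)"
proof -
 have "(sinh r)^2 = (cosh r - 1) * (cosh r + 1)"
  using cosh_square_eq[of r] by (simp add: algebra_simps power2_eq_square)
 then show ?thesis unfolding half_tanh_def
  using cosh_add_1_pos[of r] by (simp add: power_divide power2_eq_square)
qed

lemma DERIV_half_tanh: "r > 0 ==> (half_tanh has_real_derivative half_tanh r / sinh r) (at r)"
proof -
 assume r: "r > 0"
 have c: "cosh r + 1 ~= 0" "sinh r ~= 0" using cosh_add_1_pos[of r] r by (auto simp del: cosh_add_1_pos)
 have "((%r. sinh r / (cosh r + 1)) has_real_derivative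
   (cosh r * (cosh r + 1) - sinh r * sinh r) / ((cosh r + 1) * (cosh r + 1))) (at r)"
  using c by (auto intro!: derivative_eq_intros)
 also have "cosh r * (cosh r + 1) - sinh r * sinh r = cosh r + 1"
  using cosh_square_eq[of r] by (simp add: algebra_simps power2_eq_square)
 also have "(cosh r + 1) / ((cosh r + 1) * (cosh r + 1)) = half_tanh r / sinh r"
  using c by (simp add: half_tanh_def)
 finally show ?thesis unfolding half_tanh_def[abs_def] .
qed

lemma DERIV_half_tanh_power:
 assumes "r > 0"
 shows "((%r. half_tanh r ^ m) has_real_derivative real m * half_tanh r ^ m / sinh r) (at r)"
proof -
 have "((%r. half_tanh r ^ m) has_real_derivative real m * (half_tanh r / sinh r * half_tanh r ^ (m - Suc 0))) (at r)"
  using DERIV_power[OF DERIV_half_tanh[OF assms], of m] by (simp add: mult_ac)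
 also have "real m * (half_tanh r / sinh r * half_tanh r ^ (m - Suc 0)) = real m * half_tanh r ^ m / sinh r"
  by (cases m) auto
 finally show ?thesis .
qed

lemma half_tanh_tendsto_0: "(half_tanh \<longlongrightarrow> 0) (at_right 0)"
proof -
 have "isCont (%r. sinh r / (cosh r + 1)) (0::real)"
  by (intro continuous_intros) auto
 then have "half_tanh \<midarrow>0\<rightarrow> 0" unfolding isCont_def half_tanh_def[abs_def] by simp
 then show ?thesis by (rule filterlim_mono) (auto simp: at_within_le_nhds intro: at_le)
qed

lemma right_limit_bounded:
 fixes h :: "real => real"
 assumes "(h \<longlongrightarrow> l) (at_right 0)" and "!!r. 0 < r ==> r < R ==> isCont h r"
  and b: "b < R"
 shows "\<exists>M. \<forall>r. 0 < r \<longrightarrow> r <= b \<longrightarrow> \<bar>h r\<bar> <= M"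
proof -
 have "\<forall>\<^sub>F r in at_right 0. \<bar>h r - l\<bar> < 1"
  using tendstoD[OF assms(1), of 1] by (simp add: dist_real_def)
 then obtain delta where delta: "delta > 0" "!!r. 0 < r ==> r < delta ==> \<bar>h r - l\<bar> < 1"
  unfolding eventually_at_right_field by auto
 have "continuous_on {delta/2..b} h"
  using delta assms(2) b by (intro continuous_at_imp_continuous_on) force
 then have "bounded (h ` {delta/2..b})"
  by (intro compact_imp_bounded compact_continuous_image) auto
 then obtain M where M: "!!r. r \<in> {delta/2..b} ==> \<bar>h r\<bar> <= M"
  unfolding bounded_iff by (metis imageI real_norm_def)
 show ?thesis
 proof (intro exI allI impI)
  fix r assume r: "0 < r" "r <= b"
  show "\<bar>h r\<bar> <= max M (\<bar>l\<bar> + 1)"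
   using delta(2)[of r] M[of r] r by (cases "r < delta") auto
 qed
qed

locale radial_mode =
 fixes m :: nat and lam R :: real and u u' :: "real => real"
 assumes du: "!!r. 0 < r ==> r < R ==> (u has_real_derivative u' r) (at r)"
  and du': "!!r. 0 < r ==> r < R ==> (u' has_real_derivative
    ((real m)^2 / (sinh r)^2 - lam\<^sup>2) * u r - cosh r / sinh r * u' r) (at r)"
  and lim: "((%r. u r / half_tanh r ^ m) \<longlongrightarrow> 1) (at_right 0)"
  and lim': "((%r. sinh r * u' r) \<longlongrightarrow> 0) (at_right 0)"
begin

definition "h = (%r. u r / half_tanh r ^ m)"
definition "h' = (%r. (u' r - real m * u r / sinh r) / half_tanh r ^ m)"
definition "p = (%r. sinh r * half_tanh r ^ (2*m))"

lemma dh: assumes r: "0 < r" "r < R" shows "(h has_real_derivative h' r) (at r)"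
proof -
 have t: "half_tanh r > 0" using r half_tanh_pos by auto
 have "(h has_real_derivative (u' r * half_tanh r ^ m - u r * (real m * half_tanh r ^ m / sinh r)) /
   (half_tanh r ^ m * half_tanh r ^ m)) (at r)"
  unfolding h_def using DERIV_divide[OF du[OF r] DERIV_half_tanh_power[OF r(1)]] t by simp
 then show ?thesis
  by (rule DERIV_cong) (use t r in "simp add: h'_def field_simps")
qed

lemma dh': assumes r: "0 < r" "r < R"
 shows "(h' has_real_derivative - lam\<^sup>2 * h r - (cosh r + 2 * real m) / sinh r * h' r) (at r)"
proof -
 define T where "T = half_tanh r ^ m"
 have t: "T > 0" unfolding T_def using r half_tanh_pos by auto
 have s: "sinh r > 0" using r by simp
 define v where "v = (%r. u' r - real m * u r / sinh r)"
 have "(v has_real_derivative (((real m)^2 / (sinh r)^2 - lam\<^sup>2) * u r - cosh r / sinh r * u' r) -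
  (real m * u' r * sinh r - real m * u r * cosh r) / (sinh r * sinh r)) (at r)"
  unfolding v_def using du[OF r] du'[OF r] s
  by (intro DERIV_diff DERIV_divide DERIV_cmult) (auto intro!: derivative_eq_intros)
 from DERIV_divide[OF this DERIV_half_tanh_power[OF r(1), of m]] half_tanh_pos[OF r(1)]
 have "(h' has_real_derivative (((((real m)^2 / (sinh r)^2 - lam\<^sup>2) * u r - cosh r / sinh r * u' r) -
  (real m * u' r * sinh r - real m * u r * cosh r) / (sinh r * sinh r)) * T - v r * (real m * T / sinh r)) / (T * T)) (at r)"
  unfolding h'_def v_def T_def by simp
 then show ?thesis
  by (rule DERIV_cong)
   (use t s in "unfold h_def h'_def v_def T_def[symmetric], simp add: field_simps power2_eq_square")
qed

lemma p_pos: "r > 0 ==> p r > 0"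
 unfolding p_def using half_tanh_pos by simp

lemma dp: assumes "r > 0" shows "(p has_real_derivative p r * (cosh r + 2 * real m) / sinh r) (at r)"
proof -
 have s: "(sinh has_real_derivative cosh r) (at r)" by (auto intro!: derivative_eq_intros)
 have "((%r. sinh r * half_tanh r ^ (2*m)) has_real_derivative
  cosh r * half_tanh r ^ (2*m) + real (2*m) * half_tanh r ^ (2*m) / sinh r * sinh r) (at r)"
  using DERIV_mult[OF s DERIV_half_tanh_power[OF assms, of "2*m"]] by simp
 also have "cosh r * half_tanh r ^ (2*m) + real (2*m) * half_tanh r ^ (2*m) / sinh r * sinh r = p r * (cosh r + 2 * real m) / sinh r"
  unfolding p_def using assms by (simp add: field_simps)
 finally show ?thesis unfolding p_def .
qed

lemma dph: assumes r: "0 < r" "r < R"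
 shows "((%r. p r * h' r) has_real_derivative - lam\<^sup>2 * p r * h r) (at r)"
proof -
 have "((%r. p r * h' r) has_real_derivative
   p r * (cosh r + 2 * real m) / sinh r * h' r + (- lam\<^sup>2 * h r - (cosh r + 2 * real m) / sinh r * h' r) * p r) (at r)"
  using DERIV_mult[OF dp[OF r(1)] dh'[OF r]] by simp
 also have "p r * (cosh r + 2 * real m) / sinh r * h' r + (- lam\<^sup>2 * h r - (cosh r + 2 * real m) / sinh r * h' r) * p r
  = - lam\<^sup>2 * p r * h r" by (simp add: algebra_simps)
 finally show ?thesis .
qed

lemma ph_lim: "((%r. p r * h' r) \<longlongrightarrow> 0) (at_right 0)"
proof -
 have t: "((%r. half_tanh r ^ m) \<longlongrightarrow> 0 ^ m) (at_right 0)"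
  by (intro tendsto_intros half_tanh_tendsto_0)
 have "((%r. half_tanh r ^ m * (sinh r * u' r) - real m * (half_tanh r ^ m * half_tanh r ^ m * (u r / half_tanh r ^ m)))
  \<longlongrightarrow> 0 ^ m * 0 - real m * (0 ^ m * 0 ^ m * 1)) (at_right 0)"
  by (intro tendsto_intros t lim lim')
 moreover have "\<forall>\<^sub>F r in at_right 0. half_tanh r ^ m * (sinh r * u' r) - real m * (half_tanh r ^ m * half_tanh r ^ m * (u r / half_tanh r ^ m)) = p r * h' r"
 proof (rule eventually_at_right_less[THEN eventually_mono])
  fix r :: real assume r: "0 < r"
  have t: "half_tanh r > 0" using r half_tanh_pos by auto
  show "half_tanh r ^ m * (sinh r * u' r) - real m * (half_tanh r ^ m * half_tanh r ^ m * (u r / half_tanh r ^ m)) = p r * h' r"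
   unfolding p_def h'_def power_mult using t r by (simp add: field_simps power_mult_distrib power2_eq_square flip: power_mult)
 qed
 ultimately have "((%r. p r * h' r) \<longlongrightarrow> 0 ^ m * 0 - real m * (0 ^ m * 0 ^ m * 1)) (at_right 0)"
  by (rule Lim_transform_eventually)
 then show ?thesis by (cases m) auto
qed

text \<open>Integrating \<open>(p h')' = - lam\<^sup>2 p h\<close>; the comparison function is a supersolution of \<open>K' >= p\<close>.\<close>

lemma h'_bound:
 assumes M: "!!r. 0 < r ==> r <= b ==> \<bar>h r\<bar> <= M" and b: "b < R" and r: "0 < r" "r <= b"
 shows "\<bar>h' r\<bar> <= M * lam^2 / (2 * (real m + 1)) * sinh r"
proof -
 define N where "N = M * lam^2 / (2 * (real m + 1))"
 have M0: "M >= 0" using M[OF r] by linarith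
 have N0: "N >= 0" unfolding N_def using M0 by auto
 define b' where "b' = (b + R) / 2"
 define K where "K = (%r. N * (sinh r * p r))"
 define K' where "K' = (%r. N * (cosh r * p r + p r * (cosh r + 2 * real m) / sinh r * sinh r))"
 have dK: "(K has_real_derivative K' r) (at r)" if "r > 0" for r
  unfolding K_def K'_def by (intro DERIV_cmult DERIV_mult dp that) (auto intro!: derivative_eq_intros)
 have K'_ge: "K' r >= M * lam^2 * p r" if "r > 0" for r
 proof -
  have "K' r = N * p r * (2 * (cosh r + real m))" unfolding K'_def using that by (simp add: field_simps)
  also have "\<dots> >= N * p r * (2 * (1 + real m))"
   using N0 p_pos[OF that] cosh_real_ge_1[of r] by (intro mult_left_mono) auto
  also have "N * p r * (2 * (1 + real m)) = M * lam^2 * p r"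
   unfolding N_def by (simp add: divide_simps)
  finally show ?thesis .
 qed
 have sinh0: "((sinh :: real => real) \<longlongrightarrow> 0) (at_right 0)"
  using isCont_sinh[of "0::real"] unfolding isCont_def
  by (simp add: tendsto_mono[OF at_le[OF subset_UNIV]])
 have Klim: "(K \<longlongrightarrow> 0) (at_right 0)"
 proof -
  have "((%r. N * (sinh r * (sinh r * half_tanh r ^ (2*m)))) \<longlongrightarrow> N * (0 * (0 * 0 ^ (2*m)))) (at_right 0)"
   using sinh0 by (intro tendsto_mult tendsto_const tendsto_power half_tanh_tendsto_0)
  then show ?thesis unfolding K_def p_def by simp
 qed
 have est: "M * lam^2 * p s >= \<bar>lam^2 * p s * h s\<bar>" if "0 < s" "s <= b" for s
  using M[OF that] p_pos[OF that(1)]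
  using mult_right_mono[OF M[OF that], of "lam^2 * p s"] p_pos[OF that(1)] by (simp add: abs_mult mult_ac)
 have lim0: "((%r. K r - p r * h' r) \<longlongrightarrow> 0 - 0) (at_right 0)" "((%r. K r + p r * h' r) \<longlongrightarrow> 0 + 0) (at_right 0)"
  by (intro tendsto_intros Klim ph_lim)+
 have "0 <= K r' - p r' * h' r'" "0 <= K r' + p r' * h' r'" if r': "0 < r'" "r' < b" for r'
 proof -
  show "0 <= K r' - p r' * h' r'"
  proof (rule right_limit_le[where R=b and f="%r. K r - p r * h' r" and f'="%r. K' r - (- lam\<^sup>2 * p r * h r)"])
   fix s assume s: "0 < s" "s < b"
   show "((%r. K r - p r * h' r) has_real_derivative K' s - (- lam\<^sup>2 * p s * h s)) (at s)"
    using s b by (intro DERIV_diff dK dph) auto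
   show "0 <= K' s - (- lam\<^sup>2 * p s * h s)" using est[of s] K'_ge[of s] s by (simp add: abs_le_iff)
  qed (use r' lim0 in auto)
  show "0 <= K r' + p r' * h' r'"
  proof (rule right_limit_le[where R=b and f="%r. K r + p r * h' r" and f'="%r. K' r + (- lam\<^sup>2 * p r * h r)"])
   fix s assume s: "0 < s" "s < b"
   show "((%r. K r + p r * h' r) has_real_derivative K' s + (- lam\<^sup>2 * p s * h s)) (at s)"
    using s b by (intro DERIV_add dK dph) auto
   show "0 <= K' s + (- lam\<^sup>2 * p s * h s)" using est[of s] K'_ge[of s] s by (simp add: abs_le_iff)
  qed (use r' lim0 in auto)
 qed note * = this
 have lt: "\<bar>h' r'\<bar> <= N * sinh r'" if r': "0 < r'" "r' < b" for r'
 proof -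
  have "\<bar>p r' * h' r'\<bar> <= K r'" using *[OF r'] by linarith
  then have "p r' * \<bar>h' r'\<bar> <= p r' * (N * sinh r')" unfolding K_def using p_pos[OF r'(1)] by (simp add: abs_mult mult_ac)
  then show ?thesis using p_pos[OF r'(1)] by simp
 qed
 have "\<bar>h' b\<bar> <= N * sinh b"
 proof (rule tendsto_le)
  show "((%r. \<bar>h' r\<bar>) \<longlongrightarrow> \<bar>h' b\<bar>) (at_left b)"
   using DERIV_isCont[OF dh'[of b]] r b unfolding isCont_def
   by (intro tendsto_rabs) (auto intro: tendsto_mono[OF at_le[OF subset_UNIV]])
  show "((%r. N * sinh r) \<longlongrightarrow> N * sinh b) (at_left b)" by (intro tendsto_intros)
  show "\<forall>\<^sub>F x in at_left b. \<bar>h' x\<bar> <= N * sinh x"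
   unfolding eventually_at_left_field using lt r by (intro exI[of _ 0]) auto
 qed simp
 then show ?thesis using lt[of r] r unfolding N_def by (cases "r = b") auto
qed

lemma h_bound:
 assumes r: "0 < r" "r < R"
 shows "1 - lam\<^sup>2 / (2 * (real m + 1)) * (cosh r - 1) <= h r"
  and "\<bar>h' r\<bar> <= lam^2 / (2 * (real m + 1)) * sinh r"
proof -
 define N where "N = lam^2 / (2 * (real m + 1))"
 obtain M where M: "!!s. 0 < s ==> s <= r ==> \<bar>h s\<bar> <= M"
  using right_limit_bounded[of h 1 R r] lim DERIV_isCont[OF dh] r unfolding h_def by blast
 have h'1: "\<bar>h' s\<bar> <= M * N * sinh s" if "0 < s" "s <= r" for s
  using h'_bound[of r M s] M that r by (simp add: N_def)
 have limh': "(h' \<longlongrightarrow> 0) (at_right 0)"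
 proof (rule Lim_null_comparison)
  show "\<forall>\<^sub>F s in at_right 0. norm (h' s) <= M * N * sinh s"
   unfolding eventually_at_right_field using h'1 r by (intro exI[of _ r]) auto
  show "((%s. M * N * sinh s) \<longlongrightarrow> 0) (at_right 0)"
   by (rule tendsto_eq_intros refl | simp)+
 qed
 have en: "(h' s)^2 + lam^2 * (h s)^2 <= lam^2" if s: "0 < s" "s < R" for s
 proof -
  have "- (0^2 + lam^2 * 1^2) <= - ((h' s)^2 + lam^2 * (h s)^2)"
  proof (rule right_limit_le[where R=R and r=s and l="- (0^2 + lam^2 * 1^2)" and f="%s. - ((h' s)^2 + lam^2 * (h s)^2)" and f'="%s. 2 * ((cosh s + 2 * real m) / sinh s) * (h' s)^2"])
   fix s assume s: "0 < s" "s < R"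
   have "((%s. - ((h' s)^2 + lam^2 * (h s)^2)) has_real_derivative
    - (2 * (h' s) * (- lam\<^sup>2 * h s - (cosh s + 2 * real m) / sinh s * h' s) + lam^2 * (2 * h s * h' s))) (at s)"
    using dh[OF s] dh'[OF s] by (auto intro!: derivative_eq_intros)
   also have "- (2 * (h' s) * (- lam\<^sup>2 * h s - (cosh s + 2 * real m) / sinh s * h' s) + lam^2 * (2 * h s * h' s))
    = 2 * ((cosh s + 2 * real m) / sinh s) * (h' s)^2" by (simp add: algebra_simps power2_eq_square)
   finally show "((%s. - ((h' s)^2 + lam^2 * (h s)^2)) has_real_derivative 2 * ((cosh s + 2 * real m) / sinh s) * (h' s)^2) (at s)" .
   show "0 <= 2 * ((cosh s + 2 * real m) / sinh s) * (h' s)^2" using s by (simp add: add_nonneg_nonneg)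
  next
   show "((%s. - ((h' s)^2 + lam^2 * (h s)^2)) \<longlongrightarrow> - (0^2 + lam^2 * 1^2)) (at_right 0)"
    by (intro tendsto_intros limh' lim[folded h_def])
  qed (use s in auto)
  then show ?thesis by simp
 qed
 have h1: "\<bar>h s\<bar> <= 1" if "0 < s" "s < R" "lam ~= 0" for s
 proof -
  have "lam^2 * (h s)^2 <= lam^2 * 1" using en[OF that(1,2)] by (smt (verit) zero_le_power2)
  then have "(h s)^2 <= 1" using that(3) by simp
  then show ?thesis by (simp add: abs_square_le_1)
 qed
 have h'2: "\<bar>h' s\<bar> <= N * sinh s" if "0 < s" "s <= r" for s
 proof (cases "lam = 0")
  case True then show ?thesis using h'1[OF that] by (simp add: N_def)
 next
  case False then show ?thesis using h'_bound[of r 1 s] h1 that r by (simp add: N_def)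
 qed
 then show "\<bar>h' r\<bar> <= lam^2 / (2 * (real m + 1)) * sinh r" using r by (simp add: N_def)
 have "1 + N * 1 <= h s + N * cosh s" if s: "0 < s" "s < r" for s
 proof (rule right_limit_le[where R=r and r=s and l="1 + N * 1" and f="%s. h s + N * cosh s" and f'="%s. h' s + N * sinh s"])
  show "((%s. h s + N * cosh s) \<longlongrightarrow> 1 + N * 1) (at_right 0)"
   by (rule tendsto_eq_intros refl lim[folded h_def] | simp)+
 next
  fix s assume s: "0 < s" "s < r"
  show "((%s. h s + N * cosh s) has_real_derivative h' s + N * sinh s) (at s)"
   using dh[of s] s r by (auto intro!: derivative_eq_intros)
  show "0 <= h' s + N * sinh s" using h'2[of s] s by auto
 qed (use s in auto)
 moreover have "((%s. h s + N * cosh s) \<longlongrightarrow> h r + N * cosh r) (at_left r)"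
  using DERIV_isCont[OF dh[of r]] r unfolding isCont_def
  by (intro tendsto_intros) (auto intro: tendsto_mono[OF at_le[OF subset_UNIV]])
 then have "1 + N * 1 <= h r + N * cosh r"
  by (rule tendsto_lowerbound) (use r calculation in "auto simp: eventually_at_left_field intro!: exI[of _ 0]")
 then show "1 - lam\<^sup>2 / (2 * (real m + 1)) * (cosh r - 1) <= h r"
  unfolding N_def[symmetric] by (simp add: algebra_simps)
qed

end

context radial_mode begin
lemma u_eq: assumes "0 < r" shows "u r = h r * half_tanh r ^ m"
 using half_tanh_pos[OF assms] by (simp add: h_def)

lemma u'_eq: assumes "0 < r" shows "sinh r * u' r = half_tanh r ^ m * (sinh r * h' r + real m * h r)"
 using half_tanh_pos[OF assms] assms by (simp add: h_def h'_def field_simps)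

lemma integral_lower_bound:
 assumes rho: "0 < rho" "rho < R" and cu: "continuous_on {0..rho} u"
  and h0: "0 <= h0" "h0 <= 1 - lam\<^sup>2 / (2 * (real m + 1)) * (cosh rho - 1)"
  and dG: "!!r. 0 < r ==> r < rho ==> (G has_real_derivative g r) (at r)"
  and cG: "continuous_on {0..rho} G"
  and g: "!!r. 0 <= r ==> r <= rho ==> g r <= sinh r * half_tanh r ^ (2*m)"
 shows "h0^2 * (G rho - G 0) <= integral {0..rho} (%r. (u r)^2 * sinh r)"
proof (rule has_integral_le)
 have "(g has_integral G rho - G 0) {0..rho}"
  using rho cG dG by (intro fundamental_theorem_of_calculus_interior)
   (auto simp: has_real_derivative_iff_has_vector_derivative[symmetric])
 then show "((%r. h0^2 * g r) has_integral h0^2 * (G rho - G 0)) {0..rho}"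
  by (rule has_integral_mult_right)
 show "((%r. (u r)^2 * sinh r) has_integral integral {0..rho} (%r. (u r)^2 * sinh r)) {0..rho}"
  using cu by (intro integrable_integral integrable_continuous_real continuous_intros)
 fix r assume r: "r \<in> {0..rho}"
 show "h0^2 * g r <= (u r)^2 * sinh r"
 proof (cases "r = 0")
  case True then show ?thesis using g[of 0] rho by (simp add: mult_nonneg_nonpos)
 next
  case False
  then have r0: "0 < r" "r < R" "r <= rho" using r rho by auto
  have "lam^2 / (2 * (real m + 1)) * (cosh r - 1) <= lam^2 / (2 * (real m + 1)) * (cosh rho - 1)"
   using r0 rho by (intro mult_left_mono) (auto simp: cosh_real_nonneg_le_iff)
  then have "h0 <= h r" using h0(2) h_bound(1)[OF r0(1,2)] by linarith
  then have "h0^2 <= (h r)^2" using h0(1) by (intro power_mono) auto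
  have "h0^2 * g r <= h0^2 * (sinh r * half_tanh r ^ (2*m))"
   using g[of r] r0 by (intro mult_left_mono) auto
  also have "\<dots> <= (h r)^2 * (sinh r * half_tanh r ^ (2*m))"
   using \<open>h0^2 <= (h r)^2\<close> r0 half_tanh_pos[OF r0(1)] by (intro mult_right_mono) auto
  also have "\<dots> = (u r)^2 * sinh r"
   unfolding u_eq[OF r0(1)] power_even_eq power_mult_distrib by (simp only: mult_ac)
  finally show ?thesis .
 qed
qed

end

context radial_mode begin
definition "w = (%r. sqrt (sinh r) * u r)"
definition "w' = (%r. sqrt (sinh r) * (u' r + cosh r / sinh r * u r / 2))"
definition "Q = (%r. lam^2 - 1/4 + (1/4 - (real m)\<^sup>2) / (sinh r)^2)"

lemma dw: assumes r: "0 < r" "r < R" shows "(w has_real_derivative w' r) (at r)"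
proof -
 have s: "sinh r > 0" using r by simp
 have "((%r. sqrt (sinh r)) has_real_derivative cosh r / (2 * sqrt (sinh r))) (at r)"
  using s by (auto intro!: derivative_eq_intros simp: field_simps)
 from DERIV_mult[OF this du[OF r]] show ?thesis unfolding w_def
  by (rule DERIV_cong) (use s in "simp add: w'_def field_simps")
qed

lemma dw': assumes r: "0 < r" "r < R" shows "(w' has_real_derivative - Q r * w r) (at r)"
proof -
 define S where "S = sqrt (sinh r)"
 have s: "sinh r > 0" using r by simp
 then have S: "S > 0" "sinh r = S * S" by (auto simp: S_def)
 have c: "cosh r * cosh r = 1 + S^4" using cosh_square_eq[of r] S
  by (simp add: power2_eq_square power4_eq_xxxx)
 have d1: "((%r. sqrt (sinh r)) has_real_derivative cosh r / (2 * S)) (at r)"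
  using s by (auto intro!: derivative_eq_intros simp: field_simps S_def)
 have d2: "((%r. cosh r / sinh r) has_real_derivative (sinh r * sinh r - cosh r * cosh r) / (sinh r * sinh r)) (at r)"
  using s by (auto intro!: derivative_eq_intros)
 have d3: "((%r. u' r + cosh r / sinh r * u r / 2) has_real_derivative
  (((real m)^2 / (sinh r)^2 - lam\<^sup>2) * u r - cosh r / sinh r * u' r) +
  ((sinh r * sinh r - cosh r * cosh r) / (sinh r * sinh r) * u r + u' r * (cosh r / sinh r)) / 2) (at r)"
  by (intro DERIV_add du'[OF r] DERIV_cdivide DERIV_mult d2 du[OF r])
 from DERIV_mult[OF d1 d3] show ?thesis unfolding w'_def
 proof (rule DERIV_cong)
  have "cosh r / (2 * S) * (u' r + cosh r / sinh r * u r / 2) +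
  (((real m)^2 / (sinh r)^2 - lam\<^sup>2) * u r - cosh r / sinh r * u' r +
   ((sinh r * sinh r - cosh r * cosh r) / (sinh r * sinh r) * u r + u' r * (cosh r / sinh r)) / 2) * S
   = S * u r * ((cosh r * cosh r) / (4 * S^4) + (real m)^2 / S^4 - lam\<^sup>2 + (S^4 - cosh r * cosh r) / (2 * S^4))"
   using S(1) unfolding S(2) by (simp add: field_simps power2_eq_square power4_eq_xxxx)
  also have "\<dots> = S * u r * (- Q r)"
   unfolding Q_def c S(2) using S(1) by (simp add: field_simps power2_eq_square power4_eq_xxxx)
  finally show "cosh r / (2 * S) * (u' r + cosh r / sinh r * u r / 2) +
  (((real m)^2 / (sinh r)^2 - lam\<^sup>2) * u r - cosh r / sinh r * u' r +
   ((sinh r * sinh r - cosh r * cosh r) / (sinh r * sinh r) * u r + u' r * (cosh r / sinh r)) / 2) * sqrt (sinh r)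
   = - Q r * w r" by (simp add: S_def w_def)
 qed
qed

lemma w_sq: "0 < r ==> (w r)^2 = (u r)^2 * sinh r"
 by (simp add: w_def power_mult_distrib)

lemma ww': assumes "0 < r"
 shows "w r * w' r = (half_tanh r ^ m)^2 * h r * (sinh r * h' r + (real m + cosh r / 2) * h r)"
proof -
 have s: "sinh r > 0" using assms by simp
 have "w r * w' r = u r * (sinh r * u' r + cosh r * u r / 2)"
  unfolding w_def w'_def using s real_sqrt_mult_self[of "sinh r"] by (simp add: field_simps)
 also have "\<dots> = (half_tanh r ^ m)^2 * h r * (sinh r * h' r + (real m + cosh r / 2) * h r)"
  unfolding u'_eq[OF assms] u_eq[OF assms] by (simp add: algebra_simps power2_eq_square)
 finally show ?thesis .
qed

lemma w'_sq: assumes "0 < r"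
 shows "(w' r)^2 = (half_tanh r ^ m)^2 * (sinh r * h' r + (real m + cosh r / 2) * h r)^2 / sinh r"
proof -
 have s: "sinh r > 0" using assms by simp
 have "(w' r)^2 = sinh r * (u' r + cosh r / sinh r * u r / 2)^2"
  unfolding w'_def using s by (simp add: power_mult_distrib)
 also have "\<dots> = (sinh r * u' r + cosh r * u r / 2)^2 / sinh r"
  using s by (simp add: field_simps power2_eq_square)
 also have "\<dots> = (half_tanh r ^ m)^2 * (sinh r * h' r + (real m + cosh r / 2) * h r)^2 / sinh r"
  unfolding u'_eq[OF assms] u_eq[OF assms] by (simp add: algebra_simps power2_eq_square)
 finally show ?thesis .
qed

lemma slope_bound:
 assumes a: "0 < a" "a < R" and h0: "0 < h0" "h0 <= 1 - lam\<^sup>2 / (2 * (real m + 1)) * (cosh a - 1)"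
 shows "- (lam^2 / (2 * (real m + 1)) * (sinh a)^2 / h0) * h a <= sinh a * h' a" and "h0 <= h a"
proof -
 define N where "N = lam^2 / (2 * (real m + 1))"
 show ha: "h0 <= h a" using h_bound(1)[OF a] h0 by linarith
 have "N * (sinh a)^2 * 1 <= N * (sinh a)^2 * (h a / h0)"
  using ha h0 by (intro mult_left_mono) (auto simp: N_def)
 moreover have "sinh a * \<bar>h' a\<bar> <= sinh a * (N * sinh a)"
  using h_bound(2)[OF a] a by (intro mult_left_mono) (auto simp: N_def)
 then have "sinh a * h' a >= - (N * (sinh a)^2)"
  using a by (smt (verit) mult.commute mult.left_commute power2_eq_square sinh_real_pos_iff mult_left_mono minus_mult_right)
 ultimately show "- (lam^2 / (2 * (real m + 1)) * (sinh a)^2 / h0) * h a <= sinh a * h' a"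
  unfolding N_def[symmetric] by simp
qed

lemma energy_bound_aux:
 assumes a: "0 < a" "a < b" "b < R"
  and e: "!!r. a <= r ==> r <= b ==> e <= (w' r)^2 + Q r * (w r)^2"
  and wa: "0 <= w a * w' a"
  and q: "!!r. a <= r ==> r <= b ==> Q r <= q" "0 <= q"
 shows "8/15 * e * (b-a)^3 <= integral {a..b} (%r. (u r)^2 * sinh r) * (2 * q * (b-a)^2 + 4)"
proof -
 have "integral {a..b} (%r. (w r)^2) = integral {a..b} (%r. (u r)^2 * sinh r)"
  by (rule integral_cong) (use a w_sq in auto)
 then show ?thesis
  using weighted_energy_bound[of a b w w' Q e q] a e wa q dw dw' by simp
qed

lemma dQ: "0 < r ==> (Q has_real_derivative 2 * ((real m)^2 - 1/4) * cosh r / (sinh r)^3) (at r)"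
 unfolding Q_def
 by (auto intro!: derivative_eq_intros) (simp add: field_simps power2_eq_square power3_eq_cube power4_eq_xxxx)

lemma dE: assumes r: "0 < r" "r < R"
 shows "((%r. (w' r)^2 + Q r * (w r)^2) has_real_derivative 2 * ((real m)^2 - 1/4) * cosh r / (sinh r)^3 * (w r)^2) (at r)"
proof -
 have "((%r. (w' r)^2 + Q r * (w r)^2) has_real_derivative
  2 * w' r * (- Q r * w r) + (2 * ((real m)^2 - 1/4) * cosh r / (sinh r)^3 * (w r)^2 + (2 * w r * w' r) * Q r)) (at r)"
  by (intro DERIV_add DERIV_mult dQ r DERIV_cong[OF DERIV_power[OF dw[OF r], of 2]] DERIV_cong[OF DERIV_power[OF dw'[OF r], of 2]]) auto
 then show ?thesis by (rule DERIV_cong) (simp add: algebra_simps)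
qed

lemma energy_bound_increasing:
 assumes a: "0 < a" "a < b" "b < R" and m: "m >= 1"
  and h0: "0 < h0" "h0 <= 1 - lam\<^sup>2 / (2 * (real m + 1)) * (cosh a - 1)"
  and k: "lam^2 / (2 * (real m + 1)) * (sinh a)^2 / h0 <= k" "k <= real m + cosh a / 2"
  and S: "0 <= S" "S <= (real m + cosh a / 2 - k)^2 + Q a * (sinh a)^2"
  and q: "lam^2 - 1/4 <= q" "0 <= q"
 shows "8/15 * ((half_tanh a ^ m)^2 * h0^2 / sinh a * S) * (b-a)^3
  <= integral {a..b} (%r. (u r)^2 * sinh r) * (2 * q * (b-a)^2 + 4)"
proof (rule energy_bound_aux[OF a])
 have aR: "0 < a" "a < R" using a by auto
 have s: "sinh a > 0" using a by simp
 have ha: "h0 <= h a" using slope_bound[OF aR h0] by simp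
 have "- k * h a <= - (lam^2 / (2 * (real m + 1)) * (sinh a)^2 / h0) * h a"
  using k(1) ha h0 by (intro mult_right_mono) auto
 then have sl: "(real m + cosh a / 2 - k) * h a <= sinh a * h' a + (real m + cosh a / 2) * h a"
  using slope_bound(1)[OF aR h0] by (simp add: algebra_simps)
 have sl0: "0 <= (real m + cosh a / 2 - k) * h a" using k(2) ha h0 by simp
 show "0 <= w a * w' a" unfolding ww'[OF a(1)] using sl sl0 ha h0 by (intro mult_nonneg_nonneg) auto
 have "(half_tanh a ^ m)^2 * h0^2 / sinh a * S <= (half_tanh a ^ m)^2 * (h a)^2 / sinh a * S"
  using ha h0 s S by (intro mult_right_mono divide_right_mono mult_left_mono power_mono) auto
 also have "\<dots> <= (half_tanh a ^ m)^2 * (h a)^2 / sinh a * ((real m + cosh a / 2 - k)^2 + Q a * (sinh a)^2)"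
  using s S by (intro mult_left_mono) auto
 also have "\<dots> = (half_tanh a ^ m)^2 * ((real m + cosh a / 2 - k) * h a)^2 / sinh a + Q a * (w a)^2"
  unfolding w_sq[OF a(1)] u_eq[OF a(1)] using s by (simp add: field_simps power2_eq_square)
 also have "\<dots> <= (w' a)^2 + Q a * (w a)^2"
  unfolding w'_sq[OF a(1)] using sl sl0 s
  by (intro add_right_mono divide_right_mono mult_left_mono power_mono) auto
 finally have E: "(half_tanh a ^ m)^2 * h0^2 / sinh a * S <= (w' a)^2 + Q a * (w a)^2" .
 have m2: "(real m)^2 >= 1" using m by (simp add: one_le_power)
 fix r assume r: "a <= r" "r <= b"
 have "(w' a)^2 + Q a * (w a)^2 <= (w' r)^2 + Q r * (w r)^2"
 proof (rule DERIV_nonneg_imp_nondecreasing[OF r(1)])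
  fix x assume x: "a <= x" "x <= r"
  show "\<exists>y. ((%r. (w' r)^2 + Q r * (w r)^2) has_real_derivative y) (at x) \<and> 0 <= y"
   using dE[of x] x r a m2 by (intro exI conjI) auto
 qed
 with E show "(half_tanh a ^ m)^2 * h0^2 / sinh a * S <= (w' r)^2 + Q r * (w r)^2" by linarith
 have "(1/4 - (real m)\<^sup>2) / (sinh r)^2 <= 0" using m2 by (intro divide_nonpos_nonneg) auto
 then show "Q r <= q" using q unfolding Q_def by linarith
qed (use q in auto)

lemma energy_bound_decreasing:
 assumes a: "0 < a" "a < b" "b < R" and m: "m = 0" and lam: "1/4 < lam^2"
  and h0: "0 < h0" "h0 <= 1 - lam\<^sup>2 / 2 * (cosh a - 1)"
  and k: "lam^2 / 2 * (sinh a)^2 / h0 <= cosh a / 2"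
 shows "8/15 * ((lam^2 - 1/4) * (h0^2 * sinh a)) * (b-a)^3
  <= integral {a..b} (%r. (u r)^2 * sinh r) * (2 * Q a * (b-a)^2 + 4)"
proof (rule energy_bound_aux[OF a])
 have aR: "0 < a" "a < R" using a by auto
 have s: "sinh a > 0" using a by simp
 have h0': "h0 <= 1 - lam\<^sup>2 / (2 * (real m + 1)) * (cosh a - 1)" using h0 m by simp
 have ha: "h0 <= h a" using slope_bound[OF aR h0(1) h0'] by simp
 have "- (cosh a / 2) * h a <= - (lam^2 / 2 * (sinh a)^2 / h0) * h a"
  using k ha h0 by (intro mult_right_mono) auto
 then have "0 <= sinh a * h' a + (real m + cosh a / 2) * h a"
  using slope_bound(1)[OF aR h0(1) h0'] m by (simp add: algebra_simps)
 then show "0 <= w a * w' a" unfolding ww'[OF a(1)] using ha h0 by (intro mult_nonneg_nonneg) auto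
 have Qpos: "Q r > 0" if "r > 0" for r
  using that lam m unfolding Q_def by (simp add: add_pos_nonneg)
 have Qlow: "lam^2 - 1/4 <= Q r" if "r > 0" for r
  using that lam m unfolding Q_def by simp
 show "0 <= Q a" using Qpos[OF a(1)] by simp
 have "(w a)^2 = (h a)^2 * sinh a" unfolding w_sq[OF a(1)] u_eq[OF a(1)] using m by simp
 then have wa: "h0^2 * sinh a <= (w a)^2" using ha h0 s by (simp add: power_mono)
 fix r assume r: "a <= r" "r <= b"
 define E where "E = (%r. (w' r)^2 + Q r * (w r)^2)"
 have "E a / Q a <= E r / Q r"
 proof (rule DERIV_nonneg_imp_nondecreasing[OF r(1)])
  fix x assume x: "a <= x" "x <= r"
  then have x0: "0 < x" "x < R" using a r by auto
  define D where "D = 2 * ((real m)^2 - 1/4) * cosh x / (sinh x)^3"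
  have D: "D <= 0" unfolding D_def using m x0 by (auto intro!: divide_nonpos_pos mult_nonpos_nonneg)
  have "((%r. E r / Q r) has_real_derivative (D * (w x)^2 * Q x - E x * D) / (Q x * Q x)) (at x)"
   unfolding E_def D_def using Qpos[OF x0(1)] by (intro DERIV_divide dE x0 dQ) auto
  moreover have "(D * (w x)^2 * Q x - E x * D) = - D * (w' x)^2" unfolding E_def by (simp add: algebra_simps)
  moreover have "0 <= - D * (w' x)^2 / (Q x * Q x)"
   using D Qpos[OF x0(1)] by (intro divide_nonneg_pos mult_nonneg_nonneg) auto
  ultimately show "\<exists>y. ((%r. E r / Q r) has_real_derivative y) (at x) \<and> 0 <= y"
   by metis
 qed
 moreover have "h0^2 * sinh a * Q a <= E a"
  using mult_left_mono[OF wa less_imp_le[OF Qpos[OF a(1)]]] unfolding E_def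
  by (simp add: mult.commute add_increasing)
 then have "h0^2 * sinh a <= E a / Q a"
  using Qpos[OF a(1)] by (simp add: pos_le_divide_eq)
 ultimately have "h0^2 * sinh a <= E r / Q r" by linarith
 then have "h0^2 * sinh a * Q r <= E r"
  using Qpos[of r] r a pos_le_divide_eq[of "Q r" "h0^2 * sinh a" "E r"] by simp
 moreover have "(lam^2 - 1/4) * (h0^2 * sinh a) <= h0^2 * sinh a * Q r"
  using mult_right_mono[OF Qlow[of r], of "h0^2 * sinh a"] r a s by (simp add: mult.commute)
 ultimately show "(lam^2 - 1/4) * (h0^2 * sinh a) <= (w' r)^2 + Q r * (w r)^2" unfolding E_def by linarith
 have "sinh a <= sinh r" using r by simp
 then have "(sinh a)^2 <= (sinh r)^2" using s by (intro power_mono) auto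
 then show "Q r <= Q a" unfolding Q_def using m s
  by (auto intro!: frac_le)
qed

end

lemma mode2_numeric:
 fixes X y T J v l :: real
 assumes y: "0 < y" "y <= 8" and X: "0 < X"
  and T: "T >= 194/10 / X * (1 + 257/100/X)^5 + 1288/100 * y / X * (1 + 22/10/X)^3"
  and J: "J >= 313/1000 + v" and v: "0 <= v"
  and l: "X - 3/2 <= l" "0 <= l"
  and vl: "42/100 * (2655/1000 + 17226/10000 * y - 1776/10000 * y^2) * l^3 <= v * sqrt (y+2) * (4 + 2 * max 0 (1 - 2*y/9) * l^2)"
 shows "(y+2)^2 <= T * J"
proof -
 define S where "S = 2655/1000 + 17226/10000 * y - 1776/10000 * y^2"
 define kap where "kap = max 0 (1 - 2*y/9)"
 have kap: "0 <= kap" by (simp add: kap_def)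
 have yy: "y * y <= 8 * y" using y by simp
 have e: "(y+2)^2 = y*y + 4*y + 4" by (simp add: power2_eq_square algebra_simps)
 have S: "S >= 2655/1000 + 3/10 * y" using yy y unfolding S_def power2_eq_square by linarith
 have T0: "T >= 0" using T X y by (smt (verit) divide_nonneg_pos mult_nonneg_nonneg zero_le_power)
 show ?thesis
 proof (cases "X <= 3")
  case True
  have "194/10 / X * (1 + 257/100/X)^5 >= 194/10 / 3 * (1 + 257/100/3)^5"
   using True X by (intro mult_mono power_mono add_left_mono divide_left_mono) auto
  moreover have "1288/100 * y / X * (1 + 22/10/X)^3 >= 1288/100 * y / 3 * (1 + 22/10/3)^3"
   using True X y by (intro mult_mono power_mono add_left_mono divide_left_mono) auto
  then have "T >= 14267/100 + 2235/100 * y"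
   proof -
    have "194/10 / 3 * (1 + 257/100/3)^5 >= ((14267/100)::real)" "1288/100 / 3 * (1 + 22/10/3)^3 >= ((2235/100)::real)"
     by (simp_all add: eval_nat_numeral)
    note c = this
    have "y * (1288/100 / 3 * (1 + 22/10/3)^3) >= y * (2235/100)" using c(2) y by (intro mult_left_mono) auto
    moreover have "1288/100 * y / 3 * (1 + 22/10/3)^3 = y * (1288/100 / 3 * (1 + 22/10/3)^3)" by simp
    ultimately show ?thesis
     using c(1) T \<open>(194/10) / X * (1 + 257/100/X)^5 >= 194/10 / 3 * (1 + 257/100/3)^5\<close>
      \<open>(1288/100) * y / X * (1 + 22/10/X)^3 >= 1288/100 * y / 3 * (1 + 22/10/3)^3\<close> by linarith
   qed
  then have "T * J >= (14267/100 + 2235/100 * y) * (313/1000)"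
   using J v y by (intro mult_mono) auto
  moreover have "(y+2)^2 <= (14267/100 + 2235/100 * y) * (313/1000)"
   unfolding e by (simp add: field_simps) (use y yy in linarith)
  ultimately show ?thesis by linarith
 next
  case X3: False
  show ?thesis
  proof (cases "X <= 4")
   case True
   have "194/10 / X * (1 + 257/100/X)^5 >= 194/10 / 4 * (1 + 257/100/4)^5"
    using True X by (intro mult_mono power_mono add_left_mono divide_left_mono) auto
   moreover have "1288/100 * y / X * (1 + 22/10/X)^3 >= 1288/100 * y / 4 * (1 + 22/10/4)^3"
    using True X y by (intro mult_mono power_mono add_left_mono divide_left_mono) auto
   then have T4: "T >= 579/10 + 119/10 * y"
   proof -
    have "194/10 / 4 * (1 + 257/100/4)^5 >= ((579/10)::real)" "1288/100 / 4 * (1 + 22/10/4)^3 >= ((119/10)::real)"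
     by (simp_all add: eval_nat_numeral)
    note c = this
    have "y * (1288/100 / 4 * (1 + 22/10/4)^3) >= y * (119/10)" using c(2) y by (intro mult_left_mono) auto
    moreover have "1288/100 * y / 4 * (1 + 22/10/4)^3 = y * (1288/100 / 4 * (1 + 22/10/4)^3)" by simp
    ultimately show ?thesis
     using c(1) T \<open>(194/10) / X * (1 + 257/100/X)^5 >= 194/10 / 4 * (1 + 257/100/4)^5\<close>
      \<open>(1288/100) * y / X * (1 + 22/10/X)^3 >= 1288/100 * y / 4 * (1 + 22/10/4)^3\<close> by linarith
   qed
   have l15: "l >= 15/10" using l X3 by simp
   then have l3: "l^3 >= 15/10 * l^2" "l^2 >= 225/100"
    using power_mono[of "(15/10)" l 2] mult_right_mono[of "(15/10)" l "l^2"]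
    by (auto simp: power2_eq_square power3_eq_cube)
   show ?thesis
   proof (cases "y <= 45/10")
    case True
    have "sqrt (y+2) <= 256/100" by (rule real_le_lsqrt) (use True y in "auto simp: power2_eq_square")
    moreover have "4 + 2 * kap * l^2 <= 4 + 2 * l^2"
     using y unfolding kap_def by (auto intro!: mult_left_le_one_le)
    ultimately have "v * sqrt (y+2) * (4 + 2 * kap * l^2) <= v * (256/100) * (4 + 2 * l^2)"
     using v kap y by (intro mult_mono) (auto intro!: add_nonneg_nonneg mult_nonneg_nonneg)
    moreover have "42/100 * S * l^3 >= 42/100 * (2655/1000) * (15/10 * l^2)"
     using S y l3 by (intro mult_mono) auto
    ultimately have "42/100 * (2655/1000) * (15/10 * l^2) <= v * (256/100) * (4 + 2 * l^2)"
     using vl unfolding S_def kap_def by linarith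
    moreover have "v * (256/100) * (4 + 2 * l^2) <= v * (256/100) * (378/100 * l^2)"
     using v l3 by (intro mult_left_mono) auto
    ultimately have "16726/10000 * l^2 <= v * (968/100) * l^2" using l3 v by simp
    moreover have "l^2 > 0" using l15 by simp
    ultimately have "16726/10000 <= v * (968/100)" by (rule mult_right_le_imp_le)
    then have "J >= 48/100" using J by simp
    then have "T * J >= (579/10 + 119/10 * y) * (48/100)"
     using T4 y by (intro mult_mono) auto
    moreover have "(y+2)^2 <= (579/10 + 119/10 * y) * (48/100)"
     unfolding e by (simp add: field_simps) (use y mult_left_mono[OF True less_imp_le[OF y(1)]] in linarith)
    ultimately show ?thesis by linarith
   next
    case False
    have "sqrt (y+2) <= 317/100" by (rule real_le_lsqrt) (use False y in "auto simp: power2_eq_square")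
    moreover have kap0: "kap = 0" using False unfolding kap_def by simp
    ultimately have vs: "v * sqrt (y+2) * (4 + 2 * kap * l^2) <= v * (317/100) * 4"
     using v mult_left_mono[of "sqrt (y+2)" "(317/100)" v] by simp
    have "(y - 45/10) * (8 - y) >= 0" using False y by simp
    moreover have "(y - 45/10) * (8 - y) = 125/10 * y - y * y - 36" by (simp add: field_simps)
    ultimately have S5: "S >= 505/100" using False y unfolding S_def power2_eq_square by linarith
    have "42/100 * S * l^3 >= 42/100 * (505/100) * (15/10 * (225/100))"
     using l3 S5 by (intro mult_mono) auto
    then have "42/100 * (505/100) * (15/10 * (225/100)) <= v * (317/100) * 4"
     using vs vl unfolding S_def kap_def by linarith
    then have "J >= 87/100" using J by simp
    then have "T * J >= (579/10 + 119/10 * y) * (87/100)"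
     using T4 y by (intro mult_mono) auto
    moreover have "(y+2)^2 <= (579/10 + 119/10 * y) * (87/100)"
     unfolding e by (simp add: field_simps) (use y yy in linarith)
    ultimately show ?thesis by linarith
   qed
  next
   case X4: False
   define A where "A = 194/10 + 1288/100 * y"
   have b5: "(1 + 257/100/X)^5 >= 1 + 66/10/X"
   proof -
    have "1 + real 5 * (257/100/X) <= (1 + 257/100/X)^5" using X by (intro Bernoulli_inequality) (auto intro: order_trans[of _ 0])
    moreover have "66/10/X <= real 5 * (257/100/X)" using X by (simp add: field_simps)
    ultimately show ?thesis by linarith
   qed
   have b3: "(1 + 22/10/X)^3 >= 1 + 66/10/X"
   proof -
    have "1 + real 3 * (22/10/X) <= (1 + 22/10/X)^3" using X by (intro Bernoulli_inequality) (auto intro: order_trans[of _ 0])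
    moreover have "66/10/X <= real 3 * (22/10/X)" using X by (simp add: field_simps)
    ultimately show ?thesis by linarith
   qed
   have "T >= 194/10 / X * (1 + 66/10/X) + 1288/100 * y / X * (1 + 66/10/X)"
    using T b5 b3 X y mult_left_mono[OF b5, of "194/10/X"] mult_left_mono[OF b3, of "1288/100 * y / X"] by simp
   also have "194/10 / X * (1 + 66/10/X) + 1288/100 * y / X * (1 + 66/10/X) = A * (X + 66/10) / X^2"
    unfolding A_def using X by (simp add: field_simps power2_eq_square)
   finally have TA: "T >= A * (X + 66/10) / X^2" .
   define k where "k = X - 3/2"
   have k: "k >= 5/2" "k <= l" "X = k + 3/2" using X4 l by (auto simp: k_def)
   have S0: "S >= 0" using S y by simp
   have vk: "42/100 * S * k^3 <= v * sqrt (y+2) * (4 + 2 * kap * k^2)"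
   proof -
    have "42/100 * S * k^3 * (4 + 2 * kap * l^2) <= 42/100 * S * l^3 * (4 + 2 * kap * k^2)"
    proof -
     have "k^3 <= l^3" using k by (intro power_mono) auto
     moreover have "k^3 * l^2 <= l^3 * k^2"
      using k mult_right_mono[of k l "k^2 * l^2"] by (simp add: power2_eq_square power3_eq_cube mult_ac)
     ultimately have "k^3 * 4 + 2 * kap * (k^3 * l^2) <= l^3 * 4 + 2 * kap * (l^3 * k^2)"
      using kap by (intro add_mono mult_left_mono) auto
     then have "42/100 * S * (k^3 * 4 + 2 * kap * (k^3 * l^2)) <= 42/100 * S * (l^3 * 4 + 2 * kap * (l^3 * k^2))"
      using S0 by (intro mult_left_mono) auto
     then show ?thesis by (simp add: algebra_simps)
    qed
    also have "\<dots> <= v * sqrt (y+2) * (4 + 2 * kap * l^2) * (4 + 2 * kap * k^2)"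
     using vl kap unfolding S_def kap_def by (intro mult_right_mono) auto
    finally have "(42/100 * S * k^3) * (4 + 2 * kap * l^2) <= (v * sqrt (y+2) * (4 + 2 * kap * k^2)) * (4 + 2 * kap * l^2)"
     by (simp add: mult_ac)
    moreover have "4 + 2 * kap * l^2 > 0" using kap by (simp add: add_pos_nonneg)
    ultimately show ?thesis by (rule mult_right_le_imp_le)
   qed
   have s2: "sqrt (y+2) > 0" using y by simp
   \<comment> \<open>tangent lines of the square root at \<open>y + 2 = 9/4\<close> and \<open>y + 2 = 9\<close>\<close>
   have tan1: "sqrt (y+2) <= (y + 425/100) / 3"
   proof -
    have "2 * sqrt (y+2) * (15/10) <= (sqrt (y+2))^2 + (15/10)^2" using sum_squares_bound[of "sqrt (y+2)" "(15/10)"] by simp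
    then show ?thesis using y by (simp add: power2_eq_square)
   qed
   have tan2: "sqrt (y+2) <= (y + 11) / 6"
   proof -
    have "2 * sqrt (y+2) * 3 <= (sqrt (y+2))^2 + 3^2" using sum_squares_bound[of "sqrt (y+2)" "3"] by simp
    then show ?thesis using y by (simp add: power2_eq_square)
   qed
   have c1: "(y + 425/100) / 3 * (y+2)^2 = (y*(y*y) + 825/100 * (y*y) + 21 * y + 17) / 3"
    and c2: "(y + 11) / 6 * (y+2)^2 = (y*(y*y) + 15 * (y*y) + 48 * y + 44) / 6"
    and c3: "(1 - 2*y/9) * ((y + 425/100) / 3 * (y+2)^2) = (17 + 155/9 * y + 43/12 * (y*y) - 5/6 * (y*(y*y)) - 2/9 * (y*(y*(y*y)))) / 3"
    and AS: "A * S = 51507/1000 + 6761484/100000 * y + 18741648/1000000 * (y*y) - 2287488/1000000 * (y*(y*y))"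
    by (simp_all add: A_def S_def power2_eq_square field_simps)
   have y0: "y*y >= 0" "y*(y*y) >= 0" "y*(y*(y*y)) >= 0" using y by auto
   have m: "75/100 * (sqrt (y+2) * (y+2)^2) <= 42/100 * (A * S) \<and> (33/10) * kap * (sqrt (y+2) * (y+2)^2) <= 42/100 * (A * S)"
   proof (cases "y <= 3")
    case True
    have s: "sqrt (y+2) * (y+2)^2 <= (y + 425/100) / 3 * (y+2)^2" using tan1 by (intro mult_right_mono) auto
    have y3: "y*(y*y) <= 3 * (y*y)" using mult_right_mono[OF True y0(1)] .
    have k1: "kap = 1 - 2*y/9" using True by (simp add: kap_def)
    have "33/10 * kap * (sqrt (y+2) * (y+2)^2) <= 33/10 * kap * ((y + 425/100) / 3 * (y+2)^2)"
     using s kap by (intro mult_left_mono) auto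
    also have "\<dots> = 33/10 * ((1 - 2*y/9) * ((y + 425/100) / 3 * (y+2)^2))" unfolding k1 by (simp only: mult.assoc)
    also have "\<dots> <= 42/100 * (A * S)" unfolding c3 AS by (simp add: field_simps) (use y y0 y3 in linarith)
    finally have "33/10 * kap * (sqrt (y+2) * (y+2)^2) <= 42/100 * (A * S)" .
    moreover have "75/100 * (sqrt (y+2) * (y+2)^2) <= 42/100 * (A * S)"
     by (rule order_trans[OF mult_left_mono[OF s]], unfold c1 AS) (simp_all add: field_simps, use y y0 y3 in linarith)
    ultimately show ?thesis by blast
   next
    case False
    have s: "sqrt (y+2) * (y+2)^2 <= (y + 11) / 6 * (y+2)^2" using tan2 by (intro mult_right_mono) auto
    have y3: "y*(y*y) <= 8 * (y*y)" using mult_right_mono[OF y(2) y0(1)] .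
    have "33/10 * kap * (sqrt (y+2) * (y+2)^2) <= 42/100 * (A * S)"
    proof (cases "y <= 45/10")
     case True
     then have y45: "y*(y*y) <= 45/10 * (y*y)" using mult_right_mono[OF True y0(1)] by simp
     have "kap <= 1/3" using False True by (simp add: kap_def)
     then have "33/10 * kap * (sqrt (y+2) * (y+2)^2) <= 33/10 * (1/3) * ((y + 11) / 6 * (y+2)^2)"
      using s kap y by (intro mult_mono) auto
     also have "\<dots> <= 42/100 * (A * S)"
      unfolding AS c2 by (simp add: field_simps) (use y y0 y45 mult_left_mono[OF True less_imp_le[OF y(1)]] in linarith)
     finally show ?thesis .
    next
     case False
     then have "kap = 0" by (simp add: kap_def)
     then show ?thesis using S0 y by (simp add: A_def)
    qed
    moreover have "75/100 * (sqrt (y+2) * (y+2)^2) <= 42/100 * (A * S)"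
     by (rule order_trans[OF mult_left_mono[OF s]], unfold c2 AS) (simp_all add: field_simps, use y y0 y3 yy in linarith)
    ultimately show ?thesis by blast
   qed
   define m where "m = 42/100 * (A * S) / (sqrt (y+2) * (y+2)^2)"
   have d0: "sqrt (y+2) * (y+2)^2 > 0" using y by simp
   have m1: "m >= 75/100" "m >= 33/10 * kap" unfolding m_def using m d0 by (simp_all add: pos_le_divide_eq)
   have key: "X^2 * (4 + 2 * kap * k^2) <= m * (X + 66/10) * k^3"
   proof -
    define j where "j = k - 5/2"
    have j: "j >= 0" "k = j + 5/2" using k by (auto simp: j_def)
    have jp: "j * j >= 0" "j * (j * j) >= 0" "j * (j * (j * j)) >= 0" using j by auto
    define P where "P = (X + 66/10) * k^3"
    define Q where "Q = X^2 * (2 / (33/10)) * k^2"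
    have "2 * kap * k^2 <= 2 * (m / (33/10)) * k^2" using m1 by (intro mult_right_mono) auto
    then have "X^2 * (4 + 2 * kap * k^2) <= X^2 * (4 + 2 * (m / (33/10)) * k^2)"
     by (intro mult_left_mono add_left_mono) auto
    moreover have "X^2 * (4 + 2 * (m / (33/10)) * k^2) = X^2 * 4 + m * Q" by (simp add: Q_def field_simps)
    moreover have "0 <= P - Q"
     unfolding P_def Q_def k(3) j(2) power2_eq_square power3_eq_cube
     by (simp add: field_simps) (use j(1) jp in linarith)
    then have "0 <= (m - 75/100) * (P - Q)" using m1 by (intro mult_nonneg_nonneg) auto
    then have "75/100 * (P - Q) <= m * P - m * Q" by (simp add: algebra_simps)
    moreover have "X^2 * 4 <= 75/100 * (P - Q)"
     unfolding P_def Q_def k(3) j(2) power2_eq_square power3_eq_cube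
     by (simp add: field_simps) (use j(1) jp in linarith)
    ultimately have "X^2 * (4 + 2 * kap * k^2) <= m * P" by linarith
    then show ?thesis unfolding P_def by (simp only: mult.assoc)
   qed
   have md: "m * (sqrt (y+2) * (y+2)^2) = 42/100 * (A * S)" using d0 by (metis m_def nonzero_eq_divide_eq less_irrefl)
   have "(y+2)^2 * (X^2 * (sqrt (y+2) * (4 + 2 * kap * k^2))) = (X^2 * (4 + 2 * kap * k^2)) * (sqrt (y+2) * (y+2)^2)"
    by (simp add: mult_ac)
   also have "\<dots> <= (m * (X + 66/10) * k^3) * (sqrt (y+2) * (y+2)^2)"
    using key d0 by (intro mult_right_mono) auto
   also have "\<dots> = (X + 66/10) * k^3 * (m * (sqrt (y+2) * (y+2)^2))" by (simp only: mult_ac)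
   also have "\<dots> = (A * (X + 66/10)) * (42/100 * S * k^3)" unfolding md by (simp only: mult_ac)
   also have "\<dots> <= (A * (X + 66/10)) * (v * sqrt (y+2) * (4 + 2 * kap * k^2))"
    using vk y X by (intro mult_left_mono) (auto simp: A_def)
   also have "\<dots> = (A * (X + 66/10) / X^2 * v) * (X^2 * (sqrt (y+2) * (4 + 2 * kap * k^2)))" using X by simp
   finally have "(y+2)^2 <= A * (X + 66/10) / X^2 * v"
    using X s2 kap by (subst (asm) mult_le_cancel_right_pos) (auto intro!: mult_pos_pos add_pos_nonneg)
   also have "\<dots> <= T * J" using TA J v T0 X y by (intro mult_mono) (auto simp: A_def)
   finally show ?thesis .
  qed
 qed
qed

definition bound_minorant :: "real => real => real" where
 "bound_minorant lam b = 194/10 / b * (lam + 257/100/b)^5 + 145/10 / b * (lam + 22/10/b)^3 + 92/1000"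

lemma cosh_ge_quadratic: "1 + x^2 / 2 <= cosh (x::real)"
proof -
 have "\<bar>y\<bar> <= \<bar>sinh y\<bar>" for y :: real
 proof -
  have *: "z <= sinh z" if "0 <= z" for z :: real
  proof -
   have "sinh 0 - 0 <= sinh z - z"
   proof (rule DERIV_nonneg_imp_nondecreasing[OF that])
    fix t :: real
    show "\<exists>y. ((%t. sinh t - t) has_real_derivative y) (at t) \<and> 0 <= y"
     using cosh_real_ge_1[of t] by (intro exI[of _ "cosh t - 1"]) (auto intro!: derivative_eq_intros)
   qed
   then show ?thesis by simp
  qed
  show ?thesis using *[of y] *[of "-y"] by (cases "y >= 0") auto
 qed
 from power_mono[OF this[of "x/2"] abs_ge_zero, of 2]
 have "(x/2)^2 <= (sinh (x/2))^2" by (simp only: power2_abs)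
 moreover have "cosh x = 1 + 2 * (sinh (x/2))^2"
  using cosh_double[of "x/2"] cosh_square_eq[of "x/2"] by simp
 ultimately show ?thesis by (simp add: power_divide)
qed

lemma cosh_29_ge_9: "9 <= cosh (29/10 :: real)"
proof -
 have step: "2 * c^2 - 1 <= cosh (2 * x)" if "c <= cosh x" "0 <= c" for c x :: real
  unfolding cosh_double_cosh using power_mono[OF that, of 2] by simp
 have "1016/1000 + 4/10000 <= cosh (29/160::real)" using cosh_ge_quadratic[of "29/160"] by (simp add: power2_eq_square)
 from step[OF this] have "10661/10000 <= cosh (29/80::real)" by (simp add: power2_eq_square)
 from step[OF this] have "12731/10000 <= cosh (29/40::real)" by (simp add: power2_eq_square)
 from step[OF this] have "22415/10000 <= cosh (29/20::real)" by (simp add: power2_eq_square)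
 from step[OF this] show ?thesis by (simp add: power2_eq_square)
qed

lemma ln_5_le: "ln (5::real) <= 162/100"
proof -
 have "(1 + 81/800 + (81/800)^2 / 2) ^ 16 <= exp (81/800 :: real) ^ 16"
  using exp_lower_Taylor_quadratic[of "81/800::real"] by (intro power_mono) (auto simp: power2_eq_square)
 also have "\<dots> = exp (162/100)" by (simp add: exp_of_nat_mult[symmetric])
 finally have "(1 + 81/800 + (81/800)^2 / 2) ^ 16 <= exp (162/100 :: real)" .
 moreover have "(1106/1000) ^ 16 <= (1 + 81/800 + (81/800)^2 / 2 :: real) ^ 16"
  by (intro power_mono) (auto simp: power2_eq_square)
 moreover have "5 <= (1106/1000 :: real) ^ 16" by (simp add: eval_nat_numeral)
 ultimately have "5 <= exp (162/100 :: real)" by linarith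
 then show ?thesis by (metis ln_exp ln_le_cancel_iff exp_gt_zero zero_less_numeral)
qed

lemma bound_minorant_antimono:
 assumes "0 <= l" "l <= lam" "0 < b" "b <= B"
 shows "bound_minorant l B <= bound_minorant lam b"
 unfolding bound_minorant_def using assms
 by (intro add_mono mult_mono power_mono divide_left_mono divide_right_mono) (auto intro!: mult_pos_pos add_nonneg_nonneg)

context radial_mode
begin

lemma mode0_bound:
 assumes m: "m = 0" and b: "0 < b" "b < R" and cu: "continuous_on {0..b} u" and lam: "0 <= lam"
  and beta: "bound_minorant lam b <= beta"
 shows "lam^4 <= 2 * beta * integral {0..b} (%r. (u r)^2 * sinh r)"
proof (cases "lam = 0")
 case True
 have "0 <= bound_minorant lam b" unfolding bound_minorant_def using lam b by simp
 moreover have "0 <= integral {0..b} (%r. (u r)^2 * sinh r)" by (rule integral_nonneg)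
   (use cu in "auto intro!: integrable_continuous_real continuous_intros")
 ultimately show ?thesis using beta True by simp
next
 case False
 then have lam: "lam > 0" using lam by simp
 define I where "I = (%a b. integral {a..b} (%r. (u r)^2 * sinh r))"
 have ii: "(%r. (u r)^2 * sinh r) integrable_on {c..d}" if "0 <= c" "d <= b" for c d
  using that by (intro integrable_continuous_real continuous_intros continuous_on_subset[OF cu]) auto
 define a where "a = arcosh (1 + 4/10 / lam^2)"
 have ca: "cosh a = 1 + 4/10 / lam^2" and a0: "a >= 0" unfolding a_def using lam by simp_all
 then have a: "a > 0" using lam by (cases "a = 0") auto
 have simple: "64/100 * (cosh rho - 1) <= I 0 rho" if rho: "0 < rho" "rho <= a" "rho <= b" for rho
 proof -
  have "cosh rho <= cosh a" using rho by (simp add: cosh_real_nonneg_le_iff)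
  then have "lam^2 / 2 * (cosh rho - 1) <= lam^2 / 2 * (cosh a - 1)" by (intro mult_left_mono) auto
  also have "\<dots> = 2/10" unfolding ca using lam by simp
  finally have "8/10 <= 1 - lam\<^sup>2 / (2 * (real m + 1)) * (cosh rho - 1)" using m by simp
  then have "(8/10)^2 * (cosh rho - cosh 0) <= I 0 rho" unfolding I_def
   using rho b m by (intro integral_lower_bound[where g=sinh] continuous_on_subset[OF cu])
    (auto intro!: derivative_eq_intros continuous_intros)
  then show ?thesis by (simp add: power2_eq_square)
 qed
 have t: "0 <= 194/10 / b * (lam + 257/100/b)^5" "0 <= 145/10 / b * (lam + 22/10/b)^3"
  using lam b by auto
 have beta1: "194/10 / b * (lam + 257/100/b)^5 + 92/1000 <= beta"
  using beta t unfolding bound_minorant_def by linarith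
 have I0: "0 <= I 0 b" unfolding I_def by (rule integral_nonneg) (use ii[of 0 b] b in auto)
 have beta0: "0 <= beta" using beta1 t by linarith
 have "lam^4 <= 2 * beta * I 0 b"
 proof (cases "b <= a")
  case True
  have "64/100 * (b^2 / 2) <= I 0 b" using simple[of b] cosh_ge_quadratic[of b] True b by simp
  moreover have "194/10 / b * (257/100/b)^5 <= beta"
  proof -
   have "194/10 / b * (257/100/b)^5 <= 194/10 / b * (lam + 257/100/b)^5"
    using b lam by (intro mult_left_mono power_mono) auto
   then show ?thesis using beta1 by linarith
  qed
  ultimately have "2 * (194/10 / b * (257/100/b)^5) * (64/100 * (b^2 / 2)) <= 2 * beta * I 0 b"
   using b beta0 by (intro mult_mono) auto
  moreover have "1 / b^4 <= 2 * (194/10 / b * (257/100/b)^5) * (64/100 * (b^2 / 2))"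
  proof -
   have "b^2 / (b * b^5) = 1 / b^4" using b by (simp add: eval_nat_numeral)
   moreover have "2 * (194/10 / b * (257/100/b)^5) * (64/100 * (b^2 / 2))
    = 194/10 * (257/100)^5 * (64/100) * (b^2 / (b * b^5))" by (simp add: power_divide)
   moreover have "1 <= 194/10 * (257/100)^5 * (64/100 :: real)" by (simp add: eval_nat_numeral)
   then have "1 * (1 / b^4) <= 194/10 * (257/100)^5 * (64/100 :: real) * (1 / b^4)"
    by (rule mult_right_mono) simp
   ultimately show ?thesis by (simp only: mult_1)
  qed
  moreover have "lam^4 <= 1 / b^4"
  proof -
   have "b^2 / 2 <= 4/10 / lam^2" using cosh_ge_quadratic[of b] ca cosh_real_nonneg_le_iff[of b a] True b a by simp
   then have "lam^2 * b^2 <= 8/10" using lam by (simp add: field_simps)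
   then have "(lam^2 * b^2)^2 <= 1" by (intro power_le_one) auto
   moreover have "(lam^2 * b^2)^2 = lam^4 * b^4" by (simp add: power2_eq_square power4_eq_xxxx)
   ultimately show ?thesis using b by (simp add: pos_le_divide_eq)
  qed
  ultimately show ?thesis by linarith
 next
  case False
  then have ab: "a < b" by simp
  have I1: "256/1000 / lam^2 <= I 0 a" using simple[of a] ca a ab by simp
  have split: "I 0 a + I a b = I 0 b" unfolding I_def
   using a ab ii[of 0 b] by (intro Henstock_Kurzweil_Integration.integral_combine) auto
  have Iab: "0 <= I a b" unfolding I_def by (rule integral_nonneg) (use ii[of a b] a in auto)
  define X where "X = lam * b"
  have X: "X > 0" "b = X / lam" using lam b by (auto simp: X_def)
  consider "lam^2 <= 36/100" | "X <= 17" | "36/100 < lam^2" "17 < X" by linarith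
  then show ?thesis
  proof cases
   case 1
   have "92/1000 * (256/1000 / lam^2) <= beta * I 0 b"
   proof (rule mult_mono)
    show "92/1000 <= beta" using beta1 t by linarith
   qed (use I1 Iab split beta0 lam in auto)
   moreover have "lam^4 * lam^2 <= (36/100)^2 * (36/100)"
    using mult_mono[OF mult_mono[OF 1 1] 1] by (simp add: power2_eq_square power4_eq_xxxx)
   then have "lam^4 <= 2 * (92/1000 * (256/1000 / lam^2))"
    using lam by (simp add: field_simps power2_eq_square)
   ultimately show ?thesis by linarith
  next
   case 2
   have "1 + real 5 * (257/100/X) <= (1 + 257/100/X)^5" using X by (intro Bernoulli_inequality) (auto intro: order_trans[of _ 0])
   then have "lam^5 * (1 + 5 * (257/100/X)) <= lam^5 * (1 + 257/100/X)^5" using lam by (intro mult_left_mono) auto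
   also have "\<dots> = (lam + 257/100/b)^5"
    unfolding power_mult_distrib[symmetric] using lam X by (simp add: X(2) field_simps)
   finally have "194/10 / b * (lam^5 * (1 + 5 * (257/100/X))) <= 194/10 / b * (lam + 257/100/b)^5"
    using b by (intro mult_left_mono) auto
   then have "194/10 / b * (lam^5 * (1 + 5 * (257/100/X))) <= beta" using beta1 by linarith
   then have "194/10 / b * (lam^5 * (1 + 5 * (257/100/X))) * (256/1000 / lam^2) <= beta * I 0 b"
    using I1 Iab split beta0 lam X b by (intro mult_mono) auto
   moreover have "lam^4 <= 2 * (194/10 / b * (lam^5 * (1 + 5 * (257/100/X))) * (256/1000 / lam^2))"
   proof -
    have gen: "2 * (194/10 / (X / lam) * (A * Y)) * (256/1000 / B) = (A / B * lam) * (2 * (194/10) * (256/1000) * (Y / X))"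
     for A B Y :: real by (simp add: mult_ac)
    have l5: "lam^5 / lam^2 * lam = lam^4" using lam by (simp add: eval_nat_numeral)
    have "2 * (194/10 / b * (lam^5 * (1 + 5 * (257/100/X))) * (256/1000 / lam^2))
     = (lam^5 / lam^2 * lam) * (2 * (194/10) * (256/1000) * ((1 + 5 * (257/100/X)) / X))"
     unfolding X(2) using gen[of "lam^5" "1 + 5 * (257/100/X)" "lam^2"] by simp
    also have "(1 + 5 * (257/100/X)) / X = (X + 1285/100) / X^2"
     using X(1) by (simp add: field_simps power2_eq_square)
    finally have "2 * (194/10 / b * (lam^5 * (1 + 5 * (257/100/X))) * (256/1000 / lam^2))
     = lam^4 * (99328/10000 * (X + 1285/100) / X^2)" unfolding l5 by simp
    moreover have XX: "X * X <= 17 * X" using 2 X(1) by simp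
    then have "1 <= 99328/10000 * (X + 1285/100) / X^2"
     using X(1) 2 by (simp add: pos_le_divide_eq power2_eq_square field_simps) (use 2 XX in linarith)
    ultimately show ?thesis using lam mult_left_mono[of 1 _ "lam^4"] by (metis less_imp_le mult.right_neutral zero_less_power)
   qed
   ultimately show ?thesis by linarith
  next
   case 3
   define L where "L = b - a"
   have s0: "sinh a > 0" using a by simp
   have sh: "(sinh a)^2 = 4/10 / lam^2 * (4/10 / lam^2 + 2)"
    using cosh_square_eq[of a] unfolding ca by (simp add: power2_eq_square algebra_simps)
   have "8/10 / lam^2 <= (sinh a)^2" unfolding sh using lam by (simp add: field_simps)
   then have sh1: "1 / (sinh a)^2 <= lam^2 / (8/10)" using lam s0 by (simp add: field_simps)
   have "(89/100 / lam)^2 <= (sinh a)^2"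
    using \<open>(8/10) / lam^2 <= (sinh a)^2\<close> by (rule order_trans[rotated]) (use lam in "simp add: power2_eq_square field_simps")
   then have sh2: "89/100 / lam <= sinh a" by (rule power2_le_imp_le) (use s0 in simp)
   have tau: "lam^2 - 1/4 > 0" using 3 by simp
   have Qa: "Q a <= lam^2 - 1/4 + lam^2 * (3125/10000)" unfolding Q_def using sh1 m by simp
   have e: "8/15 * ((lam^2 - 1/4) * ((8/10)^2 * sinh a)) * L^3 <= I a b * (2 * Q a * L^2 + 4)"
    unfolding I_def L_def
   proof (rule energy_bound_decreasing)
    show "8/10 <= 1 - lam\<^sup>2 / 2 * (cosh a - 1)" unfolding ca using lam by simp
    have "lam^2 / 2 * (sinh a)^2 / (8/10) = (cosh a + 1) / 4" unfolding sh ca using lam by (simp add: field_simps)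
    then show "lam^2 / 2 * (sinh a)^2 / (8/10) <= cosh a / 2" using cosh_real_ge_1[of a] by simp
   qed (use a ab b m tau in auto)
   have aL: "lam * a <= 9/10"
   proof -
    have "a^2 / 2 <= 4/10 / lam^2" using cosh_ge_quadratic[of a] ca by simp
    then have "(lam * a)^2 <= (9/10)^2" using lam by (simp add: field_simps power_mult_distrib power2_eq_square)
    then show ?thesis by (rule power2_le_imp_le) simp
   qed
   have L0: "L > 0" using ab by (simp add: L_def)
   have LX: "lam * L >= 161/10" using aL 3 unfolding X_def L_def by (simp add: algebra_simps)
   have Lb: "L >= 947/1000 * b"
   proof -
    have "lam * L >= lam * (947/1000 * b)" using aL 3 unfolding X_def L_def by (simp add: algebra_simps)
    then show ?thesis using lam by simp
   qed
   have l2: "4 <= 155/10000 * lam^2 * L^2"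
   proof -
    have "161/10 * (161/10) <= (lam * L) * (lam * L)" by (rule mult_mono[OF LX LX]) (use LX in auto)
    moreover have "lam^2 * L^2 = (lam * L) * (lam * L)" by (simp add: power2_eq_square)
    ultimately show ?thesis by simp
   qed
   define q where "q = lam^2 - 1/4"
   have "2 * Q a * L^2 + 4 <= (2 * (q + lam^2 * (3125/10000)) + 155/10000 * lam^2) * L^2"
    using l2 mult_right_mono[OF Qa, of "L^2"] by (simp add: algebra_simps q_def)
   also have "\<dots> <= 1115/100 * q * L^2"
    using 3 unfolding q_def by (intro mult_right_mono) auto
   finally have den: "2 * Q a * L^2 + 4 <= 1115/100 * q * L^2" .
   have "8/15 * (q * ((8/10)^2 * (89/100/lam))) * L^3 <= 8/15 * (q * ((8/10)^2 * sinh a)) * L^3"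
    using sh2 tau L0 by (intro mult_right_mono mult_left_mono) (auto simp: q_def)
   also have "\<dots> <= I a b * (2 * Q a * L^2 + 4)" using e unfolding q_def .
   also have "\<dots> <= I a b * (1115/100 * q * L^2)" using den Iab by (intro mult_left_mono)
   finally have "(8/15 * (8/10)^2 * (89/100) / lam * L) * (q * L^2) <= (1115/100 * I a b) * (q * L^2)"
    by (simp add: power2_eq_square power3_eq_cube mult_ac)
   then have "8/15 * (8/10)^2 * (89/100) / lam * L <= 1115/100 * I a b"
    by (rule mult_right_le_imp_le) (use tau L0 in "simp add: q_def")
   then have "2724/100000 * L / lam <= I a b" using lam L0 by (simp add: power2_eq_square field_simps)
   moreover have "947/1000 * b / lam <= L / lam" using Lb lam by (intro divide_right_mono) auto
   ultimately have "2579/100000 * b / lam <= I a b" using b lam by (simp add: field_simps)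
   then have Ib: "2579/100000 * b / lam <= I 0 b" using split I1 lam order_trans[OF _ I1, of 0] by simp
   have "194/10 / b * lam^5 <= 194/10 / b * (lam + 257/100/b)^5"
    using b lam by (intro mult_left_mono power_mono) auto
   then have "194/10 / b * lam^5 <= beta" using beta1 by linarith
   then have "194/10 / b * lam^5 * (2579/100000 * b / lam) <= beta * I 0 b"
    using Ib beta0 b lam by (intro mult_mono) auto
   moreover have "lam^4 <= 2 * (194/10 / b * lam^5 * (2579/100000 * b / lam))"
   proof -
    have e1: "194/10 / b * lam^5 * (2579/100000 * b / lam) = 194/10 * (2579/100000) * (lam^5 / lam)" using b by simp
    have e2: "lam^5 / lam = lam^4" using lam by (simp add: eval_nat_numeral)
    show ?thesis unfolding e1 e2 using lam by simp
   qed
   ultimately show ?thesis by linarith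
  qed
 qed
 then show ?thesis by (simp add: I_def)
qed

lemma mode2_simple:
 assumes m: "m = 2" and rho: "0 < rho" "rho < R" and cu: "continuous_on {0..rho} u"
  and h0: "0 <= h0" "h0 <= 1 - lam\<^sup>2 / 6 * (cosh rho - 1)"
 defines "y \<equiv> cosh rho - 1"
 shows "h0^2 * (y - 4 * ln (1 + y/2) - 4 / (y+2) + 2) <= integral {0..rho} (%r. (u r)^2 * sinh r)"
  and "h0^2 * (y^3 / (3 * (y+2)^2)) <= integral {0..rho} (%r. (u r)^2 * sinh r)"
proof -
 have h0': "h0 <= 1 - lam\<^sup>2 / (2 * (real m + 1)) * (cosh rho - 1)" using h0 m by simp
 have c1: "cosh r + 1 ~= 0" for r :: real using cosh_add_1_pos[of r] by linarith
 have T4: "half_tanh r ^ (2*m) = ((cosh r - 1) / (cosh r + 1))^2" for r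
  unfolding half_tanh_sq[symmetric] using m by (simp flip: power_mult)
 have c2: "cosh r > 0" "1 + (cosh r - 1)/2 > 0" for r :: real using cosh_real_pos[of r] by (auto simp: field_simps intro: add_pos_pos)
 let ?G = "%r. (cosh r - 1) - 4 * ln (1 + (cosh r - 1)/2) - 4 / (cosh r + 1) + 2"
 have "h0^2 * (?G rho - ?G 0) <= integral {0..rho} (%r. (u r)^2 * sinh r)"
 proof (rule integral_lower_bound[OF rho cu h0(1) h0'])
  fix r :: real
  have "(?G has_real_derivative sinh r - 4 * (sinh r / 2 / (1 + (cosh r - 1)/2)) + 4 * sinh r / (cosh r + 1)^2) (at r)"
   using c1 c2[of r] by (auto intro!: derivative_eq_intros simp: power2_eq_square mult_ac)
  moreover have "sinh r - 4 * (sinh r / 2 / (1 + (cosh r - 1)/2)) + 4 * sinh r / (cosh r + 1)^2 = sinh r * half_tanh r ^ (2*m)"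
  proof -
   have "1 + (cosh r - 1)/2 = (cosh r + 1)/2" by (simp add: field_simps)
   then have "sinh r - 4 * (sinh r / 2 / (1 + (cosh r - 1)/2)) + 4 * sinh r / (cosh r + 1)^2
    = sinh r * (1 - 4 / (cosh r + 1) + 4 / (cosh r + 1)^2)" by (simp add: algebra_simps)
   also have "1 - 4 / (cosh r + 1) + 4 / (cosh r + 1)^2 = ((cosh r - 1) / (cosh r + 1))^2"
   proof -
    have "1 - 4 / z + 4 / z^2 = ((z - 2) / z)^2" if "z ~= 0" for z :: real
     using that by (simp add: field_simps power2_eq_square)
    from this[OF c1[of r]] show ?thesis by simp
   qed
   finally show ?thesis unfolding T4 .
  qed
  ultimately show "(?G has_real_derivative sinh r * half_tanh r ^ (2*m)) (at r)" by simp
 qed (use c1 c2 in "auto intro!: continuous_intros simp: less_imp_neq[symmetric]")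
 moreover have G: "?G rho - ?G 0 = y - 4 * ln (1 + y/2) - 4 / (y+2) + 2" by (simp add: y_def add.commute)
 ultimately show "h0^2 * (y - 4 * ln (1 + y/2) - 4 / (y+2) + 2) <= integral {0..rho} (%r. (u r)^2 * sinh r)"
  by (simp only: G)
 let ?H = "%r. (cosh r - 1)^3 / (3 * (cosh r + 1)^2)"
 let ?h = "%r. sinh r * (((cosh r - 1) / (cosh r + 1))^2 - 2 * (cosh r - 1)^3 / (3 * (cosh r + 1)^3))"
 have "h0^2 * (?H rho - ?H 0) <= integral {0..rho} (%r. (u r)^2 * sinh r)"
 proof (rule integral_lower_bound[OF rho cu h0(1) h0', where g="?h"])
  fix r :: real
  have "(?H has_real_derivative (3 * (cosh r - 1)^2 * sinh r * (3 * (cosh r + 1)^2) - (cosh r - 1)^3 * (3 * (2 * (cosh r + 1) * sinh r))) / ((3 * (cosh r + 1)^2) * (3 * (cosh r + 1)^2))) (at r)"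
   using c1[of r] by (auto intro!: derivative_eq_intros)
  moreover have "(3 * (cosh r - 1)^2 * sinh r * (3 * (cosh r + 1)^2) - (cosh r - 1)^3 * (3 * (2 * (cosh r + 1) * sinh r))) / ((3 * (cosh r + 1)^2) * (3 * (cosh r + 1)^2)) = ?h r"
  proof -
   have gen: "(3 * x^2 * s * (3 * z^2) - x^3 * (3 * (2 * z * s))) / ((3 * z^2) * (3 * z^2)) = s * ((x / z)^2 - 2 * x^3 / (3 * z^3))"
    if "z ~= 0" for x z s :: real using that by (simp add: field_simps power2_eq_square power3_eq_cube)
   show ?thesis by (rule gen[OF c1])
  qed
  ultimately show "(?H has_real_derivative ?h r) (at r)" by simp
 next
  fix r assume "0 <= r" "r <= rho"
  then show "?h r <= sinh r * half_tanh r ^ (2*m)"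
   unfolding T4 using cosh_real_ge_1[of r] by (intro mult_left_mono) auto
 qed (use c1 in "auto intro!: continuous_intros")
 then show "h0^2 * (y^3 / (3 * (y+2)^2)) <= integral {0..rho} (%r. (u r)^2 * sinh r)" by (simp add: y_def add.commute)
qed

lemma mode2_energy:
 assumes m: "m = 2" and a: "0 < a" "a < b" "b < R"
  and h0: "0 < h0" "h0 <= 1 - lam\<^sup>2 / 6 * (cosh a - 1)"
  and k: "lam^2 / 6 * (sinh a)^2 / h0 <= k" "k <= 2 + cosh a / 2"
  and S: "0 <= S" "S <= (2 + cosh a / 2 - k)^2 - 15/4 + (lam^2 - 1/4) * (sinh a)^2"
  and q: "lam^2 - 1/4 <= q" "0 <= q"
 shows "8/15 * (((cosh a - 1) / (cosh a + 1))^2 * h0^2 / sinh a * S) * (b-a)^3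
  <= integral {a..b} (%r. (u r)^2 * sinh r) * (2 * q * (b-a)^2 + 4)"
proof -
 have "Q a * (sinh a)^2 = - 15/4 + (lam^2 - 1/4) * (sinh a)^2"
  unfolding Q_def using m a by (simp add: field_simps)
 then show ?thesis
  using energy_bound_increasing[OF a, of h0 k S q] assms half_tanh_sq[of a] by simp
qed

lemma mode2_bound:
 assumes m: "m = 2" and b: "0 < b" "b < R" and cu: "continuous_on {0..b} u" and lam: "0 <= lam"
  and beta: "bound_minorant lam b <= beta"
 shows "1 <= beta * integral {0..b} (%r. (u r)^2 * sinh r)"
proof -
 define I where "I = (%a b. integral {a..b} (%r. (u r)^2 * sinh r))"
 have ii: "(%r. (u r)^2 * sinh r) integrable_on {c..d}" if "0 <= c" "d <= b" for c d
  using that by (intro integrable_continuous_real continuous_intros continuous_on_subset[OF cu]) auto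
 have t: "0 <= 194/10 / b * (lam + 257/100/b)^5" "0 <= 145/10 / b * (lam + 22/10/b)^3"
  using lam b by auto
 have beta0: "0 <= beta" using beta t unfolding bound_minorant_def by linarith
 define y where "y = (if lam <= 3/8 then 8 else 9/8 / lam^2)"
 have y: "0 < y" unfolding y_def by simp
 have l38: "lam^2 <= 9/64" if "lam <= 3/8" using mult_mono[OF that that] lam by (simp add: power2_eq_square)
 have l38': "lam^2 >= 9/64" if "\<not> lam <= 3/8" using mult_mono[of "3/8" lam "3/8" lam] lam that by (simp add: power2_eq_square)
 have y8: "y <= 8"
  using l38' unfolding y_def by (auto simp: field_simps)
 have ly: "lam^2 * y <= 9/8" using l38 unfolding y_def by auto
 define a where "a = arcosh (1 + y)"
 have ca: "cosh a = 1 + y" and a0: "a >= 0" unfolding a_def using y by simp_all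
 then have a: "a > 0" using y by (cases "a = 0") auto
 have a29: "a <= 29/10"
  using cosh_29_ge_9 ca y8 cosh_real_nonneg_le_iff[of a "29/10"] a by simp
 have h13: "13/16 <= 1 - lam\<^sup>2 / 6 * (cosh rho - 1)" if "0 <= rho" "rho <= a" for rho
 proof -
  have "cosh rho - 1 <= y" using that ca cosh_real_nonneg_le_iff[of rho a] a by simp
  then have "lam^2 / 6 * (cosh rho - 1) <= lam^2 / 6 * y" by (intro mult_left_mono) auto
  moreover have "lam^2 / 6 * y = (lam^2 * y) / 6" by simp
  ultimately show ?thesis using ly by linarith
 qed
 have "1 <= beta * I 0 b"
 proof (cases "b <= a")
  case True
  define z where "z = b^2 / 2"
  define v where "v = cosh b - 1"
  have z: "0 < z" "z <= 421/100" using b True a29 mult_mono[of b "29/10" b "29/10"]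
   by (auto simp: z_def power2_eq_square)
  have vz: "z <= v" using cosh_ge_quadratic[of b] by (simp add: z_def v_def)
  have "(13/16)^2 * (v^3 / (3 * (v+2)^2)) <= I 0 b"
   unfolding I_def v_def using mode2_simple(2)[OF m b cu, of "13/16"] h13[of b] True b by simp
  moreover have "194/10 / b * (257/100/b)^5 <= beta"
  proof -
   have "194/10 / b * (257/100/b)^5 <= 194/10 / b * (lam + 257/100/b)^5"
    using b lam by (intro mult_left_mono power_mono) auto
   then show ?thesis using beta t unfolding bound_minorant_def by linarith
  qed
  moreover have "194/10 / b * (257/100/b)^5 = 194/10 * (257/100)^5 / 8 / z^3"
   using b by (simp add: z_def power_divide eval_nat_numeral)
  ultimately have "194/10 * (257/100)^5 / 8 / z^3 * ((13/16)^2 * (v^3 / (3 * (v+2)^2))) <= beta * I 0 b"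
   using b beta0 z vz by (intro mult_mono) auto
  moreover have "194/10 * (257/100)^5 / 8 / z^3 * ((13/16)^2 * (v^3 / (3 * (v+2)^2)))
   = 194/10 * (257/100)^5 / 8 * (13/16)^2 / 3 * (v^3 / (z^3 * (v+2)^2))" by simp
  moreover have "194/10 * (257/100)^5 / 8 * (13/16)^2 / 3 >= (59::real)" by (simp add: eval_nat_numeral)
  moreover have "1 / 59 <= v^3 / (z^3 * (v+2)^2)"
  proof -
   have A: "z * (v + 2) <= v * (621/100)"
   proof -
    have "v * (z + 2) <= v * (621/100)" using vz z by (intro mult_left_mono) auto
    moreover have "z * (v + 2) = v * (z + 2) - 2 * v + 2 * z" by (simp add: algebra_simps)
    ultimately show ?thesis using vz by linarith
   qed
   have "(z * (v + 2)) * (z * (v + 2)) <= (v * (621/100)) * (v * (621/100))"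
    by (rule mult_mono[OF A A]) (use vz z in auto)
   from mult_mono[OF vz this] have "z * ((z * (v + 2)) * (z * (v + 2))) <= v * ((v * (621/100)) * (v * (621/100)))"
    using vz z by simp
   also have "\<dots> <= 59 * v^3" using vz z by (simp add: power3_eq_cube)
   finally have "z^3 * (v+2)^2 <= 59 * v^3" by (simp add: power2_eq_square power3_eq_cube mult_ac)
   then show ?thesis using vz z by (simp add: field_simps)
  qed
  moreover have "59 * (1/59) <= 194/10 * (257/100)^5 / 8 * (13/16)^2 / 3 * (v^3 / (z^3 * (v+2)^2))"
   using calculation(3,4) by (intro mult_mono) auto
  ultimately show ?thesis by linarith
 next
  case False
  then have ab: "a < b" "a < R" using b by auto
  have split: "I 0 a + I a b = I 0 b" unfolding I_def
   using a ab ii[of 0 b] by (intro Henstock_Kurzweil_Integration.integral_combine) auto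
  have Iab: "0 <= I a b" unfolding I_def by (rule integral_nonneg) (use ii[of a b] a in auto)
  have cua: "continuous_on {0..a} u" using ab by (intro continuous_on_subset[OF cu]) auto
  define L where "L = b - a"
  have L: "L > 0" "b = a + L" "b <= 29/10 + L" using ab a29 by (auto simp: L_def)
  have s0: "sinh a > 0" using a by simp
  have sh: "(sinh a)^2 = y * (y + 2)"
   using cosh_square_eq[of a] unfolding ca by (simp add: power2_eq_square algebra_simps)
  show ?thesis
  proof (cases "lam <= 3/8")
   case True
   have y_eq: "y = 8" using True by (simp add: y_def)
   have c9: "cosh a = 9" using ca y_eq by simp
   have "sinh a <= 8945/1000" by (rule power2_le_imp_le, unfold sh y_eq) (simp_all add: power2_eq_square)
   have simple: "h0^2 * (312/100) <= I 0 a" if h0: "0 <= h0" "h0 <= 1 - lam\<^sup>2 * (8/6)" for h0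
   proof -
    have "h0^2 * (8 - 4 * ln (1 + 8/2) - 4 / (8+2) + 2) <= I 0 a"
     unfolding I_def using mode2_simple(1)[OF m a ab(2) cua h0(1)] h0(2) c9 by simp
    moreover have "312/100 <= 8 - 4 * ln (1 + 8/2) - 4 / (8+2) + (2::real)" using ln_5_le by simp
    then have "h0^2 * (312/100) <= h0^2 * (8 - 4 * ln (1 + 8/2) - 4 / (8+2) + 2)" by (intro mult_left_mono) auto
    ultimately show ?thesis by linarith
   qed
   have energy: "8/15 * (64/100 * h0^2 / (8945/1000) * S) * L^3 <= I a b * 4"
    if h0: "0 < h0" "h0 <= 1 - lam\<^sup>2 * (8/6)" and k: "lam^2 * (80/6) / h0 <= k" "k <= 6"
     and S: "0 <= S" "S <= (13/2 - k)^2 - 95/4 + lam^2 * 80" for h0 k S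
   proof -
    have "64/100 * h0^2 / (8945/1000) * S <= 64/100 * h0^2 / sinh a * S"
     by (intro mult_right_mono divide_left_mono) (use \<open>sinh a <= 8945/1000\<close> s0 S in "auto intro!: mult_pos_pos")
    then have "8/15 * (64/100 * h0^2 / (8945/1000) * S) * L^3 <= 8/15 * (64/100 * h0^2 / sinh a * S) * L^3"
     by (rule mult_right_mono[OF mult_left_mono]) (use L in auto)
    also have "\<dots> = 8/15 * (((cosh a - 1) / (cosh a + 1))^2 * h0^2 / sinh a * S) * (b-a)^3"
     unfolding c9 L_def by (simp add: power2_eq_square)
    also have "\<dots> <= integral {a..b} (%r. (u r)^2 * sinh r) * (2 * 0 * (b-a)^2 + 4)"
     using l38[OF True] h0 k S by (intro mode2_energy[OF m a ab(1) b(2) h0(1), where k=k]) (auto simp: sh c9 y_eq)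
    finally show ?thesis by (simp add: I_def)
   qed
   show ?thesis
   proof (cases "lam <= 1/4")
    case True
    then have l2: "lam^2 <= 1/16" using mult_mono[OF True True] lam by (simp add: power2_eq_square)
    have "(11/12)^2 * (312/100) <= I 0 a" using l2 by (intro simple) auto
    then have s1: "262/100 <= I 0 a" by (simp add: power2_eq_square)
    have "8/15 * (64/100 * (11/12)^2 / (8945/1000) * (116/10)) * L^3 <= I a b * 4"
    proof (rule energy)
     have "(13/2 - lam\<^sup>2 * (80/6) / (11/12))^2 = 169/4 - lam\<^sup>2 * (2080/11) + (lam^2 * (160/11))^2"
      by (simp add: power2_eq_square field_simps)
     then show "116/10 <= (13/2 - lam\<^sup>2 * (80/6) / (11/12))^2 - 95/4 + lam^2 * 80"
      using l2 zero_le_power2[of "lam^2 * (160/11)"] by linarith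
    qed (use l2 in auto)
    then have "112288/1207575 * L^3 <= I a b" by (simp add: power2_eq_square field_simps)
    moreover have "92/1000 * L^3 <= 112288/1207575 * L^3" by (rule mult_right_mono) (use L in auto)
    ultimately have s2: "92/1000 * L^3 <= I a b" by linarith
    have BB: "bound_minorant 0 B <= beta" if "b <= B" for B
     using bound_minorant_antimono[of 0 lam b B] that beta lam b by simp
    have fin: ?thesis if "L1 <= L" "b <= B" "1 <= bound_minorant 0 B * (262/100 + 92/1000 * L1^3)" "0 <= L1" for B L1
    proof -
     have "L1^3 <= L^3" using that by (intro power_mono) auto
     then have I: "262/100 + 92/1000 * L1^3 <= I 0 b" using s1 s2 split by linarith
     have "0 <= 262/100 + 92/1000 * L1^3" using that by simp
     then have "bound_minorant 0 B * (262/100 + 92/1000 * L1^3) <= beta * I 0 b"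
      using I BB[OF that(2)] beta0 by (intro mult_mono) auto
     then show ?thesis using that(3) by linarith
    qed
    consider "L <= 2" | "2 <= L" "L <= 27/10" | "27/10 <= L" "L <= 32/10" | "32/10 <= L" "L <= 4" | "4 <= L" "L <= 46/10" | "46/10 <= L" by linarith
    then show ?thesis
    proof cases
     case 1 show ?thesis by (rule fin[of 0 "49/10"]) (use 1 L in "auto simp: bound_minorant_def power_divide power2_eq_square")
    next
     case 2 show ?thesis by (rule fin[of 2 "56/10"]) (use 2 L in "auto simp: bound_minorant_def power_divide power2_eq_square")
    next
     case 3 show ?thesis by (rule fin[of "27/10" "61/10"]) (use 3 L in "auto simp: bound_minorant_def power_divide power2_eq_square")
    next
     case 4 show ?thesis by (rule fin[of "32/10" "69/10"]) (use 4 L in "auto simp: bound_minorant_def power_divide power2_eq_square")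
    next
     case 5 show ?thesis by (rule fin[of 4 "75/10"]) (use 5 L in "auto simp: bound_minorant_def power_divide power2_eq_square")
    next
     case 6
     have "(46/10)^3 <= L^3" using 6 by (intro power_mono) auto
     then have "262/100 + 92/1000 * (46/10)^3 <= I 0 b" using s1 s2 split by linarith
     moreover have "92/1000 <= beta" using beta t unfolding bound_minorant_def by linarith
     ultimately have "92/1000 * (262/100 + 92/1000 * (46/10)^3) <= beta * I 0 b" by (intro mult_mono) auto
     then show ?thesis by (simp add: power_divide)
    qed
   next
    case False
    have l2: "lam^2 <= 9/64" by (rule l38[OF True])
    have "(13/16)^2 * (312/100) <= I 0 a" using l2 by (intro simple) auto
    then have s1: "205/100 <= I 0 a" by (simp add: power2_eq_square)
    have "8/15 * (64/100 * (13/16)^2 / (8945/1000) * (505/100)) * L^3 <= I a b * 4"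
    proof (rule energy)
     have "(13/2 - lam\<^sup>2 * (80/6) / (13/16))^2 = 169/4 - lam\<^sup>2 * (640/3) + (lam^2 * (640/39))^2"
      by (simp add: power2_eq_square field_simps)
     moreover have "2 * (9/64 * (640/39)) * (lam^2 * (640/39)) - (9/64 * (640/39))\<^sup>2 <= (lam^2 * (640/39))^2"
      using sum_squares_bound[of "lam^2 * (640/39)" "9/64 * (640/39)"] by (simp add: mult_ac)
     ultimately show "505/100 <= (13/2 - lam\<^sup>2 * (80/6) / (13/16))^2 - 95/4 + lam^2 * 80"
      using l2 by (simp add: power2_eq_square)
    qed (use l2 in auto)
    then have "17069/536700 * L^3 <= I a b" by (simp add: power2_eq_square field_simps)
    moreover have "31/1000 * L^3 <= 17069/536700 * L^3" by (rule mult_right_mono) (use L in auto)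
    ultimately have s2: "31/1000 * L^3 <= I a b" by linarith
    have BB: "bound_minorant (1/4) B <= beta" if "b <= B" for B
     using bound_minorant_antimono[of "1/4" lam b B] that beta False b by simp
    have fin: ?thesis if "L1 <= L" "b <= B" "1 <= bound_minorant (1/4) B * (205/100 + 31/1000 * L1^3)" "0 <= L1" for B L1
    proof -
     have "L1^3 <= L^3" using that by (intro power_mono) auto
     then have I: "205/100 + 31/1000 * L1^3 <= I 0 b" using s1 s2 split by linarith
     have "0 <= 205/100 + 31/1000 * L1^3" using that by simp
     then have "bound_minorant (1/4) B * (205/100 + 31/1000 * L1^3) <= beta * I 0 b"
      using I BB[OF that(2)] beta0 by (intro mult_mono) auto
     then show ?thesis using that(3) by linarith
    qed
    consider "L <= 3" | "3 <= L" "L <= 5" | "5 <= L" "L <= 7" | "7 <= L" by linarith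
    then show ?thesis
    proof cases
     case 1 show ?thesis by (rule fin[of 0 "59/10"]) (use 1 L in "auto simp: bound_minorant_def power_divide power2_eq_square")
    next
     case 2 show ?thesis by (rule fin[of 3 "79/10"]) (use 2 L in "auto simp: bound_minorant_def power_divide power2_eq_square")
    next
     case 3 show ?thesis by (rule fin[of 5 "99/10"]) (use 3 L in "auto simp: bound_minorant_def power_divide power2_eq_square")
    next
     case 4
     have "7^3 <= L^3" using 4 by (intro power_mono) auto
     then have "205/100 + 31/1000 * 7^3 <= I 0 b" using s1 s2 split by linarith
     moreover have "92/1000 <= beta" using beta t unfolding bound_minorant_def by linarith
     ultimately have "92/1000 * (205/100 + 31/1000 * 7^3) <= beta * I 0 b" by (intro mult_mono) auto
     then show ?thesis by simp
    qed
   qed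
  next
   case False
   then have lp: "lam > 0" by simp
   have ly': "lam^2 * y = 9/8" using False lp by (simp add: y_def)
   define X where "X = lam * b"
   have X: "X > 0" "b = X / lam" using lp b by (auto simp: X_def)
   define l where "l = lam * L"
   define v where "v = lam^6 * (y+2)^2 * I a b"
   have lX: "X - 3/2 <= l"
   proof -
    have "a^2 / 2 <= y" using cosh_ge_quadratic[of a] ca by simp
    then have "lam^2 * (a^2 / 2) <= lam^2 * y" by (intro mult_left_mono) auto
    then have "(lam * a)^2 <= (3/2)^2" unfolding ly' by (simp add: power_mult_distrib power_divide mult.commute)
    then have "lam * a <= 3/2" by (rule power2_le_imp_le) simp
    then show ?thesis unfolding X_def l_def L_def by (simp add: algebra_simps)
   qed
   have l6y3: "lam^6 * y^3 = 729/512"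
   proof -
    have "lam^6 * y^3 = (lam^2 * y)^3" by (simp add: power_mult_distrib flip: power_mult)
    then show ?thesis unfolding ly' by (simp add: power_divide)
   qed
   have l4y2: "lam^4 * y^2 = 81/64"
   proof -
    have "lam^4 * y^2 = (lam^2 * y)^2" by (simp add: power_mult_distrib flip: power_mult)
    then show ?thesis unfolding ly' by (simp add: power_divide)
   qed
   have J1: "313/1000 <= lam^6 * (y+2)^2 * I 0 a"
   proof -
    have "(13/16)^2 * (y^3 / (3 * (y+2)^2)) <= I 0 a"
     unfolding I_def using mode2_simple(2)[OF m a ab(2) cua, of "13/16"] h13[of a] a ca by (simp add: add.commute)
    then have "lam^6 * (y+2)^2 * ((13/16)^2 * (y^3 / (3 * (y+2)^2))) <= lam^6 * (y+2)^2 * I 0 a"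
     using lp by (intro mult_left_mono) auto
    moreover have "lam^6 * (y+2)^2 * ((13/16)^2 * (y^3 / (3 * (y+2)^2))) = (13/16)^2 / 3 * (lam^6 * y^3)"
     using y by (simp add: field_simps)
    ultimately show ?thesis unfolding l6y3 by (simp add: power2_eq_square)
   qed
   define kap where "kap = max 0 (1 - 2*y/9)"
   define S where "S = 2655/1000 + 17226/10000 * y - 1776/10000 * y^2"
   have yy: "y * y <= 8 * y" using y y8 by simp
   have S0: "S >= 0" using yy y unfolding S_def power2_eq_square by linarith
   have J2: "42/100 * S * l^3 <= v * sqrt (y+2) * (4 + 2 * kap * l^2)"
   proof -
    have q1: "lam^2 * (1 - 2*y/9) = lam^2 - 1/4" using ly' by (simp add: algebra_simps)
    have "lam^2 - 1/4 <= kap * lam^2" unfolding q1[symmetric] kap_def by (simp add: mult.commute mult_left_mono)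
    moreover have "lam^2 / 6 * (sinh a)^2 / (13/16) = 3/13 * (y+2)"
    proof -
     have "lam^2 / 6 * (y * (y+2)) / (13/16) = (lam^2 * y) * ((y+2) * (8/39))" by (simp add: field_simps)
     then show ?thesis unfolding sh ly' by simp
    qed
    moreover have kk: "3/13 * (y+2) <= 2 + cosh a / 2" unfolding ca using y by (simp add: field_simps)
    moreover have "S <= (2 + cosh a / 2 - 3/13 * (y+2))^2 - 15/4 + (lam^2 - 1/4) * (sinh a)^2"
    proof -
     have "(lam^2 - 1/4) * (sinh a)^2 = (lam^2 * y) * (y+2) - (y*y + 2*y) / 4"
      unfolding sh by (simp add: algebra_simps)
     also have "\<dots> = 9/4 + 5/8 * y - (y*y) / 4" unfolding ly' by (simp add: field_simps)
     finally have 1: "(lam^2 - 1/4) * (sinh a)^2 = 9/4 + 5/8 * y - (y*y) / 4" .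
     have 2: "(2 + cosh a / 2 - 3/13 * (y+2))^2 = (53/26)^2 + 2 * (53/26) * (7/26) * y + (7/26)^2 * (y*y)"
      unfolding ca by (simp add: power2_eq_square field_simps)
     show ?thesis unfolding 1 2 S_def unfolding power2_eq_square using y by (simp add: field_simps)
    qed
    ultimately have "8/15 * (((cosh a - 1) / (cosh a + 1))^2 * (13/16)^2 / sinh a * S) * (b-a)^3
     <= integral {a..b} (%r. (u r)^2 * sinh r) * (2 * (kap * lam^2) * (b-a)^2 + 4)"
     using S0 h13[of a] a y y8 kk by (intro mode2_energy[OF m a ab(1) b(2), where k="3/13 * (y+2)"]) (auto simp: ca kap_def)
    then have "8/15 * ((y / (y + 2))^2 * (13/16)^2 / sinh a * S) * L^3 <= I a b * (4 + 2 * kap * l^2)"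
     unfolding ca I_def L_def[symmetric] l_def by (simp add: power_mult_distrib algebra_simps)
    then have "lam^6 * (y+2)^2 * sqrt (y+2) * (8/15 * ((y / (y + 2))^2 * (13/16)^2 / sinh a * S) * L^3)
     <= lam^6 * (y+2)^2 * sqrt (y+2) * (I a b * (4 + 2 * kap * l^2))"
     using y by (intro mult_left_mono) auto
    also have "\<dots> = v * sqrt (y+2) * (4 + 2 * kap * l^2)" unfolding v_def by (simp only: mult_ac)
    also have "lam^6 * (y+2)^2 * sqrt (y+2) * (8/15 * ((y / (y + 2))^2 * (13/16)^2 / sinh a * S) * L^3)
     = 8/15 * (13/16)^2 * (lam^4 * y^2) * S * l^3 * (sqrt (y+2) / (lam * sinh a)) * (lam^6 / (lam^4 * lam^2))"
    proof -
     have "(y+2)^2 * (y / (y + 2))^2 = y^2" using y by (simp add: power_divide)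
     then have "lam^6 * (y+2)^2 * sqrt (y+2) * (8/15 * ((y / (y + 2))^2 * (13/16)^2 / sinh a * S) * L^3)
      = lam^6 * y^2 * sqrt (y+2) * (8/15 * ((13/16)^2 / sinh a * S) * L^3)" by (simp add: mult_ac)
     also have "\<dots> = 8/15 * (13/16)^2 * (lam^4 * y^2) * S * (lam * L)^3 * (sqrt (y+2) / (lam * sinh a)) * (lam^6 / (lam^4 * lam^2))"
      using lp s0 by (simp add: power_mult_distrib) (simp add: field_simps eval_nat_numeral)
     finally show ?thesis unfolding l_def .
    qed
    also have "lam^6 / (lam^4 * lam^2) = 1" using lp by (simp flip: power_add)
    finally have "8/15 * (13/16)^2 * (81/64) * S * l^3 * (sqrt (y+2) / (lam * sinh a)) <= v * sqrt (y+2) * (4 + 2 * kap * l^2)"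
     unfolding l4y2 by simp
    moreover have "10000/10607 <= sqrt (y+2) / (lam * sinh a)"
    proof -
     have "(lam * sinh a)^2 = (lam^2 * y) * (y+2)" unfolding power_mult_distrib sh by simp
     also have "\<dots> <= (10607/10000 * sqrt (y+2))^2"
      unfolding ly' power_mult_distrib using y by (simp add: power2_eq_square)
     finally have "lam * sinh a <= 10607/10000 * sqrt (y+2)" by (rule power2_le_imp_le) (use y in auto)
     then show ?thesis using lp s0 by (simp add: field_simps)
    qed
    then have "8/15 * (13/16)^2 * (81/64) * S * l^3 * (10000/10607) <= 8/15 * (13/16)^2 * (81/64) * S * l^3 * (sqrt (y+2) / (lam * sinh a))"
     using S0 lp L by (intro mult_left_mono) (auto simp: l_def)
    moreover have "42/100 * (S * l^3) <= 8/15 * (13/16)^2 * (81/64) * (10000/10607) * (S * l^3)"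
     using S0 lp L by (intro mult_right_mono) (auto simp: l_def power2_eq_square)
    then have "42/100 * S * l^3 <= 8/15 * (13/16)^2 * (81/64) * S * l^3 * (10000/10607)"
     by (simp only: mult_ac)
    ultimately show ?thesis by (meson order_trans)
   qed
   have "(y+2)^2 <= (beta / lam^6) * (lam^6 * (y+2)^2 * I 0 b)"
   proof (rule mode2_numeric[OF y y8 X(1) _ _ _ lX])
    have 1: "194/10 / b * (lam + 257/100/b)^5 = lam^6 * (194/10 / X * (1 + 257/100/X)^5)"
    proof -
     have "lam + 257/100/b = lam * (1 + 257/100/X)" unfolding X(2) using lp by (simp add: field_simps)
     then show ?thesis unfolding X(2) by (simp add: power_mult_distrib eval_nat_numeral)
    qed
    have 2: "lam^6 * (1288/100 * y / X * (1 + 22/10/X)^3) <= 145/10 / b * (lam + 22/10/b)^3"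
    proof -
     have "lam + 22/10/b = lam * (1 + 22/10/X)" unfolding X(2) using lp by (simp add: field_simps)
     then have "145/10 / b * (lam + 22/10/b)^3 = lam^4 * (145/10 * ((1 + 22/10/X)^3 / X))"
      unfolding X(2) by (simp add: power_mult_distrib eval_nat_numeral)
     moreover have "lam^6 * (1288/100 * y / X * (1 + 22/10/X)^3) = lam^4 * (lam^2 * y) * (1288/100 * ((1 + 22/10/X)^3 / X))"
      by (simp add: eval_nat_numeral)
     moreover have "lam^4 * (1449/100 * ((1 + 22/10/X)^3 / X)) <= lam^4 * (145/10 * ((1 + 22/10/X)^3 / X))"
      using X by (intro mult_left_mono mult_right_mono) auto
     ultimately show ?thesis unfolding ly' by simp
    qed
    have "lam^6 * (194/10 / X * (1 + 257/100/X)^5 + 1288/100 * y / X * (1 + 22/10/X)^3) <= beta"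
     using beta 1 2 unfolding bound_minorant_def by (simp only: distrib_left)
    then show "194/10 / X * (1 + 257/100/X)^5 + 1288/100 * y / X * (1 + 22/10/X)^3 <= beta / lam^6"
     using lp by (simp add: pos_le_divide_eq mult.commute)
    show "313/1000 + v <= lam^6 * (y+2)^2 * I 0 b" unfolding split[symmetric] v_def distrib_left using J1 by simp
    show "0 <= v" unfolding v_def using Iab lp by simp
    show "0 <= l" unfolding l_def using lp L by simp
   qed (use J2 in "simp add: S_def kap_def")
   also have "\<dots> = (y+2)^2 * (beta * I 0 b)" using lp by simp
   finally have "(y+2)^2 * 1 <= (y+2)^2 * (beta * I 0 b)" by simp
   then show ?thesis by (rule mult_left_le_imp_le) (use y in simp)
  qed
 qed
 then show ?thesis by (simp add: I_def)
qed

end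

subsection \<open>Clamped eigenvalues\<close>

lemma integral_Cauchy_Schwarz:
 fixes f g :: "real => real"
 assumes "continuous_on {a..b} f" "continuous_on {a..b} g"
 shows "(integral {a..b} (%t. f t * g t))^2 <= integral {a..b} (%t. (f t)^2) * integral {a..b} (%t. (g t)^2)"
proof -
 define A where "A = integral {a..b} (%t. (f t)^2)"
 define B where "B = integral {a..b} (%t. f t * g t)"
 define C where "C = integral {a..b} (%t. (g t)^2)"
 have i: "(%t. (f t)^2) integrable_on {a..b}" "(%t. f t * g t) integrable_on {a..b}" "(%t. (g t)^2) integrable_on {a..b}"
  using assms by (auto intro!: integrable_continuous_real continuous_intros)
 have C0: "0 <= C" and A0: "0 <= A" unfolding C_def A_def by (auto intro!: integral_nonneg i)
 have P: "0 <= x^2 * A - 2 * x * y * B + y^2 * C" for x y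
 proof -
  have "((%t. x^2 * (f t)^2 - 2 * x * y * (f t * g t) + y^2 * (g t)^2) has_integral x^2 * A - 2 * x * y * B + y^2 * C) {a..b}"
   unfolding A_def B_def C_def by (intro has_integral_add has_integral_diff has_integral_mult_right integrable_integral i)
  moreover have "x^2 * (f t)^2 - 2 * x * y * (f t * g t) + y^2 * (g t)^2 = (x * f t - y * g t)^2" for t
   by (simp add: power2_eq_square algebra_simps)
  ultimately have "((%t. (x * f t - y * g t)^2) has_integral x^2 * A - 2 * x * y * B + y^2 * C) {a..b}" by simp
  then show ?thesis by (rule has_integral_nonneg) simp
 qed
 show ?thesis unfolding A_def[symmetric] B_def[symmetric] C_def[symmetric]
 proof (cases "C = 0")
  case True
  have "0 <= A - 2 * y * B" for y using P[of 1 y] True by simp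
  from this[of "(A + 1) / (2 * B)"] have "B = 0" by (cases "B = 0") auto
  then show "B^2 <= A * C" using True by simp
 next
  case False
  have "0 <= C * (A * C - B\<^sup>2)" using P[of C B] by (simp add: power2_eq_square algebra_simps)
  then show "B^2 <= A * C" using C0 False by (simp add: zero_le_mult_iff)
 qed
qed

text \<open>The derivative of order \<open>2 k\<close> is replaced by its value in terms of \<open>u 0\<close>, which makes it
 continuous up to the endpoints.\<close>

definition clamped_eigenfunction :: "nat => real => (nat => real => real) => bool" where
 "clamped_eigenfunction k mu u \<longleftrightarrow>
  (\<forall>j\<le>2*k. continuous_on {-1/2..1/2} (u j)) \<and>
  (\<forall>j<2*k. \<forall>s\<in>{-1/2<..<1/2}. (u j has_real_derivative u (Suc j) s) (at s)) \<and>
  (\<forall>s\<in>{-1/2..1/2}. u (2*k) s = (-1)^k * mu * u 0 s) \<and>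
  (\<forall>j<k. u j (-1/2) = 0 \<and> u j (1/2) = 0) \<and>
  (\<exists>s\<in>{-1/2<..<1/2}. u 0 s ~= 0)"

lemma dirichlet_eigenvalueE:
 assumes "dirichlet_eigenvalue k mu" and k: "k >= 1"
 obtains u where "clamped_eigenfunction k mu u"
proof -
 from assms(1) obtain u :: "nat => real => real" where
  d: "!!j s. j < 2*k ==> s \<in> {-1/2..1/2} ==> (u j has_real_derivative u (Suc j) s) (at s within {-1/2..1/2})"
  and e: "!!s. s \<in> {-1/2<..<1/2} ==> (-1)^k * u (2*k) s = mu * u 0 s"
  and bc: "\<forall>j<k. u j (-1/2) = 0 \<and> u j (1/2) = 0" and nz: "\<exists>s\<in>{-1/2<..<1/2}. u 0 s ~= 0"
  unfolding dirichlet_eigenvalue_def by blast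
 define v where "v = (%j. if j = 2*k then (%s. (-1)^k * mu * u 0 s) else u j)"
 have cu: "continuous_on {-1/2..1/2} (u j)" if "j < 2*k" for j
  by (rule DERIV_continuous_on) (use d that in blast)
 have "clamped_eigenfunction k mu v"
  unfolding clamped_eigenfunction_def
 proof (intro conjI allI impI ballI)
  fix j assume "j <= 2*k" then show "continuous_on {-1/2..1/2} (v j)"
   using cu[of j] cu[of 0] k by (auto simp: v_def intro!: continuous_intros)
 next
  fix j s assume j: "j < 2*k" and s: "s \<in> {-1/2<..<1/2 :: real}"
  then have "(u j has_real_derivative u (Suc j) s) (at s)"
   using d[of j s] at_within_interior[of s "{-1/2..1/2}"] by (auto simp: interior_atLeastAtMost_real)
  moreover have "v (Suc j) s = u (Suc j) s"
  proof (cases "Suc j = 2*k")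
   case True
   have "(-1::real)^k * (-1)^k = 1" by (simp flip: power_mult_distrib)
   then have "u (2*k) s = (-1)^k * (mu * u 0 s)" unfolding e[OF s, symmetric] by (simp flip: mult.assoc)
   then show ?thesis using True by (simp add: v_def)
  qed (simp add: v_def)
  ultimately show "(v j has_real_derivative v (Suc j) s) (at s)" using j by (simp add: v_def)
 qed (use bc nz k in "auto simp: v_def")
 then show ?thesis using that by blast
qed

context
 fixes k :: nat assumes k: "k >= 1"
begin

lemma clamped_integral_by_parts:
 assumes u: "clamped_eigenfunction k mu u" and v: "clamped_eigenfunction k mu' v"
 shows "mu * integral {-1/2..1/2} (%s. u 0 s * v 0 s) = integral {-1/2..1/2} (%s. u k s * v k s)"
proof -
 let ?I = "{-1/2..1/2 :: real}"
 have cu: "continuous_on ?I (u j)" and cv: "continuous_on ?I (v j)" if "j <= 2*k" for j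
  using u v that unfolding clamped_eigenfunction_def by auto
 have "i <= k ==> integral ?I (%s. u (2*k) s * v 0 s) = (-1)^i * integral ?I (%s. u (2*k-i) s * v i s)" for i
 proof (induction i)
  case (Suc i)
  define j where "j = 2*k - Suc i"
  have j: "2*k - i = Suc j" "j < 2*k" "2*k - Suc i = j" using Suc.prems by (auto simp: j_def)
  have "((%s. u (Suc j) s * v i s + v (Suc i) s * u j s) has_integral (u j (1/2) * v i (1/2) - u j (-1/2) * v i (-1/2))) ?I"
  proof (rule fundamental_theorem_of_calculus_interior)
   fix s :: real assume s: "s \<in> {-1/2<..<1/2}"
   have "((%s. u j s * v i s) has_real_derivative u (Suc j) s * v i s + v (Suc i) s * u j s) (at s)"
    using u v s j Suc.prems unfolding clamped_eigenfunction_def by (intro DERIV_mult) auto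
   then show "((%s. u j s * v i s) has_vector_derivative u (Suc j) s * v i s + v (Suc i) s * u j s) (at s)"
    by (simp add: has_real_derivative_iff_has_vector_derivative)
  qed (use cu[of j] cv[of i] j Suc.prems in "auto intro!: continuous_intros")
  moreover have "v i (1/2) = 0" "v i (-1/2) = 0" using v Suc.prems unfolding clamped_eigenfunction_def by auto
  ultimately have "((%s. u (Suc j) s * v i s + v (Suc i) s * u j s) has_integral 0) ?I" by simp
  moreover have "(%s. u (Suc j) s * v i s) integrable_on ?I" "(%s. v (Suc i) s * u j s) integrable_on ?I"
   using cu[of j] cu[of "Suc j"] cv[of i] cv[of "Suc i"] j Suc.prems by (auto intro!: integrable_continuous_real continuous_intros)
  ultimately have "integral ?I (%s. u (Suc j) s * v i s) = - integral ?I (%s. u j s * v (Suc i) s)"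
   using integral_add[of "%s. u (Suc j) s * v i s" ?I "%s. v (Suc i) s * u j s"]
   by (simp add: integral_unique mult.commute)
  then show ?case using Suc j by simp
 qed simp
 from this[of k] have "integral ?I (%s. u (2*k) s * v 0 s) = (-1)^k * integral ?I (%s. u k s * v k s)"
  by (simp add: mult_2)
 moreover have "integral ?I (%s. u (2*k) s * v 0 s) = integral ?I (%s. ((-1)^k * mu) * (u 0 s * v 0 s))"
  by (rule integral_cong) (use u in "auto simp: clamped_eigenfunction_def")
 ultimately have "(-1)^k * (mu * integral ?I (%s. u 0 s * v 0 s)) = (-1)^k * integral ?I (%s. u k s * v k s)"
  by (simp only: integral_mult_right mult.assoc)
 then show ?thesis by simp
qed

lemma clamped_taylor:
 assumes u: "clamped_eigenfunction k mu u" and s: "-1/2 <= s" "s <= 1/2"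
 shows "u 0 s = integral {-1/2..s} (%t. (s-t)^(k-1) / fact (k-1) * u k t)"
proof -
 have cu: "continuous_on {-1/2..s} (u j)" if "j <= 2*k" for j
  using u that continuous_on_subset[of "{-1/2..1/2}" "u j" "{-1/2..s}"] s unfolding clamped_eigenfunction_def by auto
 have "i < k ==> ((%t. (s-t)^i / fact i * u (Suc i) t) has_integral u 0 s) {-1/2..s}" for i
 proof (induction i)
  case 0
  have "(u 1 has_integral (u 0 s - u 0 (-1/2))) {-1/2..s}"
   using u s cu[of 0] k unfolding clamped_eigenfunction_def
   by (intro fundamental_theorem_of_calculus_interior)
    (auto simp: has_real_derivative_iff_has_vector_derivative[symmetric])
  then show ?case using u 0 by (simp add: clamped_eigenfunction_def)
 next
  case (Suc i)
  let ?f = "%t. (s-t)^(Suc i) / fact (Suc i) * u (Suc i) t"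
  have "((%t. - ((s-t)^i / fact i) * u (Suc i) t + u (Suc (Suc i)) t * ((s-t)^(Suc i) / fact (Suc i))) has_integral (?f s - ?f (-1/2))) {-1/2..s}"
  proof (rule fundamental_theorem_of_calculus_interior)
   fix t assume t: "t \<in> {-1/2<..<s}"
   have "((%t. (s-t)^(Suc i) / fact (Suc i)) has_real_derivative (- ((s-t)^i / fact i))) (at t)"
    by (rule DERIV_cong[OF DERIV_cdivide[OF DERIV_power_Suc[OF DERIV_diff[OF DERIV_const DERIV_ident]]]])
     (simp add: divide_simps)
   then have "(?f has_real_derivative - ((s-t)^i / fact i) * u (Suc i) t + u (Suc (Suc i)) t * ((s-t)^(Suc i) / fact (Suc i))) (at t)"
    using u t s Suc.prems unfolding clamped_eigenfunction_def by (intro DERIV_mult) auto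
   then show "(?f has_vector_derivative - ((s-t)^i / fact i) * u (Suc i) t + u (Suc (Suc i)) t * ((s-t)^(Suc i) / fact (Suc i))) (at t)"
    by (simp only: has_real_derivative_iff_has_vector_derivative)
  qed (use s cu[of "Suc i"] Suc.prems in "auto intro!: continuous_intros")
  moreover have "u (Suc i) (-1/2) = 0" using u Suc.prems by (simp add: clamped_eigenfunction_def)
  ultimately have "((%t. - ((s-t)^i / fact i) * u (Suc i) t + u (Suc (Suc i)) t * ((s-t)^(Suc i) / fact (Suc i))) has_integral 0) {-1/2..s}"
   by simp
  from has_integral_add[OF Suc.IH this] Suc.prems show ?case by (simp add: mult.commute)
 qed
 from integral_unique[OF this[of "k-1"]] k show ?thesis by simp
qed

lemma clamped_pointwise:
 assumes u: "clamped_eigenfunction k mu u" and s: "-1/2 <= s" "s <= 1/2"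
 shows "(u 0 s)^2 <= (s+1/2)^(2*k-1) / ((2*real k-1) * (fact (k-1))^2) * integral {-1/2..s} (%t. (u k t)^2)"
proof -
 have cu: "continuous_on {-1/2..s} (u k)"
  using u continuous_on_subset[of "{-1/2..1/2}" "u k" "{-1/2..s}"] s unfolding clamped_eigenfunction_def by auto
 have k1: "2*k-1 = Suc (2*(k-1))" using k by simp
 have c: "(2*real k-1) = real (Suc (2*(k-1)))" using k by (simp add: of_nat_diff)
 have "((%t. (s-t)^(2*(k-1)) / (fact (k-1))^2) has_integral
  (- ((s-s)^Suc (2*(k-1)) / (real (Suc (2*(k-1))) * (fact (k-1))^2)) - (- ((s-(-1/2))^Suc (2*(k-1)) / (real (Suc (2*(k-1))) * (fact (k-1))^2))))) {-1/2..s}"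
 proof (rule fundamental_theorem_of_calculus)
  fix t assume "t \<in> {-1/2..s}"
  have "((%t. - ((s-t)^Suc (2*(k-1)) / (real (Suc (2*(k-1))) * (fact (k-1))^2))) has_real_derivative (s-t)^(2*(k-1)) / (fact (k-1))^2) (at t)"
   by (rule DERIV_cong[OF DERIV_minus[OF DERIV_cdivide[OF DERIV_power_Suc[OF DERIV_diff[OF DERIV_const DERIV_ident]]]]])
    (simp del: of_nat_mult)
  then show "((%t. - ((s-t)^Suc (2*(k-1)) / (real (Suc (2*(k-1))) * (fact (k-1))^2))) has_vector_derivative (s-t)^(2*(k-1)) / (fact (k-1))^2) (at t within {-1/2..s})"
   by (simp add: has_real_derivative_iff_has_vector_derivative has_vector_derivative_at_within)
 qed (use s in auto)
 moreover have "(s-t)^(2*(k-1)) / (fact (k-1))^2 = ((s-t)^(k-1) / fact (k-1))^2" for t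
  by (simp only: power_divide power_even_eq)
 ultimately have "((%t. ((s-t)^(k-1) / fact (k-1))^2) has_integral (s+1/2)^(2*k-1) / ((2*real k-1) * (fact (k-1))^2)) {-1/2..s}"
  unfolding c k1 by simp
 then have "integral {-1/2..s} (%t. ((s-t)^(k-1) / fact (k-1))^2) = (s+1/2)^(2*k-1) / ((2*real k-1) * (fact (k-1))^2)"
  by (rule integral_unique)
 moreover have "(u 0 s)^2 <= integral {-1/2..s} (%t. ((s-t)^(k-1) / fact (k-1))^2) * integral {-1/2..s} (%t. (u k t)^2)"
  unfolding clamped_taylor[OF u s]
  by (intro integral_Cauchy_Schwarz continuous_intros cu) simp
 ultimately show ?thesis by simp
qed

lemma clamped_half_bound:
 assumes u: "clamped_eigenfunction k mu u"
 shows "integral {-1/2..0} (%s. (u 0 s)^2) <= (1/2)^(2*k) / (2*real k * (2*real k-1) * (fact (k-1))^2) * integral {-1/2..0} (%t. (u k t)^2)"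
proof -
 have cu: "continuous_on {-1/2..s} (u j)" if "j <= 2*k" "s <= 1/2" for j s
  using u that continuous_on_subset[of "{-1/2..1/2}" "u j" "{-1/2..s}"] unfolding clamped_eigenfunction_def by auto
 define N where "N = (2*real k-1) * (fact (k-1))^2"
 have N: "N > 0" using k by (simp add: N_def)
 define E where "E = integral {-1/2..0} (%t. (u k t)^2)"
 have k1: "2*k = Suc (2*k-1)" using k by simp
 have "((%s. E / N * (s+1/2)^(2*k-1)) has_integral E / N * ((0+1/2)^(2*k) / (2*k)) - E / N * ((-1/2+1/2)^(2*k) / (2*k))) {-1/2..0}"
 proof (rule fundamental_theorem_of_calculus)
  fix t :: real assume "t \<in> {-1/2..0}"
  have "((%t. (t + 1/2)^Suc (2*k-1)) has_real_derivative (1 + real (2*k-1)) * ((1 + 0) * (t + 1/2)^(2*k-1))) (at t)"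
   by (intro DERIV_power_Suc DERIV_add DERIV_ident DERIV_const)
  from DERIV_cmult[OF DERIV_cdivide[OF this, of "real (2*k)"], of "E / N"]
  have "((%t. E / N * ((t + 1/2)^(2*k) / (2*k))) has_real_derivative E / N * (t+1/2)^(2*k-1)) (at t)"
   using k by (simp flip: k1 add: of_nat_diff)
  then show "((%t. E / N * ((t + 1/2)^(2*k) / (2*k))) has_vector_derivative E / N * (t+1/2)^(2*k-1)) (at t within {-1/2..0})"
   by (simp add: has_real_derivative_iff_has_vector_derivative has_vector_derivative_at_within)
 qed auto
 then have 1: "((%s. E / N * (s+1/2)^(2*k-1)) has_integral E / N * ((1/2)^(2*k) / (2*k))) {-1/2..0}"
  using k by (simp add: power_0_left)
 have 2: "((%s. (u 0 s)^2) has_integral integral {-1/2..0} (%s. (u 0 s)^2)) {-1/2..0}"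
  by (intro integrable_integral integrable_continuous_real continuous_intros cu) auto
 have "integral {-1/2..0} (%s. (u 0 s)^2) <= E / N * ((1/2)^(2*k) / (2*k))"
 proof (rule has_integral_le[OF 2 1])
  fix s assume s: "s \<in> {-1/2..0 :: real}"
  have "(u 0 s)^2 <= (s+1/2)^(2*k-1) / N * integral {-1/2..s} (%t. (u k t)^2)"
   unfolding N_def by (rule clamped_pointwise[OF u]) (use s in auto)
  also have "\<dots> <= (s+1/2)^(2*k-1) / N * E"
   unfolding E_def using s N
   by (intro mult_left_mono integral_subset_le integrable_continuous_real continuous_intros cu) auto
  finally show "(u 0 s)^2 <= E / N * (s+1/2)^(2*k-1)" by (simp add: mult_ac)
 qed
 moreover have "E / (M * F) * (P / (2 * real k)) = P / (2 * real k * M * F) * E" for P F M :: real by (simp add: mult_ac)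
 ultimately show ?thesis unfolding N_def E_def by (simp only: of_nat_mult of_nat_numeral)
qed

lemma clamped_reflect:
 assumes u: "clamped_eigenfunction k mu u"
 shows "clamped_eigenfunction k mu (%j s. (-1)^j * u j (-s))"
 unfolding clamped_eigenfunction_def
proof (intro conjI allI impI ballI)
 fix j assume "j <= 2*k"
 then have "continuous_on {-1/2..1/2} (u j)" using u by (auto simp: clamped_eigenfunction_def)
 then have "continuous_on {-1/2..1/2} (%s. u j (-s))"
  by (rule continuous_on_compose2) (auto intro!: continuous_intros)
 then show "continuous_on {-1/2..1/2} (%s. (-1)^j * u j (-s))"
  by (rule continuous_on_mult_left)
next
 fix j s assume j: "j < 2*k" and s: "s \<in> {-1/2<..<1/2 :: real}"
 have "(u j has_real_derivative u (Suc j) (-s)) (at (-s))" using u j s by (auto simp: clamped_eigenfunction_def)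
 then have "((%s. u j (-s)) has_real_derivative u (Suc j) (-s) * (-1)) (at s)"
  by (intro DERIV_chain'[where f="%s. -s" and g="u j"]) (auto intro!: derivative_eq_intros)
 from DERIV_cmult[OF this, of "(-1)^j"]
 show "((%s. (-1)^j * u j (-s)) has_real_derivative (-1)^(Suc j) * u (Suc j) (-s)) (at s)" by simp
next
 from u obtain s where "s \<in> {-1/2<..<1/2}" "u 0 s ~= 0" by (auto simp: clamped_eigenfunction_def)
 then show "\<exists>s\<in>{-1/2<..<1/2}. (-1)^0 * u 0 (-s) ~= 0" by (intro bexI[of _ "-s"]) auto
next
 fix s :: real assume "s \<in> {-1/2..1/2}"
 then have "-s \<in> {-1/2..1/2}" by auto
 then have "u (2*k) (-s) = (-1)^k * mu * u 0 (-s)" using u by (simp only: clamped_eigenfunction_def)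
 then show "(-1)^(2*k) * u (2*k) (-s) = (-1)^k * mu * ((-1)^0 * u 0 (-s))" by simp
next
 fix j assume "j < k"
 then have "u j (-1/2) = 0" "u j (1/2) = 0" using u by (simp_all only: clamped_eigenfunction_def)
 then show "(-1)^j * u j (- (-1/2)) = 0" "(-1)^j * u j (- (1/2)) = 0" by simp_all
qed

lemma clamped_norm_pos:
 assumes u: "clamped_eigenfunction k mu u"
 shows "0 < integral {-1/2..1/2} (%s. (u 0 s)^2)"
proof (rule ccontr)
 have c: "continuous_on {-1/2..1/2} (%s. (u 0 s)^2)" using u by (auto simp: clamped_eigenfunction_def intro!: continuous_intros)
 then have "0 <= integral {-1/2..1/2} (%s. (u 0 s)^2)" by (intro integral_nonneg integrable_continuous_real) auto
 moreover assume "\<not> 0 < integral {-1/2..1/2} (%s. (u 0 s)^2)"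
 ultimately have "integral {-1/2..1/2} (%s. (u 0 s)^2) = 0" by simp
 then have "\<forall>s\<in>{-1/2..1/2}. (u 0 s)^2 = 0" using integral_eq_0_iff[OF c] by simp
 moreover obtain s where "s \<in> {-1/2<..<1/2}" "u 0 s ~= 0" using u by (auto simp: clamped_eigenfunction_def)
 ultimately show False by auto
qed

lemma clamped_eigenvalue_bound:
 assumes u: "clamped_eigenfunction k mu u"
 shows "2^(2*k) * (2*real k * (2*real k-1) * (fact (k-1))^2) <= mu"
proof -
 define N where "N = (2*real k * (2*real k-1) * (fact (k-1))^2)"
 have N: "N > 0" using k by (simp add: N_def)
 have cu: "continuous_on {-1/2..1/2} (u j)" if "j <= 2*k" for j using u that unfolding clamped_eigenfunction_def by auto
 have refl: "integral {-1/2..0} (%s. ((-1)^j * u j (-s))^2) = integral {0..1/2} (%s. (u j s)^2)" for j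
  using Henstock_Kurzweil_Integration.integral_reflect_real[of "1/2" 0 "%s. (u j s)^2"]
  by (cases "even j") auto
 have comb: "integral {-1/2..0} (%s. (u j s)^2) + integral {0..1/2} (%s. (u j s)^2) = integral {-1/2..1/2} (%s. (u j s)^2)"
  if "j <= 2*k" for j
  by (intro Henstock_Kurzweil_Integration.integral_combine) (use cu[OF that] in "auto intro!: integrable_continuous_real continuous_intros")
 have kk: "k <= 2*k" by simp
 have "integral {-1/2..1/2} (%s. (u 0 s)^2) <= (1/2)^(2*k) / N * integral {-1/2..1/2} (%t. (u k t)^2)"
  using add_mono[OF clamped_half_bound[OF u] clamped_half_bound[OF clamped_reflect[OF u], unfolded refl]]
  unfolding N_def[symmetric] distrib_left[symmetric] comb[OF le0] comb[OF kk] .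
 also have "integral {-1/2..1/2} (%t. (u k t)^2) = mu * integral {-1/2..1/2} (%s. (u 0 s)^2)"
  using clamped_integral_by_parts[OF u u] by (simp add: power2_eq_square)
 finally have "1 * integral {-1/2..1/2} (%s. (u 0 s)^2) <= ((1/2)^(2*k) / N * mu) * integral {-1/2..1/2} (%s. (u 0 s)^2)"
  by simp
 then have "1 <= (1/2)^(2*k) / N * mu" by (rule mult_right_le_imp_le) (rule clamped_norm_pos[OF u])
 then have "2^(2*k) * N <= mu" using N by (simp add: field_simps power_divide)
 then show ?thesis unfolding N_def .
qed

lemma clamped_kernel:
 assumes u: "clamped_eigenfunction k mu u" and k2: "k >= 2" and s: "-1/2 <= s" "s <= 1/2"
 shows "u 0 s = integral {-1/2..1/2} (%t. (max 0 (s-t))^(k-1) / fact (k-1) * u k t)"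
proof -
 have cu: "continuous_on {-1/2..1/2} (u k)" using u unfolding clamped_eigenfunction_def by auto
 let ?f = "%t. (max 0 (s-t))^(k-1) / fact (k-1) * u k t"
 have "integral {-1/2..s} ?f + integral {s..1/2} ?f = integral {-1/2..1/2} ?f"
  by (intro Henstock_Kurzweil_Integration.integral_combine s integrable_continuous_real continuous_intros cu) auto
 moreover have "integral {-1/2..s} ?f = u 0 s"
  unfolding clamped_taylor[OF u s] by (rule integral_cong) auto
 moreover have "integral {s..1/2} ?f = integral {s..1/2} (%t. 0)"
  by (rule integral_cong) (use k2 in "auto simp: power_0_left")
 ultimately show ?thesis by simp
qed

text \<open>Bessel's inequality for the normalised functions \<open>u k\<close>, applied to the Taylor kernel and
 integrated over \<open>s\<close>: the number of eigenvalues up to \<open>m\<close> is at most \<open>m\<close>.\<close>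

lemma finite_dirichlet_eigenvalues:
 assumes k2: "k >= 2"
 shows "finite {mu. dirichlet_eigenvalue k mu \<and> mu <= m}"
proof (rule ccontr)
 let ?I = "{-1/2..1/2 :: real}"
 assume "infinite {mu. dirichlet_eigenvalue k mu \<and> mu <= m}"
 then obtain F where F: "finite F" "card F = nat \<lceil>\<bar>m\<bar>\<rceil> + 1" "F \<subseteq> {mu. dirichlet_eigenvalue k mu \<and> mu <= m}"
  using infinite_arbitrarily_large by blast
 have "\<exists>u. \<forall>mu\<in>F. clamped_eigenfunction k mu (u mu)"
 proof (rule bchoice, rule ballI)
  fix mu assume "mu \<in> F"
  then have "dirichlet_eigenvalue k mu" using F(3) by auto
  then show "\<exists>u. clamped_eigenfunction k mu u" by (rule dirichlet_eigenvalueE[OF _ k]) blast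
 qed
 then obtain u where u: "!!mu. mu \<in> F ==> clamped_eigenfunction k mu (u mu)" by blast
 have pos: "mu > 0" if "mu \<in> F" for mu
 proof -
  have "0 < 2^(2*k) * (2*real k * (2*real k-1) * (fact (k-1))^2)" using k by simp
  then show ?thesis using clamped_eigenvalue_bound[OF u[OF that]] by linarith
 qed
 define n where "n = (%mu. integral ?I (%t. (u mu k t)^2))"
 define n0 where "n0 = (%mu. integral ?I (%t. (u mu 0 t)^2))"
 have n0: "n0 mu > 0" if "mu \<in> F" for mu unfolding n0_def by (rule clamped_norm_pos[OF u[OF that]])
 have n: "n mu = mu * n0 mu" if "mu \<in> F" for mu
  using clamped_integral_by_parts[OF u[OF that] u[OF that]] unfolding n_def n0_def by (simp add: power2_eq_square)
 have npos: "n mu > 0" if "mu \<in> F" for mu using n[OF that] n0[OF that] pos[OF that] by simp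
 have orth: "integral ?I (%t. u mu k t * u mu' k t) = 0" if F: "mu \<in> F" "mu' \<in> F" "mu ~= mu'" for mu mu'
 proof -
  have 1: "mu * integral ?I (%s. u mu 0 s * u mu' 0 s) = integral ?I (%s. u mu k s * u mu' k s)"
   by (rule clamped_integral_by_parts[OF u[OF F(1)] u[OF F(2)]])
  have 2: "mu' * integral ?I (%s. u mu 0 s * u mu' 0 s) = integral ?I (%s. u mu k s * u mu' k s)"
   using clamped_integral_by_parts[OF u[OF F(2)] u[OF F(1)]]
   unfolding mult.commute[of "u mu' _ _"] .
  from 1 2 have "(mu - mu') * integral ?I (%s. u mu 0 s * u mu' 0 s) = 0"
   unfolding left_diff_distrib by linarith
  then have "integral ?I (%s. u mu 0 s * u mu' 0 s) = 0" using F(3) unfolding mult_eq_0_iff by linarith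
  with 1 show ?thesis unfolding mult_zero_right by (simp only: mult_zero_right)
 qed
 have ck: "continuous_on ?I (u mu k)" and c0: "continuous_on ?I (u mu 0)" if "mu \<in> F" for mu
  using u[OF that] unfolding clamped_eigenfunction_def by auto
 have bessel: "(\<Sum>mu\<in>F. (u mu 0 s)^2 / n mu) <= 1" if s: "s \<in> ?I" for s
 proof -
  define K where "K = (%t. (max 0 (s-t))^(k-1) / fact (k-1))"
  have cK: "continuous_on ?I K" unfolding K_def by (intro continuous_intros) auto
  have Ku: "integral ?I (%t. K t * u mu k t) = u mu 0 s" if "mu \<in> F" for mu
   unfolding K_def using clamped_kernel[OF u[OF that] k2] s by simp
  define c where "c = (%mu. u mu 0 s / n mu)"
  define G where "G = (%t. \<Sum>mu\<in>F. c mu * u mu k t)"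
  have cG: "continuous_on ?I G" unfolding G_def by (intro continuous_intros ck)
  have i: "(%t. f t * g t) integrable_on ?I" if "continuous_on ?I f" "continuous_on ?I g" for f g :: "real => real"
   using that by (intro integrable_continuous_real continuous_intros)
  have KG: "integral ?I (%t. f t * G t) = (\<Sum>mu\<in>F. c mu * integral ?I (%t. f t * u mu k t))"
   if "continuous_on ?I f" for f
  proof -
   have "integral ?I (%t. f t * G t) = integral ?I (%t. \<Sum>mu\<in>F. c mu * (f t * u mu k t))"
    unfolding G_def by (simp add: sum_distrib_left mult_ac)
   also have "\<dots> = (\<Sum>mu\<in>F. integral ?I (%t. c mu * (f t * u mu k t)))"
    by (rule integral_sum[OF F(1)]) (intro integrable_on_mult_right i that ck)
   finally show ?thesis by simp
  qed
  have "integral ?I (%t. K t * G t) = (\<Sum>mu\<in>F. (u mu 0 s)^2 / n mu)"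
   unfolding KG[OF cK]
  proof (rule sum.cong[OF refl])
   fix mu assume "mu \<in> F"
   from Ku[OF this] show "c mu * integral ?I (%t. K t * u mu k t) = (u mu 0 s)^2 / n mu"
    unfolding c_def power2_eq_square by simp
  qed
  moreover have "integral ?I (%t. G t * G t) = (\<Sum>mu\<in>F. (u mu 0 s)^2 / n mu)"
  proof -
   have "integral ?I (%t. G t * u mu k t) = c mu * n mu" if mu: "mu \<in> F" for mu
   proof -
    have "integral ?I (%t. G t * u mu k t) = (\<Sum>mu'\<in>F. c mu' * integral ?I (%t. u mu k t * u mu' k t))"
     using KG[OF ck[OF mu]] by (simp only: mult.commute)
    also have "\<dots> = (\<Sum>mu'\<in>F. if mu' = mu then c mu * n mu else 0)"
    proof (rule sum.cong[OF refl])
     fix mu' assume "mu' \<in> F"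
     from orth[OF mu this] show "c mu' * integral ?I (%t. u mu k t * u mu' k t) = (if mu' = mu then c mu * n mu else 0)"
      unfolding n_def power2_eq_square by (cases "mu' = mu") simp_all
    qed
    finally show ?thesis using mu F(1) by simp
   qed
   moreover have "c mu * (c mu * n mu) = (u mu 0 s)^2 / n mu" if "mu \<in> F" for mu
    using npos[OF that] unfolding c_def by (simp add: power2_eq_square)
   ultimately show ?thesis unfolding KG[OF cG] by simp
  qed
  moreover have "0 <= integral ?I (%t. K t * K t) - 2 * integral ?I (%t. K t * G t) + integral ?I (%t. G t * G t)"
  proof -
   have "((%t. K t * K t - 2 * (K t * G t) + G t * G t) has_integral
    integral ?I (%t. K t * K t) - 2 * integral ?I (%t. K t * G t) + integral ?I (%t. G t * G t)) ?I"
    by (intro has_integral_add has_integral_diff has_integral_mult_right integrable_integral i cK cG)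
   moreover have "K t * K t - 2 * (K t * G t) + G t * G t = (K t - G t)^2" for t
    by (simp add: power2_eq_square algebra_simps)
   ultimately have "((%t. (K t - G t)^2) has_integral
    integral ?I (%t. K t * K t) - 2 * integral ?I (%t. K t * G t) + integral ?I (%t. G t * G t)) ?I" by simp
   then show ?thesis by (rule has_integral_nonneg) simp
  qed
  moreover have "integral ?I (%t. K t * K t) <= 1"
  proof -
   have "((%t. 1 :: real) has_integral 1) ?I" using has_integral_const_real[of "1::real" "-1/2" "1/2"] by simp
   moreover have "K t * K t <= 1" if "t \<in> ?I" for t
   proof -
    have "(max 0 (s-t))^(k-1) <= 1" using that s by (intro power_le_one) auto
    then have "(max 0 (s-t))^(k-1) / fact (k-1) <= 1 / 1" by (intro frac_le) (auto simp: fact_ge_1)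
    then have "0 <= K t" "K t <= 1" unfolding K_def by auto
    then show ?thesis by (simp add: mult_le_one)
   qed
   ultimately show ?thesis by (rule has_integral_le[OF integrable_integral[OF i[OF cK cK]]])
  qed
  ultimately show ?thesis by linarith
 qed
 have "((%s. \<Sum>mu\<in>F. (u mu 0 s)^2 / n mu) has_integral (\<Sum>mu\<in>F. n0 mu / n mu)) ?I"
  unfolding n0_def using F(1)
  by (intro has_integral_sum has_integral_divide integrable_integral integrable_continuous_real continuous_intros c0)
 moreover have "((%t. 1 :: real) has_integral 1) ?I" using has_integral_const_real[of "1::real" "-1/2" "1/2"] by simp
 ultimately have "(\<Sum>mu\<in>F. n0 mu / n mu) <= 1" using bessel by (rule has_integral_le)
 moreover have "(\<Sum>mu\<in>F. n0 mu / n mu) = (\<Sum>mu\<in>F. 1 / mu)"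
 proof (rule sum.cong[OF refl])
  fix mu assume "mu \<in> F"
  then show "n0 mu / n mu = 1 / mu" using n n0[of mu] by simp
 qed
 moreover have "(\<Sum>mu\<in>F. 1 / mu) >= (\<Sum>mu\<in>F. 1 / \<bar>m\<bar>)"
 proof (rule sum_mono)
  fix mu assume mu: "mu \<in> F" then have "mu <= m" using F(3) by auto
  then show "1 / \<bar>m\<bar> <= 1 / mu" using pos[OF mu] by (intro divide_left_mono) auto
 qed
 moreover have "m > 0"
 proof -
  have "F ~= {}" using F(2) by auto
  then obtain mu where "mu \<in> F" by blast
  then show ?thesis using pos[of mu] F(3) by auto
 qed
 ultimately have "(\<Sum>mu\<in>F. 1 / \<bar>m\<bar>) <= 1" "m > 0" by linarith+
 then have "real (card F) <= m" by (simp add: field_simps)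
 then show False using F(2) \<open>m > 0\<close> by (simp add: ) linarith
qed

lemma nu_bound:
 assumes k2: "k >= 2" and ex: "dirichlet_eigenvalue k mu"
  and c: "0 <= c" "c^(2*k) <= 2^(2*k) * (2*real k * (2*real k-1) * (fact (k-1))^2)"
 shows "c <= nu k"
proof -
 define A where "A = {mu'. dirichlet_eigenvalue k mu' \<and> mu' <= mu}"
 have A: "finite A" "A ~= {}" using finite_dirichlet_eigenvalues[OF k2] ex unfolding A_def by auto
 define m where "m = (LEAST mu. dirichlet_eigenvalue k mu)"
 have "m = Min A" unfolding m_def
 proof (rule Least_equality)
  show "dirichlet_eigenvalue k (Min A)" using Min_in[OF A] by (simp add: A_def)
  fix y assume y: "dirichlet_eigenvalue k y"
  show "Min A <= y"
  proof (cases "y <= mu")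
   case True then show ?thesis using Min_le[OF A(1), of y] y by (simp add: A_def)
  next
   case False
   moreover have "Min A <= mu" using Min_in[OF A] by (simp add: A_def)
   ultimately show ?thesis by linarith
  qed
 qed
 then have "dirichlet_eigenvalue k m" using Min_in[OF A] by (simp add: A_def)
 then obtain u where "clamped_eigenfunction k m u" using dirichlet_eigenvalueE[OF _ k] by blast
 from clamped_eigenvalue_bound[OF this] c(2) have "c^(2*k) <= m" by linarith
 then have "root (2*k) (c^(2*k)) <= root (2*k) m" using k by simp
 then show ?thesis unfolding nu_def m_def using c(1) k by (simp add: real_root_power_cancel)
qed

end

lemma exponential_dirichlet_eigenvalue:
 fixes c rho :: "nat => complex" and n :: nat
 defines "w \<equiv> %j z. \<Sum>l<n. c l * rho l ^ j * (exp (rho l * z) + (-1)^j * exp (- rho l * z)) / 2"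
 assumes rho: "!!l. l < n ==> rho l ^ (2*k) = of_real ((-1)^k * mu)"
  and bc: "!!j. j < k ==> Re (w j (1/2)) = 0"
  and nz: "\<exists>j. Re (w j 0) ~= 0"
 shows "dirichlet_eigenvalue k mu"
proof -
 define u where "u = (%j s. Re (w j (complex_of_real s)))"
 have dw: "(w j has_field_derivative w (Suc j) z) (at z)" for j z
 proof -
  have "((%z. c l * rho l ^ j * (exp (rho l * z) + (-1)^j * exp (- rho l * z)) / 2) has_field_derivative
   c l * rho l ^ Suc j * (exp (rho l * z) + (-1)^Suc j * exp (- rho l * z)) / 2) (at z)" for l
   by (rule derivative_eq_intros refl | simp)+ (simp add: algebra_simps)
  then show ?thesis unfolding w_def by (intro DERIV_sum)
 qed
 have du: "(u j has_real_derivative u (Suc j) s) (at s)" for j s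
 proof -
  have "((%s. w j (of_real s)) has_vector_derivative w (Suc j) (of_real s)) (at s)"
   by (rule has_vector_derivative_real_field) (rule dw)
  from bounded_linear.has_vector_derivative[OF bounded_linear_Re this]
  show ?thesis unfolding u_def by (simp add: has_real_derivative_iff_has_vector_derivative)
 qed
 have parity: "w j (-z) = (-1)^j * w j z" for j z
  unfolding w_def sum_distrib_left by (rule sum.cong) (cases "even j"; simp add: algebra_simps)+
 have top: "w (2*k) z = of_real ((-1)^k * mu) * w 0 z" for z
  unfolding w_def sum_distrib_left by (rule sum.cong) (use rho in "simp_all add: mult_ac")
 show ?thesis unfolding dirichlet_eigenvalue_def
 proof (intro exI[of _ u] conjI ballI allI impI)
  fix s :: real
  show "(-1)^k * u (2*k) s = mu * u 0 s"
  proof -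
   have "u (2*k) s = ((-1)^k * mu) * u 0 s" unfolding u_def top by (metis Re_complex_of_real times_complex.simps(1) mult.commute Im_complex_of_real mult_zero_left diff_zero)
   then show ?thesis by (cases "even k") auto
  qed
 next
  fix j assume j: "j < k"
  show "u j (1/2) = 0" using bc[OF j] by (simp add: u_def)
  have "w j (of_real (-1/2)) = (-1)^j * w j (1/2)" using parity[of j "1/2"] by simp
  then show "u j (-1/2) = 0" using bc[OF j] unfolding u_def by (cases "even j") auto
 next
  show "\<exists>s\<in>{-1/2<..<1/2}. u 0 s ~= 0"
  proof (rule ccontr)
   assume "\<not> ?thesis"
   then have z0: "u 0 s = 0" if "s \<in> {-1/2<..<1/2}" for s using that by auto
   have "\<forall>s\<in>{-1/2<..<1/2}. u j s = 0" for j
   proof (induction j)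
    case (Suc j)
    show ?case
    proof
     fix s :: real assume s: "s \<in> {-1/2<..<1/2}"
     have "((%s. 0) has_real_derivative u (Suc j) s) (at s)"
      by (rule has_field_derivative_transform_within_open[OF du[of j s] _ s]) (use Suc in auto)
     then show "u (Suc j) s = 0" using DERIV_unique[OF _ DERIV_const] by blast
    qed
   qed (use z0 in auto)
   then have "Re (w j 0) = 0" for j unfolding u_def by (metis greaterThanLessThan_iff half_gt_zero_iff neg_less_0_iff_less of_real_0 zero_less_one minus_divide_left)
   then show False using nz by blast
  qed
 qed (use du in "auto intro: has_field_derivative_at_within")
qed

lemma dirichlet_eigenvalue_3: "dirichlet_eigenvalue 3 ((2*pi)^6)"
proof -
 define Sh where "Sh = sinh (sqrt 3 * pi / 2)"
 define omega where "omega = Complex (sqrt 3 * pi) pi"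
 define c where "c = (%l::nat. if l = 0 then Complex (sqrt 3) (-1) else of_real Sh)"
 define rho where "rho = (%l::nat. if l = 0 then omega else Complex 0 (2*pi))"
 have s3: "sqrt 3 * sqrt 3 = (3::real)" by simp
 have r2: "omega ^ 2 = Complex (2*pi^2) (2 * sqrt 3 * pi^2)"
  by (simp add: omega_def power2_eq_square complex_eq_iff algebra_simps)
 have r3: "omega ^ 3 = Complex 0 (8 * pi^3)"
  unfolding power3_eq_cube by (simp add: omega_def power3_eq_cube complex_eq_iff algebra_simps)
 have "omega ^ 6 = (omega ^ 3) ^ 2" by (simp flip: power_mult)
 then have r6: "omega ^ 6 = of_real (- ((2*pi)^6))"
  unfolding r3 by (simp add: complex_eq_iff power2_eq_square eval_nat_numeral)
 have e1: "exp (omega / 2) = \<i> * of_real (exp (sqrt 3 * pi / 2))"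
  by (simp add: omega_def exp_eq_polar complex_eq_iff Re_exp Im_exp)
 have e2: "exp (- (omega / 2)) = - \<i> * of_real (exp (- (sqrt 3 * pi / 2)))"
  by (simp add: omega_def exp_eq_polar complex_eq_iff Re_exp Im_exp)
 have e3: "exp (Complex 0 (2*pi) / 2) = -1" "exp (- (Complex 0 (2*pi) / 2)) = -1"
  by (simp_all add: complex_eq_iff Re_exp Im_exp)
 have Sh: "(exp (sqrt 3 * pi / 2) - exp (- (sqrt 3 * pi / 2))) / 2 = Sh" unfolding Sh_def sinh_def by simp
 have two: "{..<2::nat} = {0,1}" by auto
 show ?thesis
 proof (rule exponential_dirichlet_eigenvalue[where n=2 and c=c and rho=rho])
  fix l :: nat assume "l < 2"
  have "Complex 0 (2*pi) ^ 6 = of_real (- ((2*pi)^6))"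
   by (simp add: complex_eq_iff eval_nat_numeral)
  then show "rho l ^ (2*3) = of_real ((-1)^3 * (2*pi)^6)" using r6 by (simp add: rho_def)
 next
  fix j :: nat assume "j < 3"
  then consider "j = 0" | "j = 1" | "j = 2" by linarith
  then show "Re (\<Sum>l<2. c l * rho l ^ j * (exp (rho l * (1/2)) + (-1)^j * exp (- rho l * (1/2))) / 2) = 0"
  proof cases
   case 1
   have "Re (\<i> * of_real (exp (sqrt 3 * pi / 2)) * Complex (sqrt 3) (-1)) = exp (sqrt 3 * pi / 2)" by simp
   show ?thesis unfolding 1 two using Sh
    by (simp add: c_def rho_def e1 e2 e3)
  next
   case 2
   show ?thesis unfolding 2 two
    by (simp add: c_def rho_def e1 e2 e3) (simp add: omega_def algebra_simps)
  next
   case 3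
   show ?thesis unfolding 3 two using Sh
    by (simp add: c_def rho_def e1 e2 e3 r2) (simp add: algebra_simps power2_eq_square)
  qed
 next
  have "Sh > 0" unfolding Sh_def by simp
  then show "\<exists>j. Re (\<Sum>l<2. c l * rho l ^ j * (exp (rho l * 0) + (-1)^j * exp (- rho l * 0)) / 2) ~= 0"
   by (intro exI[of _ 0]) (simp add: two c_def add_pos_pos[THEN less_imp_neq, symmetric])
 qed
qed

text \<open>With \<open>\<nu> = 2 z\<close>, the even solutions of \<open>u\<^sup>(\<^sup>8\<^sup>) = \<nu>\<^sup>8 u\<close> are spanned by \<open>cos (\<nu> s)\<close>,
 \<open>cosh (\<nu> s)\<close> and the real and imaginary parts of \<open>cosh (omega \<nu> s)\<close> with \<open>omega\<^sup>4 = -1\<close>. The boundary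
 conditions have a nonzero solution iff the following function vanishes.\<close>

definition clamped_determinant :: "real => real" where
 "clamped_determinant z =
  - (cosh (sqrt 2 * z) + cos (sqrt 2 * z)) * sinh z * sin z
  + (cosh (sqrt 2 * z) - cos (sqrt 2 * z)) * cosh z * cos z
  + (sinh (sqrt 2 * z) - sin (sqrt 2 * z)) / sqrt 2 * (cosh z * sin z - sinh z * cos z)"

lemma clamped_determinant_root: "\<exists>z>0. clamped_determinant z = 0"
proof -
 have cosh_big: "10 <= cosh (sqrt 2 * z)" if "z >= pi" for z
 proof -
  have "9 <= z^2" using that pi_gt3 power_mono[of 3 z 2] by simp
  then show ?thesis using cosh_ge_quadratic[of "sqrt 2 * z"] by (simp add: power_mult_distrib)
 qed
 have s2: "1/2 <= 1 / sqrt 2" "1 / sqrt 2 <= 5/7" "sqrt 2 > 0"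
 proof -
  have "7/5 <= sqrt 2" by (rule real_le_rsqrt) (simp add: power2_eq_square)
  moreover have "sqrt 2 <= (2::real)" by (rule real_le_lsqrt) auto
  ultimately show "1/2 <= 1 / sqrt 2" "1 / sqrt 2 <= 5/7" by (simp_all add: field_simps)
 qed simp
 have aux1: "\<bar>sinh x - sin x\<bar> <= cosh x + 1" if "0 <= x" for x :: real
 proof -
  have "0 <= sinh x" using that by simp
  then show ?thesis unfolding abs_le_iff
   using sinh_le_cosh_real[of x] sin_le_one[of x] sin_ge_minus_one[of x] cosh_real_pos[of x] by linarith
 qed
 have aux: "\<bar>(sinh x - sin x) / sqrt 2\<bar> * c <= (cosh x - 2) * c" if "10 <= cosh x" "0 <= x" "0 <= c" for x c :: real
 proof -
  have "\<bar>sinh x - sin x\<bar> * (1 / sqrt 2) <= (cosh x + 1) * (5/7)"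
   using s2 that by (intro mult_mono aux1) auto
  also have "\<dots> <= cosh x - 2" using that(1) by simp
  finally show ?thesis using that(3) s2 by (intro mult_right_mono) (auto simp: abs_divide)
 qed
 have "clamped_determinant pi <= 0"
 proof -
  define x where "x = sqrt 2 * pi"
  have x: "10 <= cosh x" "0 <= x" unfolding x_def using cosh_big[of pi] by auto
  have "clamped_determinant pi = - (cosh x - cos x) * cosh pi + (sinh x - sin x) / sqrt 2 * sinh pi"
   by (simp add: clamped_determinant_def x_def algebra_simps)
  also have "(sinh x - sin x) / sqrt 2 * sinh pi <= \<bar>(sinh x - sin x) / sqrt 2\<bar> * sinh pi"
   by (rule mult_right_mono[OF abs_ge_self]) simp
  also have "\<dots> <= (cosh x - 2) * sinh pi" by (rule aux) (use x in auto)
  also have "\<dots> <= (cosh x - cos x) * cosh pi"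
  proof (rule mult_mono)
   show "cosh x - 2 <= cosh x - cos x" "0 <= cosh x - cos x" using cos_le_one[of x] x by linarith+
  qed (auto simp: sinh_le_cosh_real)
  finally show ?thesis by (simp add: algebra_simps)
 qed
 moreover have "0 <= clamped_determinant (3 * pi / 2)"
 proof -
  define x where "x = sqrt 2 * (3 * pi / 2)"
  have x: "10 <= cosh x" "0 <= x" unfolding x_def using cosh_big[of "3*pi/2"] by auto
  have sc: "sin (3 * pi / 2) = -1" "cos (3 * pi / 2) = 0" using sin_3over2_pi cos_3over2_pi by (simp_all add: mult.commute)
  define S where "S = sinh (3 * pi / 2)"
  define C where "C = cosh (3 * pi / 2)"
  have e: "clamped_determinant (3 * pi / 2) = (cosh x + cos x) * S - (sinh x - sin x) / sqrt 2 * C"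
   unfolding clamped_determinant_def sc x_def S_def C_def by (simp add: field_simps)
  have Spos: "S > 0" by (simp add: S_def)
  have "C^2 = S^2 + 1" using cosh_square_eq[of "3*pi/2"] by (simp add: S_def C_def)
  have S3: "S >= 3"
  proof -
   have "9 <= (3*pi/2)^2 / 2" using pi_gt3 power_mono[of "9/2" "3*pi/2" 2] by (simp add: power2_eq_square)
   then have "10 <= C" using cosh_ge_quadratic[of "3*pi/2"] by (simp add: C_def)
   then have "99 <= S^2" using power_mono[of 10 C 2] \<open>C^2 = S^2 + 1\<close> by simp
   then show ?thesis using Spos power2_le_imp_le[of 3 S] by simp
  qed
  have "(S + 1/6)^2 >= S^2 + 1" using S3 by (simp add: power2_eq_square algebra_simps)
  then have CS: "C <= S + 1/6" using \<open>C^2 = S^2 + 1\<close> Spos power2_le_imp_le[of C "S + 1/6"] by simp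
  have "(sinh x - sin x) / sqrt 2 * C <= \<bar>(sinh x - sin x) / sqrt 2\<bar> * C"
   by (rule mult_right_mono[OF abs_ge_self]) (simp add: C_def)
  also have "\<dots> <= \<bar>(sinh x - sin x) / sqrt 2\<bar> * (S + 1/6)" using CS by (intro mult_left_mono) auto
  also have "\<dots> <= (cosh x + 1) * (5/7) * (S + 1/6)"
  proof (rule mult_right_mono)
   have "\<bar>sinh x - sin x\<bar> * (1 / sqrt 2) <= (cosh x + 1) * (5/7)"
    using s2 x by (intro mult_mono aux1) auto
   then show "\<bar>(sinh x - sin x) / sqrt 2\<bar> <= (cosh x + 1) * (5/7)" by (simp add: abs_divide)
  qed (use Spos in simp)
  also have "\<dots> <= (cosh x - 1) * S"
  proof -
   have "0 <= (cosh x - 10) * (S - 3)" using x S3 by simp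
   then have "3 * cosh x + 10 * S - 30 <= cosh x * S" by (simp add: algebra_simps)
   then show ?thesis by (simp add: field_simps) (use x S3 in linarith)
  qed
  also have "\<dots> <= (cosh x + cos x) * S"
   by (rule mult_right_mono) (use Spos cos_ge_minus_one[of x] in linarith)+
  finally show ?thesis unfolding e by simp
 qed
 moreover have "continuous_on {pi..3 * pi / 2} clamped_determinant"
  unfolding clamped_determinant_def[abs_def] by (intro continuous_intros) auto
 ultimately obtain z where "pi <= z" "clamped_determinant z = 0"
  using IVT'[of clamped_determinant pi 0 "3 * pi / 2"] by auto
 then show ?thesis using pi_gt3 by (intro exI[of _ z]) auto
qed

lemma Re_annihilator:
 fixes P Q :: complex
 assumes "Im (cnj P * Q) = 0"
 obtains g where "g ~= 0" "Re (g * P) = 0" "Re (g * Q) = 0"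
proof (cases "P = 0")
 case True
 then show ?thesis
  by (cases "Q = 0") (use that[of 1] that[of "\<i> * cnj Q"] in "auto simp: algebra_simps")
next
 case False
 then show ?thesis using that[of "\<i> * cnj P"] assms by (auto simp: algebra_simps)
qed

lemma dirichlet_eigenvalue_4: "\<exists>mu. dirichlet_eigenvalue 4 mu"
proof -
 obtain z where z: "z > 0" "clamped_determinant z = 0" using clamped_determinant_root by blast
 define a where "a = z / sqrt 2"
 have az: "sqrt 2 * a = z" "2 * a = sqrt 2 * z" by (auto simp: a_def field_simps)
 have s2: "sqrt 2 * sqrt 2 = (2::real)" "sqrt 2 > (0::real)" by simp_all
 define C S Ch Sh where "C = cos z" "S = sin z" "Ch = cosh z" "Sh = sinh z"
 define K where "K = (exp (Complex a a) + exp (- Complex a a)) / 2"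
 define K' where "K' = (exp (Complex a a) - exp (- Complex a a)) / 2"
 have K: "Re K = cosh a * cos a" "Im K = sinh a * sin a" "Re K' = sinh a * cos a" "Im K' = cosh a * sin a"
  unfolding K_def K'_def by (simp_all add: Re_exp Im_exp cosh_def sinh_def field_simps)
 define P where "P = Complex 1 1 * K * Sh - Complex 0 (sqrt 2) * K' * Ch"
 define Q where "Q = Complex 1 (-1) * K * S + sqrt 2 * K' * C"
 have SC: "S * S + C * C = 1" using sin_cos_squared_add[of z] by (simp add: C_S_Ch_Sh_def power2_eq_square)
 have Ch: "Ch > 0" by (simp add: C_S_Ch_Sh_def)
 have "Im (cnj P * Q) = clamped_determinant z"
 proof -
  define k1 k2 l1 l2 where "k1 = Re K" "k2 = Im K" "l1 = Re K'" "l2 = Im K'"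
  have d: "cosh (2*a) = 1 + 2 * (sinh a * sinh a)" "cos (2*a) = 1 - 2 * (sin a * sin a)"
   and t: "cosh a * cosh a = 1 + sinh a * sinh a" "cos a * cos a = 1 - sin a * sin a"
   using cosh_square_eq[of a] sin_cos_squared_add[of a] by (simp_all add: cosh_double cos_double power2_eq_square)
  have "k1*k1 + k2*k2 = (cosh a * cosh a) * (cos a * cos a) + (sinh a * sinh a) * (sin a * sin a)"
   unfolding k1_k2_l1_l2_def K by algebra
  then have q1: "k1*k1 + k2*k2 = (cosh (2*a) + cos (2*a)) / 2" unfolding t d by (simp add: field_simps)
  have "l1*l1 + l2*l2 = (sinh a * sinh a) * (cos a * cos a) + (cosh a * cosh a) * (sin a * sin a)"
   unfolding k1_k2_l1_l2_def K by algebra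
  then have q2: "l1*l1 + l2*l2 = (cosh (2*a) - cos (2*a)) / 2" unfolding t d by (simp add: field_simps)
  have "k1*l1 + k2*l2 = (sinh a * cosh a) * (cos a * cos a + sin a * sin a)"
   unfolding k1_k2_l1_l2_def K by algebra
  then have q3: "k1*l1 + k2*l2 = sinh (2*a) / 2" unfolding t by (simp add: sinh_double)
  have "k1*l2 - k2*l1 = (cosh a * cosh a - sinh a * sinh a) * (sin a * cos a)"
   unfolding k1_k2_l1_l2_def K by algebra
  then have q4: "k1*l2 - k2*l1 = sin (2*a) / 2" unfolding t by (simp add: sin_double)
  have "Im (cnj P * Q) = - 2 * (k1*k1 + k2*k2) * Sh * S + (sqrt 2 * sqrt 2) * (l1*l1 + l2*l2) * Ch * C
   + sqrt 2 * ((k1*l2 - k2*l1) - (k1*l1 + k2*l2)) * Sh * C + sqrt 2 * ((k1*l1 + k2*l2) - (k1*l2 - k2*l1)) * Ch * S"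
   unfolding P_def Q_def k1_k2_l1_l2_def by (simp add: algebra_simps)
  also have "\<dots> = clamped_determinant z"
  proof -
   have "sqrt 2 / 2 = 1 / sqrt (2::real)" by (simp add: field_simps)
   then have r: "sqrt 2 * (x / 2) = x / sqrt 2" for x :: real by (metis mult.commute mult.left_neutral times_divide_eq_left times_divide_eq_right)
   have f1: "sqrt 2 * (sin (2*a) / 2 - sinh (2*a) / 2) = - ((sinh (sqrt 2 * z) - sin (sqrt 2 * z)) / sqrt 2)"
    using r[of "sin (2*a) - sinh (2*a)"] unfolding az diff_divide_distrib[symmetric] minus_divide_left[symmetric] by (metis minus_diff_eq minus_divide_left)
   have f2: "sqrt 2 * (sinh (2*a) / 2 - sin (2*a) / 2) = (sinh (sqrt 2 * z) - sin (sqrt 2 * z)) / sqrt 2"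
    using r[of "sinh (2*a) - sin (2*a)"] unfolding az diff_divide_distrib[symmetric] .
   show ?thesis unfolding q1 q2 q3 q4 s2 f1 f2 unfolding clamped_determinant_def C_S_Ch_Sh_def az
    by (simp add: field_simps)
  qed
  finally show ?thesis .
 qed
 then obtain g where g: "g ~= 0" "Re (g * P) = 0" "Re (g * Q) = 0" using z(2) Re_annihilator by metis
 define X where "X = Re (g * Complex 1 (-1) * K)"
 define Y where "Y = Re (g * sqrt 2 * K')"
 define V where "V = Re (g * Complex 1 1 * K)"
 define W where "W = Re (g * Complex 0 (sqrt 2) * K')"
 have XY: "X * S + Y * C = 0" using g(3) unfolding Q_def X_def Y_def by (simp add: algebra_simps)
 have VW: "V * Sh = W * Ch" using g(2) unfolding P_def V_def W_def by (simp add: algebra_simps)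
 define alpha where "alpha = (S * Y - C * X) / 2"
 define beta where "beta = - V / (2 * Ch)"
 have a1: "2 * alpha * C + X = 0"
 proof -
  have "2 * alpha * C + X = S * (X * S + Y * C) + X * (1 - (S * S + C * C))" by (simp add: alpha_def field_simps)
  then show ?thesis using XY SC by simp
 qed
 have a2: "2 * alpha * S - Y = 0"
 proof -
  have "2 * alpha * S - Y = - C * (X * S + Y * C) - Y * (1 - (S * S + C * C))" by (simp add: alpha_def field_simps)
  then show ?thesis using XY SC by simp
 qed
 have b1: "2 * beta * Ch + V = 0" using Ch by (simp add: beta_def)
 have b2: "2 * beta * Sh + W = 0" using Ch VW by (simp add: beta_def field_simps)
 define c where "c = (%l::nat. if l = 0 then of_real alpha else if l = 1 then of_real beta else g)"
 define rho where "rho = (%l::nat. if l = 0 then Complex 0 (2*z) else if l = 1 then of_real (2*z) else Complex (2*a) (2*a))"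
 have three: "{..<3::nat} = {0,1,2}" by auto
 have r2: "Complex (2*a) (2*a) ^ 2 = Complex 0 (8*a*a)" by (simp add: complex_eq_iff power2_eq_square)
 have r4: "Complex (2*a) (2*a) ^ 4 = of_real (- (64*a^4))"
 proof -
  have "Complex (2*a) (2*a) ^ 4 = (Complex (2*a) (2*a) ^ 2) ^ 2" by (simp flip: power_mult)
  then show ?thesis unfolding r2 by (simp add: complex_eq_iff power2_eq_square power4_eq_xxxx)
 qed
 have z2: "z * z = 2 * (a * a)" using az(1) s2(1) by (metis mult.assoc mult.commute mult.left_commute)
 have zW: "z * W = 2 * (a * Re (g * Complex 0 1 * K'))" "z * Y = 2 * (a * Re (g * K'))"
 proof -
  have "W = sqrt 2 * Re (g * Complex 0 1 * K')" "Y = sqrt 2 * Re (g * K')"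
   unfolding W_def Y_def by (simp_all add: algebra_simps)
  then have "z * W = (sqrt 2 * sqrt 2) * (a * Re (g * Complex 0 1 * K'))" "z * Y = (sqrt 2 * sqrt 2) * (a * Re (g * K'))"
   unfolding az(1)[symmetric] by (simp_all only: mult_ac)
  then show "z * W = 2 * (a * Re (g * Complex 0 1 * K'))" "z * Y = 2 * (a * Re (g * K'))" unfolding s2 by auto
 qed
 have e0: "exp (Complex 0 (2*z) / 2) = Complex C S" "exp (- (Complex 0 (2*z) / 2)) = Complex C (-S)"
  by (simp_all add: complex_eq_iff Re_exp Im_exp C_S_Ch_Sh_def)
 have e2: "exp (Complex (2*a) (2*a) / 2) = exp (Complex a a)" "exp (- (Complex (2*a) (2*a) / 2)) = exp (- Complex a a)"
  by (simp_all add: complex_eq_iff Re_exp Im_exp)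
 have ee: "exp (Complex a a) = K + K'" "exp (- Complex a a) = K - K'" unfolding K_def K'_def by (simp_all add: field_simps)
 have e1: "exp (complex_of_real z) = of_real (Ch + Sh)" "exp (- complex_of_real z) = of_real (Ch - Sh)"
  by (simp_all add: C_S_Ch_Sh_def cosh_def sinh_def complex_eq_iff Re_exp Im_exp field_simps)
 have "dirichlet_eigenvalue 4 ((2*z)^8)"
 proof (rule exponential_dirichlet_eigenvalue[where n=3 and c=c and rho=rho])
  fix l :: nat assume "l < 3"
  then consider "l = 0" | "l = 1" | "l = 2" by linarith
  then show "rho l ^ (2*4) = of_real ((-1)^4 * (2*z)^8)"
  proof cases
   case 1
   have "Complex 0 (2*z) ^ 8 = of_real ((2*z)^8)"  by (simp add: complex_eq_iff eval_nat_numeral)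
   then show ?thesis using 1 by (simp add: rho_def)
  next
   case 2 then show ?thesis by (simp add: rho_def)
  next
   case 3
   have "Complex (2*a) (2*a) ^ 8 = (Complex (2*a) (2*a) ^ 4) ^ 2" by (simp flip: power_mult)
   also have "\<dots> = of_real ((64*a^4)^2)" unfolding r4 by (simp flip: of_real_power)
   also have "(64*a^4)^2 = (2*z)^8"
   proof -
    have "(2*z)^8 = 256 * ((z*z)*(z*z)*(z*z)*(z*z))" by (simp add: eval_nat_numeral)
    then show ?thesis unfolding z2 by (simp add: eval_nat_numeral)
   qed
   finally show ?thesis using 3 by (simp add: rho_def)
  qed
 next
  fix j :: nat assume "j < 4"
  then consider "j = 0" | "j = 1" | "j = 2" | "j = 3" by linarith
  then show "Re (\<Sum>l<3. c l * rho l ^ j * (exp (rho l * (1/2)) + (-1)^j * exp (- rho l * (1/2))) / 2) = 0"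
  proof cases
   case 1
   have "2 * (alpha * C + beta * Ch + Re (g * K)) = (2 * alpha * C + X) + (2 * beta * Ch + V)"
    by (simp add: X_def V_def algebra_simps)
   then show ?thesis unfolding 1 three a1 b1
    by (simp add: c_def rho_def e0 e2 e1 ee)
  next
   case 2
   have "2 * z * (- alpha * S + beta * Sh) + 2 * a * Re (g * Complex 1 1 * K') = z * ((2 * beta * Sh + W) - (2 * alpha * S - Y))"
    using zW by (simp add: algebra_simps)
   then have "2 * z * (- alpha * S + beta * Sh) + 2 * a * Re (g * Complex 1 1 * K') = 0" unfolding a2 b2 by simp
   then show ?thesis unfolding 2 three
    by (simp add: c_def rho_def e0 e2 e1 ee) (simp add: algebra_simps)
  next
   case 3
   have "4 * (z*z) * (- alpha * C + beta * Ch) + 8*a*a * Re (g * \<i> * K) = 2 * (z * z) * ((2 * beta * Ch + V) - (2 * alpha * C + X))"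
    unfolding z2 by (simp add: X_def V_def algebra_simps)
   then have "4 * (z*z) * (- alpha * C + beta * Ch) + 8*a*a * Re (g * \<i> * K) = 0" unfolding a1 b1 by simp
   then show ?thesis unfolding 3 three
    by (simp add: c_def rho_def e0 e2 e1 ee r2) (simp add: algebra_simps power2_eq_square)
  next
   case 4
   have p3: "x ^ 3 = x * x ^ 2" for x :: complex by (simp add: eval_nat_numeral)
   have "8 * z * (z * z) * (alpha * S + beta * Sh) + 16*(a*(a*a)) * Re (g * Complex (-1) 1 * K')
    = 4 * (z * (z * z)) * ((2 * beta * Sh + W) + (2 * alpha * S - Y))"
   proof -
    have "16*(a*(a*a)) * Re (g * Complex (-1) 1 * K') = 8 * (2 * (a*a)) * (a * Re (g * Complex 0 1 * K') - a * Re (g * K'))"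
     by (simp add: algebra_simps)
    also have "\<dots> = 4 * (z*z) * (z * W - z * Y)" unfolding z2[symmetric] zW by (simp add: algebra_simps)
    finally show ?thesis by (simp add: algebra_simps)
   qed
   then have "8 * z * (z * z) * (alpha * S + beta * Sh) + 16*(a*(a*a)) * Re (g * Complex (-1) 1 * K') = 0" unfolding a2 b2 by simp
   then show ?thesis unfolding 4 three
    by (simp add: c_def rho_def e0 e2 e1 ee p3 r2) (simp add: algebra_simps power2_eq_square)
  qed
 next
  show "\<exists>j. Re (\<Sum>l<3. c l * rho l ^ j * (exp (rho l * 0) + (-1)^j * exp (- rho l * 0)) / 2) ~= 0"
  proof (rule ccontr)
   assume "\<not> ?thesis"
   then have 0: "Re (\<Sum>l<3. c l * rho l ^ j * (exp (rho l * 0) + (-1)^j * exp (- rho l * 0)) / 2) = 0" for j by blast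
   have p6: "x ^ 6 = x ^ 4 * x ^ 2" for x :: complex by (simp flip: power_add)
   have a0: "a ~= 0" using az z(1) by auto
   have j0: "alpha + beta + Re g = 0" using 0[of 0] by (simp add: three c_def)
   have j4: "16 * ((z*z)*(z*z)) * (alpha + beta) - 64 * a^4 * Re g = 0"
    using 0[of 4] by (simp add: three c_def rho_def r4 power4_eq_xxxx algebra_simps)
   then have "64 * a^4 * (alpha + beta - Re g) = 0" unfolding z2 by (simp add: power4_eq_xxxx algebra_simps)
   with a0 j0 have g1: "Re g = 0" by simp
   have j2: "4 * (z*z) * (beta - alpha) - 8*a*a * Im g = 0"
    using 0[of 2] by (simp add: three c_def rho_def r2 power2_eq_square algebra_simps)
   then have "8 * (a*a) * (beta - alpha - Im g) = 0" unfolding z2 by (simp add: algebra_simps)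
   with a0 have k1: "beta - alpha - Im g = 0" by simp
   have j6: "64 * ((z*z)*(z*z)*(z*z)) * (beta - alpha) + 512 * a^4 * (a*a) * Im g = 0"
    using 0[of 6] by (simp add: three c_def rho_def p6 r4 r2 power2_eq_square power4_eq_xxxx algebra_simps)
   then have "512 * (a^4 * (a*a)) * (beta - alpha + Im g) = 0" unfolding z2 by (simp add: power4_eq_xxxx algebra_simps)
   with a0 k1 have "Im g = 0" by simp
   with g1 g(1) show False by (simp add: complex_eq_iff)
  qed
 qed
 then show ?thesis by blast
qed

lemma nu_3_ge: "44/10 <= nu 3"
 by (rule nu_bound[OF _ _ dirichlet_eigenvalue_3]) (auto simp: fact_numeral power_divide eval_nat_numeral)

lemma nu_4_ge: "515/100 <= nu 4"
proof -
 obtain mu where "dirichlet_eigenvalue 4 mu" using dirichlet_eigenvalue_4 by blast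
 then show ?thesis
  by (intro nu_bound) (auto simp: fact_numeral power_divide eval_nat_numeral)
qed

subsection \<open>Hessian bound in polar coordinates\<close>

lemma bound_minorant_nonneg: "0 <= lam ==> 0 < b ==> 0 <= bound_minorant lam b"
 unfolding bound_minorant_def by simp

lemma sin_cos_double_integrals:
 shows "((%t. cos (2*t)) has_integral 0) {0..2*pi}"
  and "((%t. sin (2*t)) has_integral 0) {0..2*pi}"
  and "((%t. sin (2*t) * cos (2*t)) has_integral 0) {0..2*pi}"
  and "((%t. (cos (2*t))^2) has_integral pi) {0..2*pi}"
  and "((%t. (sin (2*t))^2) has_integral pi) {0..2*pi}"
proof -
 have per: "sin (4 * pi) = 0" "cos (4 * pi) = 1" "sin (8 * pi) = 0" "cos (8 * pi) = 1"
  using sin_npi[of 4] cos_npi[of 4] sin_npi[of 8] cos_npi[of 8] by simp_all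
 have ftc: "(f has_integral F (2*pi) - F 0) {0..2*pi}" if "!!t. (F has_real_derivative f t) (at t)" for F f :: "real => real"
  by (rule fundamental_theorem_of_calculus)
   (use that in "auto simp: has_real_derivative_iff_has_vector_derivative[symmetric] intro: has_field_derivative_at_within")
 show "((%t. cos (2*t)) has_integral 0) {0..2*pi}"
 proof -
  have "((%t. sin (2*t) / 2) has_real_derivative cos (2*t)) (at t)" for t :: real by (auto intro!: derivative_eq_intros)
  from ftc[OF this] show ?thesis using per by simp
 qed
 show "((%t. sin (2*t)) has_integral 0) {0..2*pi}"
 proof -
  have "((%t. - cos (2*t) / 2) has_real_derivative sin (2*t)) (at t)" for t :: real by (auto intro!: derivative_eq_intros)
  from ftc[OF this] show ?thesis using per by simp
 qed
 show "((%t. sin (2*t) * cos (2*t)) has_integral 0) {0..2*pi}"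
 proof -
  have "((%t. (sin (2*t))^2 / 4) has_real_derivative sin (2*t) * cos (2*t)) (at t)" for t :: real
   by (auto intro!: derivative_eq_intros)
  from ftc[OF this] show ?thesis using per by simp
 qed
 have dc: "((%t. t / 2 + sin (2*t) * cos (2*t) / 4) has_real_derivative (cos (2*t))^2) (at t)" for t :: real
 proof (rule DERIV_cong)
  show "((%t. t / 2 + sin (2*t) * cos (2*t) / 4) has_real_derivative 1/2 + (2 * (cos (2*t))^2 - 2 * (sin (2*t))^2) / 4) (at t)"
   by (auto intro!: derivative_eq_intros simp: power2_eq_square)
  show "1/2 + (2 * (cos (2*t))^2 - 2 * (sin (2*t))^2) / 4 = (cos (2*t))^2" by (simp add: sin_squared_eq field_simps)
 qed
 from ftc[OF dc] show c: "((%t. (cos (2*t))^2) has_integral pi) {0..2*pi}" using per by simp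
 have "((%t::real. 1 - (cos (2*t))\<^sup>2) has_integral 2 * pi - pi) {0..2*pi}"
  using has_integral_diff[OF has_integral_const_real[of "1::real" 0 "2*pi"] c] by simp
 then show "((%t. (sin (2*t))^2) has_integral pi) {0..2*pi}" by (simp add: sin_squared_eq)
qed

lemma bessel_second_modes:
 fixes g :: "real => real"
 assumes g: "continuous_on {0..2*pi} g"
 shows "(integral {0..2*pi} g)^2 / (2*pi) + (integral {0..2*pi} (%t. g t * cos (2*t)))^2 / pi
  + (integral {0..2*pi} (%t. g t * sin (2*t)))^2 / pi <= integral {0..2*pi} (%t. (g t)^2)"
proof -
 define a where "a = integral {0..2*pi} g"
 define b where "b = integral {0..2*pi} (%t. g t * cos (2*t))"
 define c where "c = integral {0..2*pi} (%t. g t * sin (2*t))"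
 define N where "N = integral {0..2*pi} (%t. (g t)^2)"
 have i: "(g has_integral a) {0..2*pi}" "((%t. g t * cos (2*t)) has_integral b) {0..2*pi}"
  "((%t. g t * sin (2*t)) has_integral c) {0..2*pi}" "((%t. (g t)^2) has_integral N) {0..2*pi}"
  unfolding a_def b_def c_def N_def
  by (auto intro!: integrable_integral integrable_continuous_real continuous_intros g)
 have one: "((%t. 1) has_integral 2*pi) {0..2*pi}" using has_integral_const_real[of "1::real" 0 "2*pi"] by simp
 define A B C where "A = a / (2*pi)" "B = b / pi" "C = c / pi"
 have "((%t. (g t)^2 + A^2 * 1 + B^2 * (cos (2*t))^2 + C^2 * (sin (2*t))^2 - 2 * A * g t - 2 * B * (g t * cos (2*t)) - 2 * C * (g t * sin (2*t))
  + 2 * A * B * cos (2*t) + 2 * A * C * sin (2*t) + 2 * B * C * (sin (2*t) * cos (2*t))) has_integral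
  N + A^2 * (2*pi) + B^2 * pi + C^2 * pi - 2 * A * a - 2 * B * b - 2 * C * c + 2 * A * B * 0 + 2 * A * C * 0 + 2 * B * C * 0) {0..2*pi}"
  by (intro has_integral_add has_integral_diff has_integral_mult_right i one sin_cos_double_integrals)
 moreover have "(g t)^2 + A^2 * 1 + B^2 * (cos (2*t))^2 + C^2 * (sin (2*t))^2 - 2 * A * g t - 2 * B * (g t * cos (2*t)) - 2 * C * (g t * sin (2*t))
  + 2 * A * B * cos (2*t) + 2 * A * C * sin (2*t) + 2 * B * C * (sin (2*t) * cos (2*t)) = (g t - A - B * cos (2*t) - C * sin (2*t))^2" for t
  by algebra
 ultimately have "((%t. (g t - A - B * cos (2*t) - C * sin (2*t))^2) has_integral
  N + A^2 * (2*pi) + B^2 * pi + C^2 * pi - 2 * A * a - 2 * B * b - 2 * C * c) {0..2*pi}" by simp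
 then have "0 <= N + A^2 * (2*pi) + B^2 * pi + C^2 * pi - 2 * A * a - 2 * B * b - 2 * C * c"
  by (rule has_integral_nonneg) simp
 also have "\<dots> = N - (a^2 / (2*pi) + b^2 / pi + c^2 / pi)"
  unfolding A_B_C_def by (simp add: field_simps power2_eq_square)
 finally show ?thesis unfolding a_def b_def c_def N_def by simp
qed

locale polar_eigenfunction =
 fixes lam R :: real and U U1 U11 U2 U22 :: "real => real => real" and u0 b1 b2 H11 H12 H22 :: real
 assumes dU: "!!r t. \<bar>r\<bar> < R ==> ((%r. U r t) has_real_derivative U1 r t) (at r)"
  and dU1: "!!r t. \<bar>r\<bar> < R ==> ((%r. U1 r t) has_real_derivative U11 r t) (at r)"
  and dU2: "!!r t. \<bar>r\<bar> < R ==> (U r has_real_derivative U2 r t) (at t)"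
  and dU22: "!!r t. \<bar>r\<bar> < R ==> (U2 r has_real_derivative U22 r t) (at t)"
  and cU: "continuous_on ({-R<..<R} \<times> UNIV) (%(r,t). U r t)"
  and cU1: "continuous_on ({-R<..<R} \<times> UNIV) (%(r,t). U1 r t)"
  and cU11: "continuous_on ({-R<..<R} \<times> UNIV) (%(r,t). U11 r t)"
  and cU22: "continuous_on ({-R<..<R} \<times> UNIV) (%(r,t). U22 r t)"
  and per: "!!r t. \<bar>r\<bar> < R ==> U r (t + 2*pi) = U r t"
  and eq: "!!r t. 0 < r ==> r < R ==> U11 r t + cosh r / sinh r * U1 r t + U22 r t / (sinh r)^2 = - lam\<^sup>2 * U r t"
  and U_0: "!!t. U 0 t = u0"
  and U1_0: "!!t. U1 0 t = b1 * cos t + b2 * sin t"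
  and U11_0: "!!t. U11 0 t = H11 * (cos t)^2 + 2 * H12 * (cos t * sin t) + H22 * (sin t)^2"
  and trace: "H11 + H22 = - lam\<^sup>2 * u0"
begin

lemma continuous_slice:
 assumes c: "continuous_on ({-R<..<R} \<times> UNIV) (%(r,t). F r t)" and r: "\<bar>r\<bar> < R"
 shows "continuous_on S (F r)"
proof -
 have "continuous_on S (%t. (%(r,t). F r t) (r, t))"
  by (rule continuous_on_compose2[OF c]) (use r in "auto intro!: continuous_intros")
 then show ?thesis by simp
qed

lemma DERIV_angular_integral:
 assumes d: "!!r t. \<bar>r\<bar> < R ==> ((%r. F r t) has_real_derivative F1 r t) (at r)"
  and c1: "continuous_on ({-R<..<R} \<times> UNIV) (%(r,t). F r t)"
  and c2: "continuous_on ({-R<..<R} \<times> UNIV) (%(r,t). F1 r t)"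
  and w: "continuous_on UNIV w" and r: "\<bar>r\<bar> < R"
 shows "((%r. integral {0..2*pi} (%t. F r t * w t)) has_real_derivative integral {0..2*pi} (%t. F1 r t * w t)) (at r)"
proof -
 have rR: "r \<in> {-R<..<R}" using r by auto
 have cw: "continuous_on S w" for S using w continuous_on_subset by blast
 have "((%r. integral (cbox 0 (2*pi)) (%t. F r t * w t)) has_field_derivative integral (cbox 0 (2*pi)) (%t. F1 r t * w t)) (at r within {-R<..<R})"
 proof (rule leibniz_rule_field_derivative)
  fix x t :: real assume "x \<in> {-R<..<R}"
  then have "\<bar>x\<bar> < R" by auto
  from DERIV_cmult_right[OF d[OF this, of t], of "w t"]
  show "((%x. F x t * w t) has_field_derivative F1 x t * w t) (at x within {-R<..<R})"
   by (rule has_field_derivative_at_within)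
 next
  fix x assume "x \<in> {-R<..<R}"
  then have "\<bar>x\<bar> < R" by auto
  then show "(%t. F x t * w t) integrable_on cbox 0 (2*pi)"
   by (intro integrable_continuous continuous_on_mult continuous_slice[OF c1] cw)
 next
  have "continuous_on ({-R<..<R} \<times> cbox 0 (2*pi)) (%z. (%(r,t). F1 r t) z * w (snd z))"
   by (intro continuous_on_mult continuous_on_subset[OF c2] continuous_on_compose2[OF w] continuous_on_snd continuous_on_id) auto
  then show "continuous_on ({-R<..<R} \<times> cbox 0 (2*pi)) (%(x,t). F1 x t * w t)"
   by (simp add: case_prod_unfold)
 qed (use rR in auto)
 then show ?thesis using rR at_within_open[OF rR open_greaterThanLessThan] by simp
qed

lemma angular_parts:
 assumes r: "\<bar>r\<bar> < R" and w: "!!t. (w has_real_derivative w1 t) (at t)" "!!t. (w1 has_real_derivative - k * w t) (at t)"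
  and pw: "w (2*pi) = w 0" "w1 (2*pi) = w1 0"
 shows "integral {0..2*pi} (%t. U22 r t * w t) = - k * integral {0..2*pi} (%t. U r t * w t)"
proof -
 have pU: "U r (2*pi) = U r 0" using per[OF r, of 0] by simp
 have pU2: "U2 r (2*pi) = U2 r 0"
 proof -
  have "((%t. U r (t + 2*pi)) has_real_derivative U2 r (0 + 2*pi)) (at 0)"
   using dU2[OF r, of "0 + 2*pi"] DERIV_shift by blast
  then have "(U r has_real_derivative U2 r (2*pi)) (at 0)" using per[OF r] by simp
  then show ?thesis using dU2[OF r, of 0] DERIV_unique by blast
 qed
 have "((%t. U22 r t * w t - U r t * (- k * w t)) has_integral
  (U2 r (2*pi) * w (2*pi) - U r (2*pi) * w1 (2*pi)) - (U2 r 0 * w 0 - U r 0 * w1 0)) {0..2*pi}"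
 proof (rule fundamental_theorem_of_calculus)
  fix t :: real
  have "((%t. U2 r t * w t - U r t * w1 t) has_real_derivative (U22 r t * w t + w1 t * U2 r t) - (U2 r t * w1 t + (- k * w t) * U r t)) (at t)"
   by (intro DERIV_diff DERIV_mult dU22 dU2 w r)
  then have "((%t. U2 r t * w t - U r t * w1 t) has_real_derivative U22 r t * w t - U r t * (- k * w t)) (at t)"
   by (rule DERIV_cong) simp
  then show "((%t. U2 r t * w t - U r t * w1 t) has_vector_derivative U22 r t * w t - U r t * (- k * w t)) (at t within {0..2*pi})"
   by (simp only: has_real_derivative_iff_has_vector_derivative has_vector_derivative_at_within)
 qed simp
 then have I0: "((%t. U22 r t * w t - U r t * (- k * w t)) has_integral 0) {0..2*pi}" using pU pU2 pw by simp
 have cw: "continuous_on {0..2*pi} w" by (rule DERIV_continuous_on) (use w in "auto intro: has_field_derivative_at_within")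
 have i: "(%t. U22 r t * w t) integrable_on {0..2*pi}" "(%t. U r t * w t) integrable_on {0..2*pi}"
  by (intro integrable_continuous_real continuous_on_mult cw continuous_slice[OF cU22 r] continuous_slice[OF cU r])+
 have "((%t. U22 r t * w t - (- k) * (U r t * w t)) has_integral
  integral {0..2*pi} (%t. U22 r t * w t) - (- k) * integral {0..2*pi} (%t. U r t * w t)) {0..2*pi}"
  by (intro has_integral_diff has_integral_mult_right integrable_integral i)
 then have "((%t. U22 r t * w t - U r t * (- k * w t)) has_integral
  integral {0..2*pi} (%t. U22 r t * w t) - (- k) * integral {0..2*pi} (%t. U r t * w t)) {0..2*pi}"
  by (simp add: mult_ac)
 from has_integral_unique[OF I0 this] show ?thesis by linarith
qed

definition coef :: "(real => real) => real => real" where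
 "coef w r = integral {0..2*pi} (%t. U r t * w t)"

lemma coef_radial_mode:
 assumes w: "!!t. (w has_real_derivative w1 t) (at t)" "!!t. (w1 has_real_derivative - (real m)\<^sup>2 * w t) (at t)"
  and pw: "w (2*pi) = w 0" "w1 (2*pi) = w1 0"
  and alpha: "alpha ~= 0" and lim: "((%r. coef w r / half_tanh r ^ m) \<longlongrightarrow> alpha) (at_right 0)" and R: "R > 0"
 shows "radial_mode m lam R (%r. coef w r / alpha) (%r. integral {0..2*pi} (%t. U1 r t * w t) / alpha)"
proof
 have cw: "continuous_on UNIV w" by (rule DERIV_continuous_on) (use w in auto)
 have d1: "(coef w has_real_derivative integral {0..2*pi} (%t. U1 r t * w t)) (at r)" if "\<bar>r\<bar> < R" for r
  unfolding coef_def[abs_def] by (rule DERIV_angular_integral[OF dU cU cU1 cw that])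
 have d2: "((%r. integral {0..2*pi} (%t. U1 r t * w t)) has_real_derivative integral {0..2*pi} (%t. U11 r t * w t)) (at r)" if "\<bar>r\<bar> < R" for r
  by (rule DERIV_angular_integral[OF dU1 cU1 cU11 cw that])
 fix r assume r: "0 < r" "r < R"
 then have r': "\<bar>r\<bar> < R" by simp
 show "((%r. coef w r / alpha) has_real_derivative integral {0..2*pi} (%t. U1 r t * w t) / alpha) (at r)"
  by (intro DERIV_cdivide d1 r')
 have i: "(%t. F r t * w t) integrable_on {0..2*pi}" if "continuous_on ({-R<..<R} \<times> UNIV) (%(r,t). F r t)" for F
  by (intro integrable_continuous_real continuous_on_mult continuous_on_subset[OF cw] continuous_slice[OF that r']) auto
 have "integral {0..2*pi} (%t. U11 r t * w t) = - lam\<^sup>2 * coef w r - cosh r / sinh r * integral {0..2*pi} (%t. U1 r t * w t)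
   - 1 / (sinh r)^2 * integral {0..2*pi} (%t. U22 r t * w t)"
 proof -
  have "((%t. - lam\<^sup>2 * (U r t * w t) - cosh r / sinh r * (U1 r t * w t) - 1 / (sinh r)^2 * (U22 r t * w t)) has_integral
   - lam\<^sup>2 * coef w r - cosh r / sinh r * integral {0..2*pi} (%t. U1 r t * w t) - 1 / (sinh r)^2 * integral {0..2*pi} (%t. U22 r t * w t)) {0..2*pi}"
   unfolding coef_def by (intro has_integral_diff has_integral_mult_right integrable_integral i cU cU1 cU22)
  moreover have "- lam\<^sup>2 * (U r t * w t) - cosh r / sinh r * (U1 r t * w t) - 1 / (sinh r)^2 * (U22 r t * w t) = U11 r t * w t" for t
  proof -
   have "U11 r t = - lam\<^sup>2 * U r t - cosh r / sinh r * U1 r t - U22 r t / (sinh r)^2" using eq[OF r, of t] by linarith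
   then show ?thesis by (simp only:) (simp add: algebra_simps)
  qed
  ultimately show ?thesis by (simp add: integral_unique)
 qed
 also have "integral {0..2*pi} (%t. U22 r t * w t) = - (real m)\<^sup>2 * coef w r"
  unfolding coef_def by (rule angular_parts[OF r' w pw])
 finally have e: "integral {0..2*pi} (%t. U11 r t * w t) = ((real m)^2 / (sinh r)^2 - lam\<^sup>2) * coef w r - cosh r / sinh r * integral {0..2*pi} (%t. U1 r t * w t)"
  by (simp add: algebra_simps)
 have "((%r. integral {0..2*pi} (%t. U1 r t * w t) / alpha) has_real_derivative integral {0..2*pi} (%t. U11 r t * w t) / alpha) (at r)"
  by (intro DERIV_cdivide d2 r')
 then show "((%r. integral {0..2*pi} (%t. U1 r t * w t) / alpha) has_real_derivative ((real m)^2 / (sinh r)^2 - lam\<^sup>2) * (coef w r / alpha) -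
   cosh r / sinh r * (integral {0..2*pi} (%t. U1 r t * w t) / alpha)) (at r)"
  by (rule DERIV_cong) (simp add: e diff_divide_distrib)
next
 show "((%r. coef w r / alpha / half_tanh r ^ m) \<longlongrightarrow> 1) (at_right 0)"
  using tendsto_divide[OF lim tendsto_const[of alpha] alpha] alpha by (simp add: mult.commute)
 have cw: "continuous_on UNIV w" by (rule DERIV_continuous_on) (use w in auto)
 have "isCont (%r. sinh r * (integral {0..2*pi} (%t. U1 r t * w t) / alpha)) 0"
  using R DERIV_isCont[OF DERIV_angular_integral[OF dU1 cU1 cU11 cw, of 0]] by (intro continuous_intros) (auto simp: alpha)
 then show "((%r. sinh r * (integral {0..2*pi} (%t. U1 r t * w t) / alpha)) \<longlongrightarrow> 0) (at_right 0)"
  unfolding isCont_def by (simp add: tendsto_mono[OF at_le[OF subset_UNIV]])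
qed

lemma coef_continuous:
 assumes w: "!!t. (w has_real_derivative w1 t) (at t)" and b: "b < R"
 shows "continuous_on {0..b} (coef w)"
proof -
 have cw: "continuous_on UNIV w" by (rule DERIV_continuous_on) (use w in auto)
 show ?thesis unfolding coef_def[abs_def]
  by (rule DERIV_continuous_on, rule has_field_derivative_at_within, rule DERIV_angular_integral[OF dU cU cU1 cw]) (use b in auto)
qed

lemma mode0_coef_bound:
 assumes b: "0 < b" "b < R" and lam: "0 <= lam" and beta: "bound_minorant lam b <= beta"
 shows "lam^4 * (2*pi*u0)^2 <= 2 * beta * integral {0..b} (%r. (coef (%t. 1) r)^2 * sinh r)"
proof (cases "u0 = 0")
 case True
 have "0 <= beta" using beta bound_minorant_nonneg[OF lam b(1)] by linarith
 moreover have "0 <= integral {0..b} (%r. (coef (%t. 1) r)^2 * sinh r)"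
  by (intro integral_nonneg integrable_continuous_real continuous_intros coef_continuous[where ?w1.0="%_. 0"] b) auto
 ultimately show ?thesis using True by simp
next
 case False
 define alpha where "alpha = 2*pi*u0"
 have alpha: "alpha ~= 0" using False by (simp add: alpha_def)
 have "isCont (coef (%t. 1)) 0"
  using DERIV_isCont[OF DERIV_angular_integral[OF dU cU cU1, of "%_. 1" 0]] b unfolding coef_def[abs_def] by simp
 moreover have "coef (%t. 1) 0 = alpha" unfolding coef_def U_0 alpha_def by simp
 ultimately have l: "((%r. coef (%t. 1) r / half_tanh r ^ 0) \<longlongrightarrow> alpha) (at_right 0)"
  unfolding isCont_def by (simp add: tendsto_mono[OF at_le[OF subset_UNIV]])
 interpret radial_mode 0 lam R "%r. coef (%t. 1) r / alpha" "%r. integral {0..2*pi} (%t. U1 r t * 1) / alpha"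
  by (rule coef_radial_mode[where ?w1.0="%_. 0"]) (use alpha l b in auto)
 have "lam^4 <= 2 * beta * integral {0..b} (%r. (coef (%t. 1) r / alpha)^2 * sinh r)"
  using alpha by (intro mode0_bound b lam beta continuous_intros coef_continuous[where ?w1.0="%_. 0"]) auto
 also have "integral {0..b} (%r. (coef (%t. 1) r / alpha)^2 * sinh r) = integral {0..b} (%r. (coef (%t. 1) r)^2 * sinh r) / alpha^2"
  by (simp add: power_divide)
 finally show ?thesis using alpha unfolding alpha_def[symmetric] by (simp add: field_simps)
qed

lemma mode2_coef_bound:
 assumes w: "!!t. (w has_real_derivative w1 t) (at t)" "!!t. (w1 has_real_derivative - 4 * w t) (at t)"
  and pw: "w (2*pi) = w 0" "w1 (2*pi) = w1 0"
  and b: "0 < b" "b < R" and lam: "0 <= lam" and beta: "bound_minorant lam b <= beta"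
  and w0: "integral {0..2*pi} w = 0" "integral {0..2*pi} (%t. (b1 * cos t + b2 * sin t) * w t) = 0"
  and F: "F = integral {0..2*pi} (%t. U11 0 t * w t)"
 shows "(2*F)^2 <= beta * integral {0..b} (%r. (coef w r)^2 * sinh r)"
proof (cases "F = 0")
 case True
 have "0 <= beta" using beta bound_minorant_nonneg[OF lam b(1)] by linarith
 moreover have "0 <= integral {0..b} (%r. (coef w r)^2 * sinh r)"
  by (intro integral_nonneg integrable_continuous_real continuous_intros coef_continuous[OF w(1)] b) auto
 ultimately show ?thesis using True by simp
next
 case False
 have R: "R > 0" using b by simp
 have cw: "continuous_on UNIV w" by (rule DERIV_continuous_on) (use w in auto)
 define f' where "f' = (%r. integral {0..2*pi} (%t. U1 r t * w t))"
 have d1: "(coef w has_real_derivative f' r) (at r)" if "\<bar>r\<bar> < R" for r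
  unfolding coef_def[abs_def] f'_def by (rule DERIV_angular_integral[OF dU cU cU1 cw that])
 have d2: "(f' has_real_derivative F) (at 0)"
 proof -
  have "\<bar>0::real\<bar> < R" using R by simp
  from DERIV_angular_integral[OF dU1 cU1 cU11 cw this] show ?thesis unfolding f'_def F by simp
 qed
 have f0: "coef w 0 = 0" unfolding coef_def U_0 using w0(1) by simp
 have f'0: "f' 0 = 0" unfolding f'_def U1_0 using w0(2) by simp
 have ld: "((%r. f' r / (2*r)) \<longlongrightarrow> F / 2) (at_right 0)"
 proof -
  have "(%h. f' h / h) \<midarrow>0\<rightarrow> F" using d2 f'0 unfolding DERIV_def by simp
  then have "((%h. f' h / h / 2) \<longlongrightarrow> F / 2) (at_right 0)"
   by (intro tendsto_divide tendsto_const) (auto intro: tendsto_mono[OF at_le[OF subset_UNIV]])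
  then show ?thesis by (simp add: mult.commute)
 qed
 have l1: "((%r. coef w r / r^2) \<longlongrightarrow> F / 2) (at_right 0)"
 proof (rule lhopital_right_0[OF _ _ _ _ _ _ ld])
  show "(coef w \<longlongrightarrow> 0) (at_right 0)"
   using DERIV_isCont[OF d1[of 0]] R f0 unfolding isCont_def by (simp add: tendsto_mono[OF at_le[OF subset_UNIV]])
  show "((%r::real. r^2) \<longlongrightarrow> 0) (at_right 0)"
   by (rule tendsto_eq_intros refl | simp)+
  show "\<forall>\<^sub>F r in at_right 0. (coef w has_real_derivative f' r) (at r)"
   unfolding eventually_at_right_field using R d1 by (intro exI[of _ R]) auto
  show "\<forall>\<^sub>F r in at_right 0. ((%r. r^2) has_real_derivative 2 * r) (at r)"
   by (intro always_eventually allI) (auto intro!: derivative_eq_intros)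
 qed (auto simp: eventually_at_right_field intro!: exI[of _ 1])
 have l2: "((%r. half_tanh r / r) \<longlongrightarrow> 1/2) (at_right 0)"
 proof -
  have "(half_tanh has_real_derivative 1/2) (at 0)"
   unfolding half_tanh_def[abs_def] by (auto intro!: derivative_eq_intros)
  then have "(%h. half_tanh h / h) \<midarrow>0\<rightarrow> 1/2" unfolding DERIV_def by (simp add: half_tanh_def)
  then show ?thesis by (rule tendsto_mono[OF at_le[OF subset_UNIV]])
 qed
 have "((%r. (coef w r / r^2) / (half_tanh r / r)^2) \<longlongrightarrow> (F/2) / (1/2)^2) (at_right 0)"
  by (intro tendsto_intros l1 l2) simp
 moreover have "\<forall>\<^sub>F r in at_right 0. (coef w r / r^2) / (half_tanh r / r)^2 = coef w r / half_tanh r ^ 2"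
  by (auto simp: eventually_at_right_field power_divide intro!: exI[of _ 1])
 ultimately have "((%r. coef w r / half_tanh r ^ 2) \<longlongrightarrow> (F/2) / (1/2)^2) (at_right 0)"
  by (rule Lim_transform_eventually)
 then have l: "((%r. coef w r / half_tanh r ^ 2) \<longlongrightarrow> 2 * F) (at_right 0)" by (simp add: power2_eq_square)
 interpret radial_mode 2 lam R "%r. coef w r / (2*F)" "%r. integral {0..2*pi} (%t. U1 r t * w t) / (2*F)"
  by (rule coef_radial_mode[OF w(1)]) (use False l R w pw in auto)
 have "1 <= beta * integral {0..b} (%r. (coef w r / (2*F))^2 * sinh r)"
  using False by (intro mode2_bound b lam beta continuous_intros coef_continuous[OF w(1)]) auto
 also have "integral {0..b} (%r. (coef w r / (2*F))^2 * sinh r) = integral {0..b} (%r. (coef w r)^2 * sinh r) / (2*F)^2"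
  by (simp add: power_divide)
 finally show ?thesis using False by (simp add: field_simps)
qed

lemma second_derivative_coefs:
 shows "integral {0..2*pi} (%t. U11 0 t * cos (2*t)) = pi / 2 * (H11 - H22)"
  and "integral {0..2*pi} (%t. U11 0 t * sin (2*t)) = pi * H12"
  and "integral {0..2*pi} (%t. (b1 * cos t + b2 * sin t) * cos (2*t)) = 0"
  and "integral {0..2*pi} (%t. (b1 * cos t + b2 * sin t) * sin (2*t)) = 0"
proof -
 have U: "U11 0 t = (H11 + H22) / 2 + (H11 - H22) / 2 * cos (2*t) + H12 * sin (2*t)" for t
  unfolding U11_0 by (simp add: cos_double sin_double) (simp add: cos_squared_eq field_simps)
 have "((%t. (H11 + H22) / 2 * cos (2*t) + (H11 - H22) / 2 * (cos (2*t))^2 + H12 * (sin (2*t) * cos (2*t))) has_integral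
  (H11 + H22) / 2 * 0 + (H11 - H22) / 2 * pi + H12 * 0) {0..2*pi}"
  by (intro has_integral_add has_integral_mult_right sin_cos_double_integrals)
 then show "integral {0..2*pi} (%t. U11 0 t * cos (2*t)) = pi / 2 * (H11 - H22)"
  unfolding U by (intro integral_unique) (simp add: algebra_simps power2_eq_square)
 have "((%t. (H11 + H22) / 2 * sin (2*t) + (H11 - H22) / 2 * (sin (2*t) * cos (2*t)) + H12 * (sin (2*t))^2) has_integral
  (H11 + H22) / 2 * 0 + (H11 - H22) / 2 * 0 + H12 * pi) {0..2*pi}"
  by (intro has_integral_add has_integral_mult_right sin_cos_double_integrals)
 then show "integral {0..2*pi} (%t. U11 0 t * sin (2*t)) = pi * H12"
  unfolding U by (intro integral_unique) (simp add: algebra_simps power2_eq_square)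
 have ftc: "(f has_integral F (2*pi) - F 0) {0..2*pi}" if "!!t. (F has_real_derivative f t) (at t)" for F f :: "real => real"
  by (rule fundamental_theorem_of_calculus)
   (use that in "auto simp: has_real_derivative_iff_has_vector_derivative[symmetric] intro: has_field_derivative_at_within")
 have "((%t. b1 * (sin t - 2/3 * (sin t)^3) + b2 * (cos t - 2/3 * (cos t)^3)) has_real_derivative
  (b1 * cos t + b2 * sin t) * cos (2*t)) (at t)" for t
 proof (rule DERIV_cong)
  show "((%t. b1 * (sin t - 2/3 * (sin t)^3) + b2 * (cos t - 2/3 * (cos t)^3)) has_real_derivative
   b1 * (cos t - 2 * (sin t)^2 * cos t) + b2 * (- sin t + 2 * (cos t)^2 * sin t)) (at t)"
   by (auto intro!: derivative_eq_intros simp: algebra_simps)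
  have "cos (2*t) = 1 - 2 * (sin t)^2" "cos (2*t) = 2 * (cos t)^2 - 1" by (simp_all add: cos_double cos_squared_eq)
  then have "b1 * cos t * cos (2*t) = b1 * cos t * (1 - 2 * (sin t)^2)" "b2 * sin t * cos (2*t) = b2 * sin t * (2 * (cos t)^2 - 1)" by auto
  then have e: "(b1 * cos t + b2 * sin t) * cos (2*t) = b1 * cos t * (1 - 2 * (sin t)^2) + b2 * sin t * (2 * (cos t)^2 - 1)"
   by (simp only: distrib_right)
  show "b1 * (cos t - 2 * (sin t)^2 * cos t) + b2 * (- sin t + 2 * (cos t)^2 * sin t) = (b1 * cos t + b2 * sin t) * cos (2*t)"
   unfolding e by (simp add: algebra_simps)
 qed
 from integral_unique[OF ftc[OF this]] show "integral {0..2*pi} (%t. (b1 * cos t + b2 * sin t) * cos (2*t)) = 0" by simp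
 have "((%t. - 2/3 * b1 * (cos t)^3 + 2/3 * b2 * (sin t)^3) has_real_derivative (b1 * cos t + b2 * sin t) * sin (2*t)) (at t)" for t
 proof (rule DERIV_cong)
  show "((%t. - 2/3 * b1 * (cos t)^3 + 2/3 * b2 * (sin t)^3) has_real_derivative
   2 * b1 * (cos t)^2 * sin t + 2 * b2 * (sin t)^2 * cos t) (at t)"
   by (auto intro!: derivative_eq_intros)
  show "2 * b1 * (cos t)^2 * sin t + 2 * b2 * (sin t)^2 * cos t = (b1 * cos t + b2 * sin t) * sin (2*t)"
   unfolding sin_double by (simp add: power2_eq_square algebra_simps)
 qed
 from integral_unique[OF ftc[OF this]] show "integral {0..2*pi} (%t. (b1 * cos t + b2 * sin t) * sin (2*t)) = 0" by simp
qed

theorem hessian_bound: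
 assumes b: "0 < b" "b < R" and lam: "0 <= lam" and beta: "bound_minorant lam b <= beta"
 shows "2*pi * (H11^2 + 2 * H12^2 + H22^2) <= beta * integral {0..b} (%r. integral {0..2*pi} (%t. (U r t)^2) * sinh r)"
proof -
 have per2: "sin (4*pi) = 0" "cos (4*pi) = 1" using sin_npi[of 4] cos_npi[of 4] by simp_all
 have dc: "((%t. cos (2*t)) has_real_derivative - 2 * sin (2*t)) (at t)" "((%t. - 2 * sin (2*t)) has_real_derivative - 4 * cos (2*t)) (at t)"
  "((%t. sin (2*t)) has_real_derivative 2 * cos (2*t)) (at t)" "((%t. 2 * cos (2*t)) has_real_derivative - 4 * sin (2*t)) (at t)" for t :: real
  by (auto intro!: derivative_eq_intros)
 define A where "A = integral {0..b} (%r. (coef (%t. 1) r)^2 * sinh r)"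
 define B where "B = integral {0..b} (%r. (coef (%t. cos (2*t)) r)^2 * sinh r)"
 define C where "C = integral {0..b} (%r. (coef (%t. sin (2*t)) r)^2 * sinh r)"
 have 1: "lam^4 * (2*pi*u0)^2 <= 2 * beta * A" unfolding A_def by (rule mode0_coef_bound[OF b lam beta])
 have "(2 * (pi / 2 * (H11 - H22)))^2 <= beta * B" unfolding B_def
  using second_derivative_coefs sin_cos_double_integrals per2
  by (intro mode2_coef_bound[OF dc(1,2) _ _ b lam beta]) (auto intro: integral_unique)
 then have 2: "pi^2 * (H11 - H22)^2 <= beta * B" by (simp add: power_mult_distrib)
 have "(2 * (pi * H12))^2 <= beta * C" unfolding C_def
  using second_derivative_coefs sin_cos_double_integrals per2
  by (intro mode2_coef_bound[OF dc(3,4) _ _ b lam beta]) (auto intro: integral_unique)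
 then have 3: "4 * pi^2 * H12^2 <= beta * C" by (simp add: power_mult_distrib)
 define G where "G = (%r. integral {0..2*pi} (%t. (U r t)^2))"
 have cG: "continuous_on {0..b} G"
 proof -
  have "continuous_on ({0..b} \<times> cbox 0 (2*pi)) (%z. ((%(r,t). U r t) z)^2)"
   by (intro continuous_on_power continuous_on_subset[OF cU]) (use b in auto)
  then have "continuous_on ({0..b} \<times> cbox 0 (2*pi)) (%(r,t). (U r t)^2)" by (simp add: case_prod_unfold)
  then show ?thesis unfolding G_def using integral_continuous_on_param[of "{0..b}" 0 "2*pi" "%r t. (U r t)^2"] by simp
 qed
 have cc: "continuous_on {0..b} (coef (%t. 1))" "continuous_on {0..b} (coef (%t. cos (2*t)))" "continuous_on {0..b} (coef (%t. sin (2*t)))"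
  using coef_continuous[where ?w1.0="%_. 0"] coef_continuous[OF dc(1)] coef_continuous[OF dc(3)] b by auto
 have "((%r. (coef (%t. 1) r)^2 * sinh r * (1 / (2*pi)) + (coef (%t. cos (2*t)) r)^2 * sinh r * (1 / pi) + (coef (%t. sin (2*t)) r)^2 * sinh r * (1 / pi))
  has_integral A * (1 / (2*pi)) + B * (1/pi) + C * (1/pi)) {0..b}"
  unfolding A_def B_def C_def
  by (intro has_integral_add has_integral_mult_left integrable_integral integrable_continuous_real continuous_intros cc)
 moreover have "((%r. G r * sinh r) has_integral integral {0..b} (%r. G r * sinh r)) {0..b}"
  by (intro integrable_integral integrable_continuous_real continuous_intros cG)
 ultimately have "A * (1 / (2*pi)) + B * (1/pi) + C * (1/pi) <= integral {0..b} (%r. G r * sinh r)"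
 proof (rule has_integral_le)
  fix r assume r: "r \<in> {0..b}"
  then have "(coef (%t. 1) r)^2 / (2*pi) + (coef (%t. cos (2*t)) r)^2 / pi + (coef (%t. sin (2*t)) r)^2 / pi <= G r"
   unfolding G_def coef_def mult_1_right using b by (intro bessel_second_modes continuous_slice[OF cU]) auto
  then have "((coef (%t. 1) r)^2 / (2*pi) + (coef (%t. cos (2*t)) r)^2 / pi + (coef (%t. sin (2*t)) r)^2 / pi) * sinh r <= G r * sinh r"
   using r by (intro mult_right_mono) auto
  then show "(coef (%t. 1) r)^2 * sinh r * (1 / (2*pi)) + (coef (%t. cos (2*t)) r)^2 * sinh r * (1 / pi) + (coef (%t. sin (2*t)) r)^2 * sinh r * (1 / pi) <= G r * sinh r"
   by (simp add: algebra_simps)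
 qed
 moreover have "0 <= beta" using beta bound_minorant_nonneg[OF lam b(1)] by linarith
 ultimately have "beta * (A * (1 / (2*pi)) + B * (1/pi) + C * (1/pi)) <= beta * integral {0..b} (%r. G r * sinh r)"
  by (intro mult_left_mono)
 moreover have "beta * (A * (1 / (2*pi)) + B * (1/pi) + C * (1/pi)) = (2 * beta * A + 4 * (beta * B) + 4 * (beta * C)) / (4 * pi)"
  by (simp add: field_simps)
 moreover have "2*pi * (H11^2 + 2 * H12^2 + H22^2) = (lam^4 * (2*pi*u0)^2 + 4 * (pi^2 * (H11 - H22)^2) + 4 * (4 * pi^2 * H12^2)) / (4 * pi)"
 proof -
  have "lam^4 * (2*pi*u0)^2 = 4 * pi^2 * (- lam\<^sup>2 * u0)^2" by (simp add: power2_eq_square power4_eq_xxxx)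
  then have e: "lam^4 * (2*pi*u0)^2 = 4 * pi^2 * (H11 + H22)^2" unfolding trace[symmetric] .
  show ?thesis unfolding e by (simp add: field_simps power2_eq_square)
 qed
 moreover have "(lam^4 * (2*pi*u0)^2 + 4 * (pi^2 * (H11 - H22)^2) + 4 * (4 * pi^2 * H12^2)) / (4 * pi)
  <= (2 * beta * A + 4 * (beta * B) + 4 * (beta * C)) / (4 * pi)"
  using 1 2 3 by (intro divide_right_mono add_mono mult_left_mono) auto
 ultimately show ?thesis unfolding G_def by linarith
qed

end

subsection \<open>Calculus with partial derivatives\<close>

lemma partial_eqI: "(f has_derivative f') (at x) ==> partial i f x = f' (axis i 1)"
 unfolding partial_def by (metis frechet_derivative_at)

lemma has_derivative_partial_sum:
 assumes "f differentiable (at x)"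
 shows "(f has_derivative (%v. \<Sum>i\<in>UNIV. (v $ i) *\<^sub>R partial i f x)) (at x)"
proof -
 have d: "(f has_derivative frechet_derivative f (at x)) (at x)" using assms frechet_derivative_works by blast
 then have l: "linear (frechet_derivative f (at x))" using has_derivative_linear by blast
 have "frechet_derivative f (at x) v = (\<Sum>i\<in>UNIV. (v $ i) *\<^sub>R partial i f x)" for v
 proof -
  have "frechet_derivative f (at x) v = frechet_derivative f (at x) (\<Sum>i\<in>UNIV. (v $ i) *\<^sub>R axis i 1)"
   using basis_expansion[of v] by (simp add: scalar_mult_eq_scaleR)
  then show ?thesis unfolding partial_def by (simp add: linear_sum[OF l] linear_scale[OF l])
 qed
 then have "frechet_derivative f (at x) = (%v. \<Sum>i\<in>UNIV. (v $ i) *\<^sub>R partial i f x)" by (rule ext)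
 with d show ?thesis by simp
qed

lemma Ck_on_SucD: "Ck_on (Suc k) S f ==> Ck_on k S f"
proof (induction k arbitrary: f)
 case 0 then show ?case by (simp add: differentiable_imp_continuous_on)
qed auto

lemma Ck_on_mono: "Ck_on k S f ==> j <= k ==> Ck_on j S f"
proof (induction k)
 case (Suc k)
 show ?case
 proof (cases "j = Suc k")
  case False
  with Suc.prems(2) show ?thesis using Suc.IH[OF Ck_on_SucD[OF Suc.prems(1)]] by simp
 qed (use Suc.prems in simp)
qed simp

lemma Ck_on_continuous: "Ck_on k S f ==> continuous_on S f"
 using Ck_on_mono[of k S f 0] by simp

lemma Ck_on_differentiable: "Ck_on k S f ==> k >= 1 ==> open S ==> x \<in> S ==> f differentiable (at x)"
 using Ck_on_mono[of k S f "Suc 0"] differentiable_on_eq_differentiable_at[of S f] by simp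

lemma Ck_on_partial: "Ck_on (Suc k) S f ==> Ck_on k S (partial i f)" by simp

lemma Ck_on_subset: "Ck_on k S f ==> T \<subseteq> S ==> Ck_on k T f"
 by (induction k arbitrary: f) (auto intro: continuous_on_subset differentiable_on_subset)

lemma partial_cong:
 assumes "open S" "x \<in> S" "!!y. y \<in> S ==> f y = g y"
 shows "partial i f x = partial i g x"
proof -
 have *: "(f has_derivative D) (at x) \<longleftrightarrow> (g has_derivative D) (at x)" for D
  using assms by (auto elim!: has_derivative_transform_within_open)
 show ?thesis unfolding partial_def frechet_derivative_def * ..
qed

lemma Ck_on_cong_imp:
 assumes "open S" "!!y. y \<in> S ==> f y = g y" "Ck_on k S f" shows "Ck_on k S g"
 using assms(2,3)
proof (induction k arbitrary: f g)
 case 0 then show ?case by (auto cong: continuous_on_cong)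
next
 case (Suc k)
 have "g differentiable_on S" using Suc.prems
  by (auto simp: differentiable_on_def at_within_open[OF _ assms(1)] differentiable_def)
   (metis assms(1) has_derivative_transform_within_open)
 moreover have "Ck_on k S (partial i g)" for i
  by (rule Suc.IH[where f="partial i f"]) (use Suc.prems partial_cong[OF assms(1), of _ f g] in auto)
 ultimately show ?case by simp
qed

lemma Ck_on_local:
 assumes "!!x. x \<in> S ==> \<exists>T. open T \<and> x \<in> T \<and> Ck_on k T f"
 shows "Ck_on k S f"
 using assms
proof (induction k arbitrary: f)
 case 0
 then have "continuous (at x) f" if "x \<in> S" for x
  using that continuous_on_eq_continuous_at by (metis Ck_on.simps(1))
 then show ?case by (simp add: continuous_at_imp_continuous_on)
next
 case (Suc k)
 have "f differentiable (at x)" if "x \<in> S" for x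
  using Suc.prems[OF that] Ck_on_differentiable by (metis One_nat_def Suc_le_mono le0)
 then have "f differentiable_on S" by (auto simp: differentiable_on_def intro: differentiable_at_withinI)
 moreover have "Ck_on k S (partial i f)" for i
  by (rule Suc.IH) (use Suc.prems in force)
 ultimately show ?case by simp
qed

lemma partial_const [simp]: "partial i (%x. c) = (%x. 0)"
 using partial_eqI[OF has_derivative_const] by (rule ext)

lemma Ck_on_const [simp]: "Ck_on k S (%x. c)"
proof (induction k arbitrary: c)
 case (Suc k)
 show ?case using Suc[of 0] by simp
qed simp

lemma Ck_on_bounded_linear: assumes "bounded_linear f" shows "Ck_on k S f"
proof (cases k)
 case 0 then show ?thesis using assms by (simp add: linear_continuous_on)
next
 case (Suc j)
 have d: "(f has_derivative f) (at x)" for x using assms bounded_linear_imp_has_derivative by blast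
 have "partial i f = (%x. f (axis i 1))" for i by (rule ext) (rule partial_eqI[OF d])
 moreover have "f differentiable_on S" unfolding differentiable_on_def differentiable_def
  using assms bounded_linear_imp_has_derivative by blast
 ultimately show ?thesis using Suc by simp
qed

lemma Ck_on_add:
 assumes S: "open S" shows "Ck_on k S f ==> Ck_on k S g ==> Ck_on k S (%x. f x + g x)"
proof (induction k arbitrary: f g)
 case 0 then show ?case by (auto intro: continuous_intros)
next
 case (Suc k)
 have p: "partial i f x + partial i g x = partial i (%x. f x + g x) x" if "x \<in> S" for i x
  by (rule partial_eqI[OF has_derivative_eq_rhs[OF has_derivative_add[OF has_derivative_partial_sum has_derivative_partial_sum] refl], symmetric, THEN trans[rotated]])
   (use that Suc.prems S Ck_on_differentiable[of "Suc k"] in "auto simp: axis_def if_distrib if_distribR cong: if_cong")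
 have "Ck_on k S (partial i (%x. f x + g x))" for i
  by (rule Ck_on_cong_imp[OF S p]) (use Suc in auto)
 then show ?case using Suc.prems by (auto intro: differentiable_on_add)
qed

lemma Ck_on_linear_compose:
 assumes S: "open S" and L: "bounded_linear L" shows "Ck_on k S f ==> Ck_on k S (%x. L (f x))"
  and "k >= 1 ==> Ck_on k S f ==> x \<in> S ==> partial i (%x. L (f x)) x = L (partial i f x)"
proof -
 have p: "partial i (%x. L (f x)) x = L (partial i f x)" if "f differentiable (at x)" for f i x
 proof -
  have "((%x. L (f x)) has_derivative (%v. L (frechet_derivative f (at x) v))) (at x)"
   using that frechet_derivative_works bounded_linear.has_derivative[OF L] by blast
  from partial_eqI[OF this] show ?thesis by (simp add: partial_def)
 qed
 show "k >= 1 ==> Ck_on k S f ==> x \<in> S ==> partial i (%x. L (f x)) x = L (partial i f x)"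
  using p Ck_on_differentiable S by blast
 show "Ck_on k S f ==> Ck_on k S (%x. L (f x))"
 proof (induction k arbitrary: f)
  case 0 then show ?case using L by (auto intro: bounded_linear.continuous_on)
 next
  case (Suc k)
  have df: "f differentiable (at x)" if "x \<in> S" for x using Ck_on_differentiable[OF Suc.prems] S that by simp
  have "Ck_on k S (partial i (%x. L (f x)))" for i
   by (rule Ck_on_cong_imp[OF S p[OF df, symmetric]]) (use Suc in auto)
  moreover have "(%x. L (f x)) differentiable_on S"
   unfolding differentiable_on_def
  proof
   fix x assume "x \<in> S"
   from df[OF this] obtain D where "(f has_derivative D) (at x)" by (auto simp: differentiable_def)
   from bounded_linear.has_derivative[OF L this]
   show "(%x. L (f x)) differentiable (at x within S)" by (auto simp: differentiable_def intro: has_derivative_at_withinI)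
  qed
  ultimately show ?case by simp
 qed
qed

lemma Ck_on_bilinear:
 assumes S: "open S" and B: "bounded_bilinear B"
 shows "Ck_on k S f ==> Ck_on k S g ==> Ck_on k S (%x. B (f x) (g x))"
  and "k >= 1 ==> Ck_on k S f ==> Ck_on k S g ==> x \<in> S ==> partial i (%x. B (f x) (g x)) x = B (f x) (partial i g x) + B (partial i f x) (g x)"
proof -
 have d: "((%x. B (f x) (g x)) has_derivative (%v. B (f x) (frechet_derivative g (at x) v) + B (frechet_derivative f (at x) v) (g x))) (at x)"
  if "f differentiable (at x)" "g differentiable (at x)" for f g x
  by (rule bounded_bilinear.FDERIV[OF B that[THEN frechet_derivative_works[THEN iffD1]]])
 have p: "partial i (%x. B (f x) (g x)) x = B (f x) (partial i g x) + B (partial i f x) (g x)"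
  if "f differentiable (at x)" "g differentiable (at x)" for f g i x
  using partial_eqI[OF d[OF that]] by (simp add: partial_def)
 show "Ck_on k S f ==> Ck_on k S g ==> Ck_on k S (%x. B (f x) (g x))"
 proof (induction k arbitrary: f g)
  case 0 then show ?case using B by (auto intro: bounded_bilinear.continuous_on)
 next
  case (Suc k)
  have df: "f differentiable (at x)" "g differentiable (at x)" if "x \<in> S" for x
   using Ck_on_differentiable[OF Suc.prems(1)] Ck_on_differentiable[OF Suc.prems(2)] S that by auto
  have "Ck_on k S (%x. B (f x) (partial i g x) + B (partial i f x) (g x))" for i
   by (rule Ck_on_add[OF S Suc.IH[OF Ck_on_SucD[OF Suc.prems(1)] Ck_on_partial[OF Suc.prems(2)]]
      Suc.IH[OF Ck_on_partial[OF Suc.prems(1)] Ck_on_SucD[OF Suc.prems(2)]]])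
  then have "Ck_on k S (partial i (%x. B (f x) (g x)))" for i
   by (rule Ck_on_cong_imp[OF S p[OF df, symmetric], rotated 2])
  moreover have "(%x. B (f x) (g x)) differentiable_on S"
   unfolding differentiable_on_def differentiable_def by (blast intro: has_derivative_at_withinI d[OF df])
  ultimately show ?case by simp
 qed
 assume "k >= 1" "Ck_on k S f" "Ck_on k S g" "x \<in> S"
 then show "partial i (%x. B (f x) (g x)) x = B (f x) (partial i g x) + B (partial i f x) (g x)"
  using p[OF Ck_on_differentiable[of k S f x] Ck_on_differentiable[of k S g x]] S by simp
qed

lemma Ck_on_scaleR: "open S ==> Ck_on k S f ==> Ck_on k S g ==> Ck_on k S (%x. f x *\<^sub>R g x)"
 by (rule Ck_on_bilinear(1)[OF _ bounded_bilinear_scaleR])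

lemma Ck_on_mult: "open S ==> Ck_on k S f ==> Ck_on k S g ==> Ck_on k S (%x. f x * g x :: real)"
 by (rule Ck_on_bilinear(1)[OF _ bounded_bilinear_mult])

lemma Ck_on_sum: "open S ==> finite I ==> (!!i. i \<in> I ==> Ck_on k S (f i)) ==> Ck_on k S (%x. \<Sum>i\<in>I. f i x)"
proof (rotate_tac 1, induction I rule: finite_induct)
 case (insert a I)
 then have "Ck_on k S (%x. f a x + (\<Sum>i\<in>I. f i x))" by (intro Ck_on_add) simp_all
 then show ?case using insert.hyps by simp
qed simp

lemma Ck_on_component: "open S ==> Ck_on k S f ==> Ck_on k S (%x. f x $ i)"
 by (rule Ck_on_linear_compose(1)[OF _ bounded_linear_vec_nth])

lemma Ck_on_vec:
 fixes f :: "real^'n::finite => ('b::real_normed_vector)^'m::finite"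
 shows "open S ==> (!!i. Ck_on k S (%x. f x $ i)) ==> Ck_on k S f"
proof -
 assume S: "open S" and f: "!!i. Ck_on k S (%x. f x $ i)"
 have "bounded_linear (axis i :: 'b => 'b^'m)" for i
  by (rule bounded_linear_intro[where K=1]) (simp_all add: axis_def vec_eq_iff norm_vec_def L2_set_def if_distrib if_distribR sum.delta cong: if_cong)
 then have "Ck_on k S (%x. \<Sum>i\<in>UNIV. axis i (f x $ i))"
  by (intro Ck_on_sum S Ck_on_linear_compose(1)[OF S _ f]) auto
 moreover have "(\<Sum>i\<in>UNIV. axis i (f x $ i)) = f x" for x
  by (simp add: vec_eq_iff axis_def if_distrib cong: if_cong)
 ultimately show ?thesis by simp
qed

lemma partial_compose:
 assumes "f differentiable (at (g x))" "g differentiable (at x)"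
 shows "partial i (%x. f (g x)) x = (\<Sum>a\<in>UNIV. (partial i g x $ a) *\<^sub>R partial a f (g x))"
proof -
 have g: "(g has_derivative frechet_derivative g (at x)) (at x)" using assms(2) frechet_derivative_works by blast
 from diff_chain_at[OF g has_derivative_partial_sum[OF assms(1)]]
 show ?thesis using partial_eqI[of "%x. f (g x)"] by (simp add: o_def partial_def)
qed

lemma Ck_on_compose:
 fixes g :: "real^'m::finite => real^'n::finite"
 assumes S: "open S" and T: "open T" and gT: "!!x. x \<in> S ==> g x \<in> T"
 shows "Ck_on k T f ==> Ck_on k S g ==> Ck_on k S (%x. f (g x))"
proof (induction k arbitrary: f)
 case 0 then show ?case using gT by (auto intro: continuous_on_compose2)
next
 case (Suc k)
 have df: "f differentiable (at (g x))" "g differentiable (at x)" if "x \<in> S" for x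
  using Ck_on_differentiable[OF Suc.prems(1)] Ck_on_differentiable[OF Suc.prems(2)] S T gT that by auto
 have "Ck_on k S (%x. \<Sum>a\<in>UNIV. (partial i g x $ a) *\<^sub>R partial a f (g x))" for i
  using Suc.prems Ck_on_SucD[of k S g] by (intro Ck_on_sum S Ck_on_scaleR Ck_on_component Suc.IH) auto
 then have "Ck_on k S (partial i (%x. f (g x)))" for i
  by (rule Ck_on_cong_imp[OF S partial_compose[OF df, symmetric], rotated 2])
 moreover have "(%x. f (g x)) differentiable_on S"
  unfolding differentiable_on_def
 proof
  fix x assume "x \<in> S"
  from differentiable_chain_at[OF df(2)[OF this] df(1)[OF this]]
  show "(%x. f (g x)) differentiable (at x within S)" by (simp add: o_def differentiable_at_withinI)
 qed
 ultimately show ?case by simp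
qed

lemma Ck_on_inverse:
 fixes f :: "real^'n::finite => real"
 assumes S: "open S" and nz: "!!x. x \<in> S ==> f x ~= 0"
 shows "Ck_on k S f ==> Ck_on k S (%x. inverse (f x))"
proof (induction k)
 case 0 then show ?case using nz by (auto intro: continuous_on_inverse)
next
 case (Suc k)
 have df: "((%x. inverse (f x)) has_derivative (%v. - (inverse (f x) * frechet_derivative f (at x) v * inverse (f x)))) (at x)" if "x \<in> S" for x
  using Ck_on_differentiable[OF Suc.prems] S that nz[OF that] frechet_derivative_works
  by (intro Deriv.has_derivative_inverse) auto
 have p: "(-1) * ((inverse (f x) * partial i f x) * inverse (f x)) = partial i (%x. inverse (f x)) x" if "x \<in> S" for x i
  using partial_eqI[OF df[OF that], of i] by (simp add: partial_def)
 have "Ck_on k S (%x. (-1) * ((inverse (f x) * partial i f x) * inverse (f x)))" for i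
  using Suc.prems Suc.IH[OF Ck_on_SucD[OF Suc.prems]] by (intro Ck_on_mult S Ck_on_const) auto
 then have "Ck_on k S (partial i (%x. inverse (f x)))" for i
  by (rule Ck_on_cong_imp[OF S p, rotated])
 moreover have "(%x. inverse (f x)) differentiable_on S"
  unfolding differentiable_on_def differentiable_def by (blast intro: has_derivative_at_withinI df)
 ultimately show ?case by simp
qed

lemma Ck_on_coordinate_function:
 fixes D :: "nat => real => real"
 assumes D: "!!n x. (D n has_real_derivative D (Suc n) x) (at x)" and S: "open S"
 shows "Ck_on k S (%z :: real^'n::finite. D n (z $ i))"
proof (induction k arbitrary: n)
 case 0
 have "continuous_on UNIV (D n)" by (rule DERIV_continuous_on) (use D in auto)
 then show ?case by (auto intro!: continuous_on_compose2[of UNIV "D n"] continuous_intros)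
next
 case (Suc k)
 have d: "((%z. D n (z $ i)) has_derivative (%v. v $ i * D (Suc n) (z $ i))) (at z)" for z :: "real^'n"
  using DERIV_compose_FDERIV[OF D bounded_linear_imp_has_derivative[OF bounded_linear_vec_nth]] by blast
 have p: "axis j 1 $ i * D (Suc n) (z $ i) = partial j (%z. D n (z $ i)) z" for j and z :: "real^'n"
  using partial_eqI[OF d] by metis
 have "Ck_on k S (%z :: real^'n. axis j 1 $ i * D (Suc n) (z $ i))" for j :: 'n
  by (intro Ck_on_mult S Suc.IH Ck_on_const)
 then have "Ck_on k S (partial j (%z :: real^'n. D n (z $ i)))" for j
  by (rule Ck_on_cong_imp[OF S p, rotated])
 moreover have "(%z :: real^'n. D n (z $ i)) differentiable_on S"
  unfolding differentiable_on_def differentiable_def by (blast intro: has_derivative_at_withinI d)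
 ultimately show ?case by simp
qed

lemma jacobian_entry: "jacobian f (at x) $ a $ i = partial i f x $ a"
 by (simp add: jacobian_def matrix_def partial_def)

lemma inverse_matrix_2:
 fixes A B :: "real^2^2"
 assumes "A ** B = mat 1"
 shows "B = inverse (det A) *\<^sub>R (\<chi> i j. if i = 1 then (if j = 1 then A$2$2 else - A$1$2) else (if j = 1 then - A$2$1 else A$1$1))"
  and "det A ~= 0"
proof -
 have "det A * det B = 1" using assms det_mul[of A B] by (simp add: det_I)
 then show d: "det A ~= 0" by auto
 have e: "A$1$1 * B$1$1 + A$1$2 * B$2$1 = 1" "A$1$1 * B$1$2 + A$1$2 * B$2$2 = 0"
  "A$2$1 * B$1$1 + A$2$2 * B$2$1 = 0" "A$2$1 * B$1$2 + A$2$2 * B$2$2 = 1"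
  using assms by (auto simp: vec_eq_iff matrix_matrix_mult_def sum_2 mat_def forall_2)
 have "det A * B$1$1 = A$2$2" "det A * B$1$2 = - A$1$2" "det A * B$2$1 = - A$2$1" "det A * B$2$2 = A$1$1"
  unfolding det_2 using e by algebra+
 then show "B = inverse (det A) *\<^sub>R (\<chi> i j. if i = 1 then (if j = 1 then A$2$2 else - A$1$2) else (if j = 1 then - A$2$1 else A$1$1))"
  using d by (simp add: vec_eq_iff forall_2 field_simps)
qed

lemma matrix_inv_mult:
 fixes A :: "real^'n^'n"
 assumes "invertible A" shows "A ** matrix_inv A = mat 1" and "matrix_inv A ** A = mat 1"
 using someI_ex[OF assms[unfolded invertible_def]] unfolding matrix_inv_def by blast+

lemma matrix_inv_eqI:
 fixes A :: "real^'n^'n"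
 assumes "A ** B = mat 1" shows "matrix_inv A = B"
proof -
 have "B ** A = mat 1" using assms matrix_left_right_inverse by blast
 then have i: "invertible A" using assms unfolding invertible_def by blast
 have "matrix_inv A = matrix_inv A ** (A ** B)" by (simp add: assms)
 also have "\<dots> = B" by (simp add: matrix_mul_assoc matrix_inv_mult[OF i])
 finally show ?thesis .
qed

lemma Ck_on_inverse_function:
 fixes tau sigma :: "real^2 => real^2"
 assumes S: "open S" and V: "open V" and sigma: "!!y. y \<in> V ==> sigma y \<in> S" "!!y. y \<in> V ==> tau (sigma y) = y"
  and c: "continuous_on V sigma" and inv: "!!x. x \<in> S ==> invertible (jacobian tau (at x))"
  and tau: "!!k. Ck_on k S tau"
 shows "Ck_on k V sigma" and "y \<in> V ==> jacobian tau (at (sigma y)) ** jacobian sigma (at y) = mat 1"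
proof -
 define J where "J = (%y. jacobian tau (at (sigma y)))"
 have J: "J y ** matrix_inv (J y) = mat 1" "matrix_inv (J y) ** J y = mat 1" if "y \<in> V" for y
  using matrix_inv_mult[OF inv[OF sigma(1)[OF that]]] unfolding J_def by blast+
 have dsigma: "(sigma has_derivative (%v. matrix_inv (J y) *v v)) (at y)" if y: "y \<in> V" for y
 proof (rule has_derivative_inverse_basic[where T=V and f=tau and f'="%v. J y *v v"])
  have "tau differentiable (at (sigma y))" using Ck_on_differentiable[OF tau[of 1] _ S sigma(1)[OF y]] by simp
  then show "(tau has_derivative (%v. J y *v v)) (at (sigma y))" unfolding J_def using jacobian_works by blast
  show "bounded_linear ((*v) (matrix_inv (J y)))" by (simp add: matrix_vector_mul_bounded_linear)
  show "(*v) (matrix_inv (J y)) \<circ> (*v) (J y) = id" using J[OF y] by (auto simp: matrix_vector_mul_assoc)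
  show "continuous (at y) sigma" using c V y continuous_on_eq_continuous_at by blast
 qed (use V y sigma in auto)
 have part: "partial i sigma y = matrix_inv (J y) *v axis i 1" if "y \<in> V" for i y
  by (rule partial_eqI[OF dsigma[OF that]])
 have "jacobian sigma (at y) = matrix_inv (J y)" if "y \<in> V" for y
  by (simp add: vec_eq_iff jacobian_entry part[OF that] matrix_vector_mult_basis column_def)
 then show "y \<in> V ==> jacobian tau (at (sigma y)) ** jacobian sigma (at y) = mat 1" using J unfolding J_def by simp
 define A where "A = (%y. \<chi> i j. if i = 1 then (if j = 1 then J y$2$2 else - J y$1$2) else (if j = 1 then - J y$2$1 else (J y$1$1 :: real)) :: real^2^2)"
 have minv: "matrix_inv (J y) = inverse (det (J y)) *\<^sub>R A y" "det (J y) ~= 0" if "y \<in> V" for y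
  using inverse_matrix_2[OF J(1)[OF that]] unfolding A_def by auto
 show "Ck_on k V sigma"
 proof (induction k)
  case 0 then show ?case using c by simp
 next
  case (Suc k)
  have CJ: "Ck_on k V (%y. J y $ a $ i)" for a i
  proof -
   have "Ck_on k V (%y. partial i tau (sigma y))"
    by (rule Ck_on_compose[OF V S sigma(1) _ Suc]) (use tau[of "Suc k"] in auto)
   from Ck_on_component[OF V this, of a] show ?thesis unfolding J_def jacobian_entry .
  qed
  have Cneg: "Ck_on k V (%y. - J y $ a $ i)" for a i
   using Ck_on_mult[OF V Ck_on_const[of k V "-1"] CJ[of a i]] by simp
  have Cdet: "Ck_on k V (%y. inverse (det (J y)))"
  proof (rule Ck_on_inverse[OF V])
   have "Ck_on k V (%y. J y$1$1 * J y$2$2 + (- J y$1$2) * J y$2$1)" by (intro Ck_on_add V Ck_on_mult CJ Cneg)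
   then show "Ck_on k V (%y. det (J y))" by (simp add: det_2)
  qed (use minv in auto)
  have "Ck_on k V (%y. inverse (det (J y)) * (A y $ a $ i))" for a i
   unfolding A_def using CJ Cneg by (intro Ck_on_mult V Cdet) (cases "a = 1"; cases "i = 1"; simp)
  then have "Ck_on k V (%y. partial i sigma y $ a)" for a i
   by (rule Ck_on_cong_imp[OF V, rotated]) (simp add: part minv matrix_vector_mult_basis column_def)
  then have "Ck_on k V (partial i sigma)" for i by (intro Ck_on_vec V)
  moreover have "sigma differentiable_on V" unfolding differentiable_on_def differentiable_def
   by (blast intro: has_derivative_at_withinI dsigma)
  ultimately show ?case by simp
 qed
qed

lemma mixed_partials_commute_real:
 fixes f :: "real^'n::finite => real"
 assumes S: "open S" and x: "x \<in> S" and f: "Ck_on 2 S f"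
 shows "partial i (partial j f) x = partial j (partial i f) x"
proof -
 have 1: "f differentiable (at y)" "partial k f differentiable (at y)" if "y \<in> S" for y k
  using f S that by (auto simp: numeral_2_eq_2 differentiable_on_eq_differentiable_at)
 have line: "((%t. g (a + t *\<^sub>R axis k 1)) has_real_derivative partial k g (a + t *\<^sub>R axis k 1)) (at t)"
  if "g differentiable (at (a + t *\<^sub>R axis k 1))" for g :: "real^'n => real" and a t k
 proof -
  have "((%t. a + t *\<^sub>R axis k (1::real)) has_derivative (%h. h *\<^sub>R axis k 1)) (at t)"
   by (auto intro!: derivative_eq_intros)
  from diff_chain_at[OF this has_derivative_partial_sum[OF that]]
  have "((%t. g (a + t *\<^sub>R axis k 1)) has_derivative (%h. h * partial k g (a + t *\<^sub>R axis k 1))) (at t)"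
   by (simp add: o_def axis_def if_distrib if_distribR cong: if_cong)
  then show ?thesis by (simp add: has_field_derivative_def mult_commute_abs)
 qed
 obtain e where e: "e > 0" "ball x e \<subseteq> S" using S x open_contains_ball by blast
 have inS: "x + s *\<^sub>R axis k 1 + t *\<^sub>R axis l 1 \<in> S" if "\<bar>s\<bar> + \<bar>t\<bar> < e" for s t k l
 proof -
  have "norm (s *\<^sub>R axis k (1::real) + t *\<^sub>R axis l 1 :: real^'n) <= \<bar>s\<bar> + \<bar>t\<bar>"
   by (rule order_trans[OF norm_triangle_ineq]) simp
  then have "dist (x + s *\<^sub>R axis k 1 + t *\<^sub>R axis l 1) x < e" using that
   by (simp add: dist_norm add.assoc)
  then show ?thesis using e by (auto simp: dist_commute)
 qed
 have key: "\<exists>s t. 0 < s \<and> s < h \<and> 0 < t \<and> t < h \<and>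
  f (x + h *\<^sub>R axis k 1 + h *\<^sub>R axis l 1) - f (x + h *\<^sub>R axis k 1) - f (x + h *\<^sub>R axis l 1) + f x
   = h * h * partial l (partial k f) (x + s *\<^sub>R axis k 1 + t *\<^sub>R axis l 1)"
  if h: "0 < h" "2 * h < e" for h k l
 proof -
  define G where "G = (%s. f (x + h *\<^sub>R axis l 1 + s *\<^sub>R axis k 1) - f (x + s *\<^sub>R axis k 1))"
  have "(G has_real_derivative partial k f (x + h *\<^sub>R axis l 1 + s *\<^sub>R axis k 1) - partial k f (x + s *\<^sub>R axis k 1)) (at s)"
   if "0 <= s" "s <= h" for s
   unfolding G_def
   by (intro DERIV_diff line 1) (use inS[of h s l k] inS[of s 0 k k] that h in auto)
  from MVT2[of 0 h G, OF h(1) this] obtain s where s: "0 < s" "s < h"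
   "G h - G 0 = h * (partial k f (x + h *\<^sub>R axis l 1 + s *\<^sub>R axis k 1) - partial k f (x + s *\<^sub>R axis k 1))" by auto
  have "((%t. partial k f (x + s *\<^sub>R axis k 1 + t *\<^sub>R axis l 1)) has_real_derivative
    partial l (partial k f) (x + s *\<^sub>R axis k 1 + t *\<^sub>R axis l 1)) (at t)" if "0 <= t" "t <= h" for t
   by (intro line 1) (use inS[of s t k l] that h s in auto)
  from MVT2[of 0 h, OF h(1) this] obtain t where t: "0 < t" "t < h"
   "partial k f (x + s *\<^sub>R axis k 1 + h *\<^sub>R axis l 1) - partial k f (x + s *\<^sub>R axis k 1)
    = h * partial l (partial k f) (x + s *\<^sub>R axis k 1 + t *\<^sub>R axis l 1)" by auto
  have E: "x + h *\<^sub>R axis l 1 + s *\<^sub>R axis k 1 = x + s *\<^sub>R axis k 1 + h *\<^sub>R axis l 1" for s by (simp add: algebra_simps)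
  have "f (x + h *\<^sub>R axis k 1 + h *\<^sub>R axis l 1) - f (x + h *\<^sub>R axis k 1) - f (x + h *\<^sub>R axis l 1) + f x
   = h * (h * partial l (partial k f) (x + s *\<^sub>R axis k 1 + t *\<^sub>R axis l 1))"
   using s(3)[unfolded G_def E] t(3) by simp
  then show ?thesis using s t by (auto simp: mult.assoc)
 qed
 show ?thesis
 proof (rule ccontr)
  assume ne: "partial i (partial j f) x ~= partial j (partial i f) x"
  define d where "d = \<bar>partial i (partial j f) x - partial j (partial i f) x\<bar> / 2"
  have d: "d > 0" using ne by (simp add: d_def)
  have c: "isCont (partial k (partial l f)) x" for k l
   using f S x continuous_on_eq_continuous_at by (auto simp: numeral_2_eq_2)
  have "\<exists>r>0. \<forall>y. dist y x < r \<longrightarrow> \<bar>partial k (partial l f) y - partial k (partial l f) x\<bar> < d" for k l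
   using c[of k l] d unfolding continuous_at_eps_delta dist_real_def by blast
  then obtain r r' where r: "r > 0" "!!y. dist y x < r ==> \<bar>partial i (partial j f) y - partial i (partial j f) x\<bar> < d"
   "r' > 0" "!!y. dist y x < r' ==> \<bar>partial j (partial i f) y - partial j (partial i f) x\<bar> < d"
   by meson
  define h where "h = Min {e, r, r'} / 4"
  have m: "Min {e, r, r'} > 0" "Min {e, r, r'} <= e" "Min {e, r, r'} <= r" "Min {e, r, r'} <= r'"
   using e r by (auto simp: Min_gr_iff)
  have h: "h > 0" "2 * h < e" "2 * h < r" "2 * h < r'" using m unfolding h_def by linarith+
  have near: "dist (x + s *\<^sub>R axis k 1 + t *\<^sub>R axis l 1) x < 2 * h" if "0 < s" "s < h" "0 < t" "t < h" for s t k l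
  proof -
   have "norm (s *\<^sub>R axis k (1::real) + t *\<^sub>R axis l 1 :: real^'n) <= \<bar>s\<bar> + \<bar>t\<bar>"
    by (rule order_trans[OF norm_triangle_ineq]) simp
   then show ?thesis using that by (simp add: dist_norm add.assoc)
  qed
  from key[OF h(1,2), of i j] obtain s t where st: "0 < s" "s < h" "0 < t" "t < h"
   "f (x + h *\<^sub>R axis i 1 + h *\<^sub>R axis j 1) - f (x + h *\<^sub>R axis i 1) - f (x + h *\<^sub>R axis j 1) + f x
   = h * h * partial j (partial i f) (x + s *\<^sub>R axis i 1 + t *\<^sub>R axis j 1)" by blast
  from key[OF h(1,2), of j i] obtain s' t' where st': "0 < s'" "s' < h" "0 < t'" "t' < h"
   "f (x + h *\<^sub>R axis j 1 + h *\<^sub>R axis i 1) - f (x + h *\<^sub>R axis j 1) - f (x + h *\<^sub>R axis i 1) + f x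
   = h * h * partial i (partial j f) (x + s' *\<^sub>R axis j 1 + t' *\<^sub>R axis i 1)" by blast
  have "x + h *\<^sub>R axis j 1 + h *\<^sub>R axis i 1 = x + h *\<^sub>R axis i 1 + h *\<^sub>R axis j (1::real)" by simp
  note E = this
  have "h * h * partial i (partial j f) (x + s' *\<^sub>R axis j 1 + t' *\<^sub>R axis i 1) = h * h * partial j (partial i f) (x + s *\<^sub>R axis i 1 + t *\<^sub>R axis j 1)"
   using st(5) st'(5)[unfolded E] by linarith
  then have "partial i (partial j f) (x + s' *\<^sub>R axis j 1 + t' *\<^sub>R axis i 1) = partial j (partial i f) (x + s *\<^sub>R axis i 1 + t *\<^sub>R axis j 1)"
   using h(1) by simp
  moreover have "\<bar>partial i (partial j f) (x + s' *\<^sub>R axis j 1 + t' *\<^sub>R axis i 1) - partial i (partial j f) x\<bar> < d"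
   by (rule r(2)) (use near[OF st'(1-4), of j i] h in linarith)
  moreover have "\<bar>partial j (partial i f) (x + s *\<^sub>R axis i 1 + t *\<^sub>R axis j 1) - partial j (partial i f) x\<bar> < d"
   by (rule r(4)) (use near[OF st(1-4), of i j] h in linarith)
  moreover have "\<bar>a - b\<bar> <= \<bar>v - a\<bar> + \<bar>v - b\<bar>" for a b v :: real by (simp add: abs_real_def)
  ultimately show False unfolding d_def by (smt (verit) field_sum_of_halves)
 qed
qed

lemma mixed_partials_commute:
 fixes f :: "real^'n::finite => 'b::euclidean_space"
 assumes S: "open S" and x: "x \<in> S" and f: "Ck_on 2 S f"
 shows "partial i (partial j f) x = partial j (partial i f) x"
proof (rule euclidean_eqI)
 fix b :: 'b assume "b \<in> Basis"
 have L: "bounded_linear (%y. y \<bullet> b)" by (rule bounded_linear_inner_left)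
 have f1: "Ck_on 1 S (partial k f)" "Ck_on 1 S f" for k using f Ck_on_mono[of 2 S f 1] by (auto simp: numeral_2_eq_2)
 have p: "partial k (%y. f y \<bullet> b) y = partial k f y \<bullet> b" if "y \<in> S" for k y
  by (rule Ck_on_linear_compose(2)[OF S L _ f1(2) that]) simp
 have "partial k (partial l (%y. f y \<bullet> b)) x = partial k (partial l f) x \<bullet> b" for k l
 proof -
  have "partial k (partial l (%y. f y \<bullet> b)) x = partial k (%y. partial l f y \<bullet> b) x"
   by (rule partial_cong[OF S x p])
  also have "\<dots> = partial k (partial l f) x \<bullet> b" by (rule Ck_on_linear_compose(2)[OF S L _ f1(1) x]) simp
  finally show ?thesis .
 qed
 then show "partial i (partial j f) x \<bullet> b = partial j (partial i f) x \<bullet> b"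
  using mixed_partials_commute_real[OF S x Ck_on_linear_compose(1)[OF S L f], of i j] by simp
qed

subsection \<open>Isometries into the half-plane\<close>

lemma is_chart_facts:
 assumes "is_chart X c"
 shows "openin X (fst c)" "open (snd c ` fst c)" "inj_on (snd c) (fst c)"
  "p \<in> fst c ==> chart_inv c (snd c p) = p"
  "z \<in> snd c ` fst c ==> snd c (chart_inv c z) = z"
  "z \<in> snd c ` fst c ==> chart_inv c z \<in> fst c"
  "continuous_map (subtopology X (fst c)) euclidean (snd c)"
  "openin X W ==> W \<subseteq> fst c ==> open (snd c ` W)"
  "open Q ==> openin X {p \<in> fst c. snd c p \<in> Q}"
proof -
 have h: "homeomorphic_map (subtopology X (fst c)) (top_of_set (snd c ` fst c)) (snd c)"
  and o: "openin X (fst c)" and oi: "open (snd c ` fst c)"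
  using assms by (auto simp: is_chart_def)
 show "openin X (fst c)" "open (snd c ` fst c)" by fact+
 have ts: "topspace (subtopology X (fst c)) = fst c" using openin_subset[OF o] by auto
 show inj: "inj_on (snd c) (fst c)" using homeomorphic_imp_injective_map[OF h] ts by simp
 show "p \<in> fst c ==> chart_inv c (snd c p) = p" unfolding chart_inv_def using inj by (rule inv_into_f_f)
 show "z \<in> snd c ` fst c ==> snd c (chart_inv c z) = z" unfolding chart_inv_def by (rule f_inv_into_f)
 show "z \<in> snd c ` fst c ==> chart_inv c z \<in> fst c" unfolding chart_inv_def by (rule inv_into_into)
 show cm: "continuous_map (subtopology X (fst c)) euclidean (snd c)"
  using homeomorphic_imp_continuous_map[OF h] by (simp add: continuous_map_in_subtopology)
 show "open (snd c ` W)" if "openin X W" "W \<subseteq> fst c"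
 proof -
  have "openin (subtopology X (fst c)) W" using that o by (simp add: openin_open_subtopology)
  then have "openin (top_of_set (snd c ` fst c)) (snd c ` W)"
   using homeomorphic_imp_open_map[OF h] by (simp add: open_map_def)
  then show ?thesis using oi openin_open_eq by blast
 qed
 show "openin X {p \<in> fst c. snd c p \<in> Q}" if "open Q"
 proof -
  have "openin (subtopology X (fst c)) {p \<in> fst c. snd c p \<in> Q}"
   using openin_continuous_map_preimage[OF cm, of Q] that unfolding ts by simp
  then show ?thesis using o by (simp add: openin_open_subtopology)
 qed
qed

lemma manifold_facts:
 assumes "riemannian_manifold M"
 shows "Hausdorff_space (top_space M)" "c \<in> atlas M ==> is_chart (top_space M) c"
  "p \<in> points M ==> chart_at M p \<in> atlas M" "p \<in> points M ==> p \<in> fst (chart_at M p)"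
  "c \<in> atlas M ==> Ck_on k (snd c ` fst c) (metric_in M c)"
  "c \<in> atlas M ==> z \<in> snd c ` fst c ==> transpose (metric_in M c z) = metric_in M c z"
  "c \<in> atlas M ==> z \<in> snd c ` fst c ==> v ~= 0 ==> v \<bullet> (metric_in M c z *v v) > 0"
  "(\<Union>c\<in>atlas M. fst c) = points M"
proof -
 show U: "(\<Union>c\<in>atlas M. fst c) = points M" using assms by (simp add: riemannian_manifold_def)
 have "\<exists>c. c \<in> atlas M \<and> p \<in> fst c" if "p \<in> points M" using U that by blast
 from someI_ex[OF this] show "p \<in> points M ==> chart_at M p \<in> atlas M" "p \<in> points M ==> p \<in> fst (chart_at M p)"
  by (auto simp: chart_at_def)
qed (use assms in "auto simp: riemannian_manifold_def smooth_on_def")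

abbreviation half_plane :: "(real^2) set" where "half_plane \<equiv> {z. z $ 2 > 0}"

lemma open_half_plane: "open half_plane"
 by (intro open_Collect_less continuous_intros)

lemma hyperbolic_plane_facts [simp]:
 "top_space hyperbolic_plane = top_of_set half_plane"
 "atlas hyperbolic_plane = {(half_plane, %z. z)}"
 "metric_in hyperbolic_plane c z = mat (1 / (z $ 2)^2)"
 by (auto simp: hyperbolic_plane_def)

lemma inner_mat_mult: "v \<bullet> (mat a *v w) = a * (v \<bullet> w)" for v w :: "real^'n"
proof -
 have "mat a *v w = a *\<^sub>R w"
  by (simp add: vec_eq_iff mat_def matrix_vector_mult_def if_distrib if_distribR sum.delta' cong: if_cong)
 then show ?thesis by simp
qed

lemma has_vector_derivative_compose_jacobian:
 fixes f :: "real^'n::finite => real^'m::finite"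
 assumes "f differentiable (at (eta t))" "(eta has_vector_derivative v) (at t)"
 shows "((%s. f (eta s)) has_vector_derivative (jacobian f (at (eta t)) *v v)) (at t)"
proof -
 have "(f has_derivative (%h. jacobian f (at (eta t)) *v h)) (at (eta t))" using assms(1) by (rule jacobian_works[THEN iffD1])
 from diff_chain_at[OF assms(2)[unfolded has_vector_derivative_def] this]
 show ?thesis by (simp add: has_vector_derivative_def o_def matrix_vector_mult_scaleR)
qed

lemma continuous_on_jacobian_vector:
 assumes "open Q" "Ck_on 1 Q f" "continuous_on A eta" "continuous_on A D" "!!t. t \<in> A ==> eta t \<in> Q"
 shows "continuous_on A (%t. jacobian f (at (eta t)) *v D t)"
proof -
 have "continuous_on Q (partial i f)" for i using assms(2) by simp
 then have "continuous_on A (%t. partial i f (eta t) $ a * D t $ i)" for i a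
  by (intro continuous_intros continuous_on_compose2[of Q "partial i f" A eta] assms) (use assms in auto)
 then have "continuous_on A (%t. (jacobian f (at (eta t)) *v D t) $ a)" for a
  unfolding matrix_vector_mult_def by (simp add: jacobian_entry) (intro continuous_on_sum)
 then have "continuous_on A (%t. \<chi> a. (jacobian f (at (eta t)) *v D t) $ a)" by (rule continuous_on_vec_lambda)
 then show ?thesis by simp
qed

lemma C1_differentiable_compose:
 assumes A: "open A" and Q: "open Q" and f: "Ck_on 1 Q f" and eta: "eta C1_differentiable_on A"
  and AQ: "!!t. t \<in> A ==> eta t \<in> Q" and eq: "!!t. t \<in> A ==> gam t = f (eta t)"
 shows "gam C1_differentiable_on A"
  and "t \<in> A ==> (gam has_vector_derivative (jacobian f (at (eta t)) *v vector_derivative eta (at t))) (at t)"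
proof -
 obtain D where D: "!!t. t \<in> A ==> (eta has_vector_derivative D t) (at t)" "continuous_on A D"
  using eta unfolding C1_differentiable_on_def by blast
 have vd: "vector_derivative eta (at t) = D t" if "t \<in> A" for t using D(1)[OF that] by (rule vector_derivative_at)
 have c: "continuous_on A eta"
  by (intro continuous_at_imp_continuous_on ballI has_vector_derivative_continuous[OF D(1)])
 have d: "(gam has_vector_derivative (jacobian f (at (eta t)) *v D t)) (at t)" if "t \<in> A" for t
 proof -
  have "f differentiable (at (eta t))" by (rule Ck_on_differentiable[OF f _ Q AQ[OF that]]) simp
  from has_vector_derivative_compose_jacobian[OF this D(1)[OF that]]
  show ?thesis by (rule has_vector_derivative_transform_within_open[OF _ A that]) (simp add: eq)
 qed
 then show "t \<in> A ==> (gam has_vector_derivative (jacobian f (at (eta t)) *v vector_derivative eta (at t))) (at t)"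
  using vd by simp
 show "gam C1_differentiable_on A" unfolding C1_differentiable_on_def
 proof (intro exI conjI ballI)
  show "continuous_on A (%t. jacobian f (at (eta t)) *v D t)"
   by (rule continuous_on_jacobian_vector[OF Q f c D(2) AQ])
 qed (rule d)
qed

lemma inner_congruence: "(J *v v) \<bullet> (g *v (J *v w)) = v \<bullet> ((transpose J ** g ** J) *v w)" for J g :: "real^'n^'n"
proof -
 have "v \<bullet> (transpose J *v y) = y \<bullet> (J *v v)" for y
  using dot_lmul_matrix[of y J v] by (simp add: inner_commute)
 from this[of "g *v (J *v w)"] show ?thesis by (simp add: inner_commute[of "J *v v"] matrix_vector_mul_assoc matrix_mul_assoc)
qed

lemma invertible_of_congruence:
 fixes J :: "real^'n^'n"
 assumes "transpose J ** h ** J = g" "!!v. v ~= 0 ==> v \<bullet> (g *v v) > 0"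
 shows "invertible J"
proof -
 have "v = 0" if "J *v v = 0" for v
 proof (rule ccontr)
  assume "v ~= 0"
  then have "v \<bullet> (g *v v) > 0" by (rule assms)
  moreover have "v \<bullet> (g *v v) = 0" using inner_congruence[of J v h v] that assms(1) by simp
  ultimately show False by simp
 qed
 then show ?thesis using matrix_left_invertible_ker[of J] by (simp add: invertible_left_inverse)
qed

locale hyperbolic_chart =
 fixes M :: "('a, 2) riemannian" and U :: "'a set" and V :: "(real^2) set" and F :: "'a => real^2"
 assumes mf: "riemannian_manifold M" and iso: "riemannian_isometry M U hyperbolic_plane V F"
begin

definition F_inv :: "real^2 => 'a" where "F_inv = inv_into U F"

lemma F_homeomorphic_half_plane: "homeomorphic_map (subtopology (top_space M) U) (subtopology (top_of_set half_plane) V) F"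
 and oU: "openin (top_space M) U"
 using iso by (auto simp: riemannian_isometry_def)

lemma V_half_plane: "V \<subseteq> half_plane" and oV: "open V"
proof -
 have "openin (top_of_set half_plane) V" using iso by (simp add: riemannian_isometry_def)
 then show "V \<subseteq> half_plane" "open V" using openin_open_eq[OF open_half_plane] by auto
qed

lemma U_points: "U \<subseteq> points M" using oU openin_subset by blast

lemma F_homeomorphic: "homeomorphic_map (subtopology (top_space M) U) (top_of_set V) F"
 using F_homeomorphic_half_plane V_half_plane by (simp add: subtopology_subtopology inf_absorb2)

lemma topspace_U: "topspace (subtopology (top_space M) U) = U" using U_points by auto

lemma F_bij: "F ` U = V" "inj_on F U"
 using homeomorphic_imp_surjective_map[OF F_homeomorphic] homeomorphic_imp_injective_map[OF F_homeomorphic] unfolding topspace_U by auto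

lemma F_inv: "p \<in> U ==> F_inv (F p) = p" "z \<in> V ==> F (F_inv z) = z" "z \<in> V ==> F_inv z \<in> U" "p \<in> U ==> F p \<in> V"
 using F_bij unfolding F_inv_def by (auto simp: f_inv_into_f inv_into_into)

lemma F_pos: "p \<in> U ==> F p $ 2 > 0" using F_inv(4) V_half_plane by auto

lemma open_F_image: "openin (top_space M) W ==> W \<subseteq> U ==> open (F ` W)"
proof -
 assume "openin (top_space M) W" "W \<subseteq> U"
 then have "openin (subtopology (top_space M) U) W" using oU by (simp add: openin_open_subtopology)
 then have "openin (top_of_set V) (F ` W)" using homeomorphic_imp_open_map[OF F_homeomorphic] by (simp add: open_map_def)
 then show ?thesis using oV openin_open_eq by blast
qed

lemma F_continuous: "continuous_map (subtopology (top_space M) U) euclidean F"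
 using homeomorphic_imp_continuous_map[OF F_homeomorphic] by (simp add: continuous_map_in_subtopology)

lemma F_preimage_open: "open Q ==> openin (top_space M) {p \<in> U. F p \<in> Q}"
proof -
 assume "open Q"
 then have "openin (subtopology (top_space M) U) {p \<in> U. F p \<in> Q}"
  using openin_continuous_map_preimage[OF F_continuous, of Q] unfolding topspace_U by simp
 then show ?thesis using oU by (simp add: openin_open_subtopology)
qed

lemma F_inv_continuous: "continuous_map (top_of_set V) (top_space M) F_inv"
 unfolding continuous_map_def
proof (intro conjI allI impI)
 show "F_inv \<in> topspace (top_of_set V) \<rightarrow> points M" using F_inv(3) U_points by auto
 fix W assume W: "openin (top_space M) W"
 have "{z \<in> topspace (top_of_set V). F_inv z \<in> W} = F ` (W \<inter> U)"
 proof
  show "{z \<in> topspace (top_of_set V). F_inv z \<in> W} \<subseteq> F ` (W \<inter> U)" using F_inv(2,3) by force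
  show "F ` (W \<inter> U) \<subseteq> {z \<in> topspace (top_of_set V). F_inv z \<in> W}" using F_inv(1,4) by auto
 qed
 moreover have "open (F ` (W \<inter> U))" by (rule open_F_image) (use W oU in "auto intro: openin_Int")
 moreover have "F ` (W \<inter> U) \<subseteq> V" using F_inv(4) by auto
 ultimately show "openin (top_of_set V) {z \<in> topspace (top_of_set V). F_inv z \<in> W}"
  by (simp add: open_subset)
qed

lemma coordinates:
 assumes c: "c \<in> atlas M"
 shows "Ck_on k (snd c ` (U \<inter> fst c)) (F \<circ> chart_inv c)" "open (snd c ` (U \<inter> fst c))"
  "z \<in> snd c ` (U \<inter> fst c) ==> transpose (jacobian (F \<circ> chart_inv c) (at z)) ** mat (1 / ((F (chart_inv c z)) $ 2)^2)
   ** jacobian (F \<circ> chart_inv c) (at z) = metric_in M c z"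
proof -
 have "isometric_in_charts c (metric_in M c) U (half_plane, %z. z) (metric_in hyperbolic_plane (half_plane, %z. z)) F"
  using iso c by (auto simp: riemannian_isometry_def)
 moreover have "{p \<in> U \<inter> fst c. F p \<in> half_plane} = U \<inter> fst c" using F_pos by auto
 moreover have "(%z. z) \<circ> F \<circ> chart_inv c = F \<circ> chart_inv c" by auto
 ultimately show "Ck_on k (snd c ` (U \<inter> fst c)) (F \<circ> chart_inv c)"
  "z \<in> snd c ` (U \<inter> fst c) ==> transpose (jacobian (F \<circ> chart_inv c) (at z)) ** mat (1 / ((F (chart_inv c z)) $ 2)^2)
   ** jacobian (F \<circ> chart_inv c) (at z) = metric_in M c z"
  by (auto simp: isometric_in_charts_def Let_def smooth_on_def)
 show "open (snd c ` (U \<inter> fst c))"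
  using is_chart_facts(1,8)[OF manifold_facts(2)[OF mf c]] oU by (simp add: openin_Int)
qed

definition coord_dom :: "('a, 2) chart => (real^2) set" where
 "coord_dom c = {z \<in> V. F_inv z \<in> fst c}"

lemma inverse_coordinates:
 assumes c: "c \<in> atlas M"
 shows "Ck_on k (coord_dom c) (snd c \<circ> F_inv)" "open (coord_dom c)"
  "z \<in> coord_dom c ==> transpose (jacobian (snd c \<circ> F_inv) (at z)) ** metric_in M c (snd c (F_inv z))
   ** jacobian (snd c \<circ> F_inv) (at z) = mat (1 / (z $ 2)^2)"
proof -
 note ch = is_chart_facts[OF manifold_facts(2)[OF mf c]]
 let ?S = "snd c ` (U \<inter> fst c)" and ?tau = "F \<circ> chart_inv c" and ?sigma = "snd c \<circ> F_inv"
 have dom: "coord_dom c = F ` (U \<inter> fst c)"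
 proof
  show "coord_dom c \<subseteq> F ` (U \<inter> fst c)" using F_inv(2,3) unfolding coord_dom_def by force
  show "F ` (U \<inter> fst c) \<subseteq> coord_dom c" using F_inv(1,4) unfolding coord_dom_def by auto
 qed
 show o: "open (coord_dom c)" unfolding dom using open_F_image oU ch(1) by (simp add: openin_Int)
 have sigmaS: "?sigma z \<in> ?S" "?tau (?sigma z) = z" if "z \<in> coord_dom c" for z
  using that F_inv(2,3) ch(4) by (auto simp: coord_dom_def)
 have inv: "invertible (jacobian ?tau (at y))" if "y \<in> ?S" for y
  by (rule invertible_of_congruence[OF coordinates(3)[OF c that]])
   (use that manifold_facts(7)[OF mf c] in auto)
 have cont: "continuous_on (coord_dom c) ?sigma"
 proof -
  have "continuous_map (top_of_set (coord_dom c)) (top_space M) F_inv"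
   using continuous_map_from_subtopology_mono[OF F_inv_continuous] by (auto simp: coord_dom_def)
  then have "continuous_map (top_of_set (coord_dom c)) (subtopology (top_space M) (fst c)) F_inv"
   by (auto simp: continuous_map_in_subtopology coord_dom_def)
  from continuous_map_compose[OF this ch(7)] show ?thesis by simp
 qed
 show "Ck_on k (coord_dom c) ?sigma"
  by (rule Ck_on_inverse_function(1)[OF coordinates(2)[OF c] o sigmaS cont inv coordinates(1)[OF c]])
 assume z: "z \<in> coord_dom c"
 have J: "jacobian ?tau (at (?sigma z)) ** jacobian ?sigma (at z) = mat 1"
  by (rule Ck_on_inverse_function(2)[OF coordinates(2)[OF c] o sigmaS cont inv coordinates(1)[OF c] z])
 have Ft: "F (chart_inv c (?sigma z)) = z" using sigmaS(2)[OF z] by simp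
 let ?A = "jacobian ?tau (at (?sigma z))" and ?B = "jacobian ?sigma (at z)"
 have "metric_in M c (?sigma z) = transpose ?A ** mat (1 / (z $ 2)^2) ** ?A"
  using coordinates(3)[OF c sigmaS(1)[OF z]] unfolding Ft by simp
 then have "transpose ?B ** metric_in M c (?sigma z) ** ?B = transpose (?A ** ?B) ** mat (1 / (z $ 2)^2) ** (?A ** ?B)"
  by (simp add: matrix_transpose_mul matrix_mul_assoc)
 then show "transpose ?B ** metric_in M c (snd c (F_inv z)) ** ?B = mat (1 / (z $ 2)^2)"
  unfolding J by (simp add: transpose_mat)
qed

lemma curve_into_plane:
 assumes gam: "continuous_map (top_of_set {0..1}) (top_space M) gam" and T: "finite T"
  and C1: "!!c. c \<in> atlas M ==> (snd c \<circ> gam) C1_differentiable_on {t \<in> {0<..<1} - T. gam t \<in> fst c}"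
 shows "(F \<circ> gam) C1_differentiable_on {t \<in> {0<..<1} - T. gam t \<in> U}" "open {t \<in> {0<..<1} - T. gam t \<in> U}"
  "t \<in> {0<..<1} - T ==> gam t \<in> U ==> speed M gam t = norm (vector_derivative (F \<circ> gam) (at t)) / F (gam t) $ 2"
proof -
 have oW: "open {t \<in> {0<..<1} - T. gam t \<in> W}" if "openin (top_space M) W" for W
 proof -
  have "openin (top_of_set {0..1}) {t \<in> topspace (top_of_set {0..1}). gam t \<in> W}"
   by (rule openin_continuous_map_preimage[OF gam that])
  then obtain Q where Q: "open Q" "{t \<in> {0..1}. gam t \<in> W} = {0..1} \<inter> Q" by (auto simp: openin_open)
  have "t \<in> Q \<longleftrightarrow> gam t \<in> W" if "t \<in> {0<..<1}" for t
  proof -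
   have "t \<in> {0..1}" using that by simp
   then show ?thesis using Q(2) by blast
  qed
  then have "{t \<in> {0<..<1} - T. gam t \<in> W} = ({0<..<1} - T) \<inter> Q" by blast
  then show ?thesis using Q(1) T by (simp add: open_Diff finite_imp_closed open_Int)
 qed
 let ?A = "%c. {t \<in> {0<..<1} - T. gam t \<in> U \<inter> fst c}"
 have main: "(F \<circ> gam) C1_differentiable_on ?A c"
  "t \<in> ?A c ==> ((F \<circ> gam) has_vector_derivative (jacobian (F \<circ> chart_inv c) (at (snd c (gam t))) *v vector_derivative (snd c \<circ> gam) (at t))) (at t)"
  if c: "c \<in> atlas M" for c t
 proof -
  note ch = is_chart_facts[OF manifold_facts(2)[OF mf c]]
  have "(snd c \<circ> gam) C1_differentiable_on ?A c" by (rule C1_differentiable_on_subset[OF C1[OF c]]) auto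
  note * = C1_differentiable_compose[OF oW[OF openin_Int[OF oU ch(1)]] coordinates(2)[OF c] coordinates(1)[OF c] this, of "F \<circ> gam"]
  have p: "!!t. t \<in> ?A c ==> (snd c \<circ> gam) t \<in> snd c ` (U \<inter> fst c)"
   "!!t. t \<in> ?A c ==> (F \<circ> gam) t = (F \<circ> chart_inv c) ((snd c \<circ> gam) t)" using ch(4) by auto
  from *(1)[OF p] show "(F \<circ> gam) C1_differentiable_on ?A c" .
  from *(2)[OF p, of t] show "t \<in> ?A c ==> ((F \<circ> gam) has_vector_derivative (jacobian (F \<circ> chart_inv c) (at (snd c (gam t))) *v vector_derivative (snd c \<circ> gam) (at t))) (at t)"
   by simp
 qed
 have cover: "{t \<in> {0<..<1} - T. gam t \<in> U} = (\<Union>c\<in>atlas M. ?A c)"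
  using U_points manifold_facts(8)[OF mf] by blast
 have oA: "open (?A c)" if "c \<in> atlas M" for c
  using oW[OF openin_Int[OF oU is_chart_facts(1)[OF manifold_facts(2)[OF mf that]]]] .
 show "(F \<circ> gam) C1_differentiable_on {t \<in> {0<..<1} - T. gam t \<in> U}"
  unfolding C1_differentiable_on_eq
 proof (intro conjI ballI)
  show "(F \<circ> gam) differentiable at t" if "t \<in> {t \<in> {0<..<1} - T. gam t \<in> U}" for t
  proof -
   from that obtain c where "c \<in> atlas M" "t \<in> ?A c" unfolding cover by blast
   then show ?thesis using main(1)[of c] unfolding C1_differentiable_on_eq by blast
  qed
  show "continuous_on {t \<in> {0<..<1} - T. gam t \<in> U} (%t. vector_derivative (F \<circ> gam) (at t))"
   unfolding cover using continuous_on_open_UN[of "atlas M" ?A, OF oA] main(1)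
   unfolding C1_differentiable_on_eq by blast
 qed
 show "open {t \<in> {0<..<1} - T. gam t \<in> U}" by (rule oW[OF oU])
 assume t: "t \<in> {0<..<1} - T" and U: "gam t \<in> U"
 define c where "c = chart_at M (gam t)"
 have c: "c \<in> atlas M" "gam t \<in> fst c" unfolding c_def using manifold_facts(3,4)[OF mf subsetD[OF U_points U]] by blast+
 note ch = is_chart_facts[OF manifold_facts(2)[OF mf c(1)]]
 define v where "v = vector_derivative (snd c \<circ> gam) (at t)"
 define J where "J = jacobian (F \<circ> chart_inv c) (at (snd c (gam t)))"
 have d: "vector_derivative (F \<circ> gam) (at t) = J *v v"
  unfolding J_def v_def by (rule vector_derivative_at[OF main(2)[OF c(1)]]) (use t U c in auto)
 have "transpose J ** mat (1 / (F (gam t) $ 2)^2) ** J = metric_in M c (snd c (gam t))"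
  using coordinates(3)[OF c(1), of "snd c (gam t)"] U c(2) ch(4) unfolding J_def by simp
 then have "v \<bullet> (metric_in M c (snd c (gam t)) *v v) = (norm (J *v v) / F (gam t) $ 2)^2"
  using inner_congruence[of J v "mat (1 / (F (gam t) $ 2)^2)" v] by (simp add: inner_mat_mult power_divide power2_norm_eq_inner)
 then show "speed M gam t = norm (vector_derivative (F \<circ> gam) (at t)) / F (gam t) $ 2"
  unfolding d using F_pos[OF U] by (simp add: speed_def Let_def c_def[symmetric] v_def[symmetric])
qed

lemma curve_from_plane:
 assumes A: "open A" and eta: "eta C1_differentiable_on A" and AV: "!!t. t \<in> A ==> eta t \<in> V"
  and gam: "!!t. t \<in> A ==> gam t = F_inv (eta t)"
 shows "c \<in> atlas M ==> (snd c \<circ> gam) C1_differentiable_on {t \<in> A. gam t \<in> fst c}"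
  "c \<in> atlas M ==> open {t \<in> A. gam t \<in> fst c}"
  "c \<in> atlas M ==> t \<in> A ==> gam t \<in> fst c ==> \<exists>v. ((snd c \<circ> gam) has_vector_derivative v) (at t) \<and>
   v \<bullet> (metric_in M c (snd c (gam t)) *v v) = (norm (vector_derivative eta (at t)) / eta t $ 2)^2"
  "t \<in> A ==> speed M gam t = norm (vector_derivative eta (at t)) / eta t $ 2"
proof -
 have eqA: "{t \<in> A. gam t \<in> fst c} = A \<inter> eta -` coord_dom c" for c using AV gam by (auto simp: coord_dom_def)
 have cont: "continuous_on A eta" using C1_differentiable_imp_continuous_on[OF eta] .
 show o: "open {t \<in> A. gam t \<in> fst c}" if "c \<in> atlas M" for c
  unfolding eqA using continuous_on_open_vimage[OF A, of eta] cont inverse_coordinates(2)[OF that]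
  by (simp add: Int_commute)
 have main: "(snd c \<circ> gam) C1_differentiable_on {t \<in> A. gam t \<in> fst c}"
  "t \<in> A ==> gam t \<in> fst c ==> ((snd c \<circ> gam) has_vector_derivative (jacobian (snd c \<circ> F_inv) (at (eta t)) *v vector_derivative eta (at t))) (at t)"
  if c: "c \<in> atlas M" for c t
 proof -
  have "eta C1_differentiable_on {t \<in> A. gam t \<in> fst c}" by (rule C1_differentiable_on_subset[OF eta]) auto
  note * = C1_differentiable_compose[OF o[OF c] inverse_coordinates(2)[OF c] inverse_coordinates(1)[OF c] this, of "snd c \<circ> gam"]
  have p: "!!t. t \<in> {t \<in> A. gam t \<in> fst c} ==> eta t \<in> coord_dom c"
   "!!t. t \<in> {t \<in> A. gam t \<in> fst c} ==> (snd c \<circ> gam) t = (snd c \<circ> F_inv) (eta t)" unfolding eqA using gam by auto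
  from *(1)[OF p] show "(snd c \<circ> gam) C1_differentiable_on {t \<in> A. gam t \<in> fst c}" .
  from *(2)[OF p, of t] show "t \<in> A ==> gam t \<in> fst c ==> ((snd c \<circ> gam) has_vector_derivative (jacobian (snd c \<circ> F_inv) (at (eta t)) *v vector_derivative eta (at t))) (at t)"
   by simp
 qed
 show "c \<in> atlas M ==> (snd c \<circ> gam) C1_differentiable_on {t \<in> A. gam t \<in> fst c}" by (rule main(1))
 have quad: "(jacobian (snd c \<circ> F_inv) (at (eta t)) *v v) \<bullet> (metric_in M c (snd c (gam t)) *v (jacobian (snd c \<circ> F_inv) (at (eta t)) *v v))
   = (norm v / eta t $ 2)^2" if "c \<in> atlas M" "t \<in> A" "gam t \<in> fst c" for c t v
 proof -
  have "eta t \<in> coord_dom c" using that AV gam by (simp add: coord_dom_def)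
  from inverse_coordinates(3)[OF that(1) this] that(2) gam show ?thesis
   using inner_congruence[of "jacobian (snd c \<circ> F_inv) (at (eta t))" v "metric_in M c (snd c (gam t))" v]
   by (simp add: inner_mat_mult power_divide power2_norm_eq_inner)
 qed
 show "c \<in> atlas M ==> t \<in> A ==> gam t \<in> fst c ==> \<exists>v. ((snd c \<circ> gam) has_vector_derivative v) (at t) \<and>
   v \<bullet> (metric_in M c (snd c (gam t)) *v v) = (norm (vector_derivative eta (at t)) / eta t $ 2)^2"
  by (intro exI conjI) (erule (2) main(2), erule (2) quad)
 assume t: "t \<in> A"
 define c where "c = chart_at M (gam t)"
 have p: "gam t \<in> points M" using t AV gam F_inv(3) U_points by auto
 have c: "c \<in> atlas M" "gam t \<in> fst c" unfolding c_def using manifold_facts(3,4)[OF mf p] by blast+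
 have pos: "eta t $ 2 > 0" using AV[OF t] V_half_plane by auto
 show "speed M gam t = norm (vector_derivative eta (at t)) / eta t $ 2"
  using quad[OF c(1) t c(2)] pos vector_derivative_at[OF main(2)[OF c(1) t c(2)]]
  by (simp add: speed_def Let_def c_def[symmetric])
qed

end

lemma speed_hyperbolic_plane:
 assumes "eta t $ 2 > 0"
 shows "speed hyperbolic_plane eta t = norm (vector_derivative eta (at t)) / eta t $ 2"
proof -
 have "chart_at hyperbolic_plane (eta t) = (half_plane, %z. z)" using assms unfolding chart_at_def by (intro some_equality) auto
 moreover have "(%z. z) \<circ> eta = eta" by auto
 ultimately have "speed hyperbolic_plane eta t = sqrt ((norm (vector_derivative eta (at t)) / eta t $ 2)^2)"
  by (simp add: speed_def Let_def inner_mat_mult power_divide power2_norm_eq_inner)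
 then show ?thesis using assms by simp
qed

lemma piecewise_C1_curve_hyperbolic_plane:
 "piecewise_C1_curve hyperbolic_plane eta \<longleftrightarrow> continuous_on {0..1} eta \<and> eta ` {0..1} \<subseteq> half_plane \<and>
  (\<exists>T. finite T \<and> eta C1_differentiable_on {0<..<1} - T)"
proof (cases "eta ` {0..1} \<subseteq> half_plane")
 case True
 have "eta t \<in> half_plane" if "t \<in> {0<..<1} - T" for t T
 proof -
  have "t \<in> {0..1}" using that by simp
  then show ?thesis using True by blast
 qed
 then have "{t \<in> {0<..<1} - T. eta t \<in> half_plane} = {0<..<1} - T" for T by blast
 moreover have "(%z. z) \<circ> eta = eta" by (simp add: fun_eq_iff)
 ultimately show ?thesis unfolding piecewise_C1_curve_def using True
  by (simp add: Pi_iff image_subset_iff del: mem_Collect_eq)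
next
 case False
 then show ?thesis unfolding piecewise_C1_curve_def by (auto simp: Pi_iff)
qed

subsection \<open>Lengths of curves and metric balls\<close>

lemma barrier:
 fixes gam :: "real => 'a"
 assumes gam: "continuous_map (top_of_set {a..b}) X gam" and W: "openin X W" and K: "closedin X K" "K \<subseteq> W"
  and a: "a <= b" "gam a \<in> K" and step: "!!t. a <= t ==> t <= b ==> gam ` {a..t} \<subseteq> W ==> gam t \<in> K"
 shows "t \<in> {a..b} ==> gam t \<in> K"
proof -
 define A where "A = {t \<in> {a..b}. gam t \<notin> W}"
 have "A = {}"
 proof (rule ccontr)
  assume ne: "A ~= {}"
  have "openin (top_of_set {a..b}) {t \<in> {a..b}. gam t \<in> W}"
   using openin_continuous_map_preimage[OF gam W] by simp
  then have "closedin (top_of_set {a..b}) ({a..b} - {t \<in> {a..b}. gam t \<in> W})"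
   using closedin_diff[OF closedin_topspace, of "top_of_set {a..b}"] by simp
  moreover have "{a..b} - {t \<in> {a..b}. gam t \<in> W} = A" unfolding A_def by blast
  ultimately have cl: "closed A" by (simp add: closedin_closed_eq)
  have bb: "bdd_below A" unfolding A_def by (intro bdd_belowI[of _ a]) simp
  define s where "s = Inf A"
  have sA: "s \<in> A" unfolding s_def by (rule closed_contains_Inf[OF ne bb cl])
  have below: "gam t \<in> W" if "a <= t" "t < s" for t
  proof (rule ccontr)
   assume "gam t \<notin> W"
   then have "t \<in> A" using that sA unfolding A_def by simp
   then show False using cInf_lower[OF _ bb, of t] that(2) unfolding s_def by simp
  qed
  have "gam a \<in> W" using a K by blast
  then have as: "a < s" using sA unfolding A_def by (cases "a = s") auto
  have inK: "gam t \<in> K" if "a <= t" "t < s" for t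
  proof (rule step)
   show "t <= b" using that sA unfolding A_def by simp
   show "gam ` {a..t} \<subseteq> W" using below that by auto
  qed (use that in simp)
  have "closedin (top_of_set {a..b}) {t \<in> {a..b}. gam t \<in> K}"
   using closedin_continuous_map_preimage[OF gam K(1)] by simp
  then have clK: "closed {t \<in> {a..b}. gam t \<in> K}" by (simp add: closedin_closed_eq)
  have "{a..<s} \<subseteq> {t \<in> {a..b}. gam t \<in> K}" using inK sA unfolding A_def by auto
  then have "closure {a..<s} \<subseteq> {t \<in> {a..b}. gam t \<in> K}" by (rule closure_minimal[OF _ clK])
  then have "{a..s} \<subseteq> {t \<in> {a..b}. gam t \<in> K}" using as by simp
  moreover have "s \<in> {a..s}" using as by simp
  ultimately have "gam s \<in> K" by blast
  then show False using sA K(2) unfolding A_def by blast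
 qed
 then have "gam ` {a..t} \<subseteq> W" if "t <= b" for t using that unfolding A_def by force
 then show "t \<in> {a..b} ==> gam t \<in> K" using step[of t] by simp
qed

lemma displacement_le_length:
 fixes f :: "real => 'b::euclidean_space" and s :: "real => real"
 assumes ab: "a <= b" and T: "finite T" and f: "continuous_on {a..b} f" "f C1_differentiable_on {a<..<b} - T"
  and s: "continuous_on ({a<..<b} - T) s" and Y: "Y >= 0"
  and le: "!!t. t \<in> {a<..<b} - T ==> norm (vector_derivative f (at t)) <= Y * s t"
 shows "ennreal (norm (f b - f a)) <= ennreal Y * (\<integral>\<^sup>+t\<in>{a..b}. ennreal (s t) \<partial>lborel)"
proof (cases "ennreal Y * (\<integral>\<^sup>+t\<in>{a..b}. ennreal (s t) \<partial>lborel) = top")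
 case True then show ?thesis by simp
next
 case False
 let ?A = "{a<..<b} - T" and ?D = "%t. vector_derivative f (at t)"
 define g where "g = (%t. indicator ?A t *\<^sub>R ?D t)"
 have A: "?A \<in> sets borel" using T by (intro borel_open open_Diff finite_imp_closed) auto
 have "continuous_on ?A ?D" using f(2) by (simp add: C1_differentiable_on_eq)
 from borel_measurable_continuous_on_indicator[OF A this] have gm: "g \<in> borel_measurable borel" unfolding g_def .
 have sm: "(%t. indicator ?A t *\<^sub>R s t) \<in> borel_measurable borel" by (rule borel_measurable_continuous_on_indicator[OF A s])
 have "(\<integral>\<^sup>+t. ennreal (norm (g t)) \<partial>lborel) <= (\<integral>\<^sup>+t. ennreal Y * ennreal (indicator ?A t *\<^sub>R s t) \<partial>lborel)"
 proof (rule nn_integral_mono)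
  fix t
  show "ennreal (norm (g t)) <= ennreal Y * ennreal (indicator ?A t *\<^sub>R s t)"
   using le[of t] Y by (cases "t \<in> ?A") (auto simp: g_def ennreal_mult'[symmetric] intro!: ennreal_leI)
 qed
 also have "\<dots> = ennreal Y * (\<integral>\<^sup>+t. ennreal (indicator ?A t *\<^sub>R s t) \<partial>lborel)"
  by (rule nn_integral_cmult) (use sm in simp)
 also have "\<dots> <= ennreal Y * (\<integral>\<^sup>+t\<in>{a..b}. ennreal (s t) \<partial>lborel)"
  by (intro mult_left_mono nn_integral_mono) (auto simp: indicator_def)
 finally have bnd: "(\<integral>\<^sup>+t. ennreal (norm (g t)) \<partial>lborel) <= ennreal Y * (\<integral>\<^sup>+t\<in>{a..b}. ennreal (s t) \<partial>lborel)" .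
 then have int: "integrable lborel g"
  by (intro integrableI_bounded) (use gm False in "auto simp: top.not_eq_extremum order_le_less_trans")
 have "(?D has_integral (f b - f a)) {a..b}"
 proof (rule fundamental_theorem_of_calculus_interior_strong[OF T ab _ f(1)])
  fix t assume "t \<in> {a<..<b} - T"
  then have "f differentiable (at t)" using f(2) by (simp add: C1_differentiable_on_eq)
  then show "(f has_vector_derivative ?D t) (at t)" using vector_derivative_works by blast
 qed
 then have "(g has_integral (f b - f a)) {a..b}"
  by (rule has_integral_spike_finite[rotated 2, where S="insert a (insert b T)"]) (use T in "auto simp: g_def")
 moreover have "(g has_integral (integral\<^sup>L lborel g)) UNIV" by (rule has_integral_integral_lborel[OF int])
 then have "((%t. if t \<in> {a..b} then g t else 0) has_integral (integral\<^sup>L lborel g)) UNIV"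
  by (rule has_integral_eq[rotated]) (auto simp: g_def indicator_def)
 then have "(g has_integral (integral\<^sup>L lborel g)) {a..b}" by (simp only: has_integral_restrict_UNIV)
 ultimately have "f b - f a = integral\<^sup>L lborel g" by (rule has_integral_unique)
 then show ?thesis using integral_norm_bound_ennreal[OF int] bnd by (metis order_trans)
qed

text \<open>A curve starting at \<open>q\<close> cannot leave the Euclidean ball of radius \<open>delta\<close> before its hyperbolic length
 exceeds \<open>delta / (q\<^sub>2 + delta)\<close>, because there the Euclidean speed is at most \<open>q\<^sub>2 + delta\<close> times the hyperbolic one.\<close>

lemma short_curve_stays:
 fixes gam :: "real => 'a" and F :: "'a => real^2"
 assumes gam: "continuous_map (top_of_set {0..1}) X gam" and T: "finite T"
  and W: "openin X {p \<in> U. F p \<in> ball q delta}" and K: "!!d. d < delta ==> closedin X {p \<in> U. F p \<in> cball q d}"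
  and start: "gam 0 \<in> U" "F (gam 0) = q" and q: "q $ 2 > 0" and delta: "delta > 0" and pos: "!!p. p \<in> U ==> F p $ 2 > 0"
  and cont: "!!b. b \<in> {0..1} ==> gam ` {0..b} \<subseteq> U ==> continuous_on {0..b} (F \<circ> gam)"
  and C1: "(F \<circ> gam) C1_differentiable_on {t \<in> {0<..<1} - T. gam t \<in> U}"
  and sp: "!!t. t \<in> {0<..<1} - T ==> gam t \<in> U ==> s t = norm (vector_derivative (F \<circ> gam) (at t)) / F (gam t) $ 2"
  and len: "(\<integral>\<^sup>+t\<in>{0..1}. ennreal (s t) \<partial>lborel) < ennreal (delta / (q $ 2 + delta))"
  and t: "t \<in> {0..1}"
 shows "gam t \<in> U \<and> F (gam t) \<in> ball q delta"
proof -
 define L where "L = enn2real (\<integral>\<^sup>+t\<in>{0..1}. ennreal (s t) \<partial>lborel)"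
 have fin: "(\<integral>\<^sup>+t\<in>{0..1}. ennreal (s t) \<partial>lborel) < top" using len by (rule order_less_trans) simp
 then have Leq: "(\<integral>\<^sup>+t\<in>{0..1}. ennreal (s t) \<partial>lborel) = ennreal L" "L >= 0" by (simp_all add: L_def)
 have "L < delta / (q $ 2 + delta)" using len q delta unfolding Leq by (simp add: ennreal_less_iff[OF Leq(2)])
 then have Ld: "(q $ 2 + delta) * L < delta" using q delta by (simp add: field_simps)
 define d where "d = (q $ 2 + delta) * L"
 have d0: "d >= 0" unfolding d_def using q delta Leq(2) by simp
 have "gam t \<in> {p \<in> U. F p \<in> cball q d}"
 proof (rule barrier[OF gam W K _ _ _ _ t])
  show "{p \<in> U. F p \<in> cball q d} \<subseteq> {p \<in> U. F p \<in> ball q delta}" using Ld by (auto simp: d_def)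
  show "gam 0 \<in> {p \<in> U. F p \<in> cball q d}" using start d0 by simp
  fix b assume b: "0 <= b" "b <= (1::real)" and sub: "gam ` {0..b} \<subseteq> {p \<in> U. F p \<in> ball q delta}"
  have inU: "gam t \<in> U" "F (gam t) \<in> ball q delta" if "t \<in> {0..b}" for t
   using subsetD[OF sub imageI[OF that]] by auto
  have sub': "{0<..<b} - T \<subseteq> {t \<in> {0<..<1} - T. gam t \<in> U}" using inU b by auto
  have C1b: "(F \<circ> gam) C1_differentiable_on {0<..<b} - T" by (rule C1_differentiable_on_subset[OF C1 sub'])
  have cb: "continuous_on {0..b} (F \<circ> gam)" by (rule cont) (use b inU in auto)
  have s_eq: "s t = norm (vector_derivative (F \<circ> gam) (at t)) / (F \<circ> gam) t $ 2" if "t \<in> {0<..<b} - T" for t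
   using sp[of t] that b inU(1)[of t] by simp
  have nz: "(F \<circ> gam) t $ 2 > 0" if "t \<in> {0<..<b} - T" for t using pos[OF inU(1)[of t]] that by simp
  have "continuous_on ({0<..<b} - T) (%t. norm (vector_derivative (F \<circ> gam) (at t)) / (F \<circ> gam) t $ 2)"
  proof (intro continuous_on_divide continuous_on_norm continuous_on_component)
   show "continuous_on ({0<..<b} - T) (%t. vector_derivative (F \<circ> gam) (at t))" using C1b by (simp add: C1_differentiable_on_eq)
   show "continuous_on ({0<..<b} - T) (F \<circ> gam)" by (rule continuous_on_subset[OF cb]) auto
  qed (use nz in force)
  then have sc: "continuous_on ({0<..<b} - T) s" by (rule continuous_on_eq) (rule s_eq[symmetric])
  have "ennreal (norm ((F \<circ> gam) b - (F \<circ> gam) 0)) <= ennreal (q $ 2 + delta) * (\<integral>\<^sup>+t\<in>{0..b}. ennreal (s t) \<partial>lborel)"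
  proof (rule displacement_le_length[OF b(1) T cb C1b sc])
   fix t assume t: "t \<in> {0<..<b} - T"
   have "\<bar>(F (gam t) - q) $ 2\<bar> <= norm (F (gam t) - q)" by (rule component_le_norm_cart)
   also have "\<dots> < delta" using inU(2)[of t] t by (simp add: dist_norm norm_minus_commute)
   finally have "F (gam t) $ 2 <= q $ 2 + delta" by simp
   moreover have "norm (vector_derivative (F \<circ> gam) (at t)) = F (gam t) $ 2 * s t" using s_eq[OF t] nz[OF t] by simp
   moreover have "s t >= 0" using s_eq[OF t] nz[OF t] by simp
   ultimately show "norm (vector_derivative (F \<circ> gam) (at t)) <= (q $ 2 + delta) * s t" by (simp add: mult_right_mono)
  qed (use q delta in simp)
  also have "\<dots> <= ennreal (q $ 2 + delta) * (\<integral>\<^sup>+t\<in>{0..1}. ennreal (s t) \<partial>lborel)"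
   using b by (intro mult_left_mono nn_integral_mono) (auto simp: indicator_def)
  also have "\<dots> = ennreal d" unfolding Leq d_def using q delta Leq(2) by (simp add: ennreal_mult)
  finally have "norm (F (gam b) - q) <= d" using d0 start(2) by (simp add: ennreal_le_iff)
  then show "gam b \<in> {p \<in> U. F p \<in> cball q d}" using inU[of b] b by (simp add: dist_norm norm_minus_commute)
 qed (use Ld in "simp_all add: d_def")
 then show ?thesis using Ld by (auto simp: d_def)
qed

lemma piecewise_C1_curve_const:
 assumes "x \<in> points M" shows "piecewise_C1_curve M (%_. x)" "curve_length M (%_. x) = 0"
proof -
 show "piecewise_C1_curve M (%_. x)" using assms by (auto simp: piecewise_C1_curve_def o_def intro!: exI[of _ "{}"])
 have "speed M (%_. x) t = 0" for t by (simp add: speed_def Let_def o_def)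
 then show "curve_length M (%_. x) = 0" by (simp add: curve_length_def)
qed

lemma metric_ball_iff:
 "p \<in> metric_ball M x r \<longleftrightarrow> p \<in> points M \<and> (\<exists>gam. piecewise_C1_curve M gam \<and> gam 0 = x \<and> gam 1 = p \<and> curve_length M gam < ennreal r)"
 unfolding metric_ball_def riemannian_dist_def by (auto simp: Inf_less_iff)

lemma center_in_metric_ball: "x \<in> points M ==> r > 0 ==> x \<in> metric_ball M x r"
 unfolding metric_ball_iff by (intro conjI exI[of _ "%_. x"] piecewise_C1_curve_const) (auto simp: piecewise_C1_curve_const)

text \<open>Adding \<open>t w\<close> to a curve moves its endpoint by \<open>w\<close> and changes its length continuously in \<open>w\<close>.\<close>

lemma open_hyperbolic_ball: "open (metric_ball hyperbolic_plane q r)"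
proof (rule openI)
 fix z assume "z \<in> metric_ball hyperbolic_plane q r"
 then obtain eta where eta: "piecewise_C1_curve hyperbolic_plane eta" "eta 0 = q" "eta 1 = z" "curve_length hyperbolic_plane eta < ennreal r"
  unfolding metric_ball_iff by blast
 then obtain T where T: "finite T" "eta C1_differentiable_on {0<..<1} - T" and c: "continuous_on {0..1} eta"
  and hp: "eta ` {0..1} \<subseteq> half_plane"
  unfolding piecewise_C1_curve_hyperbolic_plane by blast
 let ?A = "{0<..<1} - T"
 have "continuous_on {0..1} (%t. eta t $ 2)" by (intro continuous_on_component c)
 then obtain t0 where t0: "t0 \<in> {0..1}" "!!t. t \<in> {0..1} ==> eta t0 $ 2 <= eta t $ 2"
  using continuous_attains_inf[of "{0..1::real}" "%t. eta t $ 2"] by auto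
 define m where "m = eta t0 $ 2"
 have m: "m > 0" "!!t. t \<in> {0..1} ==> m <= eta t $ 2"
  using subsetD[OF hp imageI[OF t0(1)]] t0(2) unfolding m_def by auto
 define L where "L = enn2real (curve_length hyperbolic_plane eta)"
 have "curve_length hyperbolic_plane eta < top" using eta(4) by (rule order_less_trans) simp
 then have L: "curve_length hyperbolic_plane eta = ennreal L" "L >= 0" by (simp_all add: L_def)
 have Lr: "L < r" using eta(4) unfolding L(1) by (simp add: ennreal_less_iff[OF L(2)])
 define u where "u = min (1/2) ((r - L) / (2 * (2 + 2 * L)))"
 have u: "u > 0" "u <= 1/2" using Lr L(2) unfolding u_def by (simp, simp only: min.cobounded1)
 have "u <= (r - L) / (2 * (2 + 2 * L))" unfolding u_def by simp
 then have "u * (2 + 2 * L) <= (r - L) / 2" using L(2) by (simp add: field_simps)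
 moreover have "u * u <= u * (1/2)" using u by (intro mult_left_mono) auto
 ultimately have uL: "(1 + 2 * u) * (L + u) < r" using Lr by (simp add: algebra_simps)
 show "\<exists>e>0. ball z e \<subseteq> metric_ball hyperbolic_plane q r"
 proof (intro exI conjI subsetI)
  show "u * m > 0" using u m by simp
  fix z' assume z': "z' \<in> ball z (u * m)"
  define w where "w = z' - z"
  have w: "norm w < u * m" using z' unfolding w_def by (simp add: dist_norm norm_minus_commute)
  define zeta where "zeta = (%t. eta t + t *\<^sub>R w)"
  have vd: "(zeta has_vector_derivative (vector_derivative eta (at t) + w)) (at t)" if "t \<in> ?A" for t
  proof -
   have "eta differentiable (at t)" using T(2) that by (simp add: C1_differentiable_on_eq)
   then have "(eta has_vector_derivative vector_derivative eta (at t)) (at t)" using vector_derivative_works by blast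
   moreover have "((%t. t *\<^sub>R w) has_vector_derivative w) (at t)" by (auto intro!: derivative_eq_intros)
   ultimately show ?thesis unfolding zeta_def by (rule has_vector_derivative_add)
  qed
  have C1: "zeta C1_differentiable_on ?A" unfolding C1_differentiable_on_def
  proof (intro exI conjI ballI)
   show "continuous_on ?A (%t. vector_derivative eta (at t) + w)"
    using T(2) by (intro continuous_intros) (simp add: C1_differentiable_on_eq)
  qed (rule vd)
  have y: "zeta t $ 2 >= (1 - u) * eta t $ 2" if "t \<in> {0..1}" for t
  proof -
   have "\<bar>(t *\<^sub>R w) $ 2\<bar> <= norm (t *\<^sub>R w)" by (rule component_le_norm_cart)
   also have "\<dots> <= 1 * norm w" unfolding norm_scaleR using that by (intro mult_right_mono) auto
   also have "\<dots> <= u * eta t $ 2" using w m(2)[OF that] u by (simp add: mult_left_mono order_trans[OF less_imp_le])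
   finally have "\<bar>(t *\<^sub>R w) $ 2\<bar> <= u * eta t $ 2" .
   moreover have "zeta t $ 2 = eta t $ 2 + (t *\<^sub>R w) $ 2" by (simp add: zeta_def)
   ultimately show ?thesis by (simp add: left_diff_distrib)
  qed
  have pos: "eta t $ 2 > 0" "zeta t $ 2 > 0" if "t \<in> {0..1}" for t
  proof -
   show p: "eta t $ 2 > 0" using m(2)[OF that] m(1) by simp
   have "(1 - u) * eta t $ 2 > 0" using u p by simp
   then show "zeta t $ 2 > 0" using y[OF that] by simp
  qed
  have cz: "continuous_on {0..1} zeta" unfolding zeta_def by (intro continuous_intros c)
  have pc: "piecewise_C1_curve hyperbolic_plane zeta"
   unfolding piecewise_C1_curve_hyperbolic_plane using cz pos T(1) C1 by blast
  have sp: "speed hyperbolic_plane zeta t <= (1 + 2 * u) * (speed hyperbolic_plane eta t + u)" if "t \<in> ?A" for t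
  proof -
   have t: "t \<in> {0..1}" using that by simp
   note p = pos[OF t]
   let ?n = "norm (vector_derivative eta (at t))"
   have "norm (vector_derivative zeta (at t)) <= ?n + u * eta t $ 2"
    unfolding vector_derivative_at[OF vd[OF that]]
    using norm_triangle_ineq[of "vector_derivative eta (at t)" w] w mult_left_mono[OF m(2)[OF t], of u] u by linarith
   also have "\<dots> = (?n / eta t $ 2 + u) * eta t $ 2" using p by (simp add: field_simps)
   also have "\<dots> <= (?n / eta t $ 2 + u) * ((1 + 2 * u) * zeta t $ 2)"
   proof (rule mult_left_mono)
    have "u * u <= u * (1/2)" using u by (intro mult_left_mono) auto
    then have "1 <= (1 + 2 * u) * (1 - u)" by (simp add: algebra_simps)
    then have "1 * eta t $ 2 <= ((1 + 2 * u) * (1 - u)) * eta t $ 2" using p by (intro mult_right_mono) auto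
    also have "\<dots> <= (1 + 2 * u) * zeta t $ 2" unfolding mult.assoc using y[OF t] u by (intro mult_left_mono) auto
    finally show "eta t $ 2 <= (1 + 2 * u) * zeta t $ 2" by simp
   qed (use p u in simp)
   finally have "norm (vector_derivative zeta (at t)) / zeta t $ 2 <= (1 + 2 * u) * (?n / eta t $ 2 + u)"
    using p by (simp add: pos_divide_le_eq ac_simps)
   then show ?thesis using p by (simp add: speed_hyperbolic_plane)
  qed
  have sp0: "speed hyperbolic_plane eta t >= 0" if "t \<in> ?A" for t
   using pos(1)[of t] that by (simp add: speed_hyperbolic_plane)
  have AE: "AE t in lborel. t \<in> {0..1} \<longrightarrow> t \<in> ?A"
  proof -
   have "AE t in lborel. t \<notin> insert 0 (insert 1 T)" by (rule AE_not_in[OF finite_imp_null_set_lborel]) (use T in simp)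
   then show ?thesis by (rule eventually_mono) auto
  qed
  have A: "?A \<in> sets borel" using T(1) by (intro borel_open open_Diff finite_imp_closed) auto
  have "continuous_on ?A (speed hyperbolic_plane eta)"
  proof -
   have "continuous_on ?A (%t. norm (vector_derivative eta (at t)) / eta t $ 2)"
   proof (intro continuous_on_divide continuous_on_norm continuous_on_component)
    show "continuous_on ?A (%t. vector_derivative eta (at t))" using T(2) by (simp add: C1_differentiable_on_eq)
    show "continuous_on ?A eta" by (rule continuous_on_subset[OF c]) auto
    show "\<forall>t\<in>?A. eta t $ 2 ~= 0" using pos(1) by (simp add: less_imp_neq[symmetric])
   qed
   then show ?thesis by (rule continuous_on_eq) (use pos(1) in "simp add: speed_hyperbolic_plane")
  qed
  from borel_measurable_continuous_on_indicator[OF A this]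
  have sm: "(%t. indicator ?A t *\<^sub>R speed hyperbolic_plane eta t) \<in> borel_measurable lborel" by simp
  have "curve_length hyperbolic_plane zeta <= (\<integral>\<^sup>+t. ennreal (1 + 2 * u) * (ennreal (indicator ?A t *\<^sub>R speed hyperbolic_plane eta t) + ennreal u * indicator {0..1} t) \<partial>lborel)"
   unfolding curve_length_def
  proof (rule nn_integral_mono_AE, use AE in eventually_elim)
   case (elim t)
   show ?case
   proof (cases "t \<in> {0..1}")
    case True
    then have t: "t \<in> ?A" using elim by blast
    have "ennreal (speed hyperbolic_plane zeta t) <= ennreal ((1 + 2 * u) * (speed hyperbolic_plane eta t + u))" by (rule ennreal_leI[OF sp[OF t]])
    also have "\<dots> = ennreal (1 + 2 * u) * (ennreal (speed hyperbolic_plane eta t) + ennreal u)"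
     using u sp0[OF t] by (simp add: ennreal_mult ennreal_plus)
    finally show ?thesis using True t by simp
   qed simp
  qed
  also have "\<dots> = ennreal (1 + 2 * u) * ((\<integral>\<^sup>+t. ennreal (indicator ?A t *\<^sub>R speed hyperbolic_plane eta t) \<partial>lborel) + ennreal u)"
   using sm by (simp add: nn_integral_cmult nn_integral_add nn_integral_cmult_indicator)
  also have "\<dots> <= ennreal (1 + 2 * u) * (curve_length hyperbolic_plane eta + ennreal u)"
   unfolding curve_length_def by (intro mult_left_mono add_right_mono nn_integral_mono) (auto simp: indicator_def)
  also have "\<dots> = ennreal ((1 + 2 * u) * (L + u))" unfolding L(1) using u L(2) by (simp add: ennreal_mult ennreal_plus)
  also have "\<dots> < ennreal r"
  proof (rule ennreal_lessI[OF _ uL])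
   have "0 <= (1 + 2 * u) * (L + u)" using u L(2) by simp
   then show "0 < r" using uL by linarith
  qed
  finally have "curve_length hyperbolic_plane zeta < ennreal r" .
  moreover have "zeta 0 = q" "zeta 1 = z'" using eta(2,3) by (simp_all add: zeta_def w_def)
  moreover have "z' \<in> points hyperbolic_plane" using pos(2)[of 1] \<open>zeta 1 = z'\<close> by simp
  ultimately show "z' \<in> metric_ball hyperbolic_plane q r" unfolding metric_ball_iff using pc by blast
 qed
qed

lemma AE_interval_without_finite: "finite T ==> AE t in lborel. t \<in> {0..1::real} \<longrightarrow> t \<in> {0<..<1} - T"
proof -
 assume "finite T"
 then have "AE t in lborel. t \<notin> insert 0 (insert 1 T)" by (intro AE_not_in finite_imp_null_set_lborel) simp
 then show ?thesis by (rule eventually_mono) auto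
qed

lemma curve_length_cong:
 assumes "finite T" "!!t. t \<in> {0<..<1} - T ==> speed M gam t = speed N eta t"
 shows "curve_length M gam = curve_length N eta"
 unfolding curve_length_def
proof (rule nn_integral_cong_AE, use AE_interval_without_finite[OF assms(1)] in eventually_elim)
 case (elim t) then show ?case using assms(2) by (cases "t \<in> {0..1}") auto
qed

context hyperbolic_chart
begin

lemma closed_F_preimage:
 assumes "cball q d \<subseteq> V" shows "closedin (top_space M) {p \<in> U. F p \<in> cball q d}"
proof -
 have "compactin (top_of_set V) (cball q d)" using assms by (simp add: compactin_subtopology)
 from image_compactin[OF this F_inv_continuous] have "compactin (top_space M) (F_inv ` cball q d)" .
 moreover have "F_inv ` cball q d = {p \<in> U. F p \<in> cball q d}"
 proof
  show "F_inv ` cball q d \<subseteq> {p \<in> U. F p \<in> cball q d}" using assms F_inv(2,3) by auto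
  show "{p \<in> U. F p \<in> cball q d} \<subseteq> F_inv ` cball q d" using F_inv(1) by force
 qed
 ultimately show ?thesis using compactin_imp_closedin manifold_facts(1)[OF mf] by metis
qed

lemma small_metric_ball:
 assumes x: "x \<in> U" and delta: "delta > 0" "cball (F x) delta \<subseteq> V"
 defines "r \<equiv> delta / (F x $ 2 + delta)"
 shows "metric_ball M x r = {p \<in> U. F p \<in> metric_ball hyperbolic_plane (F x) r}"
  "metric_ball hyperbolic_plane (F x) r \<subseteq> V"
proof -
 have q: "F x $ 2 > 0" by (rule F_pos[OF x])
 have sub: "metric_ball hyperbolic_plane (F x) r \<subseteq> V \<and>
  (\<forall>z. z \<in> metric_ball hyperbolic_plane (F x) r \<longrightarrow> F_inv z \<in> metric_ball M x r)"
 proof -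
  have "z \<in> V \<and> F_inv z \<in> metric_ball M x r" if "z \<in> metric_ball hyperbolic_plane (F x) r" for z
  proof -
   from that obtain eta where eta: "piecewise_C1_curve hyperbolic_plane eta" "eta 0 = F x" "eta 1 = z" "curve_length hyperbolic_plane eta < ennreal r"
    unfolding metric_ball_iff by blast
   then obtain T where T: "finite T" "eta C1_differentiable_on {0<..<1} - T" and c: "continuous_on {0..1} eta"
    and hp: "eta ` {0..1} \<subseteq> half_plane"
    unfolding piecewise_C1_curve_hyperbolic_plane by blast
   have hp': "eta t \<in> half_plane" if "t \<in> {0..1}" for t using hp that by blast
   have tA: "{t \<in> {0<..<1} - T. eta t \<in> half_plane} = {0<..<1} - T"
   proof -
    have "eta t \<in> half_plane" if "t \<in> {0<..<1} - T" for t using hp'[of t] that by simp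
    then show ?thesis by blast
   qed
   have stay: "eta t \<in> half_plane \<and> (%z. z) (eta t) \<in> ball (F x) delta" if "t \<in> {0..1}" for t
   proof (rule short_curve_stays[where X="top_of_set half_plane" and gam=eta and T=T and s="speed hyperbolic_plane eta" and F="%z. z", OF _ T(1)])
    show "continuous_map (top_of_set {0..1}) (top_of_set half_plane) eta" using c hp by (auto simp: continuous_map_in_subtopology)
    have "{p \<in> half_plane. p \<in> ball (F x) delta} = half_plane \<inter> ball (F x) delta" by auto
    then show "openin (top_of_set half_plane) {p \<in> half_plane. p \<in> ball (F x) delta}" by (simp add: openin_open_Int)
    show "closedin (top_of_set half_plane) {p \<in> half_plane. p \<in> cball (F x) d}" for d
    proof -
     have "{p \<in> half_plane. p \<in> cball (F x) d} = half_plane \<inter> cball (F x) d" by auto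
     then show ?thesis by (simp add: closedin_closed_Int)
    qed
    show "continuous_on {0..b} ((%z. z) \<circ> eta)" if "b \<in> {0..1}" for b
     using continuous_on_subset[OF c, of "{0..b}"] that by (simp add: o_def)
    show "((%z. z) \<circ> eta) C1_differentiable_on {t \<in> {0<..<1} - T. eta t \<in> half_plane}"
     unfolding tA using T(2) by (simp add: o_def)
    show "speed hyperbolic_plane eta t = norm (vector_derivative ((%z. z) \<circ> eta) (at t)) / eta t $ 2" if "eta t \<in> half_plane" for t
     using speed_hyperbolic_plane that by (simp add: o_def)
    show "(\<integral>\<^sup>+t\<in>{0..1}. ennreal (speed hyperbolic_plane eta t) \<partial>lborel) < ennreal (delta / (F x $ 2 + delta))"
     using eta(4) by (simp add: curve_length_def r_def)
   qed (use eta(2) q delta(1) that in auto)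
   have inV: "eta t \<in> V" if "t \<in> {0..1}" for t using stay[OF that] delta(2) ball_subset_cball[of "F x" delta] by blast
   have oA: "open ({0<..<1} - T)" using T(1) by (intro open_Diff finite_imp_closed) auto
   define gam where "gam = F_inv \<circ> eta"
   have "continuous_map (top_of_set {0..1}) (top_of_set V) eta" using c inV by (auto simp: continuous_map_in_subtopology)
   from continuous_map_compose[OF this F_inv_continuous]
   have cg: "continuous_map (top_of_set {0..1}) (top_space M) gam" unfolding gam_def .
   have inV': "eta t \<in> V" if "t \<in> {0<..<1} - T" for t using inV[of t] that by simp
   have pc: "piecewise_C1_curve M gam" unfolding piecewise_C1_curve_def
   proof (intro conjI cg exI[of _ T] ballI T(1))
    fix c assume "c \<in> atlas M"
    then show "(snd c \<circ> gam) C1_differentiable_on {t \<in> {0<..<1} - T. gam t \<in> fst c}"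
     by (intro curve_from_plane(1)[OF oA T(2) inV']) (simp_all add: gam_def)
   qed
   have "curve_length M gam = curve_length hyperbolic_plane eta"
   proof (rule curve_length_cong[OF T(1)])
    fix t assume t: "t \<in> {0<..<1} - T"
    have "eta t $ 2 > 0" using hp'[of t] t by simp
    moreover have "speed M gam t = norm (vector_derivative eta (at t)) / eta t $ 2"
     by (rule curve_from_plane(4)[OF oA T(2) inV' _ t]) (simp_all add: gam_def)
    ultimately show "speed M gam t = speed hyperbolic_plane eta t" by (simp add: speed_hyperbolic_plane)
   qed
   moreover have "gam 0 = x" "gam 1 = F_inv z" using eta(2,3) F_inv(1)[OF x] by (simp_all add: gam_def)
   moreover have "z \<in> V" using inV[of 1] eta(3) by simp
   ultimately show ?thesis unfolding metric_ball_iff using pc eta(4) F_inv(3) U_points by auto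
  qed
  then show ?thesis by blast
 qed
 then show "metric_ball hyperbolic_plane (F x) r \<subseteq> V" by blast
 have "p \<in> U \<and> F p \<in> metric_ball hyperbolic_plane (F x) r" if "p \<in> metric_ball M x r" for p
 proof -
  from that obtain gam where gam: "piecewise_C1_curve M gam" "gam 0 = x" "gam 1 = p" "curve_length M gam < ennreal r"
   unfolding metric_ball_iff by blast
  then obtain T where c: "continuous_map (top_of_set {0..1}) (top_space M) gam" and T: "finite T"
   and C1: "!!c. c \<in> atlas M ==> (snd c \<circ> gam) C1_differentiable_on {t \<in> {0<..<1} - T. gam t \<in> fst c}"
   unfolding piecewise_C1_curve_def by blast
  have ci1: "(F \<circ> gam) C1_differentiable_on {t \<in> {0<..<1} - T. gam t \<in> U}"
   by (rule curve_into_plane(1)[OF c T C1])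
  have ci3: "speed M gam t = norm (vector_derivative (F \<circ> gam) (at t)) / F (gam t) $ 2"
   if "t \<in> {0<..<1} - T" "gam t \<in> U" for t by (rule curve_into_plane(3)[OF c T C1 that])
  have cont: "continuous_on {0..b} (F \<circ> gam)" if "b \<in> {0..1}" "gam ` {0..b} \<subseteq> U" for b
  proof -
   have "continuous_map (top_of_set {0..b}) (top_space M) gam"
    by (rule continuous_map_from_subtopology_mono[OF c]) (use that in auto)
   then have "continuous_map (top_of_set {0..b}) (subtopology (top_space M) U) gam"
    using that by (auto simp: continuous_map_in_subtopology)
   from continuous_map_compose[OF this F_continuous] show ?thesis by simp
  qed
  have stay: "gam t \<in> U \<and> F (gam t) \<in> ball (F x) delta" if "t \<in> {0..1}" for t
  proof (rule short_curve_stays[where X="top_space M" and gam=gam and T=T and s="speed M gam" and F=F, OF c T])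
   show "openin (top_space M) {p \<in> U. F p \<in> ball (F x) delta}" by (rule F_preimage_open) simp
   show "closedin (top_space M) {p \<in> U. F p \<in> cball (F x) d}" if "d < delta" for d
    by (rule closed_F_preimage) (use that delta(2) in "auto simp: subset_iff")
   show "(\<integral>\<^sup>+t\<in>{0..1}. ennreal (speed M gam t) \<partial>lborel) < ennreal (delta / (F x $ 2 + delta))"
    using gam(4) by (simp add: curve_length_def r_def)
  qed (use gam(2) x q delta(1) F_pos cont ci1 ci3 that in auto)
  have stay': "gam t \<in> U" if "t \<in> {0<..<1} - T" for t using stay[of t] that by simp
  have "{t \<in> {0<..<1} - T. gam t \<in> U} = {0<..<1} - T" using stay' by blast
  then have C1F: "(F \<circ> gam) C1_differentiable_on {0<..<1} - T" using ci1 by simp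
  have pos: "F (gam t) $ 2 > 0" if "t \<in> {0..1}" for t using stay[OF that] F_pos by blast
  have pc: "piecewise_C1_curve hyperbolic_plane (F \<circ> gam)" unfolding piecewise_C1_curve_hyperbolic_plane
  proof (intro conjI exI[of _ T] T C1F)
   show "continuous_on {0..1} (F \<circ> gam)" by (rule cont) (use stay in auto)
   show "(F \<circ> gam) ` {0..1} \<subseteq> half_plane" using pos by auto
  qed
  have "curve_length M gam = curve_length hyperbolic_plane (F \<circ> gam)"
  proof (rule curve_length_cong[OF T])
   fix t assume t: "t \<in> {0<..<1} - T"
   have "F (gam t) $ 2 > 0" using pos[of t] t by simp
   then show "speed M gam t = speed hyperbolic_plane (F \<circ> gam) t"
    using ci3[OF t stay'[OF t]] by (simp add: speed_hyperbolic_plane)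
  qed
  then have "F p \<in> metric_ball hyperbolic_plane (F x) r" unfolding metric_ball_iff
   using pc gam(2,3,4) pos[of 1] by (intro conjI exI[of _ "F \<circ> gam"]) auto
  then show ?thesis using stay[of 1] gam(3) by simp
 qed
 then show "metric_ball M x r = {p \<in> U. F p \<in> metric_ball hyperbolic_plane (F x) r}"
  using sub F_inv(1) by (intro set_eqI iffI) auto
qed

lemma isometry_restrict:
 assumes "open Q" "Q \<subseteq> V"
 shows "riemannian_isometry M {p \<in> U. F p \<in> Q} hyperbolic_plane Q F"
proof -
 let ?U' = "{p \<in> U. F p \<in> Q}"
 have "homeomorphic_map (subtopology (subtopology (top_space M) U) ?U') (subtopology (top_of_set V) Q) F"
  by (rule homeomorphic_map_subtopologies_alt[OF F_homeomorphic]) (simp add: topspace_U)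
 moreover have "U \<inter> ?U' = ?U'" "V \<inter> Q = Q" "half_plane \<inter> Q = Q" using assms(2) V_half_plane by auto
 ultimately have "homeomorphic_map (subtopology (top_space M) ?U') (subtopology (top_of_set half_plane) Q) F"
  by (simp add: subtopology_subtopology)
 moreover have "openin (top_of_set half_plane) Q"
  using assms V_half_plane by (intro open_subset) auto
 moreover have "isometric_in_charts c (metric_in M c) ?U' d (metric_in hyperbolic_plane d) F"
  if "c \<in> atlas M" "d \<in> atlas hyperbolic_plane" for c d
 proof -
  have "isometric_in_charts c (metric_in M c) U d (metric_in hyperbolic_plane d) F"
   using iso that unfolding riemannian_isometry_def by blast
  moreover have "snd c ` {p \<in> ?U' \<inter> fst c. F p \<in> fst d} \<subseteq> snd c ` {p \<in> U \<inter> fst c. F p \<in> fst d}" by blast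
  ultimately show ?thesis unfolding isometric_in_charts_def Let_def smooth_on_def using Ck_on_subset by blast
 qed
 ultimately show ?thesis unfolding riemannian_isometry_def using F_preimage_open[OF assms(1)] by simp
qed

end

lemma embedded_ball_exists:
 assumes "hyperbolic_surface M" "x \<in> points M"
 shows "\<exists>r>0. \<exists>p\<in>points hyperbolic_plane. \<exists>s>0. \<exists>F.
  riemannian_isometry M (metric_ball M x r) hyperbolic_plane (metric_ball hyperbolic_plane p s) F"
proof -
 obtain U V F where x: "x \<in> U" and iso: "riemannian_isometry M U hyperbolic_plane V F"
  using assms unfolding hyperbolic_surface_def by blast
 interpret hyperbolic_chart M U V F using assms iso by unfold_locales (simp_all add: hyperbolic_surface_def)
 obtain delta where delta: "delta > 0" "cball (F x) delta \<subseteq> V" using open_contains_cball[of V] oV F_inv(4)[OF x] by blast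
 define r where "r = delta / (F x $ 2 + delta)"
 have r: "r > 0" using delta F_pos[OF x] by (simp add: r_def)
 note sm = small_metric_ball[OF x delta, folded r_def]
 have "riemannian_isometry M (metric_ball M x r) hyperbolic_plane (metric_ball hyperbolic_plane (F x) r) F"
  unfolding sm(1) by (rule isometry_restrict[OF open_hyperbolic_ball sm(2)])
 moreover have "F x \<in> points hyperbolic_plane" using F_pos[OF x] by simp
 ultimately show ?thesis using r by blast
qed

subsection \<open>Geodesic polar coordinates\<close>

abbreviation pt :: "real => real => real^2" where "pt r t \<equiv> vector [r, t]"

lemma pt_eta [simp]: "pt (z $ 1) (z $ 2) = z"
 by (simp add: vec_eq_iff forall_2)

lemma pt_eq: "pt r t = r *\<^sub>R axis 1 1 + t *\<^sub>R axis 2 1"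
 by (simp add: vec_eq_iff forall_2 axis_def)

lemma slice_derivatives:
 assumes "f differentiable (at (pt r t))"
 shows "((%r. f (pt r t)) has_vector_derivative partial 1 f (pt r t)) (at r)"
  "((%t. f (pt r t)) has_vector_derivative partial 2 f (pt r t)) (at t)"
proof -
 note d = has_derivative_partial_sum[OF assms]
 have "((%r. pt r t) has_derivative (%h. h *\<^sub>R axis 1 1)) (at r)"
  unfolding pt_eq by (auto intro!: derivative_eq_intros)
 from diff_chain_at[OF this d] show "((%r. f (pt r t)) has_vector_derivative partial 1 f (pt r t)) (at r)"
  by (simp add: has_vector_derivative_def o_def sum_2 axis_def)
 have "((%t. pt r t) has_derivative (%h. h *\<^sub>R axis 2 1)) (at t)"
  unfolding pt_eq by (auto intro!: derivative_eq_intros)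
 from diff_chain_at[OF this d] show "((%t. f (pt r t)) has_vector_derivative partial 2 f (pt r t)) (at t)"
  by (simp add: has_vector_derivative_def o_def sum_2 axis_def)
qed

lemma continuous_on_pt: "continuous_on A (%(r, t). pt r t)"
 unfolding pt_eq case_prod_beta by (intro continuous_intros)

lemma Ck_on_elementary:
 assumes "open S"
 shows "Ck_on k S (%z :: real^2. sinh (z $ i))" "Ck_on k S (%z :: real^2. cosh (z $ i))"
  "Ck_on k S (%z :: real^2. sin (z $ i))" "Ck_on k S (%z :: real^2. cos (z $ i))"
proof -
 define H where "H = (%n :: nat. if even n then sinh else cosh :: real => real)"
 have "(H n has_real_derivative H (Suc n) x) (at x)" for n x
  unfolding H_def by (cases "even n") (auto intro!: derivative_eq_intros)
 from Ck_on_coordinate_function[of H, OF this assms, of k 0 i] Ck_on_coordinate_function[of H, OF this assms, of k 1 i]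
 show "Ck_on k S (%z :: real^2. sinh (z $ i))" "Ck_on k S (%z :: real^2. cosh (z $ i))" by (simp_all add: H_def)
 define D where "D = (%(n :: nat) x :: real. sin (x + real n * (pi/2)))"
 have "(D n has_real_derivative D (Suc n) x) (at x)" for n x
 proof -
  have "(D n has_real_derivative cos (x + real n * (pi/2))) (at x)" unfolding D_def by (auto intro!: derivative_eq_intros)
  moreover have "D (Suc n) x = cos (x + real n * (pi/2))"
  proof -
   have e: "x + real (Suc n) * (pi/2) = (x + real n * (pi/2)) + pi/2" by (simp add: field_simps)
   show ?thesis unfolding D_def e by (subst sin_add) simp
  qed
  ultimately show ?thesis by simp
 qed
 from Ck_on_coordinate_function[of D, OF this assms, of k 0 i] Ck_on_coordinate_function[of D, OF this assms, of k 1 i]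
 show "Ck_on k S (%z :: real^2. sin (z $ i))" "Ck_on k S (%z :: real^2. cos (z $ i))" by (simp_all add: D_def sin_add)
qed

lemma polar_denominator_pos: "cosh r - sinh r * cos t > 0" for r t :: real
proof -
 have "\<bar>sinh r * cos t\<bar> <= \<bar>sinh r\<bar>" using mult_left_le[of "\<bar>cos t\<bar>" "\<bar>sinh r\<bar>"] by (simp add: abs_mult)
 also have "\<bar>sinh r\<bar> < cosh r" by (simp add: abs_less_iff sinh_def cosh_def)
 finally show ?thesis by linarith
qed

text \<open>Geodesic polar coordinates of the half-plane at \<open>q\<close>; the radius may be negative.\<close>

definition polar :: "real^2 => real^2 => real^2" where
 "polar q z = pt (q $ 1 + q $ 2 * (sinh (z $ 1) * sin (z $ 2) / (cosh (z $ 1) - sinh (z $ 1) * cos (z $ 2))))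
  (q $ 2 / (cosh (z $ 1) - sinh (z $ 1) * cos (z $ 2)))"

lemma polar_0 [simp]: "polar q (pt 0 t) = q" by (simp add: polar_def)

lemma polar_2_pos: "q $ 2 > 0 ==> polar q z $ 2 > 0" using polar_denominator_pos by (simp add: polar_def)

lemma polar_neg: "polar q (pt (- r) t) = polar q (pt r (t + pi))" by (simp add: polar_def)

lemma Ck_on_polar: "Ck_on k UNIV (polar q)"
proof (rule Ck_on_vec[OF open_UNIV])
 fix i :: 2
 have D: "Ck_on k UNIV (%z :: real^2. inverse (cosh (z $ 1) + (-1) * (sinh (z $ 1) * cos (z $ 2))))"
  by (intro Ck_on_inverse Ck_on_add Ck_on_mult Ck_on_elementary Ck_on_const open_UNIV)
   (use polar_denominator_pos in "simp add: less_imp_neq[symmetric]")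
 have "Ck_on k UNIV (%z :: real^2. q $ 1 + q $ 2 * (sinh (z $ 1) * sin (z $ 2) * inverse (cosh (z $ 1) + (-1) * (sinh (z $ 1) * cos (z $ 2)))))"
  "Ck_on k UNIV (%z :: real^2. q $ 2 * inverse (cosh (z $ 1) + (-1) * (sinh (z $ 1) * cos (z $ 2))))"
  by (intro D Ck_on_add Ck_on_mult Ck_on_elementary Ck_on_const open_UNIV)+
 then show "Ck_on k UNIV (%z. polar q z $ i)"
  using exhaust_2[of i] by (auto simp: polar_def divide_inverse)
qed

lemma partial_polar:
 fixes r t :: real and q :: "real^2"
 defines "D \<equiv> cosh r - sinh r * cos t"
 shows "partial 1 (polar q) (pt r t) = (q $ 2 / D^2) *\<^sub>R pt (sin t) (cosh r * cos t - sinh r)"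
  "partial 2 (polar q) (pt r t) = (q $ 2 * sinh r / D^2) *\<^sub>R pt (cosh r * cos t - sinh r) (- sin t)"
proof -
 have Dne: "cosh r - sinh r * cos t ~= 0" using polar_denominator_pos[of r t] by simp
 have df: "polar q differentiable (at (pt r t))" by (rule Ck_on_differentiable[OF Ck_on_polar[of 1]]) auto
 have comp: "((%x. f x $ i) has_real_derivative d $ i) (at a)" if "(f has_vector_derivative d) (at a)"
  for f :: "real => real^2" and d a i
  using bounded_linear.has_vector_derivative[OF bounded_linear_vec_nth that] by (simp add: has_real_derivative_iff_has_vector_derivative)
 have cs: "(cosh r)^2 = 1 + (sinh r)^2" "(sin t)^2 = 1 - (cos t)\<^sup>2" by (simp_all add: cosh_square_eq sin_squared_eq)
 have e: "polar q (pt a b) $ 1 = q $ 1 + q $ 2 * (sinh a * sin b / (cosh a - sinh a * cos b))"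
  "polar q (pt a b) $ 2 = q $ 2 * (1 / (cosh a - sinh a * cos b))" for a b by (simp_all add: polar_def)
 have Dr: "((%r. cosh r - sinh r * cos t) has_real_derivative (sinh r - cosh r * cos t)) (at r)"
  and Dt: "((%t. cosh r - sinh r * cos t) has_real_derivative (sinh r * sin t)) (at t)"
  and Nr: "((%r. sinh r * sin t) has_real_derivative (cosh r * sin t)) (at r)"
  and Nt: "((%t. sinh r * sin t) has_real_derivative (sinh r * cos t)) (at t)"
  by (auto intro!: derivative_eq_intros)
 have N1: "cosh r * sin t * (cosh r - sinh r * cos t) - sinh r * sin t * (sinh r - cosh r * cos t) = sin t"
  using cs(1) by algebra
 have N3: "sinh r * cos t * (cosh r - sinh r * cos t) - sinh r * sin t * (sinh r * sin t) = sinh r * (cosh r * cos t - sinh r)"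
  using cs(2) by algebra
 have 1: "((%r. polar q (pt r t) $ 1) has_real_derivative (q $ 2 / D^2) * sin t) (at r)"
  unfolding e using DERIV_add[OF DERIV_const DERIV_cmult[OF DERIV_divide[OF Nr Dr Dne]], of "q $ 1" "q $ 2"]
  unfolding N1 by (simp add: D_def power2_eq_square)
 have 2: "((%r. polar q (pt r t) $ 2) has_real_derivative (q $ 2 / D^2) * (cosh r * cos t - sinh r)) (at r)"
  unfolding e by (rule DERIV_cong[OF DERIV_cmult[OF DERIV_divide[OF DERIV_const Dr Dne]]])
   (simp add: D_def power2_eq_square)
 have 3: "((%t. polar q (pt r t) $ 1) has_real_derivative (q $ 2 * sinh r / D^2) * (cosh r * cos t - sinh r)) (at t)"
  unfolding e using DERIV_add[OF DERIV_const DERIV_cmult[OF DERIV_divide[OF Nt Dt Dne]], of "q $ 1" "q $ 2"]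
  unfolding N3 by (simp add: D_def power2_eq_square mult.assoc)
 have 4: "((%t. polar q (pt r t) $ 2) has_real_derivative (q $ 2 * sinh r / D^2) * (- sin t)) (at t)"
  unfolding e by (rule DERIV_cong[OF DERIV_cmult[OF DERIV_divide[OF DERIV_const Dt Dne]]])
   (simp add: D_def power2_eq_square mult.assoc)
 note s1 = comp[OF slice_derivatives(1)[OF df]] and s2 = comp[OF slice_derivatives(2)[OF df]]
 show "partial 1 (polar q) (pt r t) = (q $ 2 / D^2) *\<^sub>R pt (sin t) (cosh r * cos t - sinh r)"
  using DERIV_unique[OF s1 1] DERIV_unique[OF s1 2] by (simp add: vec_eq_iff forall_2)
 show "partial 2 (polar q) (pt r t) = (q $ 2 * sinh r / D^2) *\<^sub>R pt (cosh r * cos t - sinh r) (- sin t)"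
  using DERIV_unique[OF s2 3] DERIV_unique[OF s2 4] by (simp add: vec_eq_iff forall_2)
qed

lemma polar_metric:
 assumes q: "q $ 2 > 0"
 shows "partial 1 (polar q) z \<bullet> partial 1 (polar q) z = (polar q z $ 2)^2"
  "partial 2 (polar q) z \<bullet> partial 2 (polar q) z = (sinh (z $ 1))^2 * (polar q z $ 2)^2"
  "partial 1 (polar q) z \<bullet> partial 2 (polar q) z = 0"
proof -
 define r t where "r = z $ 1" and "t = z $ 2"
 define D where "D = cosh r - sinh r * cos t"
 have z: "z = pt r t" unfolding r_def t_def by simp
 have Dp: "D > 0" unfolding D_def by (rule polar_denominator_pos)
 have y: "polar q z $ 2 = q $ 2 / D" by (simp add: polar_def D_def r_def t_def)
 have cs: "(cosh r)^2 = 1 + (sinh r)^2" "(sin t)^2 = 1 - (cos t)\<^sup>2" by (simp_all add: cosh_square_eq sin_squared_eq)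
 have "(sin t)^2 + (cosh r * cos t - sinh r)^2 = D^2" unfolding D_def using cs by algebra
 then have n: "sin t * sin t + (cosh r * cos t - sinh r) * (cosh r * cos t - sinh r) = D^2" by (simp add: power2_eq_square)
 have inn: "(a *\<^sub>R pt u v) \<bullet> (b *\<^sub>R pt u' v') = a * b * (u * u' + v * v')" for a b u v u' v'
  by (simp add: inner_vec_def sum_2 algebra_simps)
 have "partial 1 (polar q) z \<bullet> partial 1 (polar q) z = (q $ 2 / D^2) * (q $ 2 / D^2) * D^2"
  unfolding z partial_polar inn D_def[symmetric] n ..
 then show "partial 1 (polar q) z \<bullet> partial 1 (polar q) z = (polar q z $ 2)^2"
  unfolding y using Dp by (simp add: field_simps power2_eq_square)
 have n': "(cosh r * cos t - sinh r) * (cosh r * cos t - sinh r) + - sin t * - sin t = D^2" using n by simp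
 have "partial 2 (polar q) z \<bullet> partial 2 (polar q) z = (q $ 2 * sinh r / D^2) * (q $ 2 * sinh r / D^2) * D^2"
  unfolding z partial_polar inn D_def[symmetric] n' ..
 then show "partial 2 (polar q) z \<bullet> partial 2 (polar q) z = (sinh (z $ 1))^2 * (polar q z $ 2)^2"
  unfolding y r_def[symmetric] using Dp by (simp add: field_simps power2_eq_square)
 show "partial 1 (polar q) z \<bullet> partial 2 (polar q) z = 0"
  unfolding z partial_polar inn by (simp add: algebra_simps)
qed

lemma polar_inj:
 assumes q: "q $ 2 > 0" and r: "0 < r" "0 < r'" and t: "0 < t" "t < 2 * pi" "0 < t'" "t' < 2 * pi"
  and e: "polar q (pt r t) = polar q (pt r' t')"
 shows "r = r' \<and> t = t'"
proof -
 define D where "D = (%r t :: real. cosh r - sinh r * cos t)"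
 have Dp: "D r t > 0" for r t unfolding D_def by (rule polar_denominator_pos)
 have "polar q (pt r t) $ 2 = polar q (pt r' t') $ 2" "polar q (pt r t) $ 1 = polar q (pt r' t') $ 1" using e by simp_all
 then have "q $ 2 / D r t = q $ 2 / D r' t'"
  and x: "q $ 2 * (sinh r * sin t / D r t) = q $ 2 * (sinh r' * sin t' / D r' t')"
  by (simp_all add: polar_def D_def)
 then have DD: "D r t = D r' t'" using q Dp[of r t] Dp[of r' t'] by (simp add: frac_eq_eq)
 then have ss: "sinh r * sin t = sinh r' * sin t'" using x q Dp[of r t] Dp[of r' t'] by simp
 have k: "(sinh r * sin t)^2 + 1 + (D r t)^2 = 2 * cosh r * D r t" for r t
 proof -
  have "(cosh r)^2 = 1 + (sinh r)^2" "(sin t)^2 = 1 - (cos t)\<^sup>2" by (simp_all add: cosh_square_eq sin_squared_eq)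
  then show ?thesis unfolding D_def by algebra
 qed
 have "(2 * cosh r) * D r' t' = (2 * cosh r') * D r' t'" using k[of r t] k[of r' t'] unfolding ss DD by linarith
 then have "2 * cosh r = 2 * cosh r'" using mult_right_cancel[of "D r' t'"] Dp[of r' t'] by (simp only: less_imp_neq[symmetric] not_False_eq_True simp_thms)
 then have "cosh r = cosh r'" by linarith
 then have rr: "r = r'" using r cosh_real_nonneg_less_iff[of r r'] cosh_real_nonneg_less_iff[of r' r] by linarith
 have "sin t = sin t'" "cos t = cos t'" using ss DD rr r by (auto simp: D_def)
 then obtain n :: int where n: "t = t' + 2 * pi * n" using sin_cos_eq_iff[of t t'] by blast
 have "2 * pi * \<bar>real_of_int n\<bar> = \<bar>t - t'\<bar>" using n by (simp add: abs_mult)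
 also have "\<dots> < 2 * pi * 1" using t by linarith
 finally have "\<bar>real_of_int n\<bar> < 1" using mult_less_cancel_left_pos[of "2 * pi" "\<bar>real_of_int n\<bar>" 1] by simp
 then have "n = 0" by linarith
 then show ?thesis using n rr by simp
qed

lemma polar_geodesic:
 assumes q: "q $ 2 > 0"
 shows "(%s. polar q (pt s t)) C1_differentiable_on A"
  "norm (vector_derivative (%s. polar q (pt s t)) (at s)) = polar q (pt s t) $ 2"
proof -
 have d: "((%s. polar q (pt s t)) has_vector_derivative partial 1 (polar q) (pt s t)) (at s)" for s
  by (rule slice_derivatives(1)[OF Ck_on_differentiable[OF Ck_on_polar[of 1]]]) auto
 have "continuous_on UNIV (partial 1 (polar q))" using Ck_on_polar[of 1] by simp
 then have "continuous_on A (%s. partial 1 (polar q) (pt s t))"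
  by (rule continuous_on_compose2) (auto simp: pt_eq intro!: continuous_intros)
 then show "(%s. polar q (pt s t)) C1_differentiable_on A"
  unfolding C1_differentiable_on_def using d by (intro exI[of _ "%s. partial 1 (polar q) (pt s t)"] conjI ballI)
 have "(norm (partial 1 (polar q) (pt s t)))^2 = (polar q (pt s t) $ 2)^2"
  using polar_metric(1)[OF q] by (simp add: power2_norm_eq_inner)
 then show "norm (vector_derivative (%s. polar q (pt s t)) (at s)) = polar q (pt s t) $ 2"
  unfolding vector_derivative_at[OF d] using polar_2_pos[OF q, of "pt s t"] by (simp add: power2_eq_iff_nonneg)
qed

definition polar_gram :: "real^2 => real^2^2" where
 "polar_gram z = (\<chi> i j. if i = j then (if i = 1 then 1 else (sinh (z $ 1))^2) else 0)"

locale polar_chart = hyperbolic_chart +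
 fixes x :: 'a and R :: real
 assumes x: "x \<in> U" and R: "R > 0"
  and polar_in_V: "!!s t. 0 <= s ==> s < R ==> polar (F x) (pt s t) \<in> V"
begin

definition disc :: "(real^2) set" where "disc = {z. \<bar>z $ 1\<bar> < R}"

definition polar_map :: "real^2 => 'a" where "polar_map z = F_inv (polar (F x) z)"

definition polar_dom :: "('a, 2) chart => (real^2) set" where
 "polar_dom c = {z \<in> disc. polar_map z \<in> fst c}"

lemma Fx_pos: "F x $ 2 > 0" using F_pos[OF x] .

lemma open_disc: "open disc" unfolding disc_def by (intro open_Collect_less continuous_intros)

lemma disc_V: "z \<in> disc ==> polar (F x) z \<in> V"
proof -
 assume z: "z \<in> disc"
 have "polar (F x) (pt (z $ 1) (z $ 2)) \<in> V"
 proof (cases "z $ 1 >= 0")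
  case True then show ?thesis using polar_in_V[of "z $ 1" "z $ 2"] z by (simp add: disc_def)
 next
  case False
  then have "polar (F x) (pt (- z $ 1) (z $ 2 + pi)) \<in> V" using polar_in_V[of "- z $ 1" "z $ 2 + pi"] z by (simp add: disc_def)
  then show ?thesis using polar_neg[of "F x" "- z $ 1" "z $ 2"] by simp
 qed
 then show ?thesis by simp
qed

lemma polar_map_0: "polar_map (pt 0 t) = x" unfolding polar_map_def by (simp add: F_inv(1)[OF x])

lemma polar_map_U: "z \<in> disc ==> polar_map z \<in> U" unfolding polar_map_def using disc_V F_inv(3) by blast

lemma polar_dom_eq: "polar_dom c = disc \<inter> polar (F x) -` coord_dom c"
 using disc_V unfolding polar_dom_def coord_dom_def polar_map_def by blast

lemma polar_map_continuous: "continuous_map (top_of_set disc) (top_space M) polar_map"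
proof -
 have "continuous_map (top_of_set disc) (top_of_set V) (polar (F x))"
  using Ck_on_polar[of 0 "F x"] disc_V by (auto simp: continuous_map_in_subtopology intro: continuous_on_subset)
 from continuous_map_compose[OF this F_inv_continuous] show ?thesis by (simp add: polar_map_def[abs_def] o_def)
qed

context
 fixes c assumes c: "c \<in> atlas M"
begin

lemma open_polar_dom: "open (polar_dom c)"
 unfolding polar_dom_eq using open_disc Ck_on_polar[of 0 "F x"] inverse_coordinates(2)[OF c]
 by (intro open_Int open_vimage) (auto intro: continuous_on_subset)

lemma polar_dom_coord: "z \<in> polar_dom c ==> polar (F x) z \<in> coord_dom c" "polar_dom c \<subseteq> disc"
 by (auto simp: polar_dom_eq)

lemma Ck_on_polar_coordinates: "Ck_on k (polar_dom c) (snd c \<circ> polar_map)"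
proof -
 have "Ck_on k (polar_dom c) (%z. (snd c \<circ> F_inv) (polar (F x) z))"
  by (rule Ck_on_compose[OF open_polar_dom inverse_coordinates(2)[OF c] polar_dom_coord(1) inverse_coordinates(1)[OF c]
     Ck_on_subset[OF Ck_on_polar]]) auto
 then show ?thesis by (simp add: polar_map_def[abs_def] o_def)
qed

lemma partial_polar_coordinates:
 assumes "z \<in> polar_dom c"
 shows "partial i (snd c \<circ> polar_map) z = jacobian (snd c \<circ> F_inv) (at (polar (F x) z)) *v partial i (polar (F x)) z"
proof -
 have "partial i (%z. (snd c \<circ> F_inv) (polar (F x) z)) z
   = (\<Sum>a\<in>UNIV. (partial i (polar (F x)) z $ a) *\<^sub>R partial a (snd c \<circ> F_inv) (polar (F x) z))"
 proof (rule partial_compose)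
  show "(snd c \<circ> F_inv) differentiable (at (polar (F x) z))"
   by (rule Ck_on_differentiable[OF inverse_coordinates(1)[OF c, of 1] _ inverse_coordinates(2)[OF c] polar_dom_coord(1)[OF assms]]) simp
  show "polar (F x) differentiable (at z)" by (rule Ck_on_differentiable[OF Ck_on_polar[of 1]]) auto
 qed
 then show ?thesis
  by (simp add: polar_map_def[abs_def] o_def vec_eq_iff matrix_vector_mult_def jacobian_entry mult.commute)
qed

lemma polar_coordinates_gram:
 assumes z: "z \<in> polar_dom c"
 shows "partial i (snd c \<circ> polar_map) z \<bullet> (metric_in M c (snd c (polar_map z)) *v partial j (snd c \<circ> polar_map) z) = polar_gram z $ i $ j"
proof -
 have y: "polar (F x) z $ 2 > 0" by (rule polar_2_pos[OF Fx_pos])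
 have "partial i (snd c \<circ> polar_map) z \<bullet> (metric_in M c (snd c (polar_map z)) *v partial j (snd c \<circ> polar_map) z)
  = (1 / (polar (F x) z $ 2)^2) * (partial i (polar (F x)) z \<bullet> partial j (polar (F x)) z)"
  unfolding partial_polar_coordinates[OF z] inner_congruence polar_map_def
   inverse_coordinates(3)[OF c polar_dom_coord(1)[OF z]] inner_mat_mult ..
 then show ?thesis
  using polar_metric[OF Fx_pos, of z] y exhaust_2[of i] exhaust_2[of j]
  by (auto simp: polar_gram_def inner_commute)
qed

end

end

lemma chart_inv_continuous:
 assumes "is_chart X c" shows "continuous_map (top_of_set (snd c ` fst c)) X (chart_inv c)"
 unfolding continuous_map_def
proof (intro conjI allI impI)
 note ch = is_chart_facts[OF assms]
 show "chart_inv c \<in> topspace (top_of_set (snd c ` fst c)) \<rightarrow> topspace X"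
  using ch(6) openin_subset[OF ch(1)] by auto
 fix W assume W: "openin X W"
 have "{z \<in> topspace (top_of_set (snd c ` fst c)). chart_inv c z \<in> W} = snd c ` (W \<inter> fst c)"
 proof (intro set_eqI iffI)
  fix z assume "z \<in> {z \<in> topspace (top_of_set (snd c ` fst c)). chart_inv c z \<in> W}"
  then have "z \<in> snd c ` fst c" "chart_inv c z \<in> W" by simp_all
  then show "z \<in> snd c ` (W \<inter> fst c)" using ch(5,6)[of z] image_eqI[of z "snd c" "chart_inv c z" "W \<inter> fst c"] by simp
 next
  fix z assume "z \<in> snd c ` (W \<inter> fst c)"
  then show "z \<in> {z \<in> topspace (top_of_set (snd c ` fst c)). chart_inv c z \<in> W}" using ch(4) by auto
 qed
 moreover have "open (snd c ` (W \<inter> fst c))" by (rule ch(8)) (use W ch(1) in "auto intro: openin_Int")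
 ultimately show "openin (top_of_set (snd c ` fst c)) {z \<in> topspace (top_of_set (snd c ` fst c)). chart_inv c z \<in> W}"
  by (auto intro: open_subset)
qed

lemma closed_chart_cball:
 assumes H: "Hausdorff_space X" and c: "is_chart X c" and sub: "cball z d \<subseteq> snd c ` fst c"
 shows "closedin X {p \<in> fst c. snd c p \<in> cball z d}"
proof -
 note ch = is_chart_facts[OF c]
 have "compactin (top_of_set (snd c ` fst c)) (cball z d)" using sub by (simp add: compactin_subtopology)
 from image_compactin[OF this chart_inv_continuous[OF c]] have "compactin X (chart_inv c ` cball z d)" .
 moreover have "chart_inv c ` cball z d = {p \<in> fst c. snd c p \<in> cball z d}"
 proof
  show "chart_inv c ` cball z d \<subseteq> {p \<in> fst c. snd c p \<in> cball z d}"
  proof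
   fix p assume "p \<in> chart_inv c ` cball z d"
   then obtain w where w: "w \<in> cball z d" "p = chart_inv c w" by blast
   then show "p \<in> {p \<in> fst c. snd c p \<in> cball z d}" using ch(5,6)[OF subsetD[OF sub w(1)]] by simp
  qed
  show "{p \<in> fst c. snd c p \<in> cball z d} \<subseteq> chart_inv c ` cball z d"
  proof
   fix p assume p: "p \<in> {p \<in> fst c. snd c p \<in> cball z d}"
   then have "chart_inv c (snd c p) = p" using ch(4) by blast
   then show "p \<in> chart_inv c ` cball z d" using p image_eqI[of p "chart_inv c" "snd c p"] by simp
  qed
 qed
 ultimately show ?thesis using compactin_imp_closedin[OF H] by simp
qed

lemma metric_lower_bound:
 assumes mf: "riemannian_manifold M" and c: "c \<in> atlas M" and K: "compact K" "K ~= {}" "K \<subseteq> snd c ` fst c"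
 shows "\<exists>m>0. \<forall>z\<in>K. \<forall>v. m * (norm v)^2 <= v \<bullet> (metric_in M c z *v v)"
proof -
 let ?f = "%(z, v). v \<bullet> (metric_in M c z *v v)"
 have g: "continuous_on K (metric_in M c)"
  using manifold_facts(5)[OF mf c, of 0] K(3) by (auto intro: continuous_on_subset)
 have "continuous_on (K \<times> sphere 0 1) ?f"
  unfolding case_prod_beta inner_vec_def matrix_vector_mult_def
  by (simp, intro continuous_intros continuous_on_compose2[OF g]) auto
 moreover have "compact (K \<times> sphere (0 :: real^'b) 1)" by (intro compact_Times K compact_sphere)
 moreover have "axis undefined 1 \<in> sphere (0 :: real^'b) 1" by simp
 then have "sphere (0 :: real^'b) 1 ~= {}" by blast
 then have "K \<times> sphere (0 :: real^'b) 1 ~= {}" using K(2) by simp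
 ultimately obtain p where p: "p \<in> K \<times> sphere 0 1" "!!q. q \<in> K \<times> sphere 0 1 ==> ?f p <= ?f q"
  using continuous_attains_inf[of "K \<times> sphere (0 :: real^'b) 1" ?f] by blast
 define m where "m = ?f p"
 have "fst p \<in> snd c ` fst c" "snd p ~= 0" using p(1) K(3) by (auto simp: mem_Times_iff)
 then have "m > 0" using manifold_facts(7)[OF mf c] unfolding m_def by (simp add: case_prod_beta)
 moreover have "m * (norm v)^2 <= v \<bullet> (metric_in M c z *v v)" if z: "z \<in> K" for z v
 proof (cases "v = 0")
  case False
  define u where "u = (1 / norm v) *\<^sub>R v"
  have u: "v = norm v *\<^sub>R u" "norm u = 1" using False by (simp_all add: u_def)
  have "m <= ?f (z, u)" unfolding m_def by (rule p(2)) (use z u in simp)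
  then have "m * (norm v)^2 <= (u \<bullet> (metric_in M c z *v u)) * (norm v)^2" by (simp add: mult_right_mono)
  also have "\<dots> = (norm v *\<^sub>R u) \<bullet> (metric_in M c z *v (norm v *\<^sub>R u))"
   by (simp add: matrix_vector_mult_scaleR power2_eq_square)
  also have "\<dots> = v \<bullet> (metric_in M c z *v v)" unfolding u(1)[symmetric] ..
  finally show ?thesis .
 qed simp
 ultimately show ?thesis by blast
qed

context hyperbolic_chart
begin

text \<open>Completeness: the lift to \<open>M\<close> of a unit speed curve has a limit point by compactness, which still lies at
 distance less than \<open>r\<close> from \<open>x\<close>, so the lift can be continued.\<close>

lemma unit_speed_curve_stays:
 fixes gam :: "real => real^2"
 assumes comp: "compact_space (top_space M)" and U: "U = metric_ball M x r" and xU: "x \<in> U"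
  and C1: "gam C1_differentiable_on UNIV" and start: "gam 0 = F x"
  and unit: "!!s. norm (vector_derivative gam (at s)) = gam s $ 2" and pos: "!!s. gam s $ 2 > 0"
  and s: "0 <= s" "s < r"
 shows "gam s \<in> V"
proof (rule ccontr)
 assume nV: "gam s \<notin> V"
 have cont: "continuous_on UNIV gam" by (rule C1_differentiable_imp_continuous_on[OF C1])
 define A where "A = {0..s} \<inter> gam -` (- V)"
 have clA: "closed A" unfolding A_def by (intro closed_Int closed_atLeastAtMost closed_vimage closed_Compl oV cont)
 have neA: "A ~= {}" using nV s unfolding A_def by auto
 have bb: "bdd_below A" unfolding A_def by (intro bdd_belowI[of _ 0]) simp
 define sigma where "sigma = Inf A"
 have sigmaA: "sigma \<in> A" unfolding sigma_def by (rule closed_contains_Inf[OF neA bb clA])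
 have sigmaV: "gam sigma \<notin> V" and sigmas: "0 <= sigma" "sigma <= s" using sigmaA unfolding A_def by auto
 have sigma0: "sigma > 0" using sigmaV sigmas(1) start F_inv(4)[OF xU] by (cases "sigma = 0") auto
 have below: "gam u \<in> V" if "0 <= u" "u < sigma" for u
 proof (rule ccontr)
  assume "gam u \<notin> V"
  then have "u \<in> A" using that sigmas unfolding A_def by simp
  then show False using cInf_lower[OF _ bb, of u] that(2) unfolding sigma_def by simp
 qed
 define y where "y = (%u. F_inv (gam u))"
 have yU: "y u \<in> U" "F (y u) = gam u" if "0 <= u" "u < sigma" for u
  using F_inv(2,3)[OF below[OF that]] unfolding y_def by auto
 have ev0: "\<forall>\<^sub>F u in at_left sigma. u \<in> {0<..<sigma}" by (rule eventually_at_left_real[OF sigma0])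
 have "\<exists>p\<in>points M. \<forall>W. openin (top_space M) W \<longrightarrow> p \<in> W \<longrightarrow> \<not> (\<forall>\<^sub>F u in at_left sigma. y u \<notin> W)"
 proof (rule ccontr)
  assume neg: "\<not> ?thesis"
  let ?\<U> = "{W. openin (top_space M) W \<and> (\<forall>\<^sub>F u in at_left sigma. y u \<notin> W)}"
  have "points M \<subseteq> \<Union>?\<U>" using neg by blast
  then obtain \<F> where fin: "finite \<F>" "\<F> \<subseteq> ?\<U>" "points M \<subseteq> \<Union>\<F>"
   using comp[unfolded compact_space_alt, rule_format, of ?\<U>] by blast
  have "\<forall>\<^sub>F u in at_left sigma. \<forall>W\<in>\<F>. y u \<notin> W" by (rule eventually_ball_finite[OF fin(1)]) (use fin(2) in blast)
  with ev0 have "\<forall>\<^sub>F u in at_left sigma. False"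
  proof eventually_elim
   case (elim u)
   then have "y u \<in> points M" using yU(1)[of u] U_points by auto
   then show False using elim fin(3) by blast
  qed
  then show False by simp
 qed
 then obtain p where p: "p \<in> points M"
  and cl: "!!W. openin (top_space M) W ==> p \<in> W ==> \<not> (\<forall>\<^sub>F u in at_left sigma. y u \<notin> W)" by blast
 define c where "c = chart_at M p"
 have c: "c \<in> atlas M" "p \<in> fst c" using manifold_facts(3,4)[OF mf p] unfolding c_def by auto
 note ic = manifold_facts(2)[OF mf c(1)]
 note ch = is_chart_facts[OF ic]
 define c0 where "c0 = snd c p"
 have "c0 \<in> snd c ` fst c" using c(2) unfolding c0_def by blast
 then obtain rho where rho: "rho > 0" "cball c0 rho \<subseteq> snd c ` fst c" using ch(2) open_contains_cball by blast
 have "cball c0 rho ~= {}" using rho by simp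
 then obtain m where m: "m > 0" "!!z v. z \<in> cball c0 rho ==> m * (norm v)^2 <= v \<bullet> (metric_in M c z *v v)"
  using metric_lower_bound[OF mf c(1) compact_cball[of c0 rho] _ rho(2)] by metis
 have sm: "sqrt m > 0" using m by simp
 have ycont: "continuous_map (top_of_set {a..b}) (top_space M) y" if "0 <= a" "b < sigma" for a b
 proof -
  have "continuous_map (top_of_set {a..b}) (top_of_set V) gam"
   using continuous_on_subset[OF cont, of "{a..b}"] below that by (auto simp: continuous_map_in_subtopology)
  from continuous_map_compose[OF this F_inv_continuous] show ?thesis by (simp add: y_def o_def)
 qed
 have C1': "gam C1_differentiable_on {0<..<sigma}" by (rule C1_differentiable_on_subset[OF C1]) simp
 have deriv: "(snd c \<circ> y) differentiable (at u) \<and> norm (vector_derivative (snd c \<circ> y) (at u)) <= 1 / sqrt m"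
  if u: "u \<in> {0<..<sigma}" and yc: "y u \<in> fst c" "snd c (y u) \<in> cball c0 rho" for u
 proof -
  have "\<exists>v. ((snd c \<circ> y) has_vector_derivative v) (at u) \<and>
   v \<bullet> (metric_in M c (snd c (y u)) *v v) = (norm (vector_derivative gam (at u)) / gam u $ 2)^2"
   by (rule curve_from_plane(3)[where eta=gam and gam=y, OF _ C1' _ _ c(1) u yc(1)]) (use below in "auto simp: y_def")
  then obtain v where v: "((snd c \<circ> y) has_vector_derivative v) (at u)" "v \<bullet> (metric_in M c (snd c (y u)) *v v) = 1"
   using unit[of u] pos[of u] by auto
  have "m * (norm v)^2 <= 1" using m(2)[OF yc(2), of v] v(2) by simp
  then have "(sqrt m * norm v)^2 <= 1^2" using m(1) by (simp add: power_mult_distrib)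
  then have "sqrt m * norm v <= 1" by (rule power2_le_imp_le) simp
  then have "norm v <= 1 / sqrt m" using sm by (simp add: field_simps)
  then show ?thesis using vector_derivative_at[OF v(1)] differentiableI_vector[OF v(1)] by simp
 qed
 have near: "\<forall>\<^sub>F u in at_left sigma. y u \<in> {q \<in> fst c. snd c q \<in> ball c0 e}" if e: "0 < e" "e <= rho" for e
 proof -
  define W where "W = {q \<in> fst c. snd c q \<in> ball c0 (e/2)}"
  have oW: "openin (top_space M) W" unfolding W_def by (rule ch(9)) simp
  have pW: "p \<in> W" using c(2) e unfolding W_def c0_def by simp
  define b where "b = max 0 (sigma - e/2 * sqrt m)"
  have b: "b < sigma" "b >= 0" using sigma0 e sm unfolding b_def by auto
  have b3: "sigma - b <= e/2 * sqrt m" using max.cobounded2[of "sigma - e/2 * sqrt m" 0] unfolding b_def by linarith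
  have "\<exists>u\<in>{b<..<sigma}. y u \<in> W"
  proof (rule ccontr)
   assume "\<not> ?thesis"
   then have "\<forall>\<^sub>F u in at_left sigma. y u \<notin> W" by (intro eventually_mono[OF eventually_at_left_real[OF b(1)]]) blast
   then show False using cl[OF oW pW] by blast
  qed
  then obtain u1 where u1: "u1 \<in> {b<..<sigma}" "y u1 \<in> W" by blast
  have "y u \<in> {q \<in> fst c. snd c q \<in> ball c0 e}" if u: "u \<in> {u1<..<sigma}" for u
  proof -
   define d where "d = e/2 + (u - u1) / sqrt m"
   have "u - u1 < e/2 * sqrt m" using u u1(1) b3 unfolding greaterThanLessThan_iff by linarith
   then have "(u - u1) / sqrt m < e/2" using sm by (simp add: field_simps)
   then have d: "d < e" unfolding d_def by linarith
   have de: "e/2 <= d" using u sm unfolding d_def by simp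
   have "y u \<in> {q \<in> fst c. snd c q \<in> cball c0 d}"
   proof (rule barrier[where a=u1 and b=u and gam=y and X="top_space M"])
    show "continuous_map (top_of_set {u1..u}) (top_space M) y" by (rule ycont) (use u u1 b in auto)
    show "openin (top_space M) {q \<in> fst c. snd c q \<in> ball c0 e}" by (rule ch(9)) simp
    show "closedin (top_space M) {q \<in> fst c. snd c q \<in> cball c0 d}"
     by (rule closed_chart_cball[OF manifold_facts(1)[OF mf] ic])
      (use subset_cball[of d rho c0] d e(2) rho(2) in auto)
    show "{q \<in> fst c. snd c q \<in> cball c0 d} \<subseteq> {q \<in> fst c. snd c q \<in> ball c0 e}" using d by auto
    show "y u1 \<in> {q \<in> fst c. snd c q \<in> cball c0 d}" using u1(2) de unfolding W_def by auto
    fix t assume t: "u1 <= t" "t <= u" and sub: "y ` {u1..t} \<subseteq> {q \<in> fst c. snd c q \<in> ball c0 e}"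
    have in': "y w \<in> fst c" "snd c (y w) \<in> ball c0 e" if "w \<in> {u1..t}" for w using subsetD[OF sub imageI[OF that]] by auto
    have in0: "w \<in> {0<..<sigma}" if "w \<in> {u1..t}" for w using that t u u1(1) b(2) by auto
    have inr: "snd c (y w) \<in> cball c0 rho" if "w \<in> {u1..t}" for w using in'(2)[OF that] e(2) by simp
    have "norm ((snd c \<circ> y) t - (snd c \<circ> y) u1) <= (t - u1) * (1 / sqrt m)"
    proof (cases "u1 = t")
     case False
     then have lt: "u1 < t" using t by simp
     let ?D = "%w. vector_derivative (snd c \<circ> y) (at w)"
     have dd: "((snd c \<circ> y) has_derivative (%h. h *\<^sub>R ?D w)) (at w)" if "w \<in> {u1..t}" for w
      using deriv[OF in0[OF that] in'(1)[OF that] inr[OF that]] vector_derivative_works[of "snd c \<circ> y" "at w"]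
      unfolding has_vector_derivative_def by simp
     have "continuous_on {u1..t} (snd c \<circ> y)"
      by (intro continuous_at_imp_continuous_on ballI has_derivative_continuous[OF dd])
     moreover have "((snd c \<circ> y) has_derivative (%h. h *\<^sub>R ?D w)) (at w)" if "u1 < w" "w < t" for w
      by (rule dd) (use that in simp)
     ultimately have "\<exists>w\<in>{u1<..<t}. norm ((snd c \<circ> y) t - (snd c \<circ> y) u1) <= norm ((t - u1) *\<^sub>R ?D w)"
      by (rule mvt_general[OF lt])
     then obtain w where w: "w \<in> {u1<..<t}" "norm ((snd c \<circ> y) t - (snd c \<circ> y) u1) <= norm ((t - u1) *\<^sub>R ?D w)" by blast
     have wi: "w \<in> {u1..t}" using w(1) by simp
     have "norm (?D w) <= 1 / sqrt m" using deriv[OF in0[OF wi] in'(1)[OF wi] inr[OF wi]] by blast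
     then have "(t - u1) * norm (?D w) <= (t - u1) * (1 / sqrt m)" using lt by (intro mult_left_mono) auto
     then show ?thesis using w(2) lt by simp
    qed simp
    also have "\<dots> <= (u - u1) / sqrt m" using t(2) sm by (simp add: divide_right_mono)
    finally have "dist (snd c (y u1)) (snd c (y t)) <= (u - u1) / sqrt m" by (simp add: dist_norm norm_minus_commute)
    moreover have "dist c0 (snd c (y u1)) < e/2" using u1(2) unfolding W_def by simp
    ultimately have "dist c0 (snd c (y t)) <= d"
     using dist_triangle[of c0 "snd c (y t)" "snd c (y u1)"] unfolding d_def by linarith
    then show "y t \<in> {q \<in> fst c. snd c q \<in> cball c0 d}" using in'(1)[of t] t by simp
   qed (use u in auto)
   then show ?thesis using d by auto
  qed
  then show ?thesis
   by (intro eventually_mono[OF eventually_at_left_real[of u1 sigma]]) (use u1(1) in auto)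
 qed
 have lim: "\<forall>\<^sub>F u in at_left sigma. y u \<in> W" if W: "openin (top_space M) W" "p \<in> W" for W
 proof -
  have "open (snd c ` (W \<inter> fst c))" by (rule ch(8)) (use W(1) ch(1) in "auto intro: openin_Int")
  moreover have "c0 \<in> snd c ` (W \<inter> fst c)" using W(2) c(2) unfolding c0_def by blast
  ultimately obtain e where e: "e > 0" "ball c0 e \<subseteq> snd c ` (W \<inter> fst c)" using open_contains_ball by blast
  have "0 < min e rho" "min e rho <= rho" using e(1) rho(1) by auto
  from near[OF this] show ?thesis
  proof eventually_elim
   case (elim u)
   then have "snd c (y u) \<in> snd c ` (W \<inter> fst c)" using e(2) by auto
   then obtain w where "w \<in> W \<inter> fst c" "snd c (y u) = snd c w" by blast
   then show ?case using elim inj_onD[OF ch(3), of "y u" w] by auto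
  qed
 qed
 define zeta where "zeta = (%t. if t < 1 then y (sigma * t) else p)"
 have sigmat: "0 <= sigma * t" "sigma * t < sigma" if "0 <= t" "t < 1" for t using that sigma0 by auto
 have czeta: "continuous_map (top_of_set {0..1}) (top_space M) zeta"
  unfolding continuous_map_def
 proof (intro conjI allI impI)
  show "zeta \<in> topspace (top_of_set {0..1}) \<rightarrow> points M"
  proof
   fix t :: real assume "t \<in> topspace (top_of_set {0..1})"
   then have "t \<in> {0..1}" by simp
   then show "zeta t \<in> points M" using subsetD[OF U_points yU(1)[OF sigmat[of t]]] p by (simp add: zeta_def)
  qed
  fix W assume W: "openin (top_space M) W"
  show "openin (top_of_set {0..1}) {t \<in> topspace (top_of_set {0..1}). zeta t \<in> W}"
  proof (subst openin_subopen, intro ballI)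
   fix t assume "t \<in> {t \<in> topspace (top_of_set {0..1}). zeta t \<in> W}"
   then have t: "t \<in> {0..1}" "zeta t \<in> W" by auto
   show "\<exists>T. openin (top_of_set {0..1}) T \<and> t \<in> T \<and> T \<subseteq> {t \<in> topspace (top_of_set {0..1}). zeta t \<in> W}"
   proof (cases "t < 1")
    case True
    have oQ: "open (F ` (W \<inter> U))" by (rule open_F_image) (use W oU in "auto intro: openin_Int")
    have "open ((%t. gam (sigma * t)) -` (F ` (W \<inter> U)))"
     by (intro open_vimage oQ continuous_on_compose2[OF cont] continuous_intros) auto
    then have "openin (top_of_set {0..1}) ({0..1} \<inter> ({..<1} \<inter> (%t. gam (sigma * t)) -` (F ` (W \<inter> U))))"
     by (intro openin_open_Int open_Int) auto
    moreover have "t \<in> {0..1} \<inter> ({..<1} \<inter> (%t. gam (sigma * t)) -` (F ` (W \<inter> U)))"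
    proof -
     have "y (sigma * t) \<in> W \<inter> U" "F (y (sigma * t)) = gam (sigma * t)" using t True yU[OF sigmat[of t]] by (auto simp: zeta_def)
     then have "gam (sigma * t) \<in> F ` (W \<inter> U)" by (metis imageI)
     then show ?thesis using t True by simp
    qed
    moreover have "{0..1} \<inter> ({..<1} \<inter> (%t. gam (sigma * t)) -` (F ` (W \<inter> U))) \<subseteq> {t \<in> topspace (top_of_set {0..1}). zeta t \<in> W}"
    proof
     fix t' assume t': "t' \<in> {0..1} \<inter> ({..<1} \<inter> (%t. gam (sigma * t)) -` (F ` (W \<inter> U)))"
     then obtain w where "w \<in> W \<inter> U" "gam (sigma * t') = F w" by auto
     then have "y (sigma * t') \<in> W" using F_inv(1)[of w] unfolding y_def by simp
     then show "t' \<in> {t \<in> topspace (top_of_set {0..1}). zeta t \<in> W}" using t' by (simp add: zeta_def)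
    qed
    ultimately show ?thesis by blast
   next
    case False
    then have "p \<in> W" using t by (simp add: zeta_def)
    from lim[OF W this] obtain b where b: "b < sigma" "!!u. b < u ==> u < sigma ==> y u \<in> W"
     unfolding eventually_at_left_field by blast
    have "openin (top_of_set {0..1}) ({0..1} \<inter> {b / sigma<..})" by (intro openin_open_Int) simp
    moreover have "t \<in> {0..1} \<inter> {b / sigma<..}" using t(1) False b(1) sigma0 by (simp add: field_simps)
    moreover have "{0..1} \<inter> {b / sigma<..} \<subseteq> {t \<in> topspace (top_of_set {0..1}). zeta t \<in> W}"
    proof
     fix t' assume t': "t' \<in> {0..1} \<inter> {b / sigma<..}"
     then have "b < sigma * t'" using sigma0 by (simp add: field_simps)
     then show "t' \<in> {t \<in> topspace (top_of_set {0..1}). zeta t \<in> W}"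
      using t' b(2)[of "sigma * t'"] sigmat[of t'] \<open>p \<in> W\<close> by (auto simp: zeta_def)
    qed
    ultimately show ?thesis by blast
   qed
  qed
 qed
 define eta where "eta = (%t. gam (sigma * t))"
 have dgam: "(gam has_vector_derivative vector_derivative gam (at u)) (at u)" for u
  using C1 by (intro vector_derivative_works[THEN iffD1]) (simp add: C1_differentiable_on_eq)
 have deta: "(eta has_vector_derivative (sigma *\<^sub>R vector_derivative gam (at (sigma * t)))) (at t)" for t
 proof -
  have "((%t. sigma * t) has_vector_derivative sigma) (at t)" by (auto intro!: derivative_eq_intros)
  from vector_diff_chain_at[OF this dgam] show ?thesis unfolding eta_def o_def .
 qed
 have C1eta: "eta C1_differentiable_on {0<..<1}" unfolding C1_differentiable_on_def
 proof (intro exI conjI ballI)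
  have "continuous_on UNIV (%u. vector_derivative gam (at u))" using C1 by (simp add: C1_differentiable_on_eq)
  then show "continuous_on {0<..<1} (%t. sigma *\<^sub>R vector_derivative gam (at (sigma * t)))"
   by (intro continuous_on_scaleR continuous_on_const continuous_on_compose2[where f="%t. sigma * t" and g="%u. vector_derivative gam (at u)"])
    (auto intro!: continuous_on_mult_left continuous_on_id)
 qed (rule deta)
 have etaV: "eta t \<in> V" if "t \<in> {0<..<1}" for t unfolding eta_def using below[OF sigmat[of t]] that by simp
 have zetaeta: "zeta t = F_inv (eta t)" if "t \<in> {0<..<1}" for t using that by (simp add: zeta_def eta_def y_def)
 have "piecewise_C1_curve M zeta" unfolding piecewise_C1_curve_def
 proof (intro conjI czeta exI[of _ "{}"] ballI finite.emptyI)
  fix d assume d: "d \<in> atlas M"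
  have "(snd d \<circ> zeta) C1_differentiable_on {t \<in> {0<..<1}. zeta t \<in> fst d}"
   by (rule curve_from_plane(1)[OF _ C1eta etaV zetaeta d]) auto
  then show "(snd d \<circ> zeta) C1_differentiable_on {t \<in> {0<..<1} - {}. zeta t \<in> fst d}" by simp
 qed
 moreover have "curve_length M zeta = ennreal sigma"
 proof -
  have sp: "speed M zeta t = sigma" if t: "t \<in> {0<..<1}" for t
  proof -
   have "speed M zeta t = norm (vector_derivative eta (at t)) / eta t $ 2"
    by (rule curve_from_plane(4)[OF _ C1eta etaV zetaeta t]) auto
   then show ?thesis unfolding vector_derivative_at[OF deta] using unit pos[of "sigma * t"] sigma0 by (simp add: eta_def)
  qed
  have "AE t in lborel. ennreal (speed M zeta t) * indicator {0..1} t = ennreal sigma * indicator {0..1} t"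
   by (rule eventually_mono[OF AE_interval_without_finite[OF finite.emptyI]]) (use sp in "auto simp: indicator_def")
  then have "curve_length M zeta = (\<integral>\<^sup>+t. ennreal sigma * indicator {0..1::real} t \<partial>lborel)"
   unfolding curve_length_def by (rule nn_integral_cong_AE)
  then show ?thesis by (simp add: nn_integral_cmult_indicator)
 qed
 moreover have "zeta 0 = x" "zeta 1 = p" using F_inv(1)[OF xU] start by (simp_all add: zeta_def y_def)
 moreover have "ennreal sigma < ennreal r" using s sigmas sigma0 by (intro ennreal_lessI) linarith+
 ultimately have pU: "p \<in> U" unfolding U metric_ball_iff using p
  by (intro conjI exI[of _ zeta]) simp_all
 have "(gam \<longlongrightarrow> F p) (at_left sigma)"
 proof (rule topological_tendstoI)
  fix Q assume Q: "open Q" "F p \<in> Q"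
  have "\<forall>\<^sub>F u in at_left sigma. y u \<in> {q \<in> U. F q \<in> Q}" by (rule lim[OF F_preimage_open[OF Q(1)]]) (use pU Q in simp)
  with ev0 show "\<forall>\<^sub>F u in at_left sigma. gam u \<in> Q"
  proof eventually_elim
   case (elim u) then show ?case using yU(2)[of u] by auto
  qed
 qed
 moreover have "isCont gam sigma" using cont by (simp add: continuous_on_eq_continuous_at)
 then have "(gam \<longlongrightarrow> gam sigma) (at_left sigma)" unfolding isCont_def by (rule tendsto_mono[OF at_le[OF subset_UNIV]])
 ultimately have "F p = gam sigma" by (rule tendsto_unique[OF trivial_limit_at_left_real])
 then show False using sigmaV F_inv(4)[OF pU] by simp
qed

end

subsection \<open>Second covariant derivative in polar coordinates\<close>

lemma line_derivative:
 fixes f :: "real^'n::finite => real"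
 assumes "f differentiable (at z)"
 shows "((%t. f (z + t *\<^sub>R axis i 1)) has_real_derivative partial i f z) (at 0)"
proof -
 have l: "((%t. z + t *\<^sub>R axis i (1::real)) has_derivative (%h. h *\<^sub>R axis i 1)) (at 0)"
  by (auto intro!: derivative_eq_intros)
 have "f differentiable (at (z + 0 *\<^sub>R axis i 1))" using assms by simp
 from diff_chain_at[OF l has_derivative_partial_sum[OF this]]
 have "((%t. f (z + t *\<^sub>R axis i 1)) has_derivative (%h. h * partial i f z)) (at 0)"
  by (simp add: o_def axis_def if_distrib if_distribR cong: if_cong)
 then show ?thesis by (simp add: has_field_derivative_def mult_commute_abs)
qed

lemma partial_component:
 assumes "Ck_on 1 S f" "open S" "z \<in> S"
 shows "partial i (%z. f z $ a) z = partial i f z $ a"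
 by (rule Ck_on_linear_compose(2)[OF assms(2) bounded_linear_vec_nth _ assms(1,3)]) simp

definition first_kind :: "(real^2 => real^2^2) => 2 => 2 => 2 => real^2 => real" where
 "first_kind g n a b y = (partial a (%y. g y $ b $ n) y + partial b (%y. g y $ a $ n) y - partial n (%y. g y $ a $ b) y) / 2"

text \<open>The covariant acceleration of the map \<open>kap\<close> with its index lowered by the metric \<open>g\<close>.\<close>

definition lowered_accel :: "(real^2 => real^2^2) => (real^2 => real^2) => 2 => 2 => real^2 => real^2" where
 "lowered_accel g kap i j z = (\<chi> n. (g (kap z) *v partial i (partial j kap) z) $ n +
  (\<Sum>a\<in>UNIV. \<Sum>b\<in>UNIV. first_kind g n a b (kap z) * partial i kap z $ a * partial j kap z $ b))"

lemma gram_derivative: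
 fixes kap :: "real^2 => real^2" and g :: "real^2 => real^2^2"
 assumes S: "open S" and Q: "open Q" and kap: "Ck_on 2 S kap" and kapQ: "!!z. z \<in> S ==> kap z \<in> Q" and g: "Ck_on 1 Q g"
  and gram: "!!z. z \<in> S ==> partial j kap z \<bullet> (g (kap z) *v partial l kap z) = G z" and z: "z \<in> S"
 shows "partial i G z = (\<Sum>m\<in>UNIV. \<Sum>n\<in>UNIV.
   partial i (partial j kap) z $ m * g (kap z) $ m $ n * partial l kap z $ n
  + partial j kap z $ m * g (kap z) $ m $ n * partial i (partial l kap) z $ n
  + partial j kap z $ m * partial l kap z $ n * (\<Sum>a\<in>UNIV. partial i kap z $ a * partial a (%y. g y $ m $ n) (kap z)))"
proof -
 have kap1: "Ck_on 1 S kap" "Ck_on 1 S (partial k kap)" for k using Ck_on_mono[OF kap, of 1] kap by (auto simp: numeral_2_eq_2)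
 have gc: "Ck_on 1 Q (%y. g y $ m $ n)" for m n by (intro Ck_on_component Q g)
 let ?e = "%t. z + t *\<^sub>R axis i (1::real)"
 have K: "((%t. partial k kap (?e t) $ m) has_real_derivative partial i (partial k kap) z $ m) (at 0)" for k m
 proof -
  have "(%z. partial k kap z $ m) differentiable (at z)"
   by (rule Ck_on_differentiable[OF Ck_on_component[OF S kap1(2)] _ S z]) simp
  from line_derivative[OF this, of i] show ?thesis unfolding partial_component[OF kap1(2) S z] .
 qed
 have Gd: "((%t. g (kap (?e t)) $ m $ n) has_real_derivative (\<Sum>a\<in>UNIV. partial i kap z $ a * partial a (%y. g y $ m $ n) (kap z))) (at 0)" for m n
 proof -
  have d: "(%y. g y $ m $ n) differentiable (at (kap z))" "kap differentiable (at z)"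
   by (rule Ck_on_differentiable[OF gc _ Q kapQ[OF z]], simp) (rule Ck_on_differentiable[OF kap1(1) _ S z], simp)
  have "Ck_on 1 S (%z. g (kap z) $ m $ n)" by (rule Ck_on_compose[OF S Q kapQ gc kap1(1)])
  then have "(%z. g (kap z) $ m $ n) differentiable (at z)" by (rule Ck_on_differentiable[OF _ _ S z]) simp
  from line_derivative[OF this, of i] show ?thesis
   unfolding partial_compose[OF d, of i] by simp
 qed
 have prod: "((%t. partial j kap (?e t) $ m * g (kap (?e t)) $ m $ n * partial l kap (?e t) $ n) has_real_derivative
   partial i (partial j kap) z $ m * g (kap z) $ m $ n * partial l kap z $ n
  + partial j kap z $ m * g (kap z) $ m $ n * partial i (partial l kap) z $ n
  + partial j kap z $ m * partial l kap z $ n * (\<Sum>a\<in>UNIV. partial i kap z $ a * partial a (%y. g y $ m $ n) (kap z))) (at 0)" for m n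
  by (rule DERIV_cong[OF DERIV_mult[OF DERIV_mult[OF K Gd] K]]) (simp add: algebra_simps)
 have sum: "((%t. \<Sum>m\<in>UNIV. \<Sum>n\<in>UNIV. partial j kap (?e t) $ m * g (kap (?e t)) $ m $ n * partial l kap (?e t) $ n) has_real_derivative
  (\<Sum>m\<in>UNIV. \<Sum>n\<in>UNIV. partial i (partial j kap) z $ m * g (kap z) $ m $ n * partial l kap z $ n
  + partial j kap z $ m * g (kap z) $ m $ n * partial i (partial l kap) z $ n
  + partial j kap z $ m * partial l kap z $ n * (\<Sum>a\<in>UNIV. partial i kap z $ a * partial a (%y. g y $ m $ n) (kap z)))) (at 0)"
  by (intro DERIV_sum prod)
 have GF: "G z = (\<Sum>m\<in>UNIV. \<Sum>n\<in>UNIV. partial j kap z $ m * g (kap z) $ m $ n * partial l kap z $ n)" if "z \<in> S" for z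
  unfolding gram[OF that, symmetric] by (simp add: inner_vec_def matrix_vector_mult_def sum_2 algebra_simps)
 have "Ck_on 1 S (%z. \<Sum>m\<in>UNIV. \<Sum>n\<in>UNIV. partial j kap z $ m * g (kap z) $ m $ n * partial l kap z $ n)"
  by (intro Ck_on_sum Ck_on_mult S finite Ck_on_component kap1 Ck_on_compose[OF S Q kapQ gc])
 then have "Ck_on 1 S G" by (rule Ck_on_cong_imp[OF S, rotated]) (rule GF[symmetric])
 then have "G differentiable (at z)" by (rule Ck_on_differentiable[OF _ _ S z]) simp
 from line_derivative[OF this, of i]
 have l: "((%t. G (?e t)) has_real_derivative partial i G z) (at 0)" .
 have "open (?e -` S)" by (intro open_vimage S continuous_intros)
 then have "((%t. \<Sum>m\<in>UNIV. \<Sum>n\<in>UNIV. partial j kap (?e t) $ m * g (kap (?e t)) $ m $ n * partial l kap (?e t) $ n) has_real_derivative partial i G z) (at 0)"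
  by (rule has_field_derivative_transform_within_open[OF l]) (use z GF in auto)
 from DERIV_unique[OF this sum] show ?thesis .
qed

lemma koszul_formula:
 fixes kap :: "real^2 => real^2" and g G :: "real^2 => real^2^2"
 assumes S: "open S" and Q: "open Q" and kap: "Ck_on 2 S kap" and kapQ: "!!z. z \<in> S ==> kap z \<in> Q" and g: "Ck_on 1 Q g"
  and sym: "!!y. y \<in> Q ==> transpose (g y) = g y"
  and gram: "!!z i j. z \<in> S ==> partial i kap z \<bullet> (g (kap z) *v partial j kap z) = G z $ i $ j" and z: "z \<in> S"
 shows "partial l kap z \<bullet> lowered_accel g kap i j z =
  (partial i (%z. G z $ j $ l) z + partial j (%z. G z $ i $ l) z - partial l (%z. G z $ i $ j) z) / 2"
proof -
 have D: "partial i (%z. G z $ j $ l) z = (\<Sum>m\<in>UNIV. \<Sum>n\<in>UNIV.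
   partial i (partial j kap) z $ m * g (kap z) $ m $ n * partial l kap z $ n
  + partial j kap z $ m * g (kap z) $ m $ n * partial i (partial l kap) z $ n
  + partial j kap z $ m * partial l kap z $ n * (\<Sum>a\<in>UNIV. partial i kap z $ a * partial a (%y. g y $ m $ n) (kap z)))" for i j l
  by (rule gram_derivative[OF S Q kap kapQ g gram z])
 have s: "g y $ 2 $ 1 = g y $ 1 $ 2" if "y \<in> Q" for y
 proof -
  have "g y $ 2 $ 1 = transpose (g y) $ 2 $ 1" unfolding sym[OF that] ..
  also have "\<dots> = g y $ 1 $ 2" by (simp add: transpose_def)
  finally show ?thesis .
 qed
 have s': "partial a (%y. g y $ 2 $ 1) (kap z) = partial a (%y. g y $ 1 $ 2) (kap z)" for a
  by (rule partial_cong[OF Q kapQ[OF z] s])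
 have c: "partial a (partial b kap) z = partial b (partial a kap) z" for a b by (rule mixed_partials_commute[OF S z kap])
 have c1: "partial j (partial i kap) z = partial i (partial j kap) z" "partial l (partial i kap) z = partial i (partial l kap) z"
  "partial l (partial j kap) z = partial j (partial l kap) z" by (rule c)+
 show ?thesis unfolding D[of i j l] D[of j i l] D[of l i j] lowered_accel_def first_kind_def c1
  by (simp add: inner_vec_def matrix_vector_mult_def sum_2 s[OF kapQ[OF z]] s' field_simps)
qed

lemma second_partial_compose:
 fixes kap :: "real^2 => real^2" and f :: "real^2 => 'b::real_normed_vector"
 assumes S: "open S" and Q: "open Q" and kap: "Ck_on 2 S kap" and kapQ: "!!z. z \<in> S ==> kap z \<in> Q" and f: "Ck_on 2 Q f" and z: "z \<in> S"
 shows "partial i (%z. f (kap z)) z = (\<Sum>a\<in>UNIV. (partial i kap z $ a) *\<^sub>R partial a f (kap z))"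
  "partial i (partial j (%z. f (kap z))) z = (\<Sum>a\<in>UNIV. (partial i (partial j kap) z $ a) *\<^sub>R partial a f (kap z)) +
   (\<Sum>a\<in>UNIV. \<Sum>b\<in>UNIV. (partial j kap z $ a * partial i kap z $ b) *\<^sub>R partial b (partial a f) (kap z))"
proof -
 have kap1: "Ck_on 1 S kap" "Ck_on 1 S (partial k kap)" for k using Ck_on_mono[OF kap, of 1] kap by (auto simp: numeral_2_eq_2)
 have f1: "Ck_on 1 Q f" "Ck_on 1 Q (partial k f)" for k using Ck_on_mono[OF f, of 1] f by (auto simp: numeral_2_eq_2)
 have dkap: "kap differentiable (at z)" if "z \<in> S" for z by (rule Ck_on_differentiable[OF kap1(1) _ S that]) simp
 have df: "f differentiable (at (kap z))" "partial k f differentiable (at (kap z))" if "z \<in> S" for z k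
  by (rule Ck_on_differentiable[OF f1(1) _ Q kapQ[OF that]], simp) (rule Ck_on_differentiable[OF f1(2) _ Q kapQ[OF that]], simp)
 have first: "partial k (%z. f (kap z)) z = (\<Sum>a\<in>UNIV. (partial k kap z $ a) *\<^sub>R partial a f (kap z))" if "z \<in> S" for z k
  by (rule partial_compose[OF df(1)[OF that] dkap[OF that]])
 show "partial i (%z. f (kap z)) z = (\<Sum>a\<in>UNIV. (partial i kap z $ a) *\<^sub>R partial a f (kap z))" by (rule first[OF z])
 have cc: "Ck_on 1 S (%z. partial j kap z $ a)" "Ck_on 1 S (%z. partial a f (kap z))" for a
  by (rule Ck_on_component[OF S kap1(2)], rule Ck_on_compose[OF S Q kapQ f1(2) kap1(1)])
 let ?h = "%a z. (partial j kap z $ a) *\<^sub>R partial a f (kap z)"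
 have t: "(?h a has_derivative frechet_derivative (?h a) (at z)) (at z)" for a
  by (rule frechet_derivative_works[THEN iffD1], rule Ck_on_differentiable[OF Ck_on_scaleR[OF S cc(1)[of a] cc(2)[of a]] _ S z]) simp
 have "((%z. \<Sum>a\<in>UNIV. ?h a z) has_derivative (%v. \<Sum>a\<in>UNIV. frechet_derivative (?h a) (at z) v)) (at z)"
  by (rule has_derivative_sum) (rule t)
 note psum = partial_eqI[OF this, of i, folded partial_def[of i "?h _" z]]
 have "partial i (partial j (%z. f (kap z))) z = partial i (%z. \<Sum>a\<in>UNIV. (partial j kap z $ a) *\<^sub>R partial a f (kap z)) z"
  by (rule partial_cong[OF S z first])
 also have "\<dots> = (\<Sum>a\<in>UNIV. partial i (%z. (partial j kap z $ a) *\<^sub>R partial a f (kap z)) z)"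
  by (rule psum)
 also have "\<dots> = (\<Sum>a\<in>UNIV. (partial j kap z $ a) *\<^sub>R (\<Sum>b\<in>UNIV. (partial i kap z $ b) *\<^sub>R partial b (partial a f) (kap z))
   + (partial i (partial j kap) z $ a) *\<^sub>R partial a f (kap z))"
 proof (rule sum.cong[OF refl])
  fix a
  show "partial i (%z. (partial j kap z $ a) *\<^sub>R partial a f (kap z)) z = (partial j kap z $ a) *\<^sub>R (\<Sum>b\<in>UNIV. (partial i kap z $ b) *\<^sub>R partial b (partial a f) (kap z))
   + (partial i (partial j kap) z $ a) *\<^sub>R partial a f (kap z)"
   unfolding Ck_on_bilinear(2)[OF S bounded_bilinear_scaleR order_refl cc(1)[of a] cc(2)[of a] z]
    partial_component[OF kap1(2) S z] partial_compose[OF df(2)[OF z] dkap[OF z]] ..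
 qed
 finally show "partial i (partial j (%z. f (kap z))) z = (\<Sum>a\<in>UNIV. (partial i (partial j kap) z $ a) *\<^sub>R partial a f (kap z)) +
   (\<Sum>a\<in>UNIV. \<Sum>b\<in>UNIV. (partial j kap z $ a * partial i kap z $ b) *\<^sub>R partial b (partial a f) (kap z))"
  by (simp add: sum_2 scaleR_add_right)
qed

lemma continuous_on_lowered_accel:
 assumes S: "open S" and Q: "open Q" and kap: "Ck_on 2 S kap" and kapQ: "!!z. z \<in> S ==> kap z \<in> Q" and g: "Ck_on 1 Q g"
 shows "continuous_on S (lowered_accel g kap i j)"
proof -
 have kap1: "continuous_on S kap" "continuous_on S (partial k kap)" "continuous_on S (partial k (partial l kap))" for k l
  using Ck_on_continuous[OF kap] Ck_on_continuous[of 1 S "partial k kap"] kap by (auto simp: numeral_2_eq_2)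
 have g1: "continuous_on Q (%y. g y $ m $ n)" "continuous_on Q (partial a (%y. g y $ m $ n))" for m n a
  using Ck_on_component[OF Q Ck_on_component[OF Q g], of m n] Ck_on_continuous[of 1 Q "%y. g y $ m $ n"] by auto
 have g2: "continuous_on S (%z. g (kap z) $ m $ n)" "continuous_on S (%z. partial a (%y. g y $ m $ n) (kap z))" for m n a
  by (rule continuous_on_compose2[OF g1(1) kap1(1)], use kapQ in blast)
   (rule continuous_on_compose2[OF g1(2) kap1(1)], use kapQ in blast)
 have "continuous_on S (%z. (\<Sum>m\<in>UNIV. g (kap z) $ n $ m * partial i (partial j kap) z $ m) +
  (\<Sum>a\<in>UNIV. \<Sum>b\<in>UNIV. (partial a (%y. g y $ b $ n) (kap z) + partial b (%y. g y $ a $ n) (kap z)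
   - partial n (%y. g y $ a $ b) (kap z)) / 2 * partial i kap z $ a * partial j kap z $ b))" for n
  by (intro continuous_on_add continuous_on_sum continuous_on_mult continuous_on_divide continuous_on_diff
    continuous_on_const continuous_on_component g2 kap1 ballI) simp
 then show ?thesis unfolding lowered_accel_def first_kind_def matrix_vector_mult_def
  by (intro continuous_on_vec_lambda) simp
qed

lemma inverse_metric_frame:
 fixes g :: "real^2^2"
 assumes "e1 \<bullet> (g *v e1) = 1" "e2 \<bullet> (g *v e2) = 1" "e1 \<bullet> (g *v e2) = 0" "e2 \<bullet> (g *v e1) = 0"
 shows "matrix_inv g = (\<chi> a b. e1 $ a * e1 $ b + e2 $ a * e2 $ b)"
proof -
 define J :: "real^2^2" where "J = (\<chi> a i. if i = 1 then e1 $ a else e2 $ a)"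
 have J: "J *v axis 1 1 = e1" "J *v axis 2 1 = e2"
  by (simp_all add: J_def vec_eq_iff matrix_vector_mult_basis column_def)
 have entry: "(transpose J ** g ** J) $ i $ j = (J *v axis i 1) \<bullet> (g *v (J *v axis j 1))" for i j
  unfolding inner_congruence by (simp add: inner_axis' matrix_vector_mult_basis column_def)
 have "transpose J ** g ** J = mat 1"
  by (simp add: vec_eq_iff forall_2 entry J assms mat_def)
 then have "J ** (transpose J ** g) = mat 1" using matrix_left_right_inverse by blast
 then have "(J ** transpose J) ** g = mat 1" by (simp add: matrix_mul_assoc)
 then have "g ** (J ** transpose J) = mat 1" using matrix_left_right_inverse by blast
 then have "matrix_inv g = J ** transpose J" by (rule matrix_inv_eqI)
 then show ?thesis by (simp add: J_def vec_eq_iff matrix_matrix_mult_def sum_2 transpose_def)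
qed

lemma partial_polar_gram:
 "partial i (%z. polar_gram z $ a $ b) z = (if i = 1 \<and> a = 2 \<and> b = 2 then 2 * sinh (z $ 1) * cosh (z $ 1) else 0)"
proof (cases "a = 2 \<and> b = 2")
 case True
 have "((%x. (sinh x)^2) has_real_derivative 2 * sinh (z $ 1) * cosh (z $ 1)) (at (z $ 1))"
  by (auto intro!: derivative_eq_intros)
 from DERIV_compose_FDERIV[OF this bounded_linear_imp_has_derivative[OF bounded_linear_vec_nth]]
 have "((%z :: real^2. (sinh (z $ 1))^2) has_derivative (%v. v $ 1 * (2 * sinh (z $ 1) * cosh (z $ 1)))) (at z)" .
 from partial_eqI[OF this, of i] show ?thesis using True exhaust_2[of i] by (auto simp: polar_gram_def axis_def)
next
 case False
 then have "(%z. polar_gram z $ a $ b) = (%z. if a = b then 1 else 0)" using exhaust_2[of a] by (auto simp: polar_gram_def)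
 then show ?thesis using False by auto
qed

lemma christoffel_first_kind:
 "christoffel M c k i j y = (\<Sum>l\<in>UNIV. matrix_inv (metric_in M c y) $ k $ l * first_kind (metric_in M c) l i j y)"
 unfolding christoffel_def inverse_metric_def first_kind_def by (simp add: sum_2 field_simps)

lemma cov_hessian_symmetric:
 assumes mf: "riemannian_manifold M" and c: "c \<in> atlas M" and \<phi>: "smooth_function M \<phi>" and y: "y \<in> snd c ` fst c"
 shows "cov_hessian M c \<phi> i j y = cov_hessian M c \<phi> j i y"
proof -
 have o: "open (snd c ` fst c)" by (rule is_chart_facts(2)[OF manifold_facts(2)[OF mf c]])
 have "Ck_on 2 (snd c ` fst c) (\<phi> \<circ> chart_inv c)" using \<phi> c by (simp add: smooth_function_def smooth_on_def)
 from mixed_partials_commute[OF o y this]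
 have 1: "partial i (partial j (\<phi> \<circ> chart_inv c)) y = partial j (partial i (\<phi> \<circ> chart_inv c)) y" .
 have e: "metric_in M c y $ a $ b = metric_in M c y $ b $ a" if "y \<in> snd c ` fst c" for y a b
 proof -
  have "metric_in M c y $ a $ b = transpose (metric_in M c y) $ a $ b"
   unfolding manifold_facts(6)[OF mf c that] ..
  then show ?thesis by (simp add: transpose_def)
 qed
 have "partial l (%y. metric_in M c y $ i $ j) y = partial l (%y. metric_in M c y $ j $ i) y" for l
  by (rule partial_cong[OF o y e])
 then have "christoffel M c k i j y = christoffel M c k j i y" for k unfolding christoffel_def by (simp add: algebra_simps)
 then show ?thesis unfolding cov_hessian_def 1 by simp
qed

definition hess_form :: "('a, 2) riemannian => ('a, 2) chart => ('a => complex) => real^2 => real^2 => real^2 => complex" where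
 "hess_form M c \<phi> y v w = (\<Sum>a\<in>UNIV. \<Sum>b\<in>UNIV. of_real (v $ a * w $ b) * cov_hessian M c \<phi> a b y)"

lemma hess_form_linear:
 "hess_form M c \<phi> y (a *\<^sub>R v + b *\<^sub>R v') w = of_real a * hess_form M c \<phi> y v w + of_real b * hess_form M c \<phi> y v' w"
 "hess_form M c \<phi> y w (a *\<^sub>R v + b *\<^sub>R v') = of_real a * hess_form M c \<phi> y w v + of_real b * hess_form M c \<phi> y w v'"
 by (simp_all add: hess_form_def sum_2 algebra_simps)

lemma norm_sq_frame:
 fixes H :: "2 => 2 => complex" and e1 e2 :: "real^2"
 defines "h \<equiv> %v w :: real^2. \<Sum>a\<in>UNIV. \<Sum>b\<in>UNIV. of_real (v $ a * w $ b) * H a b"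
  and "k \<equiv> %a b. e1 $ a * e1 $ b + e2 $ a * e2 $ b"
 shows "(\<Sum>i\<^sub>1\<in>UNIV. \<Sum>i\<^sub>2\<in>UNIV. \<Sum>j\<^sub>1\<in>UNIV. \<Sum>j\<^sub>2\<in>UNIV. of_real (k i\<^sub>1 j\<^sub>1) * of_real (k i\<^sub>2 j\<^sub>2) * H i\<^sub>1 i\<^sub>2 * cnj (H j\<^sub>1 j\<^sub>2))
  = h e1 e1 * cnj (h e1 e1) + h e1 e2 * cnj (h e1 e2) + h e2 e1 * cnj (h e2 e1) + h e2 e2 * cnj (h e2 e2)"
 unfolding h_def k_def by (simp add: sum_2 algebra_simps)

locale polar_function = polar_chart +
 fixes \<phi> :: "'a => complex" and lam :: real
 assumes smooth: "smooth_function M \<phi>"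
  and eigen: "!!p. p \<in> points M ==> laplacian M \<phi> p = of_real (lam^2) * \<phi> p"
begin

definition u :: "real^2 => complex" where "u = \<phi> \<circ> polar_map"

context
 fixes c assumes c: "c \<in> atlas M"
begin

abbreviation (input) "kap \<equiv> snd c \<circ> polar_map"
abbreviation (input) "g \<equiv> metric_in M c"
abbreviation (input) "f \<equiv> \<phi> \<circ> chart_inv c"
abbreviation (input) "Q \<equiv> snd c ` fst c"

lemma local_facts:
 "open (polar_dom c)" "open Q" "Ck_on k (polar_dom c) kap" "z \<in> polar_dom c ==> kap z \<in> Q"
 "Ck_on k Q g" "Ck_on k Q f" "y \<in> Q ==> transpose (g y) = g y"
 "z \<in> polar_dom c ==> partial i kap z \<bullet> (g (kap z) *v partial j kap z) = polar_gram z $ i $ j"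
 "z \<in> polar_dom c ==> u z = f (kap z)"
proof -
 note ch = is_chart_facts[OF manifold_facts(2)[OF mf c]]
 show "open (polar_dom c)" by (rule open_polar_dom[OF c])
 show "open Q" by (rule ch(2))
 show "Ck_on k (polar_dom c) kap" by (rule Ck_on_polar_coordinates[OF c])
 show "z \<in> polar_dom c ==> kap z \<in> Q" by (auto simp: polar_dom_def)
 show "Ck_on k Q g" by (rule manifold_facts(5)[OF mf c])
 show "Ck_on k Q f" using smooth c by (simp add: smooth_function_def smooth_on_def)
 show "y \<in> Q ==> transpose (g y) = g y" by (rule manifold_facts(6)[OF mf c])
 show "z \<in> polar_dom c ==> partial i kap z \<bullet> (g (kap z) *v partial j kap z) = polar_gram z $ i $ j"
  using polar_coordinates_gram[OF c] by simp
 show "z \<in> polar_dom c ==> u z = f (kap z)" using ch(4) by (auto simp: polar_dom_def u_def)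
qed

lemma Ck_on_u_local: "Ck_on k (polar_dom c) u"
 by (rule Ck_on_cong_imp[OF local_facts(1), rotated, OF Ck_on_compose[OF local_facts(1,2) local_facts(4) local_facts(6) local_facts(3)]])
  (simp_all add: local_facts(9))

lemma koszul:
 assumes "z \<in> polar_dom c"
 shows "partial l kap z \<bullet> lowered_accel g kap i j z =
  (partial i (%z. polar_gram z $ j $ l) z + partial j (%z. polar_gram z $ i $ l) z - partial l (%z. polar_gram z $ i $ j) z) / 2"
 by (rule koszul_formula[OF local_facts(1,2,3) local_facts(4) local_facts(5) local_facts(7) local_facts(8) assms])

lemma partials_span:
 assumes z: "z \<in> polar_dom c" "z $ 1 ~= 0" and w: "partial 1 kap z \<bullet> w = 0" "partial 2 kap z \<bullet> w = 0"
 shows "w = 0"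
proof -
 let ?J = "jacobian kap (at z)"
 have col: "?J *v axis i 1 = partial i kap z" for i by (simp add: vec_eq_iff matrix_vector_mult_basis column_def jacobian_entry)
 have entry: "(transpose ?J ** g (kap z) ** ?J) $ i $ j = (?J *v axis i 1) \<bullet> (g (kap z) *v (?J *v axis j 1))" for i j
  unfolding inner_congruence by (simp add: inner_axis' matrix_vector_mult_basis column_def)
 have cong: "transpose ?J ** g (kap z) ** ?J = polar_gram z"
  unfolding vec_eq_iff entry col local_facts(8)[OF z(1)] by simp
 have "invertible ?J"
 proof (rule invertible_of_congruence[OF cong])
  fix v :: "real^2" assume v: "v ~= 0"
  have "v \<bullet> (polar_gram z *v v) = (v $ 1)^2 + (sinh (z $ 1) * v $ 2)^2"
   by (simp add: inner_vec_def matrix_vector_mult_def sum_2 polar_gram_def power2_eq_square)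
  moreover have "v $ 1 ~= 0 \<or> sinh (z $ 1) * v $ 2 ~= 0" using v z(2) by (auto simp: vec_eq_iff forall_2)
  ultimately show "v \<bullet> (polar_gram z *v v) > 0" using sum_power2_gt_zero_iff by metis
 qed
 then obtain B where B: "?J ** B = mat 1" unfolding invertible_def by blast
 have "w v* ?J = 0" using w by (simp add: vec_eq_iff forall_2 vector_matrix_mult_def inner_vec_def jacobian_entry sum_2 mult.commute)
 then have "(w v* ?J) v* B = 0" by simp
 then show "w = 0" unfolding vector_matrix_mul_assoc B by simp
qed

lemma accel_rr: assumes z: "z \<in> polar_dom c" shows "lowered_accel g kap 1 1 z = 0"
proof -
 have off: "lowered_accel g kap 1 1 z = 0" if "z \<in> polar_dom c" "z $ 1 ~= 0" for z
  by (rule partials_span[OF that]) (simp_all add: koszul[OF that(1)] partial_polar_gram)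
 show ?thesis
 proof (rule ccontr)
  assume ne: "lowered_accel g kap 1 1 z ~= 0"
  have "continuous_on (polar_dom c) (lowered_accel g kap 1 1)"
   by (rule continuous_on_lowered_accel[OF local_facts(1,2,3) local_facts(4) local_facts(5)])
  then have "open (lowered_accel g kap 1 1 -` (- {0}) \<inter> polar_dom c)"
   using continuous_on_open_vimage[OF local_facts(1)] by blast
  moreover have "z \<in> lowered_accel g kap 1 1 -` (- {0}) \<inter> polar_dom c" using ne z by simp
  ultimately obtain e where e: "e > 0" "ball z e \<subseteq> lowered_accel g kap 1 1 -` (- {0}) \<inter> polar_dom c"
   using open_contains_ball by blast
  have z0: "z $ 1 = 0" using ne off[OF z] by blast
  define w where "w = z + (e/2) *\<^sub>R axis 1 1"
  have "w \<in> ball z e" using e(1) by (simp add: w_def dist_norm)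
  then have "lowered_accel g kap 1 1 w ~= 0" "w \<in> polar_dom c" using e(2) by auto
  moreover have "w $ 1 ~= 0" using e(1) z0 by (simp add: w_def axis_def)
  ultimately show False using off[of w] by simp
 qed
qed

lemma accel_tt:
 assumes z: "z \<in> polar_dom c" "z $ 1 ~= 0"
 shows "lowered_accel g kap 2 2 z = - (sinh (z $ 1) * cosh (z $ 1)) *\<^sub>R (g (kap z) *v partial 1 kap z)"
proof -
 have "lowered_accel g kap 2 2 z + (sinh (z $ 1) * cosh (z $ 1)) *\<^sub>R (g (kap z) *v partial 1 kap z) = 0"
 proof -
  have gr: "partial i kap z \<bullet> (g (snd c (polar_map z)) *v partial j kap z) = polar_gram z $ i $ j" for i j
   by (rule polar_coordinates_gram[OF c z(1)])
  have e: "polar_gram z $ 1 $ 1 = 1" "polar_gram z $ 2 $ 1 = 0" by (simp_all add: polar_gram_def)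
  show ?thesis
   by (rule partials_span[OF z]) (simp_all add: inner_add_right koszul[OF z(1)] partial_polar_gram gr e)
 qed
 then show ?thesis by (simp add: eq_neg_iff_add_eq_0)
qed

lemma metric_inverse: assumes "y \<in> Q" shows "matrix_inv (g y) ** g y = mat 1"
proof -
 have "v = 0" if "g y *v v = 0" for v
 proof (rule ccontr)
  assume "v ~= 0"
  from manifold_facts(7)[OF mf c assms this] show False using that by simp
 qed
 then have "invertible (g y)" using matrix_left_invertible_ker[of "g y"] by (simp add: invertible_left_inverse)
 then show ?thesis by (rule matrix_inv_mult)
qed

lemma second_partial_u:
 assumes z: "z \<in> polar_dom c"
 shows "partial i (partial j u) z = hess_form M c \<phi> (kap z) (partial j kap z) (partial i kap z)
   + (\<Sum>k\<in>UNIV. ((matrix_inv (g (kap z)) *v lowered_accel g kap i j z) $ k) *\<^sub>R partial k f (kap z))"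
  "partial i u z = (\<Sum>k\<in>UNIV. (partial i kap z $ k) *\<^sub>R partial k f (kap z))"
proof -
 note sp = second_partial_compose[OF local_facts(1,2,3) local_facts(4) local_facts(6) z]
 have 1: "partial i u z = partial i (%z. f (kap z)) z" if "z \<in> polar_dom c" for i z
  by (rule partial_cong[OF local_facts(1) that local_facts(9)])
 have 2: "partial i (partial j u) z = partial i (partial j (%z. f (kap z))) z"
  by (rule partial_cong[OF local_facts(1) z 1])
 show "partial i u z = (\<Sum>k\<in>UNIV. (partial i kap z $ k) *\<^sub>R partial k f (kap z))" unfolding 1[OF z] by (rule sp(1))
 have 3: "partial i (partial j u) z = (\<Sum>a\<in>UNIV. (partial i (partial j kap) z $ a) *\<^sub>R partial a f (kap z)) +
   (\<Sum>a\<in>UNIV. \<Sum>b\<in>UNIV. (partial j kap z $ a * partial i kap z $ b) *\<^sub>R partial b (partial a f) (kap z))"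
  unfolding 2 by (rule sp(2))
 let ?G = "matrix_inv (g (kap z))"
 define w where "w = (\<chi> n. \<Sum>a\<in>UNIV. \<Sum>b\<in>UNIV. first_kind g n a b (kap z) * partial i kap z $ a * partial j kap z $ b)"
 have "lowered_accel g kap i j z = g (kap z) *v partial i (partial j kap) z + w"
  by (simp add: lowered_accel_def w_def vec_eq_iff)
 then have L: "?G *v lowered_accel g kap i j z = partial i (partial j kap) z + ?G *v w"
  by (simp add: matrix_vector_right_distrib matrix_vector_mul_assoc metric_inverse[OF local_facts(4)[OF z], unfolded o_apply])
 have sym: "first_kind g n a b y = first_kind g n b a y" if "y \<in> Q" for n a b y
 proof -
  have e: "g y $ a $ b = g y $ b $ a" if "y \<in> Q" for y
  proof -
   have "g y $ a $ b = transpose (g y) $ a $ b" unfolding local_facts(7)[OF that] ..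
   then show ?thesis by (simp add: transpose_def)
  qed
  have "partial n (%y. g y $ a $ b) y = partial n (%y. g y $ b $ a) y" by (rule partial_cong[OF local_facts(2) that e])
  then show ?thesis by (simp add: first_kind_def)
 qed
 have s12: "first_kind g n 2 1 (kap z) = first_kind g n 1 2 (kap z)" for n by (rule sym[OF local_facts(4)[OF z]])
 show "partial i (partial j u) z = hess_form M c \<phi> (kap z) (partial j kap z) (partial i kap z)
   + (\<Sum>k\<in>UNIV. ((?G *v lowered_accel g kap i j z) $ k) *\<^sub>R partial k f (kap z))"
  unfolding 3 L hess_form_def cov_hessian_def christoffel_first_kind
  using mixed_partials_commute[OF local_facts(2) local_facts(4)[OF z] local_facts(6), of 2 1]
  by (simp add: sum_2 w_def matrix_vector_mult_def scaleR_conv_of_real s12[unfolded o_apply] algebra_simps)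
qed

end

end

subsection \<open>Volume of the embedded ball\<close>

lemma measurable_pt: "(%(r, t). pt r t) \<in> borel_measurable (lborel \<Otimes>\<^sub>M lborel)"
proof -
 have "(%(r, t). pt r t) \<in> borel_measurable borel" by (rule borel_measurable_continuous_onI[OF continuous_on_pt])
 moreover have "sets (lborel \<Otimes>\<^sub>M lborel) = sets (borel :: (real \<times> real) measure)" unfolding lborel_prod by simp
 ultimately show ?thesis by (simp cong: measurable_cong_sets)
qed

lemma lborel_pt: "distr (lborel \<Otimes>\<^sub>M lborel) borel (%(r, t). pt r t) = lborel"
proof (rule lborel_eqI[symmetric])
 fix l v :: "real^2" assume lv: "!!b. b \<in> Basis ==> l \<bullet> b <= v \<bullet> b"
 have B: "(Basis :: (real^2) set) = {axis 1 1, axis 2 1}"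
  by (auto simp: Basis_vec_def UNIV_2)
 have le: "l $ 1 <= v $ 1" "l $ 2 <= v $ 2" using lv[of "axis 1 1"] lv[of "axis 2 1"] by (simp_all add: B inner_axis)
 note m = measurable_pt
 have "(%(r, t). pt r t) -` box l v \<inter> space (lborel \<Otimes>\<^sub>M lborel) = {l $ 1<..<v $ 1} \<times> {l $ 2<..<v $ 2}"
  by (auto simp: mem_box_cart forall_2 space_pair_measure)
 then have "emeasure (distr (lborel \<Otimes>\<^sub>M lborel) borel (%(r, t). pt r t)) (box l v)
   = emeasure (lborel \<Otimes>\<^sub>M lborel) ({l $ 1<..<v $ 1} \<times> {l $ 2<..<v $ 2})"
  by (subst emeasure_distr[OF m]) simp_all
 also have "\<dots> = emeasure lborel {l $ 1<..<v $ 1} * emeasure lborel {l $ 2<..<v $ 2}"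
  by (rule lborel.emeasure_pair_measure_Times) simp_all
 also have "\<dots> = ennreal ((v $ 1 - l $ 1) * (v $ 2 - l $ 2))" using le by (simp add: ennreal_mult)
 also have "(v $ 1 - l $ 1) * (v $ 2 - l $ 2) = (\<Prod>b\<in>Basis. (v - l) \<bullet> b)" by (simp add: B inner_axis axis_eq_axis)
 finally show "emeasure (distr (lborel \<Otimes>\<^sub>M lborel) borel (%(r, t). pt r t)) (box l v) = (\<Prod>b\<in>Basis. (v - l) \<bullet> b)" .
qed simp

lemma borel_preimage:
 assumes h: "continuous_map (top_of_set S) X h" and S: "S \<in> sets borel" and A: "A \<in> sigma_sets (topspace X) {U. openin X U}"
 shows "S \<inter> h -` A \<in> sets borel"
 using A
proof (induction rule: sigma_sets.induct)
 case (Basic a)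
 then have "openin (top_of_set S) {z \<in> S. h z \<in> a}" using openin_continuous_map_preimage[OF h] by simp
 then obtain T where "open T" "{z \<in> S. h z \<in> a} = S \<inter> T" by (auto simp: openin_open)
 moreover have "{z \<in> S. h z \<in> a} = S \<inter> h -` a" by blast
 ultimately show ?case using S by (simp add: sets.Int borel_open)
next
 case (Compl a)
 have "h z \<in> topspace X" if "z \<in> S" for z using continuous_map_image_subset_topspace[OF h] that by auto
 then have "S \<inter> h -` (topspace X - a) = S - (S \<inter> h -` a)" by blast
 then show ?case using S Compl.IH by (simp add: sets.Diff)
next
 case (Union a)
 have eq: "S \<inter> h -` (\<Union>i. a i) = (\<Union>i. S \<inter> h -` a i)" by blast
 show ?case unfolding eq by (intro sets.countable_UN) (use Union.IH in auto)
qed simp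

lemma volume_facts:
 assumes "riemannian_volume M vol"
 shows "space vol = points M" "sets vol = sigma_sets (points M) {U. openin (top_space M) U}"
  "c \<in> atlas M ==> B \<in> sets vol ==> B \<subseteq> fst c ==>
   emeasure vol B = (\<integral>\<^sup>+x\<in>snd c ` B. ennreal (sqrt (det (metric_in M c x))) \<partial>lborel)"
proof -
 note d = assms[unfolded riemannian_volume_def]
 show "space vol = points M" by (rule d[THEN conjunct1])
 show "sets vol = sigma_sets (points M) {U. openin (top_space M) U}" by (rule d[THEN conjunct2, THEN conjunct1])
 assume "c \<in> atlas M" "B \<in> sets vol" "B \<subseteq> fst c"
 then show "emeasure vol B = (\<integral>\<^sup>+x\<in>snd c ` B. ennreal (sqrt (det (metric_in M c x))) \<partial>lborel)"
  by (rule d[THEN conjunct2, THEN conjunct2, rule_format])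
qed

lemma riemannian_volume_finite:
 fixes M :: "('a, 2) riemannian"
 assumes mf: "riemannian_manifold M" and comp: "compact_space (top_space M)" and rv: "riemannian_volume M vol"
 shows "emeasure vol (points M) < top"
proof -
 let ?\<U> = "{W. openin (top_space M) W \<and> emeasure vol W < top}"
 have os: "W \<in> sets vol" if "openin (top_space M) W" for W
  unfolding volume_facts(2)[OF rv] by (rule sigma_sets.Basic) (simp add: that)
 have "\<exists>W\<in>?\<U>. p \<in> W" if p: "p \<in> points M" for p
 proof -
  define c where "c = chart_at M p"
  have c: "c \<in> atlas M" "p \<in> fst c" using manifold_facts(3,4)[OF mf p] unfolding c_def by auto
  note ch = is_chart_facts[OF manifold_facts(2)[OF mf c(1)]]
  have "snd c p \<in> snd c ` fst c" using c(2) by blast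
  then obtain rho where rho: "rho > 0" "cball (snd c p) rho \<subseteq> snd c ` fst c" using ch(2) open_contains_cball by blast
  define W where "W = {q \<in> fst c. snd c q \<in> ball (snd c p) rho}"
  have oW: "openin (top_space M) W" unfolding W_def by (rule ch(9)) simp
  let ?w = "%y. sqrt (det (metric_in M c y))"
  have "continuous_on (snd c ` fst c) (metric_in M c)" using manifold_facts(5)[OF mf c(1), of 0] by simp
  then have "continuous_on (cball (snd c p) rho) (metric_in M c)" by (rule continuous_on_subset[OF _ rho(2)])
  then have "continuous_on (cball (snd c p) rho) ?w"
   unfolding det_2 by (intro continuous_on_real_sqrt continuous_on_diff continuous_on_mult continuous_on_component)
  then have "compact (?w ` cball (snd c p) rho)" by (rule compact_continuous_image) simp
  then have "bounded (?w ` cball (snd c p) rho)" by (rule compact_imp_bounded)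
  then have "\<exists>B. \<forall>v\<in>?w ` cball (snd c p) rho. norm v <= B" by (rule bounded_iff[THEN iffD1])
  then obtain B where B': "!!v. v \<in> ?w ` cball (snd c p) rho ==> norm v <= B" by blast
  have B: "?w y <= B" if "y \<in> cball (snd c p) rho" for y
   by (rule order_trans[OF abs_ge_self B'[OF imageI[OF that], unfolded real_norm_def]])
  have "emeasure vol W = (\<integral>\<^sup>+y\<in>snd c ` W. ennreal (?w y) \<partial>lborel)"
   by (rule volume_facts(3)[OF rv c(1) os[OF oW]]) (auto simp: W_def)
  also have "\<dots> <= (\<integral>\<^sup>+y. ennreal B * indicator (cball (snd c p) rho) y \<partial>lborel)"
   using B by (intro nn_integral_mono) (auto simp: W_def indicator_def intro: ennreal_leI)
  also have "\<dots> = ennreal B * emeasure lborel (cball (snd c p) rho)" by (rule nn_integral_cmult_indicator) simp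
  also have "\<dots> < top" using emeasure_compact_finite[OF compact_cball, of "snd c p" rho]
   by (simp add: ennreal_mult_less_top)
  finally show ?thesis using oW c(2) rho(1) by (auto simp: W_def)
 qed
 then have "points M \<subseteq> \<Union>?\<U>" by blast
 then obtain \<F> where fin: "finite \<F>" "\<F> \<subseteq> ?\<U>" "points M \<subseteq> \<Union>\<F>"
  using comp[unfolded compact_space_alt, rule_format, of ?\<U>] by blast
 have ss: "\<F> \<subseteq> sets vol" using fin(2) os by blast
 have "emeasure vol (points M) <= emeasure vol (\<Union>W\<in>\<F>. W)"
  by (rule emeasure_mono) (use fin(3) ss fin(1) in "auto intro: sets.finite_Union")
 also have "\<dots> <= (\<Sum>W\<in>\<F>. emeasure vol W)" by (rule emeasure_subadditive_finite[OF fin(1)]) (use ss in auto)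
 also have "\<dots> < top" using fin by (auto simp: ennreal_sum_less_top)
 finally show ?thesis .
qed

context polar_chart
begin

definition rect :: "real => (real^2) set" where
 "rect b = {z. 0 < z $ 1 \<and> z $ 1 < b \<and> 0 < z $ 2 \<and> z $ 2 < 2 * pi}"

lemma open_rect: "open (rect b)"
 unfolding rect_def by (intro open_Collect_conj open_Collect_less continuous_intros)

lemma rect_disc: "b <= R ==> rect b \<subseteq> disc" by (auto simp: rect_def disc_def)

lemma inj_on_polar_map: assumes "b <= R" shows "inj_on polar_map (rect b)"
proof (rule inj_onI)
 fix z w assume zw: "z \<in> rect b" "w \<in> rect b" and e: "polar_map z = polar_map w"
 have 1: "F (polar_map v) = polar (F x) v" if "v \<in> rect b" for v
  unfolding polar_map_def by (rule F_inv(2)[OF disc_V[OF subsetD[OF rect_disc[OF assms] that]]])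
 have "polar (F x) z = polar (F x) w" using 1[OF zw(1)] unfolding e 1[OF zw(2)] by (rule sym)
 then have "polar (F x) (pt (z $ 1) (z $ 2)) = polar (F x) (pt (w $ 1) (w $ 2))" by simp
 then have "z $ 1 = w $ 1 \<and> z $ 2 = w $ 2" by (rule polar_inj[OF Fx_pos, rotated 6]) (use zw in "auto simp: rect_def")
 then show "z = w" by (simp add: vec_eq_iff forall_2)
qed

lemma volume_in_chart:
 assumes rv: "riemannian_volume M vol" and c: "c \<in> atlas M" and A: "A \<in> sets vol" "A \<subseteq> fst c" and b: "b <= R"
 shows "(\<integral>\<^sup>+z. ennreal (sinh (z $ 1)) * indicator (rect b \<inter> polar_map -` A) z \<partial>lborel) <= emeasure vol A"
proof -
 let ?kap = "snd c \<circ> polar_map" and ?g = "metric_in M c"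
 let ?w = "%y. sqrt (det (?g y))"
 note ch = is_chart_facts[OF manifold_facts(2)[OF mf c]]
 define E where "E = rect b \<inter> polar_map -` A"
 define E' where "E' = rect b \<inter> polar_dom c"
 have EE: "E \<subseteq> E'" using A(2) rect_disc[OF b] by (auto simp: E_def E'_def polar_dom_def)
 have oE': "open E'" unfolding E'_def by (intro open_Int open_rect open_polar_dom[OF c])
 have inj: "inj_on ?kap E'"
 proof (rule comp_inj_on)
  show "inj_on polar_map E'" by (rule inj_on_subset[OF inj_on_polar_map[OF b]]) (auto simp: E'_def)
  show "inj_on (snd c) (polar_map ` E')" by (rule inj_on_subset[OF ch(3)]) (auto simp: E'_def polar_dom_def)
 qed
 have k1: "Ck_on 1 E' ?kap" by (rule Ck_on_subset[OF Ck_on_polar_coordinates[OF c]]) (auto simp: E'_def)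
 have oI: "open (?kap ` E')" by (rule invariance_of_domain[OF Ck_on_continuous[OF k1] oE' inj])
 have sub: "?kap ` E' \<subseteq> snd c ` fst c" by (auto simp: E'_def polar_dom_def)
 have A': "A \<in> sigma_sets (points M) {U. openin (top_space M) U}" using A(1) unfolding volume_facts(2)[OF rv] .
 have bE: "E \<in> sets borel"
 proof -
  have "continuous_map (top_of_set (rect b)) (top_space M) polar_map"
   by (rule continuous_map_from_subtopology_mono[OF polar_map_continuous rect_disc[OF b]])
  from borel_preimage[OF this _ A'] show ?thesis unfolding E_def using open_rect by simp
 qed
 have img: "?kap ` E = ?kap ` E' \<inter> chart_inv c -` A"
 proof -
  have ci: "chart_inv c (?kap z) = polar_map z" if "z \<in> E'" for z using that ch(4) by (auto simp: E'_def polar_dom_def)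
  show ?thesis
  proof (intro set_eqI iffI)
   fix y assume "y \<in> ?kap ` E"
   then obtain z where "z \<in> E" "y = ?kap z" by blast
   then show "y \<in> ?kap ` E' \<inter> chart_inv c -` A" using ci[of z] EE by (auto simp: E_def)
  next
   fix y assume "y \<in> ?kap ` E' \<inter> chart_inv c -` A"
   then obtain z where z: "z \<in> E'" "y = ?kap z" "chart_inv c y \<in> A" by blast
   then have "z \<in> E" using ci[of z] by (auto simp: E_def E'_def)
   then show "y \<in> ?kap ` E" using z(2) by blast
  qed
 qed
 have bI: "?kap ` E \<in> sets borel"
 proof -
  have "continuous_map (top_of_set (?kap ` E')) (top_space M) (chart_inv c)"
   by (rule continuous_map_from_subtopology_mono[OF chart_inv_continuous[OF manifold_facts(2)[OF mf c]] sub])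
  from borel_preimage[OF this _ A'] show ?thesis unfolding img using oI by simp
 qed
 have wc: "continuous_on (snd c ` fst c) ?w"
  using manifold_facts(5)[OF mf c, of 0]
  unfolding det_2 by (intro continuous_on_real_sqrt continuous_on_diff continuous_on_mult continuous_on_component) simp_all
 define h where "h = (%y. indicator (?kap ` E) y *\<^sub>R \<bar>?w y\<bar>)"
 have hm: "h \<in> borel_measurable borel"
 proof -
  have "(%y. indicator (?kap ` E') y *\<^sub>R \<bar>?w y\<bar>) \<in> borel_measurable borel"
   by (rule borel_measurable_continuous_on_indicator) (use oI wc sub in "auto intro!: continuous_on_rabs intro: continuous_on_subset")
  then have "(%y. indicator (?kap ` E) y * (indicator (?kap ` E') y *\<^sub>R \<bar>?w y\<bar>)) \<in> borel_measurable borel"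
   by (intro borel_measurable_times borel_measurable_indicator bI)
  moreover have "(%y. indicator (?kap ` E) y * (indicator (?kap ` E') y *\<^sub>R \<bar>?w y\<bar>)) = h"
   using EE by (auto simp: h_def indicator_def fun_eq_iff)
  ultimately show ?thesis by simp
 qed
 have det_eq: "\<bar>det (jacobian ?kap (at z))\<bar> * \<bar>?w (?kap z)\<bar> = sinh (z $ 1)" if z: "z \<in> E'" for z
 proof -
  let ?J = "jacobian ?kap (at z)"
  have zd: "z \<in> polar_dom c" using z by (simp add: E'_def)
  have col: "?J *v axis i 1 = partial i ?kap z" for i by (simp add: vec_eq_iff matrix_vector_mult_basis column_def jacobian_entry)
  have entry: "(transpose ?J ** ?g (?kap z) ** ?J) $ i $ j = (?J *v axis i 1) \<bullet> (?g (?kap z) *v (?J *v axis j 1))" for i j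
   unfolding inner_congruence by (simp add: inner_axis' matrix_vector_mult_basis column_def)
  have "transpose ?J ** ?g (?kap z) ** ?J = polar_gram z"
   unfolding vec_eq_iff entry col using polar_coordinates_gram[OF c zd] by simp
  then have "det (transpose ?J ** ?g (?kap z) ** ?J) = (sinh (z $ 1))^2" by (simp add: det_2 polar_gram_def)
  then have "(det ?J)^2 * det (?g (?kap z)) = (sinh (z $ 1))^2" by (simp add: det_mul det_transpose power2_eq_square ac_simps)
  then have "sqrt ((det ?J)^2 * det (?g (?kap z))) = \<bar>sinh (z $ 1)\<bar>" by simp
  then have "\<bar>det ?J\<bar> * ?w (?kap z) = \<bar>sinh (z $ 1)\<bar>" by (simp add: real_sqrt_mult)
  then have "\<bar>\<bar>det ?J\<bar> * ?w (?kap z)\<bar> = \<bar>sinh (z $ 1)\<bar>" by simp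
  then show ?thesis using z by (simp add: abs_mult E'_def rect_def)
 qed
 have le: "(\<integral>\<^sup>+y. ennreal (h y) \<partial>lborel) <= emeasure vol A"
 proof -
  have w0: "?w y >= 0" if yE: "y \<in> ?kap ` E" for y
  proof -
   obtain z where z: "z \<in> E'" "y = ?kap z" using yE EE by blast
   have "det (?g y) >= 0"
   proof (rule ccontr)
    assume neg: "\<not> det (?g y) >= 0"
    have g: "v ~= 0 ==> v \<bullet> (?g y *v v) > 0" for v
     by (rule manifold_facts(7)[OF mf c]) (use z sub in blast)
    have t: "transpose (?g y) = ?g y" by (rule manifold_facts(6)[OF mf c]) (use z sub in blast)
    have g12: "?g y $ 2 $ 1 = ?g y $ 1 $ 2"
    proof -
     have "?g y $ 2 $ 1 = transpose (?g y) $ 2 $ 1" unfolding t ..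
     then show ?thesis by (simp add: transpose_def)
    qed
    have a: "?g y $ 1 $ 1 > 0" using g[of "axis 1 1"] by (simp add: inner_axis' matrix_vector_mult_basis column_def)
    define v :: "real^2" where "v = pt (- (?g y $ 1 $ 2)) (?g y $ 1 $ 1)"
    have "v \<bullet> (?g y *v v) = ?g y $ 1 $ 1 * det (?g y)"
     by (simp add: v_def inner_vec_def matrix_vector_mult_def sum_2 det_2 g12 algebra_simps)
    moreover have "v ~= 0" using a by (auto simp: v_def vec_eq_iff forall_2)
    ultimately have "?g y $ 1 $ 1 * det (?g y) > 0" using g[of v] by simp
    then show False using neg a by (simp add: zero_less_mult_iff)
   qed
   then show ?thesis by simp
  qed
  have "emeasure vol A = (\<integral>\<^sup>+y\<in>snd c ` A. ennreal (?w y) \<partial>lborel)"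
   by (rule volume_facts(3)[OF rv c A])
  moreover have "(\<integral>\<^sup>+y. ennreal (h y) \<partial>lborel) <= (\<integral>\<^sup>+y\<in>snd c ` A. ennreal (?w y) \<partial>lborel)"
  proof (rule nn_integral_mono)
   fix y
   have "?kap ` E \<subseteq> snd c ` A" by (auto simp: E_def)
   then show "ennreal (h y) <= ennreal (?w y) * indicator (snd c ` A) y"
    using w0[of y] by (auto simp: h_def indicator_def)
  qed
  ultimately show ?thesis by simp
 qed
 show ?thesis
 proof (cases "(\<integral>\<^sup>+y. ennreal (h y) \<partial>lborel) = top")
  case True
  then have "emeasure vol A = top" using le by (simp add: top_unique)
  then show ?thesis by simp
 next
  case False
  define r where "r = enn2real (\<integral>\<^sup>+y. ennreal (h y) \<partial>lborel)"
  have r: "(\<integral>\<^sup>+y. ennreal (h y) \<partial>lborel) = ennreal r" "r >= 0" using False by (simp_all add: r_def less_top)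
  have h0: "h y >= 0" for y by (simp add: h_def indicator_def)
  have "(h has_integral r) UNIV" by (rule nn_integral_has_integral[OF hm h0 r])
  then have "((%y. if y \<in> ?kap ` E then \<bar>?w y\<bar> else 0) has_integral r) UNIV"
   by (rule has_integral_eq[rotated]) (simp add: h_def indicator_def)
  then have hw: "((%y. \<bar>?w y\<bar>) has_integral r) (?kap ` E)" by (simp only: has_integral_restrict_UNIV)
  define W :: "real^2 => real^1" where "W = (%y. vec \<bar>?w y\<bar>)"
  have wabs: "(%y. \<bar>?w y\<bar>) absolutely_integrable_on ?kap ` E"
   by (rule nonnegative_absolutely_integrable_1) (use hw in "auto simp: integrable_on_def")
  have Wint: "W absolutely_integrable_on ?kap ` E \<and> integral (?kap ` E) W = vec r"
   using wabs integral_unique[OF hw] unfolding absolutely_integrable_on_1_iff integral_on_1_eq by (simp add: W_def)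
  have der: "(?kap has_derivative (%v. jacobian ?kap (at z) *v v)) (at z within E)" if zE: "z \<in> E" for z
  proof (rule has_derivative_at_withinI)
   have "?kap differentiable (at z)" by (rule Ck_on_differentiable[OF k1 _ oE']) (use zE EE in auto)
   then show "(?kap has_derivative (%v. jacobian ?kap (at z) *v v)) (at z)" by (rule jacobian_works[THEN iffD1])
  qed
  have EL: "E \<in> sets lebesgue" using bE by simp
  have "(%z. \<bar>det (matrix (%v. jacobian ?kap (at z) *v v))\<bar> *\<^sub>R W (?kap z)) absolutely_integrable_on E \<and>
   integral E (%z. \<bar>det (matrix (%v. jacobian ?kap (at z) *v v))\<bar> *\<^sub>R W (?kap z)) = vec r"
   by (rule has_absolute_integral_change_of_variables[THEN iffD2, OF EL der inj_on_subset[OF inj EE] Wint])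
  then have ai: "(%z. \<bar>det (jacobian ?kap (at z))\<bar> * \<bar>?w (?kap z)\<bar>) absolutely_integrable_on E"
   and ii: "integral E (%z. \<bar>det (jacobian ?kap (at z))\<bar> * \<bar>?w (?kap z)\<bar>) = r"
   unfolding absolutely_integrable_on_1_iff integral_on_1_eq by (simp_all add: W_def vec_eq_iff)
  have "((%z. \<bar>det (jacobian ?kap (at z))\<bar> * \<bar>?w (?kap z)\<bar>) has_integral r) E"
   using integrable_integral[OF set_lebesgue_integral_eq_integral(1)[OF ai]] unfolding ii .
  then have "((%z. sinh (z $ 1)) has_integral r) E"
   by (rule has_integral_eq[rotated]) (use det_eq EE in auto)
  then have "(\<integral>\<^sup>+z. ennreal (sinh (z $ 1)) * indicator E z \<partial>lborel) = ennreal r"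
   by (rule nn_integral_has_integral_lebesgue'[rotated]) (auto simp: E_def rect_def)
  then show ?thesis using le unfolding r E_def by simp
 qed
qed

lemma volume_lower_bound:
 assumes rv: "riemannian_volume M vol" and comp: "compact_space (top_space M)" and b: "b <= R" and h: "h \<in> borel_measurable vol"
 shows "(\<integral>\<^sup>+z. h (polar_map z) * (ennreal (sinh (z $ 1)) * indicator (rect b) z) \<partial>lborel) <= (\<integral>\<^sup>+p. h p \<partial>vol)"
proof -
 have sv: "space vol = points M" "sets vol = sigma_sets (points M) {U. openin (top_space M) U}"
  by (rule volume_facts[OF rv])+
 define \<Psi> where "\<Psi> = (%z. if z \<in> rect b then polar_map z else x)"
 have xp: "x \<in> points M" using x U_points by blast
 have pm: "polar_map z \<in> points M" if "z \<in> rect b" for z using that rect_disc[OF b] polar_map_U U_points by blast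
 have cm: "continuous_map (top_of_set (rect b)) (top_space M) polar_map"
  by (rule continuous_map_from_subtopology_mono[OF polar_map_continuous rect_disc[OF b]])
 have bp: "rect b \<inter> polar_map -` A \<in> sets borel" if "A \<in> sets vol" for A
  by (rule borel_preimage[OF cm]) (use open_rect that in "simp_all add: sv(2)")
 have \<Psi>m: "\<Psi> \<in> measurable borel vol"
 proof (rule measurableI)
  show "\<Psi> z \<in> space vol" for z using xp pm sv by (simp add: \<Psi>_def)
  fix A assume A: "A \<in> sets vol"
  have "\<Psi> -` A \<inter> space borel = (rect b \<inter> polar_map -` A) \<union> (if x \<in> A then - rect b else {})" by (auto simp: \<Psi>_def split: if_splits)
  moreover have "(if x \<in> A then - rect b else {}) \<in> sets borel" using open_rect by auto
  ultimately show "\<Psi> -` A \<inter> space borel \<in> sets borel" using bp[OF A] by auto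
 qed
 have sm: "(%z :: real^2. ennreal (sinh (z $ 1)) * indicator (rect b) z) \<in> borel_measurable borel"
 proof (intro borel_measurable_times_ennreal borel_measurable_indicator)
  have "continuous_on UNIV (%z :: real^2. sinh (z $ 1))" using Ck_on_elementary(1)[OF open_UNIV, of 0 1] by simp
  then show "(%z :: real^2. ennreal (sinh (z $ 1))) \<in> borel_measurable borel"
   by (intro measurable_compose[OF borel_measurable_continuous_onI measurable_ennreal])
 qed (use open_rect in simp)
 define mu where "mu = density lborel (%z. ennreal (sinh (z $ 1)) * indicator (rect b) z)"
 define N where "N = distr mu vol \<Psi>"
 have \<Psi>m': "\<Psi> \<in> measurable mu vol" using \<Psi>m unfolding mu_def by (simp cong: measurable_cong_sets)
 have N: "emeasure N A = (\<integral>\<^sup>+z. ennreal (sinh (z $ 1)) * indicator (rect b \<inter> polar_map -` A) z \<partial>lborel)" if A: "A \<in> sets vol" for A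
 proof -
  have "emeasure N A = emeasure mu (\<Psi> -` A \<inter> space mu)" unfolding N_def by (rule emeasure_distr[OF \<Psi>m' A])
  also have "\<dots> = (\<integral>\<^sup>+z. ennreal (sinh (z $ 1)) * indicator (rect b) z * indicator (\<Psi> -` A \<inter> space mu) z \<partial>lborel)"
   unfolding mu_def by (rule emeasure_density) (use sm measurable_sets[OF \<Psi>m A] in simp_all)
  also have "\<dots> = (\<integral>\<^sup>+z. ennreal (sinh (z $ 1)) * indicator (rect b \<inter> polar_map -` A) z \<partial>lborel)"
   by (rule nn_integral_cong) (auto simp: \<Psi>_def mu_def indicator_def)
  finally show ?thesis .
 qed
 have sN: "sets N = sets vol" by (simp add: N_def)
 obtain C where C: "finite C" "C \<subseteq> fst ` atlas M" "points M \<subseteq> \<Union>C"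
 proof -
  have "\<forall>W\<in>fst ` atlas M. openin (top_space M) W"
   using is_chart_facts(1)[OF manifold_facts(2)[OF mf]] by auto
  moreover have "points M \<subseteq> \<Union>(fst ` atlas M)" using manifold_facts(8)[OF mf] by simp
  ultimately show ?thesis using that comp[unfolded compact_space_alt, rule_format, of "fst ` atlas M"] by blast
 qed
 have cover: "\<forall>A\<in>sets vol. A \<subseteq> \<Union>C' \<longrightarrow> emeasure N A <= emeasure vol A" if "finite C'" "C' \<subseteq> fst ` atlas M" for C'
  using that
 proof (induction C' rule: finite_induct)
  case empty then show ?case by auto
 next
  case (insert W C')
  show ?case
  proof (intro ballI impI)
   fix A assume A: "A \<in> sets vol" "A \<subseteq> \<Union>(insert W C')"
   obtain c where c: "c \<in> atlas M" "W = fst c" using insert.prems by blast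
   have W: "W \<in> sets vol" unfolding c(2) sv(2)
    by (rule sigma_sets.Basic) (use is_chart_facts(1)[OF manifold_facts(2)[OF mf c(1)]] in simp)
   have 1: "emeasure N (A \<inter> W) <= emeasure vol (A \<inter> W)"
    unfolding N[OF sets.Int[OF A(1) W]] by (rule volume_in_chart[OF rv c(1) _ _ b]) (use A W c in auto)
   have 2: "emeasure N (A - W) <= emeasure vol (A - W)"
   proof (rule insert.IH[rule_format])
    show "C' \<subseteq> fst ` atlas M" using insert.prems by simp
    show "A - W \<in> sets vol" by (rule sets.Diff[OF A(1) W])
    show "A - W \<subseteq> \<Union>C'" using A(2) by auto
   qed
   have "emeasure m A = emeasure m (A \<inter> W) + emeasure m (A - W)" if "sets m = sets vol" for m
   proof -
    have "emeasure m (A \<inter> W) + emeasure m (A - W) = emeasure m ((A \<inter> W) \<union> (A - W))"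
     by (rule plus_emeasure) (use A W that in auto)
    moreover have "(A \<inter> W) \<union> (A - W) = A" by blast
    ultimately show ?thesis by simp
   qed
   note eq = this
   show "emeasure N A <= emeasure vol A" unfolding eq[OF sN] eq[OF refl] by (rule add_mono[OF 1 2])
  qed
 qed
 have Nv: "emeasure N A <= emeasure vol A" if "A \<in> sets vol" for A
 proof -
  have "A \<subseteq> \<Union>C" using C(3) sets.sets_into_space[OF that] sv(1) by blast
  then show ?thesis using cover[OF C(1,2)] that by blast
 qed
 have "N <= vol" using Nv sN by (simp add: le_measure)
 then have "(\<integral>\<^sup>+p. h p \<partial>N) <= (\<integral>\<^sup>+p. h p \<partial>vol)" by (rule nn_integral_mono_measure[OF sN])
 moreover have "(\<integral>\<^sup>+p. h p \<partial>N) = (\<integral>\<^sup>+z. h (\<Psi> z) \<partial>mu)" unfolding N_def by (rule nn_integral_distr[OF \<Psi>m']) (use h in simp)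
 moreover have "(\<integral>\<^sup>+z. h (\<Psi> z) \<partial>mu) = (\<integral>\<^sup>+z. ennreal (sinh (z $ 1)) * indicator (rect b) z * h (\<Psi> z) \<partial>lborel)"
  unfolding mu_def by (rule nn_integral_density) (use sm measurable_compose[OF \<Psi>m h] in simp_all)
 moreover have "\<dots> = (\<integral>\<^sup>+z. h (polar_map z) * (ennreal (sinh (z $ 1)) * indicator (rect b) z) \<partial>lborel)"
  by (rule nn_integral_cong) (auto simp: \<Psi>_def indicator_def mult.commute)
 ultimately show ?thesis by simp
qed

lemma radius_bounded:
 assumes rv: "riemannian_volume M vol" and comp: "compact_space (top_space M)"
 shows "ennreal ((R - 2) * (2 * pi)) <= emeasure vol (points M)"
proof (cases "R >= 2")
 case True
 have sv: "space vol = points M" by (rule volume_facts(1)[OF rv])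
 have B: "(Basis :: (real^2) set) = {axis 1 1, axis 2 1}" by (auto simp: Basis_vec_def UNIV_2)
 have "emeasure lborel (box (pt 2 0) (pt R (2 * pi))) = ennreal ((R - 2) * (2 * pi))"
 proof -
  have "emeasure lborel (box (pt 2 0) (pt R (2 * pi))) = (\<Prod>b\<in>Basis. (pt R (2 * pi) - pt 2 0) \<bullet> b)"
   by (rule emeasure_lborel_box) (use True in "auto simp: B inner_axis")
  then show ?thesis by (simp add: B inner_axis axis_eq_axis)
 qed
 then have "ennreal ((R - 2) * (2 * pi)) = (\<integral>\<^sup>+z. indicator (box (pt 2 0) (pt R (2 * pi))) z \<partial>lborel)" by simp
 also have "\<dots> <= (\<integral>\<^sup>+z. 1 * (ennreal (sinh (z $ 1)) * indicator (rect R) z) \<partial>lborel)"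
 proof (rule nn_integral_mono)
  fix z :: "real^2"
  show "indicator (box (pt 2 0) (pt R (2 * pi))) z <= 1 * (ennreal (sinh (z $ 1)) * indicator (rect R) z)"
  proof (cases "z \<in> box (pt 2 0) (pt R (2 * pi))")
   case True
   then have z: "2 < z $ 1" "z \<in> rect R" by (auto simp: mem_box_cart forall_2 rect_def)
   have aux: "1 <= (a - c) / 2" if "3 <= a" "c <= 1" for a c :: real using that by simp
   have "3 <= exp (z $ 1)" using z(1) exp_ge_add_one_self[of "z $ 1"] by linarith
   moreover have "exp (- (z $ 1)) <= 1" using z(1) by simp
   ultimately have "1 <= sinh (z $ 1)" unfolding sinh_field_def by (rule aux)
   then have "ennreal 1 <= ennreal (sinh (z $ 1))" by (rule ennreal_leI)
   then show ?thesis using True z(2) by simp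
  qed simp
 qed
 also have "\<dots> <= (\<integral>\<^sup>+p. 1 \<partial>vol)" by (rule volume_lower_bound[OF rv comp order_refl]) simp
 also have "\<dots> = emeasure vol (points M)" using sv by simp
 finally show ?thesis .
next
 case False
 then have "(R - 2) * (2 * pi) <= 0" by (intro mult_nonpos_nonneg) auto
 then show ?thesis by (simp add: ennreal_neg)
qed

end

context polar_function
begin

lemma chart_choice:
 assumes "z \<in> disc"
 shows "chart_at M (polar_map z) \<in> atlas M" "z \<in> polar_dom (chart_at M (polar_map z))"
proof -
 have "polar_map z \<in> points M" using polar_map_U[OF assms] U_points by blast
 from manifold_facts(3,4)[OF mf this] assms
 show "chart_at M (polar_map z) \<in> atlas M" "z \<in> polar_dom (chart_at M (polar_map z))" by (auto simp: polar_dom_def)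
qed

lemma Ck_on_u: "Ck_on k disc u"
proof (rule Ck_on_local)
 fix z assume z: "z \<in> disc"
 note cc = chart_choice[OF z]
 show "\<exists>T. open T \<and> z \<in> T \<and> Ck_on k T u" using open_polar_dom[OF cc(1)] cc(2) Ck_on_u_local[OF cc(1)] by blast
qed

lemma u_equation:
 assumes z: "z \<in> disc" and nz: "z $ 1 ~= 0"
 shows "partial 1 (partial 1 u) z + of_real (cosh (z $ 1) / sinh (z $ 1)) * partial 1 u z
  + of_real (1 / (sinh (z $ 1))^2) * partial 2 (partial 2 u) z = of_real (- lam\<^sup>2) * u z"
proof -
 define c where "c = chart_at M (polar_map z)"
 note cc = chart_choice[OF z, folded c_def]
 define y where "y = snd c (polar_map z)"
 define k1 where "k1 = partial 1 (snd c \<circ> polar_map) z"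
 define k2 where "k2 = partial 2 (snd c \<circ> polar_map) z"
 define G where "G = metric_in M c y"
 define s where "s = sinh (z $ 1)"
 have s0: "s ~= 0" using nz by (simp add: s_def)
 have yQ: "y \<in> snd c ` fst c" using cc(2) by (auto simp: y_def polar_dom_def)
 have gram: "k1 \<bullet> (G *v k1) = 1" "k2 \<bullet> (G *v k2) = s^2" "k1 \<bullet> (G *v k2) = 0" "k2 \<bullet> (G *v k1) = 0"
  unfolding k1_def k2_def G_def y_def s_def polar_coordinates_gram[OF cc] by (simp_all add: polar_gram_def)
 have "matrix_inv G = (\<chi> a b. k1 $ a * k1 $ b + ((1/s) *\<^sub>R k2) $ a * ((1/s) *\<^sub>R k2) $ b)"
  by (rule inverse_metric_frame) (use gram s0 in "simp_all add: matrix_vector_mult_scaleR power2_eq_square")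
 then have inv: "inverse_metric M c y $ a $ b = k1 $ a * k1 $ b + (1/s^2) * (k2 $ a * k2 $ b)" for a b
  by (simp add: inverse_metric_def G_def power2_eq_square)
 have "laplacian M \<phi> (polar_map z) = - (hess_form M c \<phi> y k1 k1 + of_real (1/s^2) * hess_form M c \<phi> y k2 k2)"
  unfolding laplacian_def Let_def c_def[symmetric] y_def[symmetric] inv hess_form_def
  by (simp add: sum_2 algebra_simps)
 moreover have "laplacian M \<phi> (polar_map z) = of_real (lam^2) * u z"
  using eigen[OF subsetD[OF U_points polar_map_U[OF z]]] by (simp add: u_def)
 ultimately have "- (hess_form M c \<phi> y k1 k1 + of_real (1/s^2) * hess_form M c \<phi> y k2 k2) = of_real (lam^2) * u z" by (rule subst)
 then have "- (- (hess_form M c \<phi> y k1 k1 + of_real (1/s^2) * hess_form M c \<phi> y k2 k2)) = - (of_real (lam^2) * u z)" by (rule arg_cong)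
 then have lap: "hess_form M c \<phi> y k1 k1 + of_real (1/s^2) * hess_form M c \<phi> y k2 k2 = of_real (- lam\<^sup>2) * u z"
  by (simp only: minus_minus of_real_minus mult_minus_left)
 have U11: "partial 1 (partial 1 u) z = hess_form M c \<phi> y k1 k1"
  unfolding second_partial_u(1)[OF cc] accel_rr[OF cc] by (simp add: y_def k1_def)
 have Gi: "matrix_inv G ** G = mat 1" unfolding G_def by (rule metric_inverse[OF cc(1) yQ])
 have "matrix_inv G *v (- (s * cosh (z $ 1)) *\<^sub>R (G *v k1)) = - (s * cosh (z $ 1)) *\<^sub>R k1"
  by (simp only: matrix_vector_mult_scaleR matrix_vector_mul_assoc Gi matrix_vector_mul_lid)
 then have E: "matrix_inv (metric_in M c ((snd c \<circ> polar_map) z)) *v lowered_accel (metric_in M c) (snd c \<circ> polar_map) 2 2 z = - (s * cosh (z $ 1)) *\<^sub>R k1"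
  unfolding accel_tt[OF cc nz] by (simp add: G_def y_def k1_def s_def)
 have U1: "partial 1 u z = (\<Sum>k\<in>UNIV. (k1 $ k) *\<^sub>R partial k (\<phi> \<circ> chart_inv c) y)"
  unfolding second_partial_u(2)[OF cc] by (simp add: k1_def y_def)
 have U22: "partial 2 (partial 2 u) z = hess_form M c \<phi> y k2 k2 - of_real (s * cosh (z $ 1)) * partial 1 u z"
  unfolding second_partial_u(1)[OF cc] E U1 by (simp add: y_def k2_def sum_2 scaleR_conv_of_real[where 'a=complex] algebra_simps)
 have "(1/s^2) * (s * cosh (z $ 1)) = cosh (z $ 1) / s" using s0 by (simp add: power2_eq_square)
 then have m: "of_real (1/s^2) * of_real (s * cosh (z $ 1)) = (of_real (cosh (z $ 1) / s) :: complex)"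
  by (simp only: of_real_mult[symmetric])
 have "A + k * w + m * (B - l * w) = A + m * B + (k - m * l) * w" for A B k l m w :: complex by (simp add: algebra_simps)
 then show ?thesis unfolding U11 U22 s_def[symmetric] by (simp only: m lap diff_self mult_zero_left add_0_right)
qed

definition center_frame :: "real => real^2" where
 "center_frame t = partial 1 (snd (chart_at M x) \<circ> polar_map) (pt 0 t)"

definition e1 where "e1 = center_frame 0"
definition e2 where "e2 = center_frame (pi / 2)"
definition hess_at :: "real^2 => real^2 => complex" where
 "hess_at = hess_form M (chart_at M x) \<phi> (snd (chart_at M x) x)"
definition grad_at :: "real^2 => complex" where
 "grad_at v = (\<Sum>k\<in>UNIV. (v $ k) *\<^sub>R partial k (\<phi> \<circ> chart_inv (chart_at M x)) (snd (chart_at M x) x))"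

lemma center_chart: "chart_at M x \<in> atlas M" "x \<in> fst (chart_at M x)" "pt 0 t \<in> disc" "pt 0 t \<in> polar_dom (chart_at M x)"
proof -
 show d: "pt 0 t \<in> disc" using R by (simp add: disc_def)
 have "x \<in> points M" using x U_points by blast
 from manifold_facts(3,4)[OF mf this] show "chart_at M x \<in> atlas M" "x \<in> fst (chart_at M x)" by auto
 then show "pt 0 t \<in> polar_dom (chart_at M x)" using d by (simp add: polar_dom_def polar_map_0)
qed

lemma center_frame_eq: "center_frame t = cos t *\<^sub>R e1 + sin t *\<^sub>R e2"
proof -
 have "center_frame t = jacobian (snd (chart_at M x) \<circ> F_inv) (at (F x)) *v (F x $ 2 *\<^sub>R pt (sin t) (cos t))" for t
  unfolding center_frame_def partial_polar_coordinates[OF center_chart(1,4)] partial_polar by simp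
 then show ?thesis unfolding e1_def e2_def
  by (simp add: vec_eq_iff forall_2 matrix_vector_mult_def sum_2 algebra_simps)
qed

lemma center_orthonormal:
 defines "G \<equiv> metric_in M (chart_at M x) (snd (chart_at M x) x)"
 shows "e1 \<bullet> (G *v e1) = 1" "e2 \<bullet> (G *v e2) = 1" "e1 \<bullet> (G *v e2) = 0" "e2 \<bullet> (G *v e1) = 0"
proof -
 let ?J = "jacobian (snd (chart_at M x) \<circ> F_inv) (at (F x))"
 have cf: "center_frame t = ?J *v (F x $ 2 *\<^sub>R pt (sin t) (cos t))" for t
  unfolding center_frame_def partial_polar_coordinates[OF center_chart(1,4)] partial_polar by simp
 have dom: "F x \<in> coord_dom (chart_at M x)" using F_inv(1,4)[OF x] center_chart(2) by (simp add: coord_dom_def)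
 have "transpose ?J ** G ** ?J = mat (1 / (F x $ 2)^2)"
  using inverse_coordinates(3)[OF center_chart(1) dom] F_inv(1)[OF x] by (simp add: G_def)
 then have "(?J *v v) \<bullet> (G *v (?J *v w)) = (1 / (F x $ 2)^2) * (v \<bullet> w)" for v w
  unfolding inner_congruence by (simp only: inner_mat_mult)
 then show "e1 \<bullet> (G *v e1) = 1" "e2 \<bullet> (G *v e2) = 1" "e1 \<bullet> (G *v e2) = 0" "e2 \<bullet> (G *v e1) = 0"
  unfolding e1_def e2_def cf using Fx_pos by (simp_all add: inner_vec_def sum_2 power2_eq_square)
qed

lemma center_inverse_metric:
 "inverse_metric M (chart_at M x) (snd (chart_at M x) x) $ a $ b = e1 $ a * e1 $ b + e2 $ a * e2 $ b"
 unfolding inverse_metric_def inverse_metric_frame[OF center_orthonormal] by simp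

lemma hess_at_symmetric: "hess_at v w = hess_at w v"
proof -
 have "snd (chart_at M x) x \<in> snd (chart_at M x) ` fst (chart_at M x)" using center_chart(2) by blast
 from cov_hessian_symmetric[OF mf center_chart(1) smooth this, of 2 1]
 show ?thesis by (simp add: hess_at_def hess_form_def sum_2 algebra_simps)
qed

lemma center_trace: "hess_at e1 e1 + hess_at e2 e2 = of_real (- lam\<^sup>2) * \<phi> x"
proof -
 have "x \<in> points M" using x U_points by blast
 from eigen[OF this]
 have "- (hess_at e1 e1 + hess_at e2 e2) = of_real (lam^2) * \<phi> x"
  unfolding laplacian_def Let_def center_inverse_metric hess_at_def hess_form_def by (simp add: sum_2 algebra_simps)
 then have "- (- (hess_at e1 e1 + hess_at e2 e2)) = - (of_real (lam^2) * \<phi> x)" by (rule arg_cong)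
 then show ?thesis by (simp only: minus_minus of_real_minus mult_minus_left)
qed

lemma norm_sq_center:
 "cov_hessian_norm_sq M \<phi> x = (cmod (hess_at e1 e1))^2 + 2 * (cmod (hess_at e1 e2))^2 + (cmod (hess_at e2 e2))^2"
proof -
 have "cov_hessian_norm_sq M \<phi> x = Re (hess_at e1 e1 * cnj (hess_at e1 e1) + hess_at e1 e2 * cnj (hess_at e1 e2)
   + hess_at e2 e1 * cnj (hess_at e2 e1) + hess_at e2 e2 * cnj (hess_at e2 e2))"
  unfolding cov_hessian_norm_sq_def Let_def center_inverse_metric norm_sq_frame hess_at_def hess_form_def ..
 then show ?thesis unfolding hess_at_symmetric[of e2 e1] complex_norm_square[symmetric] by (simp flip: of_real_add)
qed

lemma center_derivatives:
 "partial 1 u (pt 0 t) = of_real (cos t) * grad_at e1 + of_real (sin t) * grad_at e2"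
 "partial 1 (partial 1 u) (pt 0 t) = of_real ((cos t)^2) * hess_at e1 e1 + of_real (2 * (cos t * sin t)) * hess_at e1 e2
  + of_real ((sin t)^2) * hess_at e2 e2"
proof -
 note cd = center_chart(1,4)
 have "partial 1 u (pt 0 t) = grad_at (center_frame t)"
  unfolding second_partial_u(2)[OF cd] grad_at_def center_frame_def by (simp add: polar_map_0)
 then show "partial 1 u (pt 0 t) = of_real (cos t) * grad_at e1 + of_real (sin t) * grad_at e2"
  unfolding center_frame_eq grad_at_def by (simp add: sum_2 scaleR_conv_of_real[where 'a=complex] algebra_simps)
 have "partial 1 (partial 1 u) (pt 0 t) = hess_at (center_frame t) (center_frame t)"
  unfolding second_partial_u(1)[OF cd] accel_rr[OF cd] hess_at_def center_frame_def by (simp add: polar_map_0)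
 also have "\<dots> = of_real ((cos t)^2) * hess_at e1 e1 + of_real (2 * (cos t * sin t)) * hess_at e1 e2
  + of_real ((sin t)^2) * hess_at e2 e2"
  using hess_at_symmetric[of e2 e1] unfolding center_frame_eq
  unfolding hess_at_def hess_form_linear by (simp add: power2_eq_square algebra_simps)
 finally show "partial 1 (partial 1 u) (pt 0 t) = of_real ((cos t)^2) * hess_at e1 e1 + of_real (2 * (cos t * sin t)) * hess_at e1 e2
  + of_real ((sin t)^2) * hess_at e2 e2" .
qed

lemma u_periodic: "u (pt r (t + 2 * pi)) = u (pt r t)"
 by (simp add: u_def polar_map_def polar_def)

lemma continuous_on_disc_pt:
 assumes "continuous_on disc v" "!!r t. (r, t) \<in> A ==> \<bar>r\<bar> < R"
 shows "continuous_on A (%(r, t). v (pt r t))"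
proof -
 have "continuous_on A (%p. v ((%(r, t). pt r t) p))"
  by (rule continuous_on_compose2[OF assms(1) continuous_on_pt]) (use assms(2) in "auto simp: disc_def")
 then show ?thesis by (simp add: case_prod_beta)
qed

lemma polar_eigenfunction_part:
 assumes L: "bounded_linear L" and sc: "!!a w. L (of_real a * w) = a * L w"
 shows "polar_eigenfunction lam R (%r t. L (u (pt r t))) (%r t. L (partial 1 u (pt r t))) (%r t. L (partial 1 (partial 1 u) (pt r t)))
  (%r t. L (partial 2 u (pt r t))) (%r t. L (partial 2 (partial 2 u) (pt r t))) (L (\<phi> x)) (L (grad_at e1)) (L (grad_at e2))
  (L (hess_at e1 e1)) (L (hess_at e1 e2)) (L (hess_at e2 e2))"
proof -
 have add: "L (v + w) = L v + L w" for v w using L by (simp add: linear_simps)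
 have C: "Ck_on 2 disc u" "Ck_on 1 disc u" "Ck_on 1 disc (partial i u)" for i
  using Ck_on_u[of 2] Ck_on_u[of 1] by (auto simp: numeral_2_eq_2)
 have inD: "pt r t \<in> disc" if "\<bar>r\<bar> < R" for r t using that by (simp add: disc_def)
 have df: "u differentiable (at (pt r t))" "partial i u differentiable (at (pt r t))" if "\<bar>r\<bar> < R" for r t i
  by (rule Ck_on_differentiable[OF C(2) _ open_disc inD[OF that]], simp) (rule Ck_on_differentiable[OF C(3) _ open_disc inD[OF that]], simp)
 have real: "((%s. L (v s)) has_real_derivative L d) (at s)" if "(v has_vector_derivative d) (at s)" for v d s
  using bounded_linear.has_vector_derivative[OF L that] by (simp add: has_real_derivative_iff_has_vector_derivative)
 have cont: "continuous_on ({-R<..<R} \<times> UNIV) (%(r, t). L (v (pt r t)))" if "continuous_on disc v" for v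
 proof -
  have "continuous_on ({-R<..<R} \<times> UNIV) (%(r, t). v (pt r t))" by (rule continuous_on_disc_pt[OF that]) auto
  from bounded_linear.continuous_on[OF L this] show ?thesis by (simp add: case_prod_beta)
 qed
 have cu: "continuous_on disc u" "continuous_on disc (partial i u)" "continuous_on disc (partial i (partial j u))" for i j
  using Ck_on_continuous[OF C(2)] Ck_on_continuous[OF C(3)] C(1) by (auto simp: numeral_2_eq_2)
 show ?thesis
 proof (rule polar_eigenfunction.intro)
  fix r t :: real assume r: "0 < r" "r < R"
  then have "pt r t \<in> disc" "pt r t $ 1 ~= 0" by (auto simp: disc_def)
  from arg_cong[OF u_equation[OF this], of L]
  show "L (partial 1 (partial 1 u) (pt r t)) + cosh r / sinh r * L (partial 1 u (pt r t)) + L (partial 2 (partial 2 u) (pt r t)) / (sinh r)^2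
    = - lam\<^sup>2 * L (u (pt r t))"
   unfolding add sc by simp
 next
  show "L (hess_at e1 e1) + L (hess_at e2 e2) = - lam\<^sup>2 * L (\<phi> x)"
   using arg_cong[OF center_trace, of L] unfolding add sc .
 next
  fix t
  show "L (partial 1 u (pt 0 t)) = L (grad_at e1) * cos t + L (grad_at e2) * sin t"
   unfolding center_derivatives add sc by simp
  show "L (partial 1 (partial 1 u) (pt 0 t)) = L (hess_at e1 e1) * (cos t)^2 + 2 * L (hess_at e1 e2) * (cos t * sin t) + L (hess_at e2 e2) * (sin t)^2"
   unfolding center_derivatives add sc by simp
  show "L (u (pt 0 t)) = L (\<phi> x)" by (simp add: u_def polar_map_0)
 qed (auto intro!: real slice_derivatives df cont cu simp: u_periodic)
qed

lemma mass_le_1: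
 assumes rv: "riemannian_volume M vol" and comp: "compact_space (top_space M)"
  and norm: "(\<integral>p. (cmod (\<phi> p))^2 \<partial>vol) = 1" and b: "0 < b" "b < R"
 shows "integral {0..b} (%r. integral {0..2*pi} (%t. (cmod (u (pt r t)))^2) * sinh r) <= 1"
proof -
 let ?f = "%r t. (cmod (u (pt r t)))^2"
 define G where "G = (%r. integral {0..2*pi} (?f r))"
 have cu: "continuous_on disc u" using Ck_on_u[of 0] by simp
 have cf: "continuous_on ({0..b} \<times> cbox 0 (2*pi)) (%(r, t). ?f r t)"
  by (rule continuous_on_disc_pt[of "%z. (cmod (u z))^2"]) (use cu b in "auto intro!: continuous_intros")
 have cG: "continuous_on {0..b} G"
  using integral_continuous_on_param[OF cf] by (simp add: G_def cbox_interval)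
 have inner: "(?f r has_integral G r) {0..2*pi}" if "r \<in> {0..b}" for r
  unfolding G_def
 proof (rule integrable_integral, rule integrable_continuous_real)
  have "continuous_on {0..2*pi} (%t. (%(r, t). ?f r t) (r, t))"
   by (rule continuous_on_compose2[OF cf]) (use that in "auto intro!: continuous_intros simp: cbox_interval")
  then show "continuous_on {0..2*pi} (?f r)" by simp
 qed
 have G0: "G r >= 0" if "r \<in> {0..b}" for r by (rule has_integral_nonneg[OF inner[OF that]]) simp
 define I where "I = integral {0..b} (%r. G r * sinh r)"
 have "((%r. G r * sinh r) has_integral I) {0..b}" unfolding I_def
  by (intro integrable_integral integrable_continuous_real continuous_on_mult cG continuous_intros)
 then have outer: "(\<integral>\<^sup>+r. ennreal (G r * sinh r) * indicator {0..b} r \<partial>lborel) = ennreal I"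
  by (rule nn_integral_has_integral_lebesgue'[rotated]) (simp add: G0)
 define H where "H = (%z. ennreal ((cmod (u z))^2) * (ennreal (sinh (z $ 1)) * indicator (rect b) z))"
 have Hm: "H \<in> borel_measurable borel"
 proof -
  have "continuous_on (rect b) (%z. (cmod (u z))^2 * sinh (z $ 1))"
   using continuous_on_subset[OF cu rect_disc[of b]] b continuous_on_subset[OF Ck_on_continuous[OF Ck_on_elementary(1)[OF open_UNIV, of 0 1]], of "rect b"]
   by (intro continuous_on_mult continuous_on_power continuous_on_norm) auto
  from borel_measurable_continuous_on_indicator[OF _ this] open_rect
  have "(%z. indicator (rect b) z *\<^sub>R ((cmod (u z))^2 * sinh (z $ 1))) \<in> borel_measurable borel" by simp
  then have "(%z. ennreal (indicator (rect b) z *\<^sub>R ((cmod (u z))^2 * sinh (z $ 1)))) \<in> borel_measurable borel" by simp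
  moreover have "(%z. ennreal (indicator (rect b) z *\<^sub>R ((cmod (u z))^2 * sinh (z $ 1)))) = H"
   by (auto simp: H_def fun_eq_iff indicator_def ennreal_mult rect_def)
  ultimately show ?thesis by simp
 qed
 have "(\<integral>\<^sup>+z. H z \<partial>lborel) = (\<integral>\<^sup>+z. H z \<partial>distr (lborel \<Otimes>\<^sub>M lborel) borel (%(r, t). pt r t))" unfolding lborel_pt ..
 also have "\<dots> = (\<integral>\<^sup>+p. H ((%(r, t). pt r t) p) \<partial>(lborel \<Otimes>\<^sub>M lborel))" by (rule nn_integral_distr[OF measurable_pt]) (use Hm in simp)
 also have "\<dots> = (\<integral>\<^sup>+r. \<integral>\<^sup>+t. H ((%(r, t). pt r t) (r, t)) \<partial>lborel \<partial>lborel)"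
  by (rule lborel.nn_integral_fst[symmetric]) (rule measurable_compose[OF measurable_pt Hm])
 also have "\<dots> = (\<integral>\<^sup>+r. ennreal (G r * sinh r) * indicator {0..b} r \<partial>lborel)"
 proof (rule nn_integral_cong_AE)
  have slice: "(\<integral>\<^sup>+t. H (pt r t) \<partial>lborel) = ennreal (G r * sinh r) * indicator {0..b} r" if r: "r ~= 0" "r ~= b" for r
  proof (cases "r \<in> {0..b}")
   case True
   then have rr: "0 < r" "r < b" using r by auto
   have "AE t in lborel. H (pt r t) = ennreal (?f r t * sinh r) * indicator {0..2*pi} t"
   proof -
    have "AE t in lborel. t ~= (0::real)" "AE t in lborel. t ~= 2*pi" by (rule AE_lborel_singleton)+
    then show ?thesis
    proof eventually_elim
     case (elim t)
     then show ?case using rr by (auto simp: H_def rect_def indicator_def ennreal_mult)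
    qed
   qed
   then have "(\<integral>\<^sup>+t. H (pt r t) \<partial>lborel) = (\<integral>\<^sup>+t. ennreal (?f r t * sinh r) * indicator {0..2*pi} t \<partial>lborel)"
    by (rule nn_integral_cong_AE)
   also have "\<dots> = ennreal (G r * sinh r)"
    by (rule nn_integral_has_integral_lebesgue'[OF _ has_integral_mult_left[OF inner[OF True]]]) (use rr in simp)
   finally show ?thesis using True by simp
  next
   case False
   then have "H (pt r t) = 0" for t using b by (auto simp: H_def rect_def)
   then show ?thesis using False by simp
  qed
  have "AE r in lborel. r ~= (0::real)" "AE r in lborel. r ~= b" by (rule AE_lborel_singleton)+
  then show "AE r in lborel. (\<integral>\<^sup>+t. H ((%(r, t). pt r t) (r, t)) \<partial>lborel) = ennreal (G r * sinh r) * indicator {0..b} r"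
  proof eventually_elim
   case (elim r)
   then show ?case using slice[of r] by simp
  qed
 qed
 also have "\<dots> = ennreal I" by (rule outer)
 finally have HI: "(\<integral>\<^sup>+z. H z \<partial>lborel) = ennreal I" .
 have int: "integrable vol (%p. (cmod (\<phi> p))^2)"
 proof (rule ccontr)
  assume "\<not> ?thesis"
  then have "(\<integral>p. (cmod (\<phi> p))^2 \<partial>vol) = 0" by (rule not_integrable_integral_eq)
  then show False using norm by simp
 qed
 have "(\<integral>\<^sup>+p. ennreal ((cmod (\<phi> p))^2) \<partial>vol) = ennreal 1"
  using nn_integral_eq_integral[OF int] norm by simp
 moreover have "(\<integral>\<^sup>+z. H z \<partial>lborel) <= (\<integral>\<^sup>+p. ennreal ((cmod (\<phi> p))^2) \<partial>vol)"
  using volume_lower_bound[OF rv comp less_imp_le[OF b(2)], of "%p. ennreal ((cmod (\<phi> p))^2)"] int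
  by (simp add: H_def u_def)
 ultimately have "ennreal I <= ennreal 1" using HI by simp
 then have "I <= 1" by (simp only: ennreal_le_iff zero_le_one)
 then show ?thesis unfolding I_def G_def .
qed

lemma hessian_norm_bound:
 assumes rv: "riemannian_volume M vol" and comp: "compact_space (top_space M)"
  and norm: "(\<integral>p. (cmod (\<phi> p))^2 \<partial>vol) = 1" and lam: "0 <= lam" and b: "0 < b" "b < R" and beta: "bound_minorant lam b <= beta"
 shows "2 * pi * cov_hessian_norm_sq M \<phi> x <= beta"
proof -
 interpret re: polar_eigenfunction lam R "%r t. Re (u (pt r t))" "%r t. Re (partial 1 u (pt r t))" "%r t. Re (partial 1 (partial 1 u) (pt r t))"
  "%r t. Re (partial 2 u (pt r t))" "%r t. Re (partial 2 (partial 2 u) (pt r t))" "Re (\<phi> x)" "Re (grad_at e1)" "Re (grad_at e2)"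
  "Re (hess_at e1 e1)" "Re (hess_at e1 e2)" "Re (hess_at e2 e2)"
  by (rule polar_eigenfunction_part[OF bounded_linear_Re]) simp
 interpret im: polar_eigenfunction lam R "%r t. Im (u (pt r t))" "%r t. Im (partial 1 u (pt r t))" "%r t. Im (partial 1 (partial 1 u) (pt r t))"
  "%r t. Im (partial 2 u (pt r t))" "%r t. Im (partial 2 (partial 2 u) (pt r t))" "Im (\<phi> x)" "Im (grad_at e1)" "Im (grad_at e2)"
  "Im (hess_at e1 e1)" "Im (hess_at e1 e2)" "Im (hess_at e2 e2)"
  by (rule polar_eigenfunction_part[OF bounded_linear_Im]) simp
 have cu: "continuous_on disc u" using Ck_on_u[of 0] by simp
 define A where "A = (%(L :: complex => real) r. integral {0..2*pi} (%t. (L (u (pt r t)))^2) * sinh r)"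
 have ci: "(%t. (L (u (pt r t)))^2) integrable_on {0..2*pi}" "A L integrable_on {0..b}" if L: "continuous_on UNIV L" and r: "r \<in> {0..b}" for L r
 proof -
  have cf: "continuous_on ({0..b} \<times> cbox 0 (2*pi)) (%(r, t). (L (u (pt r t)))^2)"
   by (rule continuous_on_disc_pt[of "%z. (L (u z))^2"]) (use b in "auto intro!: continuous_on_power continuous_on_compose2[OF L cu]")
  have "continuous_on {0..2*pi} (%t. (%(r, t). (L (u (pt r t)))^2) (r, t))"
   by (rule continuous_on_compose2[OF cf]) (use r in "auto intro!: continuous_intros simp: cbox_interval")
  then show "(%t. (L (u (pt r t)))^2) integrable_on {0..2*pi}" by (intro integrable_continuous_real) simp
  have "continuous_on {0..b} (%r. integral {0..2*pi} (%t. (L (u (pt r t)))^2))"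
   using integral_continuous_on_param[OF cf] by (simp add: cbox_interval)
  then have "continuous_on {0..b} (A L)" unfolding A_def by (intro continuous_on_mult) (auto intro!: continuous_intros)
  then show "A L integrable_on {0..b}" by (rule integrable_continuous_real)
 qed
 have RI: "continuous_on UNIV Re" "continuous_on UNIV Im" by (auto intro!: continuous_intros)
 have b0: "0 \<in> {0..b}" using b by simp
 have "integral {0..b} (A Re) + integral {0..b} (A Im) = integral {0..b} (%r. A Re r + A Im r)"
  by (rule integral_add[OF ci(2)[OF RI(1) b0] ci(2)[OF RI(2) b0], symmetric])
 also have "\<dots> = integral {0..b} (%r. integral {0..2*pi} (%t. (cmod (u (pt r t)))^2) * sinh r)"
 proof (rule integral_cong)
  fix r assume r: "r \<in> {0..b}"
  have "integral {0..2*pi} (%t. (cmod (u (pt r t)))^2) = integral {0..2*pi} (%t. (Re (u (pt r t)))^2 + (Im (u (pt r t)))^2)"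
   by (simp only: cmod_power2)
  also have "\<dots> = integral {0..2*pi} (%t. (Re (u (pt r t)))^2) + integral {0..2*pi} (%t. (Im (u (pt r t)))^2)"
   by (rule integral_add[OF ci(1)[OF RI(1) r] ci(1)[OF RI(2) r]])
  finally show "A Re r + A Im r = integral {0..2*pi} (%t. (cmod (u (pt r t)))^2) * sinh r" by (simp add: A_def distrib_right)
 qed
 also have "\<dots> <= 1" by (rule mass_le_1[OF rv comp norm b])
 finally have mass: "integral {0..b} (A Re) + integral {0..b} (A Im) <= 1" .
 have beta0: "beta >= 0" using bound_minorant_nonneg[OF lam b(1)] beta by linarith
 have "2 * pi * cov_hessian_norm_sq M \<phi> x
  = 2*pi * ((Re (hess_at e1 e1))^2 + 2 * (Re (hess_at e1 e2))^2 + (Re (hess_at e2 e2))^2)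
  + 2*pi * ((Im (hess_at e1 e1))^2 + 2 * (Im (hess_at e1 e2))^2 + (Im (hess_at e2 e2))^2)"
  unfolding norm_sq_center cmod_power2 by (simp add: algebra_simps)
 also have "\<dots> <= beta * integral {0..b} (A Re) + beta * integral {0..b} (A Im)"
  unfolding A_def by (intro add_mono re.hessian_bound[OF b lam beta] im.hessian_bound[OF b lam beta])
 also have "\<dots> <= beta * 1" unfolding distrib_left[symmetric] by (rule mult_left_mono[OF mass beta0])
 finally show ?thesis by simp
qed

end

subsection \<open>The bound\<close>

lemma bound_minorant_le_bound:
 fixes b lam :: real
 assumes b: "b > 0" and lam: "lam >= 0"
 shows "bound_minorant lam b <= 2 * pi * (1 / (12 * pi) * ((24 * (nu 4)^2 + 6 * pi * nu 4) / (pi * (2 * b)) * (lam + nu 4 / (2 * b)) ^ 5)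
  + 1 / (8 * pi) * ((16 * (nu 3)^2 + 4 * pi * nu 3) / (pi * (2 * b)) * (lam + nu 3 / (2 * b)) ^ 3)
  + 29 / (630 * pi))"
proof -
 have n: "515/100 <= nu 4" "44/10 <= nu 3" by (rule nu_4_ge, rule nu_3_ge)
 have p: "pi > 0" "pi <= 3146/1000" using pi_approx by simp_all
 have "(515/100)^2 <= (nu 4)^2" "(44/10)^2 <= (nu 3)^2" by (rule power_mono, use n in simp_all)+
 then have sq: "265225/10000 <= (nu 4)^2" "1936/100 <= (nu 3)^2" by (simp_all add: power2_eq_square)
 have "194/10 * pi <= 2 * (nu 4)^2 + 515/200 * pi" "145/10 * pi <= 2 * (nu 3)^2 + 44/20 * pi" using sq p(2) by linarith+
 moreover have "515/200 * pi <= nu 4 / 2 * pi" "44/20 * pi <= nu 3 / 2 * pi" by (rule mult_right_mono, use n p in simp_all)+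
 ultimately have "194/10 * pi <= 2 * (nu 4)^2 + nu 4 / 2 * pi" "145/10 * pi <= 2 * (nu 3)^2 + nu 3 / 2 * pi" by linarith+
 then have "194/10 <= (2 * (nu 4)^2 + nu 4 / 2 * pi) / pi" "145/10 <= (2 * (nu 3)^2 + nu 3 / 2 * pi) / pi"
  unfolding pos_le_divide_eq[OF p(1)] .
 then have c: "194/10 <= 2 * (nu 4)^2 / pi + nu 4 / 2" "145/10 <= 2 * (nu 3)^2 / pi + nu 3 / 2"
  using p(1) by (simp_all add: add_divide_distrib)
 have s: "lam + 257/100/b <= lam + nu 4 / (2 * b)" "lam + 22/10/b <= lam + nu 3 / (2 * b)"
  using n b by (simp_all add: field_simps)
 have pos: "0 <= lam + 257/100/b" "0 <= lam + 22/10/b" using b lam by simp_all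
 have "194/10 / b * (lam + 257/100/b)^5 <= (2 * (nu 4)^2 / pi + nu 4 / 2) / b * (lam + nu 4 / (2 * b))^5"
  by (intro mult_mono power_mono divide_right_mono s c pos) (use b c pos in auto)
 moreover have "145/10 / b * (lam + 22/10/b)^3 <= (2 * (nu 3)^2 / pi + nu 3 / 2) / b * (lam + nu 3 / (2 * b))^3"
  by (intro mult_mono power_mono divide_right_mono s c pos) (use b c pos in auto)
 moreover have "92/1000 <= (29/315 :: real)" by simp
 ultimately have "bound_minorant lam b <= (2 * (nu 4)^2 / pi + nu 4 / 2) / b * (lam + nu 4 / (2 * b))^5
   + (2 * (nu 3)^2 / pi + nu 3 / 2) / b * (lam + nu 3 / (2 * b))^3 + 29/315"
  unfolding bound_minorant_def by linarith
 also have "\<dots> = 2 * pi * (1 / (12 * pi) * ((24 * (nu 4)^2 + 6 * pi * nu 4) / (pi * (2 * b)) * (lam + nu 4 / (2 * b)) ^ 5)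
  + 1 / (8 * pi) * ((16 * (nu 3)^2 + 4 * pi * nu 3) / (pi * (2 * b)) * (lam + nu 3 / (2 * b)) ^ 3)
  + 29 / (630 * pi))"
 proof -
  define X Y where "X = (lam + nu 4 / (2 * b)) ^ 5" and "Y = (lam + nu 3 / (2 * b)) ^ 3"
  show ?thesis unfolding X_def[symmetric] Y_def[symmetric] using p(1) b by (simp add: field_simps power2_eq_square)
 qed
 finally show ?thesis .
qed

lemma polar_function_of_isometric_ball:
 assumes hs: "hyperbolic_surface M" and comp: "compact_space (top_space M)" and x: "x \<in> points M" and r: "r > 0"
  and eig: "laplace_eigenfunction M (lam^2) \<phi>"
  and iso: "riemannian_isometry M (metric_ball M x r) hyperbolic_plane V F"
 shows "polar_function M (metric_ball M x r) V F x r \<phi> lam"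
proof -
 have mf: "riemannian_manifold M" using hs by (simp add: hyperbolic_surface_def)
 interpret hyperbolic_chart M "metric_ball M x r" V F by (rule hyperbolic_chart.intro[OF mf iso])
 have xU: "x \<in> metric_ball M x r" by (rule center_in_metric_ball[OF x r])
 have q: "F x $ 2 > 0" by (rule F_pos[OF xU])
 have V: "polar (F x) (pt s t) \<in> V" if "0 <= s" "s < r" for s t
  by (rule unit_speed_curve_stays[OF comp refl xU polar_geodesic(1)[OF q] polar_0 polar_geodesic(2)[OF q] polar_2_pos[OF q] that])
 have smooth: "smooth_function M \<phi>" using eig by (simp add: laplace_eigenfunction_def)
 have ev: "laplacian M \<phi> p = of_real (lam^2) * \<phi> p" if "p \<in> points M" for p
  using eig that unfolding laplace_eigenfunction_def by blast
 show ?thesis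
  by (intro polar_function.intro polar_chart.intro polar_chart_axioms.intro polar_function_axioms.intro
    hyperbolic_chart_axioms xU r V smooth ev)
qed

theorem corollary3p14:
  fixes M :: "('a, 2) riemannian" and vol :: "'a measure"
    and x :: 'a and \<phi> :: "'a \<Rightarrow> complex" and lam d :: real
  assumes "hyperbolic_surface M" and "compact_space (top_space M)"
    and "riemannian_volume M vol"
    and "x \<in> points M" and "d = embedded_ball_diameter M x"
    and "lam \<ge> 0" and "laplace_eigenfunction M (lam\<^sup>2) \<phi>"
    and "(\<integral>p. (cmod (\<phi> p))\<^sup>2 \<partial>vol) = 1"
  shows "cov_hessian_norm_sq M \<phi> x \<le>
     1 / (12 * pi) * ((24 * (nu 4)\<^sup>2 + 6 * pi * nu 4) / (pi * d) * (lam + nu 4 / d) ^ 5)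
     + 1 / (8 * pi) * ((16 * (nu 3)\<^sup>2 + 4 * pi * nu 3) / (pi * d) * (lam + nu 3 / d) ^ 3)
     + 29 / (630 * pi)"
proof -
 let ?S = "{r. r > 0 \<and> (\<exists>p\<in>points hyperbolic_plane. \<exists>s>0. \<exists>F.
  riemannian_isometry M (metric_ball M x r) hyperbolic_plane (metric_ball hyperbolic_plane p s) F)}"
 define B where "B = (%d. 1 / (12 * pi) * ((24 * (nu 4)^2 + 6 * pi * nu 4) / (pi * d) * (lam + nu 4 / d) ^ 5)
  + 1 / (8 * pi) * ((16 * (nu 3)^2 + 4 * pi * nu 3) / (pi * d) * (lam + nu 3 / d) ^ 3)
  + 29 / (630 * pi))"
 define rho where "rho = Sup ?S"
 have d: "d = 2 * rho" using assms(5) unfolding embedded_ball_diameter_def rho_def .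
 have mf: "riemannian_manifold M" using assms(1) by (simp add: hyperbolic_surface_def)
 have polar: "\<exists>V F. polar_function M (metric_ball M x r) V F x r \<phi> lam" if r: "r \<in> ?S" for r
 proof -
  from r obtain p s F where "r > 0"
   "riemannian_isometry M (metric_ball M x r) hyperbolic_plane (metric_ball hyperbolic_plane p s) F" by blast
  from polar_function_of_isometric_ball[OF assms(1,2,4) this(1) assms(7) this(2)] show ?thesis by blast
 qed
 define v where "v = enn2real (emeasure vol (points M))"
 have v: "emeasure vol (points M) = ennreal v" "v >= 0"
  using riemannian_volume_finite[OF mf assms(2,3)] by (simp_all add: v_def)
 have upper: "r <= v / (2 * pi) + 2" if r: "r \<in> ?S" for r
 proof -
  from polar[OF r] obtain V F where "polar_function M (metric_ball M x r) V F x r \<phi> lam" by blast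
  then interpret polar_function M "metric_ball M x r" V F x r \<phi> lam .
  have "(r - 2) * (2 * pi) <= v" using radius_bounded[OF assms(3,2)] v by (simp add: ennreal_le_iff)
  then show ?thesis by (simp add: field_simps)
 qed
 obtain r0 where r0: "r0 \<in> ?S" using embedded_ball_exists[OF assms(1,4)] by blast
 then have ne: "?S ~= {}" by blast
 have "r0 <= rho" unfolding rho_def by (rule cSup_upper[OF r0 bdd_aboveI[OF upper]])
 moreover have "r0 > 0" using r0 by simp
 ultimately have rho: "rho > 0" by simp
 have bound: "cov_hessian_norm_sq M \<phi> x <= B (2 * b)" if b: "0 < b" "b < rho" for b
 proof -
  obtain r where r: "r \<in> ?S" "b < r" using less_cSupD[OF ne b(2)[unfolded rho_def]] by blast
  from polar[OF r(1)] obtain V F where "polar_function M (metric_ball M x r) V F x r \<phi> lam" by blast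
  then interpret polar_function M "metric_ball M x r" V F x r \<phi> lam .
  have "2 * pi * cov_hessian_norm_sq M \<phi> x <= 2 * pi * B (2 * b)" unfolding B_def
   by (rule hessian_norm_bound[OF assms(3,2,8,6) b(1) r(2) bound_minorant_le_bound[OF b(1) assms(6)]])
  then show ?thesis by simp
 qed
 have "((%b. B (2 * b)) \<longlongrightarrow> B (2 * rho)) (at_left rho)"
  unfolding B_def by (intro tendsto_intros) (use rho in simp_all)
 moreover have "\<forall>\<^sub>F b in at_left rho. cov_hessian_norm_sq M \<phi> x <= B (2 * b)"
  by (rule eventually_mono[OF eventually_at_left_real[OF rho]]) (use bound in simp)
 ultimately have "cov_hessian_norm_sq M \<phi> x <= B (2 * rho)" by (rule tendsto_lowerbound) simp
 then show ?thesis unfolding d B_def .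
qed

end
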